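(* Let $\mathbb{P}$ be a Borel probability measure on $\mathbb{H}_+(d)$ with $\mathbb{P}(\mathbb{H}_{++}(d))>0$ and $\mathbb{E}\operatorname{tr}S<+\infty$ for $S\sim\mathbb{P}$, and let $\mathbb{A}=Q_0+\mathbb{M}$ be an affine subspace of $\mathbb{H}(d)$ with $\mathbb{H}_{++}(d)\cap\mathbb{A}\ne\emptyset$. Let $S_1,S_2,\dots$ be i.i.d. with law $\mathbb{P}$, let $Q_*$ be the barycenter of $\mathbb{P}$ in $\mathbb{A}$ and $Q_n$ the empirical barycenter in $\mathbb{A}$ of $S_1,\dots,S_n$. Then, as $n\to\infty$, $$\mathcal{L}\bigl(\sqrt n\,d_{BW}(Q_n,Q_* )\bigr)\ \text{ converges weakly to }\ \mathcal{L}\Bigl(\bigl\|Q_*^{1/2}\,dT_{Q_*}^{Q_*}(Z)\bigr\|_F\Bigr),$$ where $Z$ is a random element of $\mathbb{M}$ with $Z\sim\mathcal{N}(0,\Xi)$. Moreover, almost surely, $$d_w\Bigl(\mathcal{L}\bigl(\sqrt n\,d_{BW}(Q_n,Q_* )\bigr),\ \mathcal{L}\bigl(\bigl\|Q_n^{1/2}\,dT_{Q_n}^{Q_n}(Z_n)\bigr\|_F\bigr)\Bigr)\to0,$$ where, given the sample, $Z_n\in\mathbb{M}$, $Z_n\sim\mathcal{N}(0,\hat\Xi_n)$, the second law being the conditional law given $S_1,\dots,S_n$, and $d_w$ is a metric inducing weak convergence of probability measures on $\mathbb{R}$.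
   Context: $\mathbb{H}(d)$ is the real vector space of $d\times d$ complex Hermitian matrices with inner product $\langle X,Y\rangle=\operatorname{tr}(XY)$; $\mathbb{H}_+(d)$, $\mathbb{H}_{++}(d)$ are the positive semi-definite and positive definite ones; $\|\cdot\|_F$ is the Frobenius norm; $\mathcal{L}(\cdot)$ denotes the law. $d_{BW}^2(Q,S)=\operatorname{tr}Q+\operatorname{tr}S-2\operatorname{tr}(Q^{1/2}SQ^{1/2})^{1/2}$. For $Q\in\mathbb{H}_{++}(d)$, $S\in\mathbb{H}_+(d)$, $T_Q^S=Q^{-1/2}(Q^{1/2}SQ^{1/2})^{1/2}Q^{-1/2}$, and $dT_Q^S:\mathbb{H}(d)\to\mathbb{H}(d)$ denotes the Fréchet differential at $Q$ of the map $Q\mapsto T_Q^S$ with $S$ held fixed; thus $dT_{Q}^{Q}$ is this differential with $S$ fixed equal to $Q$. $\mathbb{M}\subseteq\mathbb{H}(d)$ is a real linear subspace, $\Pi_{\mathbb{M}}$ the orthogonal projector onto it, and for a linear operator $A$ on $\mathbb{H}(d)$, $(A)_{\mathbb{M}}:\mathbb{M}\to\mathbb{M}$ is $(A)_{\mathbb{M}}(X)=\Pi_{\mathbb{M}}A(X)$. $Q_*$ is the unique minimizer over $\mathbb{H}_+(d)\cap\mathbb{A}$ of $Q\mapsto\mathbb{E}\,d_{BW}^2(Q,S)$ (it is positive definite), and $Q_n$ is the (measurable) minimizer over $\mathbb{H}_+(d)\cap\mathbb{A}$ of $Q\mapsto\frac1n\sum_{i=1}^nd_{BW}^2(Q,S_i)$;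 it is unique and positive definite as soon as some $S_i\in\mathbb{H}_{++}(d)$, hence almost surely for all large $n$. For $A,B\in\mathbb{H}(d)$, $(A\otimes B)(X)=\langle B,X\rangle A$. Set $$\Sigma=\mathbb{E}\,(T_{Q_*}^S-\mathbb{E}T_{Q_*}^S)\otimes(T_{Q_*}^S-\mathbb{E}T_{Q_*}^S),\qquad\hat\Sigma_n=\frac1n\sum_{i=1}^n(T_{Q_n}^{S_i}-I)\otimes(T_{Q_n}^{S_i}-I),$$ $$F=-\mathbb{E}\,(dT_{Q_*}^S)_{\mathbb{M}},\quad\hat F_n=-\frac1n\sum_{i=1}^n(dT_{Q_n}^{S_i})_{\mathbb{M}},\quad\Xi=F^{-1}(\Sigma)_{\mathbb{M}}F^{-1},\quad\hat\Xi_n=\hat F_n^{-1}(\hat\Sigma_n)_{\mathbb{M}}\hat F_n^{-1}.$$ Quantities depending on $Q_n$ are considered where well defined (and set arbitrarily elsewhere). $\mathcal{N}(0,C)$ is the centred Gaussian law on $\mathbb{M}$ with covariance operator $C$. $\Xi$ is simply the name of an operator (Greek capital Xi). *)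

theory Defs
  imports "HOL-Probability.Probability"
begin

text \<open>
  Matrices live in \<^typ>\<open>complex^'d^'d\<close>, a real Euclidean space whose norm is the Frobenius norm
  and whose inner product is the trace form on Hermitian matrices (\<open>norm_eq_frobenius\<close> and
  \<open>inner_eq_trace\<close> below).  The space of Hermitian matrices is a real subspace of this type, and
  an operator on a subspace is a function on the whole type whose values off the subspace are
  irrelevant.
\<close>

subsection \<open>Hermitian matrices\<close>

definition ctranspose :: "complex^'n^'m \<Rightarrow> complex^'m^'n" where
  "ctranspose A = (\<chi> i j. cnj (A $ j $ i))"

definition hermitian :: "(complex^'d^'d) set" where
  "hermitian = {A. ctranspose A = A}"

text \<open>On \<^typ>\<open>complex^'d\<close> the real inner product \<open>v \<bullet> w\<close> is the real part of the Hermitian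
  product of \<open>v\<close> and \<open>w\<close>, so \<open>v \<bullet> (A *v v)\<close> is the (real) Hermitian form of \<open>A\<close> at \<open>v\<close>.\<close>

definition psd :: "(complex^'d^'d) set" where
  "psd = {A \<in> hermitian. \<forall>v. 0 \<le> v \<bullet> (A *v v)}"

definition pd :: "(complex^'d^'d) set" where
  "pd = {A \<in> hermitian. \<forall>v. v \<noteq> 0 \<longrightarrow> 0 < v \<bullet> (A *v v)}"

definition rtrace :: "complex^'d^'d \<Rightarrow> real" where
  "rtrace A = Re (trace A)"

lemma inner_eq_rtrace_ctranspose: "X \<bullet> Y = rtrace (X ** ctranspose Y)"
  for X Y :: "complex^'d^'d"
  by (simp add: inner_vec_def rtrace_def trace_def matrix_matrix_mult_def ctranspose_def
      inner_complex_def)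

lemma inner_eq_trace:
  assumes "X \<in> hermitian" "Y \<in> hermitian"
  shows "complex_of_real (X \<bullet> Y) = trace (X ** Y)"
proof -
  have X: "cnj (X $ i $ j) = X $ j $ i" for i j
    using assms(1) by (simp add: hermitian_def ctranspose_def vec_eq_iff)
  have Y: "cnj (Y $ i $ j) = Y $ j $ i" for i j
    using assms(2) by (simp add: hermitian_def ctranspose_def vec_eq_iff)
  have "cnj (trace (X ** Y)) = (\<Sum>i\<in>UNIV. \<Sum>j\<in>UNIV. X $ j $ i * Y $ i $ j)"
    by (simp add: trace_def matrix_matrix_mult_def X Y)
  also have "\<dots> = trace (X ** Y)"
    unfolding trace_def matrix_matrix_mult_def by (subst sum.swap) simp
  finally have "trace (X ** Y) \<in> \<real>"
    by (simp add: complex_is_Real_iff complex_eq_iff)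
  moreover have "X \<bullet> Y = Re (trace (X ** Y))"
    using assms(2) by (simp add: inner_eq_rtrace_ctranspose rtrace_def hermitian_def)
  ultimately show ?thesis
    by simp
qed

lemma norm_eq_frobenius: "norm X = sqrt (rtrace (X ** ctranspose X))"
  for X :: "complex^'d^'d"
  by (simp add: norm_eq_sqrt_inner inner_eq_rtrace_ctranspose)

definition psd_sqrt :: "complex^'d^'d \<Rightarrow> complex^'d^'d" where
  "psd_sqrt A = (THE B. B \<in> psd \<and> B ** B = A)"

subsection \<open>Bures--Wasserstein geometry\<close>

definition bw_dist_sq :: "complex^'d^'d \<Rightarrow> complex^'d^'d \<Rightarrow> real" where
  "bw_dist_sq Q S =
     rtrace Q + rtrace S - 2 * rtrace (psd_sqrt (psd_sqrt Q ** S ** psd_sqrt Q))"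

definition bw_dist :: "complex^'d^'d \<Rightarrow> complex^'d^'d \<Rightarrow> real" where
  "bw_dist Q S = sqrt (bw_dist_sq Q S)"

definition transport :: "complex^'d^'d \<Rightarrow> complex^'d^'d \<Rightarrow> complex^'d^'d" where
  "transport Q S =
     matrix_inv (psd_sqrt Q) ** psd_sqrt (psd_sqrt Q ** S ** psd_sqrt Q) ** matrix_inv (psd_sqrt Q)"

text \<open>The Frechet differential within \<^const>\<open>hermitian\<close> is determined only on Hermitian
  directions, and it is only ever applied to those.\<close>

definition dtransport :: "complex^'d^'d \<Rightarrow> complex^'d^'d \<Rightarrow> complex^'d^'d \<Rightarrow> complex^'d^'d" where
  "dtransport Q S = frechet_derivative (\<lambda>R. transport R S) (at Q within hermitian)"

definition is_barycenter ::
    "(complex^'d^'d) measure \<Rightarrow> (complex^'d^'d) set \<Rightarrow> complex^'d^'d \<Rightarrow> bool" where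
  "is_barycenter P A Q \<longleftrightarrow> is_arg_min (\<lambda>R. LINT S|P. bw_dist_sq R S) (\<lambda>R. R \<in> psd \<inter> A) Q"

text \<open>Samples are indexed from 0, so the first \<open>n\<close> observations are \<open>s 0, \<dots>, s (n - 1)\<close>.\<close>

definition is_empirical_barycenter ::
    "nat \<Rightarrow> (nat \<Rightarrow> complex^'d^'d) \<Rightarrow> (complex^'d^'d) set \<Rightarrow> complex^'d^'d \<Rightarrow> bool" where
  "is_empirical_barycenter n s A Q \<longleftrightarrow>
     is_arg_min (\<lambda>R. (1 / real n) * (\<Sum>i<n. bw_dist_sq R (s i))) (\<lambda>R. R \<in> psd \<inter> A) Q"

subsection \<open>Operators on a subspace\<close>

definition orth_proj :: "'a::euclidean_space set \<Rightarrow> 'a \<Rightarrow> 'a" where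
  "orth_proj M x = (THE y. y \<in> M \<and> (\<forall>z\<in>M. orthogonal (x - y) z))"

definition compress :: "'a::euclidean_space set \<Rightarrow> ('a \<Rightarrow> 'a) \<Rightarrow> 'a \<Rightarrow> 'a" where
  "compress M A X = orth_proj M (A X)"

definition tensor_op :: "'a::euclidean_space \<Rightarrow> 'a \<Rightarrow> 'a \<Rightarrow> 'a" where
  "tensor_op A B X = (B \<bullet> X) *\<^sub>R A"

text \<open>Expectations and averages of operators are taken pointwise.  The inverses below are inverses
  of maps from \<open>M\<close> to \<open>M\<close>.\<close>

definition Sigma_op ::
    "(complex^'d^'d) measure \<Rightarrow> complex^'d^'d \<Rightarrow> complex^'d^'d \<Rightarrow> complex^'d^'d" where
  "Sigma_op P Q X =
     (let m = (LINT S|P. transport Q S)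
      in LINT S|P. tensor_op (transport Q S - m) (transport Q S - m) X)"

definition F_op ::
    "(complex^'d^'d) measure \<Rightarrow> (complex^'d^'d) set \<Rightarrow> complex^'d^'d
      \<Rightarrow> complex^'d^'d \<Rightarrow> complex^'d^'d" where
  "F_op P M Q X = - (LINT S|P. compress M (dtransport Q S) X)"

definition Xi_op ::
    "(complex^'d^'d) measure \<Rightarrow> (complex^'d^'d) set \<Rightarrow> complex^'d^'d
      \<Rightarrow> complex^'d^'d \<Rightarrow> complex^'d^'d" where
  "Xi_op P M Q = inv_into M (F_op P M Q) \<circ> compress M (Sigma_op P Q) \<circ> inv_into M (F_op P M Q)"

definition Sigma_hat ::
    "nat \<Rightarrow> (nat \<Rightarrow> complex^'d^'d) \<Rightarrow> complex^'d^'d \<Rightarrow> complex^'d^'d \<Rightarrow> complex^'d^'d" where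
  "Sigma_hat n s Q X =
     (1 / real n) *\<^sub>R
       (\<Sum>i<n. tensor_op (transport Q (s i) - mat 1) (transport Q (s i) - mat 1) X)"

definition F_hat ::
    "nat \<Rightarrow> (nat \<Rightarrow> complex^'d^'d) \<Rightarrow> (complex^'d^'d) set \<Rightarrow> complex^'d^'d
      \<Rightarrow> complex^'d^'d \<Rightarrow> complex^'d^'d" where
  "F_hat n s M Q X = - ((1 / real n) *\<^sub>R (\<Sum>i<n. compress M (dtransport Q (s i)) X))"

definition Xi_hat ::
    "nat \<Rightarrow> (nat \<Rightarrow> complex^'d^'d) \<Rightarrow> (complex^'d^'d) set \<Rightarrow> complex^'d^'d
      \<Rightarrow> complex^'d^'d \<Rightarrow> complex^'d^'d" where
  "Xi_hat n s M Q =
     inv_into M (F_hat n s M Q) \<circ> compress M (Sigma_hat n s Q) \<circ> inv_into M (F_hat n s M Q)"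

subsection \<open>Gaussian laws and weak convergence\<close>

definition centred_normal :: "real \<Rightarrow> real measure" where
  "centred_normal \<sigma> = (if \<sigma> = 0 then return borel 0 else density lborel (normal_density 0 \<sigma>))"

text \<open>A centred Gaussian law on \<open>M\<close> is a law on \<open>M\<close> (here: a Borel law on the ambient space,
  carried by \<open>M\<close>) under which every linear functional is a possibly degenerate centred normal
  variable; \<open>C\<close> is its covariance operator.\<close>

definition centred_gaussian ::
    "'a::euclidean_space set \<Rightarrow> ('a \<Rightarrow> 'a) \<Rightarrow> 'a measure \<Rightarrow> bool" where
  "centred_gaussian M C \<mu> \<longleftrightarrow>
     prob_space \<mu> \<and> sets \<mu> = sets borel \<and> (AE z in \<mu>. z \<in> M) \<and>
     (\<forall>u\<in>M. \<exists>\<sigma>\<ge>0. distr \<mu> borel (\<lambda>z. z \<bullet> u) = centred_normal \<sigma>) \<and>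
     (\<forall>u\<in>M. \<forall>v\<in>M. (LINT z|\<mu>. (z \<bullet> u) * (z \<bullet> v)) = u \<bullet> C v)"

definition gaussian_law :: "'a::euclidean_space set \<Rightarrow> ('a \<Rightarrow> 'a) \<Rightarrow> 'a measure" where
  "gaussian_law M C = (THE \<mu>. centred_gaussian M C \<mu>)"

text \<open>A metric topology is determined by its convergent sequences, so it suffices to compare
  these.\<close>

definition metrizes_weak_convergence :: "(real measure \<Rightarrow> real measure \<Rightarrow> real) \<Rightarrow> bool" where
  "metrizes_weak_convergence d \<longleftrightarrow>
     Metric_space {\<mu>. real_distribution \<mu>} d \<and>
     (\<forall>\<mu>s \<mu>. (\<forall>n. real_distribution (\<mu>s n)) \<and> real_distribution \<mu> \<longrightarrow>
        ((\<lambda>n. d (\<mu>s n) \<mu>) \<longlonglongrightarrow> 0 \<longleftrightarrow> weak_conv_m \<mu>s \<mu>))"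

end

theory Submission
  imports Defs
begin

text \<open>
  Write \<open>T = transport Q S\<close>.  Everything rests on four facts about this map.

  \<^item> It is the only positive semidefinite solution of \<open>T Q T = S\<close> (\<open>transport_psd\<close>, \<open>transport_unique\<close>).
    Hence \<open>bw_dist Q S\<close> is exactly the Frobenius norm of \<open>Q\<^bsup>1/2\<^esup> (T - 1)\<close> (\<open>bw_dist_eq_norm\<close>), and
    expanding the distance to first order amounts to differentiating \<open>T\<close>.
  \<^item> It is differentiable in \<open>Q\<close> even when \<open>S\<close> is singular, because of the formula
    \<open>T = S\<^bsup>1/2\<^esup> (S\<^bsup>1/2\<^esup> Q S\<^bsup>1/2\<^esup> + P)\<^bsup>-1/2\<^esup> S\<^bsup>1/2\<^esup>\<close> with \<open>P\<close> the projector onto the kernel of \<open>S\<close>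
    (\<open>transport_eq\<close>).  The differential is symmetric and negative, strictly so for definite \<open>S\<close>
    (\<open>transport_deriv_negative\<close>).
  \<^item> If \<open>- h Q \<le> H \<le> h Q\<close>, then \<open>- (h/2) T \<le> dT(H) \<le> (h/2) T\<close> (\<open>transport_deriv_order_bound\<close>).  So the
    differential is dominated by \<open>T\<close> itself, whose squared norm is of the order of the trace of \<open>S\<close>,
    and the single moment assumption on \<open>P\<close> bounds all quantities that get averaged.
  \<^item> The squared distance is convex in \<open>Q\<close> with subgradient \<open>1 - T\<close> (\<open>bw_dist_sq_subgradient\<close>).

  Barycenters are thus zeros of an averaged score: the average of \<open>T - 1\<close> is orthogonal to \<open>M\<close>, at
  \<open>Qstar\<close> for the law \<open>P\<close> (\<open>barycenter_stationary\<close>, after \<open>barycenter_pd\<close> has excluded the boundary of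
  the cone) and at \<open>Q n\<close> for the sample (\<open>empirical_stationary\<close>).  The uniform law of large numbers
  makes the empirical Hessian close to \<open>F\<close> near \<open>Qstar\<close>.  As \<open>F\<close> is coercive on \<open>M\<close>, convexity forces
  \<open>Q n\<close> to converge to \<open>Qstar\<close> (\<open>consistency\<close>), and Taylor's formula gives
  \<open>Q n - Qstar = (1/n) \<Sum> F\<^bsup>-1\<^esup> \<Pi> (transport Qstar (S i) - 1)\<close> up to a relative error that vanishes
  almost surely (\<open>linearization\<close>).  Therefore \<open>\<surd>n bw_dist (Q n) Qstar\<close> is, up to such an error, the
  seminorm \<open>phi\<close> of a normalised sum of independent terms (\<open>distance_linearization\<close>).

  For these sums the one-dimensional central limit theorem yields convergence of the characteristic
  functions.  The second moments are bounded, and approximation by trigonometric polynomials turns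
  this into weak convergence of every Lipschitz image, remainder included (\<open>weak_conv_compose\<close>).

  On the almost sure event \<open>good\<close> the plug-in covariances converge to the limiting one and the plug-in
  maps to \<open>phi\<close>, so the same criterion, applied to the conditional Gaussian laws, gives them the same
  weak limit (\<open>plugin_weak_limit\<close>).  The triangle inequality for \<open>dw\<close> concludes (\<open>metrized_merge\<close>).
\<close>

section \<open>Self-adjoint operators\<close>

lemma nonneg_quadratic_imp_zero:
  fixes a b :: real
  assumes "\<And>t. 0 \<le> 2 * t * a + t\<^sup>2 * b"
  shows "a = 0"
proof (rule ccontr)
  assume a: "a \<noteq> 0"
  define c where "c = 1 + \<bar>b\<bar>"
  have c: "c > 0" by (simp add: c_def)
  have "0 \<le> 2 * (- a / c) * a + (- a / c)\<^sup>2 * b" by (rule assms)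
  also have "\<dots> = (a\<^sup>2 / c\<^sup>2) * (b - 2 * c)"
    using c by (simp add: field_simps power2_eq_square)
  finally have "0 \<le> (a\<^sup>2 / c\<^sup>2) * (b - 2 * c)" .
  moreover have "a\<^sup>2 / c\<^sup>2 > 0" using a c by simp
  ultimately have "b - 2 * c \<ge> 0"
    by (metis not_le mult_pos_neg linorder_not_less)
  then show False by (simp add: c_def)
qed

text \<open>A maximiser \<open>v\<close> of the Rayleigh quotient is an eigenvector: moving it by \<open>t w\<close> for
  \<open>w = l v - f v\<close> changes \<open>l \<bar>x\<bar>\<^sup>2 - f x \<bullet> x \<ge> 0\<close>, which vanishes at \<open>v\<close>, by \<open>2 t (w \<bullet> w)\<close> to first order.\<close>

lemma selfadjoint_eigenvector:
  fixes f :: "'a::euclidean_space \<Rightarrow> 'a"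
  assumes U: "subspace U" "U \<noteq> {0}" and lin: "linear f"
    and inv: "\<And>x. x \<in> U \<Longrightarrow> f x \<in> U"
    and sa: "\<And>x y. x \<in> U \<Longrightarrow> y \<in> U \<Longrightarrow> f x \<bullet> y = x \<bullet> f y"
  shows "\<exists>v\<in>U. \<exists>l. norm v = 1 \<and> f v = l *\<^sub>R v"
proof -
  interpret linear f by (rule lin)
  let ?K = "sphere 0 1 \<inter> U"
  have "compact ?K"
    using closed_subspace[OF U(1)] by (simp add: compact_Int_closed)
  moreover have "?K \<noteq> {}"
  proof -
    obtain x where x: "x \<in> U" "x \<noteq> 0"
      using U subspace_0[OF U(1)] by blast
    then have "(1 / norm x) *\<^sub>R x \<in> ?K"
      using subspace_scale[OF U(1)] by simp
    then show ?thesis by blast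
  qed
  moreover have "continuous_on ?K (\<lambda>x. f x \<bullet> x)"
    by (intro continuous_intros linear_continuous_on linear_linear[THEN iffD2] lin
        linear_conv_bounded_linear[THEN iffD1])
  ultimately obtain v where v: "v \<in> ?K" and max: "\<And>x. x \<in> ?K \<Longrightarrow> f x \<bullet> x \<le> f v \<bullet> v"
    using continuous_attains_sup[of ?K "\<lambda>x. f x \<bullet> x"] by blast
  define l where "l = f v \<bullet> v"
  have le: "f x \<bullet> x \<le> l * (x \<bullet> x)" if x: "x \<in> U" for x
  proof (cases "x = 0")
    case False
    have "f ((1 / norm x) *\<^sub>R x) \<bullet> ((1 / norm x) *\<^sub>R x) \<le> l"
      unfolding l_def using x False subspace_scale[OF U(1)] by (intro max) simp
    then have "f x \<bullet> x / (norm x)\<^sup>2 \<le> l"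
      by (simp add: scaleR power2_eq_square)
    then show ?thesis
      using False by (simp add: pos_divide_le_eq dot_square_norm)
  qed (simp add: zero)
  define w where "w = l *\<^sub>R v - f v"
  have vU: "v \<in> U" and nv: "norm v = 1" using v by auto
  have wU: "w \<in> U"
    unfolding w_def using vU inv U(1) by (intro subspace_diff subspace_scale) auto
  have "w \<bullet> w = 0"
  proof (rule nonneg_quadratic_imp_zero)
    fix t :: real
    let ?x = "v + t *\<^sub>R w"
    have "?x \<in> U" using vU wU U(1) by (intro subspace_add subspace_scale) auto
    from le[OF this] have "0 \<le> l * (?x \<bullet> ?x) - f ?x \<bullet> ?x" by simp
    also have "\<dots> = (l * (v \<bullet> v) - f v \<bullet> v) + t * (2 * l * (v \<bullet> w) - f v \<bullet> w - f w \<bullet> v)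
        + t\<^sup>2 * (l * (w \<bullet> w) - f w \<bullet> w)"
      by (simp add: add scaleR inner_add inner_commute algebra_simps power2_eq_square)
    also have "f w \<bullet> v = f v \<bullet> w" using sa[OF wU vU] by (simp add: inner_commute)
    also have "l * (v \<bullet> v) - f v \<bullet> v = 0" using nv by (simp add: l_def norm_eq_1)
    also have "2 * l * (v \<bullet> w) - f v \<bullet> w - f v \<bullet> w = 2 * (w \<bullet> w)"
    proof -
      have "w \<bullet> w = l * (v \<bullet> w) - f v \<bullet> w"
        by (subst (1) w_def) (simp add: inner_diff_left)
      then show ?thesis by simp
    qed
    finally show "0 \<le> 2 * t * (w \<bullet> w) + t\<^sup>2 * (l * (w \<bullet> w) - f w \<bullet> w)"
      by (simp add: algebra_simps)
  qed
  then have "f v = l *\<^sub>R v" by (simp add: w_def)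
  then show ?thesis using vU nv by blast
qed

text \<open>Once an eigenvector is split off, its orthogonal complement is again invariant, by self-adjointness.\<close>

lemma selfadjoint_spectral:
  fixes f :: "'a::euclidean_space \<Rightarrow> 'a"
  assumes "subspace U" and lin: "linear f"
    and "\<And>x. x \<in> U \<Longrightarrow> f x \<in> U"
    and "\<And>x y. x \<in> U \<Longrightarrow> y \<in> U \<Longrightarrow> f x \<bullet> y = x \<bullet> f y"
  shows "\<exists>B l. B \<subseteq> U \<and> finite B \<and> pairwise orthogonal B \<and> (\<forall>b\<in>B. norm b = 1) \<and>
           span B = U \<and> (\<forall>b\<in>B. f b = l b *\<^sub>R b)"
  using assms(1,3,4)
proof (induction "dim U" arbitrary: U rule: less_induct)
  case less
  show ?case
  proof (cases "U = {0}")
    case True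
    then show ?thesis by (intro exI[of _ "{}"]) auto
  next
    case False
    then obtain v m where v: "v \<in> U" "norm v = 1" "f v = m *\<^sub>R v"
      using selfadjoint_eigenvector[OF less.prems(1) False lin less.prems(2,3)] by blast
    have vv: "v \<bullet> v = 1" using v(2) by (simp add: norm_eq_1)
    define V where "V = {x\<in>U. v \<bullet> x = 0}"
    have sV: "subspace V"
      using less.prems(1) by (auto simp: V_def subspace_def inner_add_right)
    have "v \<notin> V" using vv by (simp add: V_def)
    then have "V \<subset> U" using v(1) unfolding V_def by blast
    then have dimV: "dim V < dim U"
      using sV less.prems(1) by (intro dim_psubset) (simp add: span_eq_iff[THEN iffD2])
    have VU: "V \<subseteq> U" by (auto simp: V_def)
    have inv: "f x \<in> V" if "x \<in> V" for x
    proof -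
      have "v \<bullet> f x = m * (v \<bullet> x)"
        using less.prems(3)[OF v(1), of x] that v(3) by (simp add: V_def)
      then show ?thesis using that less.prems(2) by (simp add: V_def)
    qed
    obtain B l where B: "B \<subseteq> V" "finite B" "pairwise orthogonal B" "\<And>b. b \<in> B \<Longrightarrow> norm b = 1"
      "span B = V" "\<And>b. b \<in> B \<Longrightarrow> f b = l b *\<^sub>R b"
      using less.hyps[OF dimV sV inv] less.prems(3) VU by (metis subsetD)
    have vB: "v \<notin> B" using B(1) vv by (auto simp: V_def)
    have "span (insert v B) = U"
    proof
      show "span (insert v B) \<subseteq> U"
        using v(1) B(1) VU less.prems(1) by (intro span_minimal) auto
      show "U \<subseteq> span (insert v B)"
      proof
        fix x assume x: "x \<in> U"
        let ?y = "x - (v \<bullet> x) *\<^sub>R v"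
        have "?y \<in> V"
          using x v(1) vv less.prems(1)
          by (auto simp: V_def inner_diff_right intro: subspace_diff subspace_scale)
        then have "?y \<in> span (insert v B)"
          using B(5) span_mono[of B "insert v B"] by blast
        moreover have "(v \<bullet> x) *\<^sub>R v \<in> span (insert v B)"
          by (intro span_scale span_base) simp
        ultimately have "?y + (v \<bullet> x) *\<^sub>R v \<in> span (insert v B)" by (rule span_add)
        then show "x \<in> span (insert v B)" by simp
      qed
    qed
    moreover have "pairwise orthogonal (insert v B)"
      using B(1,3) by (auto simp: pairwise_insert V_def orthogonal_def inner_commute)
    ultimately show ?thesis
      using B VU v vB
      by (intro exI[of _ "insert v B"] exI[of _ "l(v := m)"]) (auto)
  qed
qed

section \<open>The algebra of complex matrices\<close>

lemma matrix_mult_scaleR_left: "(r *\<^sub>R A) ** B = r *\<^sub>R (A ** B)"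
  for A :: "complex^'n^'m"
  by (simp add: matrix_matrix_mult_def vec_eq_iff scaleR_sum_right)

lemma matrix_mult_scaleR_right: "A ** (r *\<^sub>R B) = r *\<^sub>R (A ** B)"
  for A :: "complex^'n^'m"
  by (simp add: matrix_matrix_mult_def vec_eq_iff scaleR_sum_right)

lemma matrix_mult_diff_left: "(A - B) ** C = A ** C - B ** C"
  for A :: "complex^'n^'m"
  by (simp add: matrix_matrix_mult_def vec_eq_iff left_diff_distrib sum_subtractf)

lemma matrix_mult_diff_right: "C ** (A - B) = C ** A - C ** B"
  for A :: "complex^'n^'m"
  by (simp add: matrix_matrix_mult_def vec_eq_iff right_diff_distrib sum_subtractf)

lemma matrix_mult_add_left: "(A + B) ** C = A ** C + B ** C"
  for A :: "complex^'n^'m"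
  by (simp add: matrix_matrix_mult_def vec_eq_iff distrib_right sum.distrib)

lemma matrix_mult_minus_left: "(- A) ** C = - (A ** C)"
  for A :: "complex^'n^'m"
  by (simp add: matrix_matrix_mult_def vec_eq_iff sum_negf)

lemma matrix_mult_minus_right: "C ** (- A) = - (C ** A)"
  for A :: "complex^'n^'m"
  by (simp add: matrix_matrix_mult_def vec_eq_iff sum_negf)

lemmas matrix_simps = matrix_mult_scaleR_left matrix_mult_scaleR_right matrix_mult_diff_left
  matrix_mult_diff_right matrix_mult_add_left matrix_add_ldistrib
  matrix_mult_minus_left matrix_mult_minus_right matrix_mul_assoc

lemma bounded_bilinear_matrix_mult:
  "bounded_bilinear ((**) :: complex^'n^'m \<Rightarrow> complex^'k^'n \<Rightarrow> _)"
  by (subst bilinear_conv_bounded_bilinear[symmetric])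
    (simp add: bilinear_def linear_iff matrix_simps)

lemmas tendsto_matrix_mult [tendsto_intros] = bounded_bilinear.tendsto[OF bounded_bilinear_matrix_mult]
lemmas continuous_on_matrix_mult [continuous_intros] =
  bounded_bilinear.continuous_on[OF bounded_bilinear_matrix_mult]

lemma scaleR_matrix_vector: "(r *\<^sub>R A) *v x = r *\<^sub>R (A *v x)"
  for A :: "complex^'n^'m"
  by (simp add: matrix_vector_mult_def vec_eq_iff scaleR_sum_right)

lemma matrix_vector_scaleR: "A *v (r *\<^sub>R x) = r *\<^sub>R (A *v x)"
  for A :: "complex^'n^'m"
  by (simp add: matrix_vector_mult_def vec_eq_iff scaleR_sum_right)

lemma matrix_vector_minus: "(- A) *v x = - (A *v x)" "A *v (- x) = - (A *v x)"
  for A :: "complex^'n^'m"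
  by (simp_all add: matrix_vector_mult_def vec_eq_iff sum_negf)

lemmas matvec_simps = scaleR_matrix_vector matrix_vector_scaleR matrix_vector_mult_add_rdistrib
  matrix_vector_mult_diff_rdistrib matrix_vector_right_distrib matrix_vector_mult_diff_distrib
  matrix_vector_minus

lemma bounded_linear_matrix_vector: "bounded_linear (\<lambda>x. A *v x)" for A :: "complex^'n^'m"
  by (simp add: linear_conv_bounded_linear[symmetric] linear_iff matvec_simps)

lemma bounded_bilinear_matrix_vector:
  "bounded_bilinear ((*v) :: complex^'n^'m \<Rightarrow> complex^'n \<Rightarrow> _)"
  by (subst bilinear_conv_bounded_bilinear[symmetric])
    (simp add: bilinear_def linear_iff matvec_simps)

lemma ctranspose_mult: "ctranspose (A ** B) = ctranspose B ** ctranspose A"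
  by (simp add: ctranspose_def matrix_matrix_mult_def vec_eq_iff mult.commute)

lemma ctranspose_add: "ctranspose (A + B) = ctranspose A + ctranspose B"
  by (simp add: ctranspose_def vec_eq_iff)

lemma ctranspose_diff: "ctranspose (A - B) = ctranspose A - ctranspose B"
  by (simp add: ctranspose_def vec_eq_iff)

lemma ctranspose_minus: "ctranspose (- A) = - ctranspose A"
  by (simp add: ctranspose_def vec_eq_iff)

lemma ctranspose_scaleR: "ctranspose (r *\<^sub>R A) = r *\<^sub>R ctranspose A"
  by (simp add: ctranspose_def vec_eq_iff)

lemma ctranspose_ctranspose [simp]: "ctranspose (ctranspose A) = A"
  by (simp add: ctranspose_def vec_eq_iff)

lemma ctranspose_mat1 [simp]: "ctranspose (mat 1) = mat 1"
  by (simp add: ctranspose_def vec_eq_iff mat_def)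

lemma rtrace_commute: "rtrace (A ** B) = rtrace (B ** A)"
  unfolding rtrace_def trace_def matrix_matrix_mult_def
  by (simp, subst sum.swap, simp add: mult.commute)

lemma inner_matrix_mult_left: "(A ** X) \<bullet> Y = X \<bullet> (ctranspose A ** Y)"
  for A X Y :: "complex^'d^'d"
  unfolding inner_eq_rtrace_ctranspose
  by (simp add: ctranspose_mult rtrace_commute[of A] matrix_mul_assoc[symmetric])

lemma inner_matrix_mult_right: "(X ** A) \<bullet> Y = X \<bullet> (Y ** ctranspose A)"
  for A X Y :: "complex^'d^'d"
  unfolding inner_eq_rtrace_ctranspose
  by (simp add: ctranspose_mult matrix_mul_assoc)

lemma rtrace_eq_inner: "rtrace A = A \<bullet> mat 1"
  by (simp add: inner_eq_rtrace_ctranspose)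

lemma inner_matrix_vector: "(A *v x) \<bullet> y = x \<bullet> (ctranspose A *v y)"
  for A :: "complex^'d^'d"
proof -
  have "(A *v x) \<bullet> y = (\<Sum>i\<in>UNIV. \<Sum>j\<in>UNIV. Re (A $ i $ j * x $ j * cnj (y $ i)))"
    by (simp add: inner_vec_def matrix_vector_mult_def inner_complex_def sum_distrib_left
        sum_distrib_right sum.distrib[symmetric])
  also have "\<dots> = (\<Sum>j\<in>UNIV. \<Sum>i\<in>UNIV. Re (A $ i $ j * x $ j * cnj (y $ i)))"
    by (rule sum.swap)
  also have "\<dots> = x \<bullet> (ctranspose A *v y)"
    by (simp add: inner_vec_def matrix_vector_mult_def inner_complex_def sum_distrib_left
        sum_distrib_right sum.distrib[symmetric] ctranspose_def algebra_simps)
  finally show ?thesis .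
qed

lemma hermitianD: "A \<in> hermitian \<Longrightarrow> ctranspose A = A"
  by (simp add: hermitian_def)

lemma hermitianI: "ctranspose A = A \<Longrightarrow> A \<in> hermitian"
  by (simp add: hermitian_def)

lemma hermitian_iff_selfadjoint:
  "A \<in> hermitian \<longleftrightarrow> (\<forall>x y. (A *v x) \<bullet> y = x \<bullet> (A *v y))"
proof
  assume *: "\<forall>x y. (A *v x) \<bullet> y = x \<bullet> (A *v y)"
  have "ctranspose A *v y = A *v y" for y
  proof -
    have "x \<bullet> (ctranspose A *v y - A *v y) = 0" for x
      using * by (simp add: inner_diff_right inner_matrix_vector[symmetric])
    then have "ctranspose A *v y - A *v y = 0" by (metis inner_eq_zero_iff)
    then show ?thesis by simp
  qed
  then show "A \<in> hermitian" by (simp add: hermitian_def matrix_eq)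
qed (simp add: inner_matrix_vector hermitianD)

lemma subspace_hermitian: "subspace hermitian"
  by (auto simp: subspace_def hermitian_def ctranspose_add ctranspose_scaleR)
    (simp add: ctranspose_def vec_eq_iff)

lemma hermitian_intros:
  "A \<in> hermitian \<Longrightarrow> B \<in> hermitian \<Longrightarrow> A + B \<in> hermitian"
  "A \<in> hermitian \<Longrightarrow> B \<in> hermitian \<Longrightarrow> A - B \<in> hermitian"
  "A \<in> hermitian \<Longrightarrow> - A \<in> hermitian"
  "A \<in> hermitian \<Longrightarrow> r *\<^sub>R A \<in> hermitian"
  "mat 1 \<in> hermitian" "0 \<in> hermitian"
  "A \<in> hermitian \<Longrightarrow> B \<in> hermitian \<Longrightarrow> B ** A ** B \<in> hermitian"
  by (auto simp: hermitian_def ctranspose_add ctranspose_diff ctranspose_minus ctranspose_scaleR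
      ctranspose_mult matrix_mul_assoc) (simp_all add: ctranspose_def vec_eq_iff)

text \<open>A Hermitian matrix acts as a self-adjoint operator on the real Euclidean space
  \<^typ>\<open>complex^'d\<close>.  This is the only route by which eigenvectors enter: the eigenbasis is a real
  one, twice as long as a complex one, and commutation with complex scalars is recovered from
  the fact that eigenspaces are complex subspaces.\<close>

lemma hermitian_spectral:
  fixes A :: "complex^'d^'d"
  assumes "A \<in> hermitian"
  obtains B l where "finite B" "pairwise orthogonal B" "\<And>b. b \<in> B \<Longrightarrow> norm b = 1"
    "\<And>x. (\<Sum>b\<in>B. (b \<bullet> x) *\<^sub>R b) = x" "\<And>b. b \<in> B \<Longrightarrow> A *v b = l b *\<^sub>R b"
proof -
  obtain B l where B: "finite B" "pairwise orthogonal B" "\<And>b. b \<in> B \<Longrightarrow> norm b = 1"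
    "span B = UNIV" "\<And>b. b \<in> B \<Longrightarrow> A *v b = l b *\<^sub>R b"
    using selfadjoint_spectral[of UNIV "\<lambda>x. A *v x"] assms
      bounded_linear.linear[OF bounded_linear_matrix_vector[of A]]
    by (simp add: hermitian_iff_selfadjoint) metis
  moreover have "(\<Sum>b\<in>B. (b \<bullet> x) *\<^sub>R b) = x" for x
    using orthonormal_basis_expand[OF B(2,3) _ B(1), of x] B(4) by (simp add: inner_commute)
  ultimately show ?thesis using that[of B l] by blast
qed

text \<open>Identities between matrices built from \<open>A\<close> reduce to identities between numbers.\<close>

lemma eq_on_eigenvectorsI:
  assumes "A \<in> hermitian" "\<And>x l. A *v x = l *\<^sub>R x \<Longrightarrow> G *v x = G' *v x"
  shows "G = G'"
proof -
  obtain B l where B: "finite B" "pairwise orthogonal B" "\<And>b. b \<in> B \<Longrightarrow> norm b = 1"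
    "\<And>x. (\<Sum>b\<in>B. (b \<bullet> x) *\<^sub>R b) = x" "\<And>b. b \<in> B \<Longrightarrow> A *v b = l b *\<^sub>R b"
    using hermitian_spectral[OF assms(1)] by blast
  have "G *v x = G' *v x" for x
  proof -
    interpret g: bounded_linear "\<lambda>x. G *v x" by (rule bounded_linear_matrix_vector)
    interpret g': bounded_linear "\<lambda>x. G' *v x" by (rule bounded_linear_matrix_vector)
    have "G *v (\<Sum>b\<in>B. (b \<bullet> x) *\<^sub>R b) = G' *v (\<Sum>b\<in>B. (b \<bullet> x) *\<^sub>R b)"
      unfolding g.sum g'.sum g.scaleR g'.scaleR using assms(2) B(5) by (intro sum.cong) auto
    then show ?thesis by (simp add: B(4))
  qed
  then show ?thesis by (simp add: matrix_eq)
qed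

lemma hermitian_quadratic_form:
  fixes A :: "complex^'d^'d"
  assumes "finite B" "\<And>x. (\<Sum>b\<in>B. (b \<bullet> x) *\<^sub>R b) = x" "\<And>b. b \<in> B \<Longrightarrow> A *v b = l b *\<^sub>R b"
  shows "x \<bullet> (A *v x) = (\<Sum>b\<in>B. l b * (b \<bullet> x)\<^sup>2)"
proof -
  interpret g: bounded_linear "\<lambda>x. A *v x" by (rule bounded_linear_matrix_vector)
  have "x \<bullet> (A *v x) = x \<bullet> (A *v (\<Sum>b\<in>B. (b \<bullet> x) *\<^sub>R b))" by (simp add: assms(2))
  also have "\<dots> = (\<Sum>b\<in>B. l b * (b \<bullet> x)\<^sup>2)"
    unfolding g.sum g.scaleR inner_sum_right
    by (intro sum.cong) (auto simp: assms(3) power2_eq_square inner_commute)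
  finally show ?thesis .
qed

lemma negative_eigenvector:
  fixes A :: "complex^'d^'d"
  assumes "A \<in> hermitian" "x \<bullet> (A *v x) < 0"
  shows "\<exists>v l. norm v = 1 \<and> l < 0 \<and> A *v v = l *\<^sub>R v"
proof -
  obtain B l where B: "finite B" "pairwise orthogonal B" "\<And>b. b \<in> B \<Longrightarrow> norm b = 1"
    "\<And>x. (\<Sum>b\<in>B. (b \<bullet> x) *\<^sub>R b) = x" "\<And>b. b \<in> B \<Longrightarrow> A *v b = l b *\<^sub>R b"
    using hermitian_spectral[OF assms(1)] by blast
  have "\<exists>b\<in>B. l b < 0"
  proof (rule ccontr)
    assume "\<not> ?thesis"
    moreover have "x \<bullet> (A *v x) = (\<Sum>b\<in>B. l b * (b \<bullet> x)\<^sup>2)"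
      using B(1,4,5) by (rule hermitian_quadratic_form)
    ultimately have "0 \<le> x \<bullet> (A *v x)"
      by (auto simp: not_less intro!: sum_nonneg)
    then show False using assms(2) by simp
  qed
  then show ?thesis using B(3,5) by blast
qed

text \<open>\<open>G\<close> is defined through the real eigenbasis.  It is a complex matrix nevertheless, because complex
  multiples of an eigenvector of \<open>A\<close> are eigenvectors for the same eigenvalue.\<close>

lemma functional_calculus:
  fixes A :: "complex^'d^'d" and f :: "real \<Rightarrow> real"
  assumes A: "A \<in> hermitian" and f: "\<And>l. f l \<ge> 0"
  shows "\<exists>G\<in>psd. \<forall>x l. A *v x = l *\<^sub>R x \<longrightarrow> G *v x = f l *\<^sub>R x"
proof -
  obtain B l where B: "finite B" "pairwise orthogonal B" "\<And>b. b \<in> B \<Longrightarrow> norm b = 1"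
    "\<And>x. (\<Sum>b\<in>B. (b \<bullet> x) *\<^sub>R b) = x" "\<And>b. b \<in> B \<Longrightarrow> A *v b = l b *\<^sub>R b"
    using hermitian_spectral[OF A] by blast
  define g where "g x = (\<Sum>b\<in>B. (f (l b) * (b \<bullet> x)) *\<^sub>R b)" for x
  have eig: "g x = f m *\<^sub>R x" if x: "A *v x = m *\<^sub>R x" for x m
  proof -
    have "l b = m \<or> b \<bullet> x = 0" if "b \<in> B" for b
    proof -
      have "(A *v b) \<bullet> x = b \<bullet> (A *v x)"
        using A by (simp add: hermitian_iff_selfadjoint)
      then show ?thesis using x B(5)[OF that] by auto
    qed
    then have "g x = (\<Sum>b\<in>B. f m *\<^sub>R ((b \<bullet> x) *\<^sub>R b))"
      unfolding g_def by (intro sum.cong) auto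
    then show ?thesis by (simp only: scaleR_sum_right[symmetric] B(4))
  qed
  have lin: "linear g"
    by (simp add: linear_iff g_def inner_add_right distrib_left scaleR_add_left sum.distrib
        scaleR_sum_right mult.left_commute)
  have smult: "g (c *s x) = c *s g x" for c x
  proof -
    have b: "g (c *s b) = c *s g b" if "b \<in> B" for b
    proof -
      have "A *v (c *s b) = c *s (l b *\<^sub>R b)"
        unfolding vector_scalar_commute by (simp only: B(5)[OF that])
      also have "\<dots> = l b *\<^sub>R (c *s b)" by (simp add: vec_eq_iff scaleR_conv_of_real)
      finally have "A *v (c *s b) = l b *\<^sub>R (c *s b)" .
      then have "g (c *s b) = f (l b) *\<^sub>R (c *s b)" by (rule eig)
      also have "\<dots> = c *s (f (l b) *\<^sub>R b)" by (simp add: vec_eq_iff scaleR_conv_of_real)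
      also have "\<dots> = c *s g b" using eig[OF B(5)[OF that]] by simp
      finally show ?thesis .
    qed
    interpret g: linear g by (rule lin)
    have lin2: "linear (\<lambda>x::complex^'d. c *s x)"
      by (simp add: linear_iff vec_eq_iff scaleR_conv_of_real distrib_left)
    interpret s: linear "\<lambda>x::complex^'d. c *s x" by (rule lin2)
    have "g (c *s (\<Sum>b\<in>B. (b \<bullet> x) *\<^sub>R b)) = c *s g (\<Sum>b\<in>B. (b \<bullet> x) *\<^sub>R b)"
      unfolding s.sum g.sum s.scaleR g.scaleR using b by (intro sum.cong) auto
    then show ?thesis by (simp add: B(4))
  qed
  have "Vector_Spaces.linear (*s) (*s) g"
    using lin smult
    by (simp add: Vector_Spaces.linear_iff vec.vector_space_axioms linear_add)
  then have G: "matrix g *v x = g x" for x by (rule matrix_works)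
  have "matrix g \<in> psd"
    unfolding psd_def
  proof (intro CollectI conjI allI)
    show "matrix g \<in> hermitian"
      unfolding hermitian_iff_selfadjoint G
      by (auto simp: g_def inner_sum_left inner_sum_right inner_commute intro!: sum.cong)
    show "0 \<le> v \<bullet> (matrix g *v v)" for v
    proof -
      have "v \<bullet> (f (l b) * (b \<bullet> v)) *\<^sub>R b = f (l b) * (b \<bullet> v)\<^sup>2" for b
        by (simp add: inner_commute power2_eq_square)
      then show ?thesis
        unfolding G unfolding g_def inner_sum_right by (intro sum_nonneg) (simp only:, simp add: f)
    qed
  qed
  then show ?thesis using eig by (intro bexI[of _ "matrix g"]) (simp_all add: G)
qed

section \<open>Positive semidefinite matrices and their square roots\<close>

lemma psd_hermitian: "A \<in> psd \<Longrightarrow> A \<in> hermitian" by (simp add: psd_def)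
lemma pd_hermitian: "A \<in> pd \<Longrightarrow> A \<in> hermitian" by (simp add: pd_def)
lemma psd_form: "A \<in> psd \<Longrightarrow> 0 \<le> v \<bullet> (A *v v)" by (simp add: psd_def)
lemma pd_form: "A \<in> pd \<Longrightarrow> v \<noteq> 0 \<Longrightarrow> 0 < v \<bullet> (A *v v)" by (simp add: pd_def)

lemma pd_imp_psd: "A \<in> pd \<Longrightarrow> A \<in> psd"
  unfolding pd_def psd_def by (auto simp: less_imp_le) (metis inner_zero_left less_imp_le order_refl)

lemma psd_intros:
  "A \<in> psd \<Longrightarrow> B \<in> psd \<Longrightarrow> A + B \<in> psd"
  "A \<in> psd \<Longrightarrow> 0 \<le> r \<Longrightarrow> r *\<^sub>R A \<in> psd"
  "0 \<in> psd" "mat 1 \<in> psd"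
  by (auto simp: psd_def hermitian_intros matvec_simps inner_add_right)

lemma pd_add_psd: "A \<in> pd \<Longrightarrow> B \<in> psd \<Longrightarrow> A + B \<in> pd"
  by (auto simp: psd_def pd_def hermitian_intros matvec_simps inner_add_right add_pos_nonneg)

lemma psd_add_pd: "B \<in> psd \<Longrightarrow> A \<in> pd \<Longrightarrow> B + A \<in> pd"
  by (metis pd_add_psd add.commute)

lemma pd_scaleR: "A \<in> pd \<Longrightarrow> 0 < r \<Longrightarrow> r *\<^sub>R A \<in> pd"
  by (auto simp: pd_def hermitian_intros matvec_simps)

lemma pd_mat1: "mat 1 \<in> pd"
  by (auto simp: pd_def hermitian_intros)

lemma psd_conj:
  assumes "A \<in> psd" "B \<in> hermitian"
  shows "B ** A ** B \<in> psd"
  using assms psd_form[OF assms(1)]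
  by (auto simp: psd_def hermitian_intros matrix_vector_mul_assoc[symmetric])
     (metis hermitian_iff_selfadjoint)

lemma pd_conj:
  assumes "A \<in> pd" "B \<in> hermitian" "\<And>x. B *v x = 0 \<Longrightarrow> x = 0"
  shows "B ** A ** B \<in> pd"
  using assms pd_form[OF assms(1)]
  by (auto simp: pd_def hermitian_intros matrix_vector_mul_assoc[symmetric])
     (metis hermitian_iff_selfadjoint)

lemma pd_kernel: "A \<in> pd \<Longrightarrow> A *v x = 0 \<Longrightarrow> x = 0"
  using pd_form[of A x] by force

lemma pd_inverse:
  fixes A :: "complex^'d^'d"
  assumes "A \<in> pd"
  shows "A ** matrix_inv A = mat 1" "matrix_inv A ** A = mat 1" "matrix_inv A \<in> pd"
proof -
  have "inj ((*v) A)"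
    using pd_kernel[OF assms] by (auto simp: inj_on_def) (metis eq_iff_diff_eq_0 matrix_vector_mult_diff_distrib)
  then have "invertible A"
    by (simp add: invertible_left_inverse matrix_left_invertible_injective)
  then show *: "A ** matrix_inv A = mat 1" "matrix_inv A ** A = mat 1"
    unfolding invertible_def matrix_inv_def by (metis (mono_tags, lifting) someI_ex)+
  have h: "matrix_inv A \<in> hermitian"
  proof (rule hermitianI)
    have "ctranspose (matrix_inv A) ** A = mat 1"
      using arg_cong[OF *(1), of ctranspose] pd_hermitian[OF assms]
      by (simp add: ctranspose_mult hermitianD)
    then have "ctranspose (matrix_inv A) ** A ** matrix_inv A = matrix_inv A" by simp
    then show "ctranspose (matrix_inv A) = matrix_inv A"
      by (simp add: matrix_mul_assoc[symmetric] *)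
  qed
  have k: "matrix_inv A *v x = 0 \<Longrightarrow> x = 0" for x
    by (metis "*"(1) matrix_vector_mul_assoc matrix_vector_mul_lid matrix_vector_mult_0_right)
  have "matrix_inv A ** A ** matrix_inv A \<in> pd"
    using assms h k by (rule pd_conj)
  then show "matrix_inv A \<in> pd" by (simp add: *)
qed

lemma pd_lower_bound:
  fixes A :: "complex^'d^'d"
  assumes "A \<in> pd"
  shows "\<exists>m>0. A - m *\<^sub>R mat 1 \<in> psd"
proof -
  obtain B l where B: "finite B" "pairwise orthogonal B" "\<And>b. b \<in> B \<Longrightarrow> norm b = 1"
    "\<And>x. (\<Sum>b\<in>B. (b \<bullet> x) *\<^sub>R b) = x" "\<And>b. b \<in> B \<Longrightarrow> A *v b = l b *\<^sub>R b"
    using hermitian_spectral[OF pd_hermitian[OF assms]] by blast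
  have pos: "0 < l b" if "b \<in> B" for b
  proof -
    have "b \<noteq> 0" using B(3)[OF that] by force
    then show ?thesis using pd_form[OF assms, of b] B(3,5)[OF that] by (simp add: norm_eq_1)
  qed
  define m where "m = Min (insert 1 (l ` B))"
  have m: "m > 0" "\<And>b. b \<in> B \<Longrightarrow> m \<le> l b" using B(1) pos by (auto simp: m_def)
  have "A - m *\<^sub>R mat 1 \<in> psd"
  proof -
    have h: "A - m *\<^sub>R mat 1 \<in> hermitian" using pd_hermitian[OF assms] by (intro hermitian_intros)
    have "x \<bullet> ((A - m *\<^sub>R mat 1) *v x) = (\<Sum>b\<in>B. (l b - m) * (b \<bullet> x)\<^sup>2)" for x
      using B(1,4) by (rule hermitian_quadratic_form) (auto simp: matvec_simps B(5) scaleR_diff_left)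
    moreover have "0 \<le> (\<Sum>b\<in>B. (l b - m) * (b \<bullet> x)\<^sup>2)" for x
      using m by (intro sum_nonneg) auto
    ultimately show ?thesis using h by (simp add: psd_def)
  qed
  then show ?thesis using m(1) by blast
qed

lemma pd_of_lower_bound: "A - m *\<^sub>R mat 1 \<in> psd \<Longrightarrow> m > 0 \<Longrightarrow> A \<in> pd"
  using psd_add_pd[of "A - m *\<^sub>R mat 1" "m *\<^sub>R mat 1"] pd_scaleR[OF pd_mat1, of m] by simp

lemma psd_sqrt_exists:
  assumes "A \<in> psd"
  shows "\<exists>B\<in>psd. B ** B = A"
proof -
  obtain G where G: "G \<in> psd" "\<And>x l. A *v x = l *\<^sub>R x \<Longrightarrow> G *v x = sqrt \<bar>l\<bar> *\<^sub>R x"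
    using functional_calculus[OF psd_hermitian[OF assms], of "\<lambda>l. sqrt \<bar>l\<bar>"] by auto
  have "G ** G = A"
  proof (rule eq_on_eigenvectorsI[OF psd_hermitian[OF assms]])
    fix x l assume x: "A *v x = l *\<^sub>R x"
    have "l \<ge> 0 \<or> x = 0"
    proof (cases "x = 0")
      case False
      then have "x \<bullet> x > 0" by simp
      then show ?thesis
        using psd_form[OF assms, of x] mult_neg_pos[of l "x \<bullet> x"] x by (auto simp: not_le[symmetric])
    qed simp
    then show "(G ** G) *v x = A *v x"
      by (auto simp: matrix_vector_mul_assoc[symmetric] G(2)[OF x] matrix_vector_scaleR x)
  qed
  then show ?thesis using G by blast
qed

text \<open>If \<open>X - Y\<close> had a negative eigenvalue \<open>l\<close> with eigenvector \<open>v\<close>, then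
  \<open>v \<bullet> (X\<^sup>2 - Y\<^sup>2) v = l v \<bullet> (X + Y) v\<close> would be nonpositive, so that \<open>v\<close> would be killed by \<open>X\<close> and
  \<open>Y\<close>.\<close>

lemma psd_square_monotone:
  fixes X Y :: "complex^'d^'d"
  assumes X: "X \<in> psd" and Y: "Y \<in> psd" and le: "X ** X - Y ** Y \<in> psd"
  shows "X - Y \<in> psd"
proof (rule ccontr)
  assume n: "X - Y \<notin> psd"
  have h: "X - Y \<in> hermitian" using X Y by (intro hermitian_intros psd_hermitian)
  obtain v l where v: "norm v = 1" "l < 0" "(X - Y) *v v = l *\<^sub>R v"
    using n h negative_eigenvector[OF h] by (force simp: psd_def not_le)
  have "X ** X - Y ** Y = X ** (X - Y) + (X - Y) ** Y" by (simp add: matrix_simps)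
  then have "0 \<le> v \<bullet> ((X ** (X - Y) + (X - Y) ** Y) *v v)" using psd_form[OF le] by metis
  also have "\<dots> = v \<bullet> (X *v ((X - Y) *v v)) + ((X - Y) *v v) \<bullet> (Y *v v)"
    using h by (simp add: matvec_simps(3) inner_add_right matrix_vector_mul_assoc[symmetric]
        hermitian_iff_selfadjoint[of "X - Y"])
  also have "\<dots> = l * (v \<bullet> (X *v v) + v \<bullet> (Y *v v))"
    unfolding v(3) by (simp add: matrix_vector_scaleR inner_commute algebra_simps)
  finally have "v \<bullet> (X *v v) + v \<bullet> (Y *v v) \<le> 0"
    using v(2) by (simp add: zero_le_mult_iff)
  then have "v \<bullet> (X *v v) = 0" "v \<bullet> (Y *v v) = 0"
    using psd_form[OF X, of v] psd_form[OF Y, of v] by linarith+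
  then have "v \<bullet> ((X - Y) *v v) = 0" by (simp add: matvec_simps inner_diff_right)
  then have "l * (v \<bullet> v) = 0" by (simp add: v(3))
  then show False using v by (simp add: norm_eq_1)
qed

lemma psd_antisym:
  fixes X :: "complex^'d^'d"
  assumes "X - Y \<in> psd" "Y - X \<in> psd"
  shows "X = Y"
proof -
  have h: "X - Y \<in> hermitian" using assms(1) by (rule psd_hermitian)
  have 0: "v \<bullet> ((X - Y) *v v) = 0" for v
  proof -
    have "v \<bullet> ((Y - X) *v v) = - (v \<bullet> ((X - Y) *v v))"
      by (simp add: matvec_simps inner_diff_right)
    then show ?thesis
      using psd_form[OF assms(1), of v] psd_form[OF assms(2), of v] by simp
  qed
  have "X - Y = 0"
  proof (rule eq_on_eigenvectorsI[OF h])
    fix x l assume "(X - Y) *v x = l *\<^sub>R x"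
    with 0[of x] show "(X - Y) *v x = 0 *v x" by auto
  qed
  then show ?thesis by simp
qed

lemma psd_square_inject: "X \<in> psd \<Longrightarrow> Y \<in> psd \<Longrightarrow> X ** X = Y ** Y \<Longrightarrow> X = Y"
  using psd_square_monotone[of X Y] psd_square_monotone[of Y X] psd_antisym[of X Y]
  by (simp add: psd_intros)

lemma psd_sqrt:
  assumes "A \<in> psd"
  shows "psd_sqrt A \<in> psd" "psd_sqrt A ** psd_sqrt A = A"
proof -
  have "\<exists>!B. B \<in> psd \<and> B ** B = A"
    using psd_sqrt_exists[OF assms] psd_square_inject by metis
  from theI'[OF this] show "psd_sqrt A \<in> psd" "psd_sqrt A ** psd_sqrt A = A"
    by (auto simp: psd_sqrt_def)
qed

lemma psd_sqrt_unique: "B \<in> psd \<Longrightarrow> B ** B = A \<Longrightarrow> psd_sqrt A = B"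
  unfolding psd_sqrt_def using psd_square_inject by (intro the_equality) auto

lemma psd_sqrt_hermitian: "A \<in> psd \<Longrightarrow> psd_sqrt A \<in> hermitian"
  by (intro psd_hermitian psd_sqrt)

lemma psd_sqrt_pd:
  assumes "A \<in> pd"
  shows "psd_sqrt A \<in> pd"
proof -
  note p = psd_sqrt[OF pd_imp_psd[OF assms]]
  have "0 < v \<bullet> (psd_sqrt A *v v)" if v: "v \<noteq> 0" for v
  proof -
    let ?X = "psd_sqrt A" and ?R = "psd_sqrt (psd_sqrt A)"
    note r = psd_sqrt[OF p(1)]
    have "v \<bullet> (?X *v v) = (?R *v v) \<bullet> (?R *v v)"
      using psd_hermitian[OF r(1)] r(2)
      by (metis hermitian_iff_selfadjoint matrix_vector_mul_assoc)
    moreover have "?R *v v \<noteq> 0"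
    proof
      assume "?R *v v = 0"
      then have "?X *v v = 0" by (metis r(2) matrix_vector_mul_assoc matrix_vector_mult_0_right)
      then have "A *v v = 0" by (metis p(2) matrix_vector_mul_assoc matrix_vector_mult_0_right)
      then show False using pd_kernel[OF assms] v by blast
    qed
    ultimately show ?thesis by simp
  qed
  then show ?thesis using psd_hermitian[OF p(1)] by (simp add: pd_def)
qed

lemma rtrace_psd_nonneg: "A \<in> psd \<Longrightarrow> 0 \<le> rtrace A"
proof -
  assume A: "A \<in> psd"
  have "rtrace A = (\<Sum>i\<in>UNIV. axis i 1 \<bullet> (A *v axis i 1))"
  proof -
    have "(A *v axis i 1) $ i = A $ i $ i" for i
      by (simp add: matrix_vector_mult_def axis_def if_distrib cong: if_cong)
    then show ?thesis by (simp add: rtrace_def trace_def inner_axis' inner_complex_def)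
  qed
  then show ?thesis using psd_form[OF A] by (simp add: sum_nonneg)
qed

text \<open>The inner product is the trace of \<open>A\<^bsup>1/2\<^esup> B A\<^bsup>1/2\<^esup>\<close>.\<close>

lemma inner_psd_nonneg:
  assumes "A \<in> psd" "B \<in> psd"
  shows "0 \<le> A \<bullet> B"
proof -
  let ?N = "psd_sqrt A"
  have N: "?N \<in> hermitian" "?N ** ?N = A" using psd_sqrt[OF assms(1)] psd_hermitian by auto
  have "A \<bullet> B = (?N ** ?N) \<bullet> B" by (simp add: N)
  also have "\<dots> = (?N ** (B ** mat 1)) \<bullet> ?N"
    by (subst inner_matrix_mult_left) (simp add: hermitianD[OF N(1)] inner_commute)
  also have "\<dots> = rtrace (?N ** B ** ?N)"
    by (subst (2) hermitianD[OF N(1), symmetric])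
       (simp add: rtrace_eq_inner inner_matrix_mult_right hermitianD[OF N(1)])
  finally show ?thesis using rtrace_psd_nonneg[OF psd_conj[OF assms(2) N(1)]] by simp
qed

lemma norm_square_hermitian: "X \<in> hermitian \<Longrightarrow> (norm X)\<^sup>2 = rtrace (X ** X)"
  by (simp add: power2_norm_eq_inner inner_eq_rtrace_ctranspose hermitianD)

lemma norm_psd_sqrt: "A \<in> psd \<Longrightarrow> (norm (psd_sqrt A))\<^sup>2 = rtrace A"
  using norm_square_hermitian[OF psd_sqrt_hermitian] psd_sqrt(2) by metis

lemma norm_matrix_vector_le: "norm (A *v x) \<le> norm A * norm x"
  for A :: "complex^'n^'m"
proof -
  have 1: "norm ((A *v x) $ i) \<le> norm (A $ i) * norm x" for i
  proof -
    have "norm ((A *v x) $ i) \<le> (\<Sum>j\<in>UNIV. norm (A $ i $ j) * norm (x $ j))"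
      unfolding matrix_vector_mult_def by (simp add: norm_mult[symmetric] sum_norm_le)
    also have "\<dots> \<le> L2_set (\<lambda>j. norm (A $ i $ j)) UNIV * L2_set (\<lambda>j. norm (x $ j)) UNIV"
      by (rule order_trans[OF _ L2_set_mult_ineq]) (simp add: sum_mono)
    finally show ?thesis by (simp add: norm_vec_def)
  qed
  have "norm (A *v x) \<le> L2_set (\<lambda>i. norm (A $ i) * norm x) UNIV"
    unfolding norm_vec_def[of "A *v x"] by (intro L2_set_mono 1) auto
  also have "\<dots> = norm A * norm x"
    by (simp add: L2_set_left_distrib norm_vec_def[of A])
  finally show ?thesis .
qed

lemma psd_le_rtrace:
  assumes "A \<in> psd"
  shows "rtrace A *\<^sub>R mat 1 - A \<in> psd"
proof -
  let ?N = "psd_sqrt A"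
  have N: "?N \<in> hermitian" "?N ** ?N = A" using psd_sqrt[OF assms(1)] psd_hermitian by auto
  have "0 \<le> v \<bullet> ((rtrace A *\<^sub>R mat 1 - A) *v v)" for v
  proof -
    have "v \<bullet> (A *v v) = (norm (?N *v v))\<^sup>2"
      using N by (metis dot_square_norm hermitian_iff_selfadjoint matrix_vector_mul_assoc)
    also have "\<dots> \<le> (norm ?N * norm v)\<^sup>2"
      by (intro power_mono norm_matrix_vector_le) simp
    finally show ?thesis
      by (simp add: matvec_simps inner_diff_right norm_psd_sqrt[OF assms] power_mult_distrib
          dot_square_norm)
  qed
  then show ?thesis using psd_hermitian[OF assms] by (simp add: psd_def hermitian_intros)
qed

lemma norm_psd_le_rtrace:
  assumes "A \<in> psd"
  shows "norm A \<le> rtrace A"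
proof -
  have "0 \<le> A \<bullet> (rtrace A *\<^sub>R mat 1 - A)"
    using assms psd_le_rtrace[OF assms] by (rule inner_psd_nonneg)
  then have "A \<bullet> A \<le> (rtrace A)\<^sup>2"
    by (simp add: inner_diff_right rtrace_eq_inner power2_eq_square)
  then have "(norm A)\<^sup>2 \<le> (rtrace A)\<^sup>2" by (simp only: power2_norm_eq_inner)
  then show ?thesis using rtrace_psd_nonneg[OF assms] by (rule power2_le_imp_le)
qed

lemma hermitian_le_norm:
  assumes "A \<in> hermitian" "norm A \<le> c"
  shows "c *\<^sub>R mat 1 - A \<in> psd" "c *\<^sub>R mat 1 + A \<in> psd"
proof -
  have "\<bar>v \<bullet> (A *v v)\<bar> \<le> c * (v \<bullet> v)" for v
  proof -
    have "\<bar>v \<bullet> (A *v v)\<bar> \<le> norm v * (norm A * norm v)"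
      by (rule order_trans[OF Cauchy_Schwarz_ineq2]) (simp add: mult_left_mono norm_matrix_vector_le)
    also have "\<dots> = norm A * (v \<bullet> v)" by (simp add: dot_square_norm power2_eq_square)
    also have "\<dots> \<le> c * (v \<bullet> v)" using assms(2) by (intro mult_right_mono) auto
    finally show ?thesis .
  qed
  then show "c *\<^sub>R mat 1 - A \<in> psd" "c *\<^sub>R mat 1 + A \<in> psd"
    using assms(1) by (auto simp: psd_def hermitian_intros matvec_simps inner_diff_right
        inner_add_right abs_le_iff) (metis add.commute add_le_cancel_right diff_ge_0_iff_ge diff_minus_eq_add)
qed

text \<open>On positive semidefinite matrices the trace is additive and dominates the norm, so two-sided bounds
  in the Loewner order become norm bounds.\<close>

lemma norm_le_of_order_bounds:
  fixes D B :: "complex^'d^'d"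
  assumes "B - D \<in> psd" "B + D \<in> psd"
  shows "norm D \<le> 3 * rtrace B"
proof -
  have "B = (1/2) *\<^sub>R ((B - D) + (B + D))" by (simp add: scaleR_2[symmetric])
  then have "B \<in> psd" using assms psd_intros by (metis zero_le_divide_1_iff zero_le_numeral)
  have "D = (B + D) - B" by simp
  then have "norm D \<le> norm (B + D) + norm B" by (metis norm_triangle_ineq4)
  also have "\<dots> \<le> rtrace (B + D) + rtrace B"
    using assms \<open>B \<in> psd\<close> by (intro add_mono norm_psd_le_rtrace)
  also have "\<dots> \<le> rtrace (B + D) + rtrace (B - D) + rtrace B"
    using rtrace_psd_nonneg[OF assms(1)] by simp
  also have "\<dots> = 3 * rtrace B" by (simp add: rtrace_eq_inner inner_add_left inner_diff_left)
  finally show ?thesis .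
qed

text \<open>From \<open>B \<le> A + \<epsilon> \<le> (\<surd>A + \<surd>\<epsilon>)\<^sup>2\<close> and monotonicity of the square root, \<open>\<surd>B \<le> \<surd>A + \<surd>\<epsilon>\<close>.\<close>

lemma psd_sqrt_Hoelder:
  fixes A B :: "complex^'d^'d"
  assumes A: "A \<in> psd" and B: "B \<in> psd"
  shows "norm (psd_sqrt A - psd_sqrt B) \<le> 3 * rtrace (mat 1 :: complex^'d^'d) * sqrt (norm (A - B))"
proof -
  have *: "sqrt (norm (A - B)) *\<^sub>R mat 1 - (psd_sqrt B - psd_sqrt A) \<in> psd"
    if A: "A \<in> psd" and B: "B \<in> psd" for A B :: "complex^'d^'d"
  proof -
    define e where "e = norm (A - B)"
    have e: "0 \<le> e" by (simp add: e_def)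
    let ?X = "psd_sqrt A + sqrt e *\<^sub>R mat 1"
    have X: "?X \<in> psd" using psd_sqrt(1)[OF A] by (intro psd_intros) (auto simp: e)
    have "?X ** ?X - psd_sqrt B ** psd_sqrt B =
      (e *\<^sub>R mat 1 + (A - B)) + (2 * sqrt e) *\<^sub>R psd_sqrt A"
    proof -
      have "(2 * sqrt e) *\<^sub>R psd_sqrt A = sqrt e *\<^sub>R psd_sqrt A + sqrt e *\<^sub>R psd_sqrt A"
        unfolding mult_2 by (rule scaleR_left_distrib)
      then show ?thesis
        using e by (simp add: matrix_simps psd_sqrt(2)[OF A] psd_sqrt(2)[OF B] scaleR_add_right)
    qed
    also have "\<dots> \<in> psd"
    proof (rule psd_intros(1))
      show "e *\<^sub>R mat 1 + (A - B) \<in> psd"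
        using hermitian_le_norm(2)[OF hermitian_intros(2)[OF psd_hermitian[OF A] psd_hermitian[OF B]]]
        by (simp add: e_def)
      show "(2 * sqrt e) *\<^sub>R psd_sqrt A \<in> psd"
        using psd_sqrt(1)[OF A] e by (intro psd_intros(2)) auto
    qed
    finally have "?X - psd_sqrt B \<in> psd" by (rule psd_square_monotone[OF X psd_sqrt(1)[OF B]])
    moreover have "?X - psd_sqrt B = sqrt e *\<^sub>R mat 1 - (psd_sqrt B - psd_sqrt A)" by simp
    ultimately show ?thesis by (simp only: e_def)
  qed
  have "norm (psd_sqrt A - psd_sqrt B) \<le> 3 * rtrace (sqrt (norm (A - B)) *\<^sub>R mat 1 :: complex^'d^'d)"
  proof (rule norm_le_of_order_bounds)
    show "sqrt (norm (A - B)) *\<^sub>R mat 1 - (psd_sqrt A - psd_sqrt B) \<in> psd"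
      using *[OF B A] by (simp only: norm_minus_commute)
    have "sqrt (norm (A - B)) *\<^sub>R mat 1 + (psd_sqrt A - psd_sqrt B) =
        sqrt (norm (A - B)) *\<^sub>R mat 1 - (psd_sqrt B - psd_sqrt A)" by simp
    then show "sqrt (norm (A - B)) *\<^sub>R mat 1 + (psd_sqrt A - psd_sqrt B) \<in> psd"
      using *[OF A B] by (simp only:)
  qed
  then show ?thesis by (simp add: rtrace_eq_inner mult_ac)
qed

lemma continuous_on_psd_sqrt: "continuous_on psd psd_sqrt"
  unfolding continuous_on_def
proof
  fix A :: "complex^'d^'d" assume A: "A \<in> psd"
  have "((\<lambda>B. norm (psd_sqrt B - psd_sqrt A)) \<longlongrightarrow> 0) (at A within psd)"
  proof (rule tendsto_sandwich[OF _ _ tendsto_const])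
    show "\<forall>\<^sub>F B in at A within psd. norm (psd_sqrt B - psd_sqrt A) \<le>
        3 * rtrace (mat 1 :: complex^'d^'d) * sqrt (norm (B - A))"
      using psd_sqrt_Hoelder[OF _ A] by (auto simp: eventually_at_filter)
    have "((\<lambda>B. 3 * rtrace (mat 1 :: complex^'d^'d) * sqrt (norm (B - A))) \<longlongrightarrow>
        3 * rtrace (mat 1 :: complex^'d^'d) * sqrt (norm (A - A))) (at A within psd)"
      by (intro tendsto_intros)
    then show "((\<lambda>B. 3 * rtrace (mat 1 :: complex^'d^'d) * sqrt (norm (B - A))) \<longlongrightarrow> 0)
        (at A within psd)" by simp
  qed auto
  then show "(psd_sqrt \<longlongrightarrow> psd_sqrt A) (at A within psd)"
    by (simp add: tendsto_norm_zero_iff LIM_zero_iff)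
qed

lemma closed_hermitian: "closed hermitian"
  by (rule closed_subspace[OF subspace_hermitian])

lemma closed_psd: "closed (psd :: (complex^'d^'d) set)"
proof -
  have eq: "(psd :: (complex^'d^'d) set) = hermitian \<inter> (\<Inter>v. {A. 0 \<le> v \<bullet> (A *v v)})" by (auto simp: psd_def)
  have "closed {A. 0 \<le> v \<bullet> (A *v v)}" for v :: "complex^'d"
  proof -
    have "continuous_on UNIV (\<lambda>A. v \<bullet> (A *v v))"
        by (intro continuous_on_inner continuous_on_const continuous_on_id
          bounded_bilinear.continuous_on[OF bounded_bilinear_matrix_vector])
    then show ?thesis by (rule closed_Collect_le[OF continuous_on_const])
  qed
  then have "closed (hermitian \<inter> (\<Inter>v::complex^'d. {A. 0 \<le> v \<bullet> (A *v v)}))"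
    by (intro closed_Int closed_INT closed_hermitian) blast
  then show ?thesis by (simp only: eq)
qed

lemma add_diff_cancel_middle: "(a - m) + (r + (b - a)) = b - (m - r)" for a :: "'a::ab_group_add"
  by simp

lemma pd_neighbourhood:
  assumes "A - m *\<^sub>R mat 1 \<in> psd" "B \<in> hermitian" "norm (B - A) \<le> r"
  shows "B - (m - r) *\<^sub>R mat 1 \<in> psd"
proof -
  have h: "A \<in> hermitian"
    using psd_hermitian[OF assms(1)] hermitian_intros(1)[of "A - m *\<^sub>R mat 1" "m *\<^sub>R mat 1"]
    by (simp add: hermitian_intros)
  have "(A - m *\<^sub>R mat 1) + (r *\<^sub>R mat 1 + (B - A)) \<in> psd"
    by (rule psd_intros(1)[OF assms(1) hermitian_le_norm(2)[OF hermitian_intros(2)[OF assms(2) h] assms(3)]])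
  moreover have "(A - m *\<^sub>R mat 1) + (r *\<^sub>R mat 1 + (B - A)) = B - (m - r) *\<^sub>R mat 1"
    unfolding scaleR_left_diff_distrib by (rule add_diff_cancel_middle)
  ultimately show ?thesis by (simp only:)
qed

section \<open>The Sylvester equation\<close>

text \<open>\<open>sylvester X\<close> inverts \<open>Y \<mapsto> X Y + Y X\<close>, the differential at \<open>X\<close> of squaring; it is therefore the
  differential of the square root at \<open>X\<^sup>2\<close>.\<close>

definition sylvester :: "complex^'d^'d \<Rightarrow> complex^'d^'d \<Rightarrow> complex^'d^'d" where
  "sylvester X C = (THE Y. X ** Y + Y ** X = C)"

lemma psd_mult_inner_nonneg:
  fixes W Y :: "complex^'d^'d"
  assumes "W \<in> psd"
  shows "0 \<le> (W ** Y) \<bullet> Y" "0 \<le> (Y ** W) \<bullet> Y"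
proof -
  let ?N = "psd_sqrt W"
  have N: "ctranspose ?N = ?N" "?N ** ?N = W"
    using psd_sqrt[OF assms] by (auto dest: psd_hermitian hermitianD)
  have "(W ** Y) \<bullet> Y = (?N ** (?N ** Y)) \<bullet> Y" by (simp add: matrix_mul_assoc N)
  also have "\<dots> = (?N ** Y) \<bullet> (?N ** Y)" by (subst inner_matrix_mult_left) (simp add: N)
  finally show "0 \<le> (W ** Y) \<bullet> Y" by simp
  have "(Y ** W) \<bullet> Y = ((Y ** ?N) ** ?N) \<bullet> Y" by (simp add: matrix_mul_assoc[symmetric] N)
  also have "\<dots> = (Y ** ?N) \<bullet> (Y ** ?N)" by (subst inner_matrix_mult_right) (simp add: N)
  finally show "0 \<le> (Y ** W) \<bullet> Y" by simp
qed

lemma mult_inner_lower_bound: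
  fixes X Y :: "complex^'d^'d"
  assumes "X - m *\<^sub>R mat 1 \<in> psd"
  shows "m * (norm Y)\<^sup>2 \<le> (X ** Y) \<bullet> Y" "m * (norm Y)\<^sup>2 \<le> (Y ** X) \<bullet> Y"
  using psd_mult_inner_nonneg[OF assms, of Y]
  by (simp_all add: matrix_simps inner_diff_left power2_norm_eq_inner)

text \<open>Test \<open>X Y + Y X'\<close> against \<open>Y\<close>.  Distinct \<open>X\<close> and \<open>X'\<close> serve to compare the square roots of two
  different matrices.\<close>

lemma sylvester_lower_bound:
  fixes X X' Y :: "complex^'d^'d"
  assumes "X - m *\<^sub>R mat 1 \<in> psd" "X' - m' *\<^sub>R mat 1 \<in> psd"
  shows "(m + m') * norm Y \<le> norm (X ** Y + Y ** X')"
proof (cases "Y = 0")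
  case False
  have "(m + m') * (norm Y)\<^sup>2 \<le> (X ** Y + Y ** X') \<bullet> Y"
    using mult_inner_lower_bound(1)[OF assms(1), of Y] mult_inner_lower_bound(2)[OF assms(2), of Y]
    by (simp add: inner_add_left algebra_simps)
  also have "\<dots> \<le> norm (X ** Y + Y ** X') * norm Y" by (rule norm_cauchy_schwarz)
  finally show ?thesis using False by (simp add: power2_eq_square)
qed simp

lemma sylvester_ex1:
  fixes X C :: "complex^'d^'d"
  assumes "X \<in> pd"
  shows "\<exists>!Y. X ** Y + Y ** X = C"
proof -
  obtain m where m: "m > 0" "X - m *\<^sub>R mat 1 \<in> psd" using pd_lower_bound[OF assms] by blast
  let ?f = "\<lambda>Y. X ** Y + Y ** X"
  have lin: "linear ?f" by (simp add: linear_iff matrix_simps scaleR_add_right)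
  have "inj ?f"
  proof -
    have "Y = 0" if "?f Y = 0" for Y
      using sylvester_lower_bound[OF m(2) m(2), of Y] m(1) that by (simp add: mult_le_0_iff)
    then show ?thesis unfolding linear_injective_0[OF lin] by blast
  qed
  then have "bij ?f" using linear_injective_imp_surjective[OF lin] by (simp add: bij_def)
  then show ?thesis unfolding bij_iff by blast
qed

lemma sylvester_eq: "X \<in> pd \<Longrightarrow> X ** sylvester X C + sylvester X C ** X = C"
  unfolding sylvester_def by (rule theI'[OF sylvester_ex1])

lemma sylvester_unique: "X \<in> pd \<Longrightarrow> X ** Y + Y ** X = C \<Longrightarrow> sylvester X C = Y"
  using sylvester_eq sylvester_ex1 by metis

lemma linear_sylvester: "X \<in> pd \<Longrightarrow> linear (sylvester X)"
proof -
  assume X: "X \<in> pd"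
  show ?thesis
  proof (rule linearI)
    fix C D r
    show "sylvester X (C + D) = sylvester X C + sylvester X D"
      using sylvester_eq[OF X, of C] sylvester_eq[OF X, of D]
      by (intro sylvester_unique[OF X]) (simp add: matrix_simps algebra_simps)
    show "sylvester X (r *\<^sub>R C) = r *\<^sub>R sylvester X C"
      using sylvester_eq[OF X, of C]
      by (intro sylvester_unique[OF X]) (simp add: matrix_simps scaleR_add_right[symmetric])
  qed
qed

lemma sylvester_hermitian:
  assumes X: "X \<in> pd" and C: "C \<in> hermitian"
  shows "sylvester X C \<in> hermitian"
proof (rule hermitianI, rule sym, rule sylvester_unique[OF X])
  have "ctranspose (X ** sylvester X C + sylvester X C ** X) = C"
    using sylvester_eq[OF X, of C] C by (simp add: hermitianD)
  then show "X ** ctranspose (sylvester X C) + ctranspose (sylvester X C) ** X = C"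
    using hermitianD[OF pd_hermitian[OF X]]
    by (simp add: ctranspose_add ctranspose_mult add.commute)
qed

lemma norm_sylvester_le:
  assumes "X - m *\<^sub>R mat 1 \<in> psd" "m > 0"
  shows "norm (sylvester X C) \<le> norm C / (2 * m)"
  using sylvester_lower_bound[OF assms(1,1), of "sylvester X C"]
    sylvester_eq[OF pd_of_lower_bound[OF assms], of C] assms(2)
  by (simp add: field_simps)

text \<open>At a unit eigenvector \<open>v\<close> of the solution with eigenvalue \<open>l\<close>, the form of \<open>C\<close> is \<open>2 l (v \<bullet> X v)\<close>.\<close>

lemma sylvester_psd:
  fixes X C :: "complex^'d^'d"
  assumes X: "X \<in> pd" and C: "C \<in> psd"
  shows "sylvester X C \<in> psd"
proof (rule ccontr)
  let ?Y = "sylvester X C"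
  assume n: "?Y \<notin> psd"
  have h: "?Y \<in> hermitian" using X psd_hermitian[OF C] by (rule sylvester_hermitian)
  obtain v l where v: "norm v = 1" "l < 0" "?Y *v v = l *\<^sub>R v"
    using n h negative_eigenvector[OF h] by (force simp: psd_def not_le)
  have "0 \<le> v \<bullet> ((X ** ?Y + ?Y ** X) *v v)" unfolding sylvester_eq[OF X] by (rule psd_form[OF C])
  also have "\<dots> = v \<bullet> (X *v (?Y *v v)) + (?Y *v v) \<bullet> (X *v v)"
    using h by (simp add: matvec_simps(3) inner_add_right matrix_vector_mul_assoc[symmetric]
        hermitian_iff_selfadjoint[of ?Y])
  also have "\<dots> = 2 * l * (v \<bullet> (X *v v))"
    unfolding v(3) by (simp add: matrix_vector_scaleR)
  also have "v \<noteq> 0" using v(1) by force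
  then have "2 * l * (v \<bullet> (X *v v)) < 0" using pd_form[OF X, of v] v(2) by (simp add: mult_neg_pos)
  finally show False by simp
qed

lemma sylvester_square: "X \<in> pd \<Longrightarrow> sylvester X (r *\<^sub>R (X ** X)) = (r / 2) *\<^sub>R X"
  by (rule sylvester_unique) (simp_all add: matrix_simps scaleR_left_distrib[symmetric])

lemma eventually_lower_bound:
  assumes "(f \<longlongrightarrow> X) F" "X \<in> pd" "\<forall>\<^sub>F x in F. f x \<in> hermitian"
  shows "\<exists>m>0. X - m *\<^sub>R mat 1 \<in> psd \<and> (\<forall>\<^sub>F x in F. f x - m *\<^sub>R mat 1 \<in> psd)"
proof -
  obtain m where m: "m > 0" "X - m *\<^sub>R mat 1 \<in> psd" using pd_lower_bound[OF assms(2)] by blast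
  have "\<forall>\<^sub>F x in F. dist (f x) X < m / 2" using tendstoD[OF assms(1), of "m / 2"] m(1) by simp
  with assms(3) have "\<forall>\<^sub>F x in F. f x - (m / 2) *\<^sub>R mat 1 \<in> psd"
  proof eventually_elim
    case (elim x)
    then show ?case using pd_neighbourhood[OF m(2), of "f x" "m / 2"] by (simp add: dist_norm)
  qed
  moreover have "X - (m / 2) *\<^sub>R mat 1 \<in> psd"
    using pd_neighbourhood[OF m(2) pd_hermitian[OF assms(2)], of "m / 2"] m(1) by simp
  ultimately show ?thesis using m(1) by (intro exI[of _ "m / 2"]) simp
qed

text \<open>The error solves a Sylvester equation whose right-hand side tends to zero, and the solution operators
  are uniformly bounded near \<open>X\<close>.\<close>

lemma tendsto_sylvester:
  fixes X C :: "complex^'d^'d"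
  assumes X: "(f \<longlongrightarrow> X) F" "X \<in> pd" "\<forall>\<^sub>F x in F. f x \<in> hermitian" and C: "(c \<longlongrightarrow> C) F"
  shows "((\<lambda>x. sylvester (f x) (c x)) \<longlongrightarrow> sylvester X C) F"
proof -
  obtain m where m: "m > 0" "\<forall>\<^sub>F x in F. f x - m *\<^sub>R mat 1 \<in> psd"
    using eventually_lower_bound[OF X] by blast
  let ?Y = "sylvester X C"
  let ?g = "\<lambda>x. norm ((c x - C) - ((f x - X) ** ?Y + ?Y ** (f x - X)))"
  have "((\<lambda>x. norm (sylvester (f x) (c x) - ?Y)) \<longlongrightarrow> 0) F"
  proof (rule tendsto_sandwich[OF _ _ tendsto_const])
    show "\<forall>\<^sub>F x in F. norm (sylvester (f x) (c x) - ?Y) \<le> ?g x / (2 * m)"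
      using m(2)
    proof eventually_elim
      case (elim x)
      have p: "f x \<in> pd" using elim m(1) by (rule pd_of_lower_bound)
      have "sylvester (f x) ((c x - C) - ((f x - X) ** ?Y + ?Y ** (f x - X))) =
          sylvester (f x) (c x) - ?Y"
        using sylvester_eq[OF X(2), of C] sylvester_eq[OF p, of "c x"]
        by (intro sylvester_unique[OF p]) (simp add: matrix_simps algebra_simps)
      then show ?case using norm_sylvester_le[OF elim m(1)] by metis
    qed
    have "((\<lambda>x. ?g x / (2 * m)) \<longlongrightarrow>
        norm ((C - C) - ((X - X) ** ?Y + ?Y ** (X - X))) / (2 * m)) F"
      by (intro tendsto_intros X(1) C) (use m(1) in auto)
    then show "((\<lambda>x. ?g x / (2 * m)) \<longlongrightarrow> 0) F" by simp
  qed auto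
  then show ?thesis by (simp add: tendsto_norm_zero_iff LIM_zero_iff)
qed

section \<open>Derivatives of the square root and of the inverse\<close>

lemma at_within_pd: "Q \<in> pd \<Longrightarrow> at Q within pd = at Q within hermitian"
proof -
  assume Q: "Q \<in> pd"
  obtain m where m: "m > 0" "Q - m *\<^sub>R mat 1 \<in> psd" using pd_lower_bound[OF Q] by blast
  have "R \<in> pd" if "R \<in> hermitian" "dist Q R < m" for R
    using pd_neighbourhood[OF m(2) that(1) order_refl] that(2)
    by (intro pd_of_lower_bound[of R "m - norm (R - Q)"]) (auto simp: dist_norm norm_minus_commute)
  then show ?thesis
    using m(1) by (intro at_within_nhd[of Q "ball Q m"]) (auto dest: pd_hermitian)
qed

lemma has_derivative_quadratic_remainder:
  fixes f :: "'a::real_normed_vector \<Rightarrow> 'b::real_normed_vector"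
  assumes "bounded_linear L" "\<forall>\<^sub>F y in at x within S. norm (f y - f x - L (y - x)) \<le> C * (norm (y - x))\<^sup>2"
  shows "(f has_derivative L) (at x within S)"
  unfolding has_derivative_within
proof (intro conjI assms(1))
  have "((\<lambda>y. norm ((1 / norm (y - x)) *\<^sub>R (f y - (f x + L (y - x))))) \<longlongrightarrow> 0) (at x within S)"
  proof (rule tendsto_sandwich[OF _ _ tendsto_const])
    show "\<forall>\<^sub>F y in at x within S. norm ((1 / norm (y - x)) *\<^sub>R (f y - (f x + L (y - x)))) \<le> C * norm (y - x)"
      using assms(2)
    proof eventually_elim
      case (elim y)
      then show ?case
        by (cases "y = x") (auto simp: diff_diff_eq divide_le_eq power2_eq_square mult.assoc)
    qed
    have "((\<lambda>y. C * norm (y - x)) \<longlongrightarrow> C * norm (x - x)) (at x within S)" by (intro tendsto_intros)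
    then show "((\<lambda>y. C * norm (y - x)) \<longlongrightarrow> 0) (at x within S)" by simp
  qed auto
  then show "((\<lambda>y. (1 / norm (y - x)) *\<^sub>R (f y - (f x + L (y - x)))) \<longlongrightarrow> 0) (at x within S)"
    by (rule tendsto_norm_zero_cancel)
qed

lemma matrix_mult_norm_bound:
  "\<exists>K>0. \<forall>(A::complex^'d^'d) (B::complex^'d^'d). norm (A ** B) \<le> norm A * norm B * K"
  using bounded_bilinear.pos_bounded[OF bounded_bilinear_matrix_mult] by blast

text \<open>Let \<open>X\<close> and \<open>Y\<close> be the square roots of \<open>A\<close> and \<open>B\<close>, and \<open>D = Y - X\<close>.  From \<open>Y D + D X = B - A\<close> the
  difference \<open>D\<close> is of order \<open>B - A\<close>; from \<open>X D + D X = B - A - D\<^sup>2\<close> the remainder solves a Sylvester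
  equation with right-hand side \<open>D\<^sup>2\<close>.\<close>

lemma psd_sqrt_has_derivative:
  fixes A :: "complex^'d^'d"
  assumes A: "A \<in> pd"
  shows "(psd_sqrt has_derivative sylvester (psd_sqrt A)) (at A within pd)"
proof -
  let ?X = "psd_sqrt A"
  have Xpd: "?X \<in> pd" and XX: "?X ** ?X = A"
    using psd_sqrt_pd[OF A] psd_sqrt[OF pd_imp_psd[OF A]] by auto
  obtain m where m: "m > 0" "?X - m *\<^sub>R mat 1 \<in> psd" using pd_lower_bound[OF Xpd] by blast
  obtain K where K: "K > 0" "\<And>(A::complex^'d^'d) (B::complex^'d^'d). norm (A ** B) \<le> norm A * norm B * K"
    using matrix_mult_norm_bound by blast
  have "norm (psd_sqrt B - ?X - sylvester ?X (B - A)) \<le> K / (2 * m ^ 3) * (norm (B - A))\<^sup>2"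
    if B: "B \<in> pd" for B
  proof -
    let ?Y = "psd_sqrt B" let ?D = "?Y - ?X"
    have Y: "?Y \<in> psd" "?Y ** ?Y = B" using psd_sqrt[OF pd_imp_psd[OF B]] by auto
    have "(0 + m) * norm ?D \<le> norm (?Y ** ?D + ?D ** ?X)"
      using Y(1) m(2) by (intro sylvester_lower_bound) auto
    also have "?Y ** ?D + ?D ** ?X = B - A" by (simp add: matrix_simps Y(2) XX)
    finally have D: "norm ?D \<le> norm (B - A) / m" using m(1) by (simp add: field_simps)
    have "sylvester ?X (?D ** ?D) = sylvester ?X (B - A) - ?D"
    proof (rule sylvester_unique[OF Xpd])
      have "?X ** (sylvester ?X (B - A) - ?D) + (sylvester ?X (B - A) - ?D) ** ?X
        = (?X ** sylvester ?X (B - A) + sylvester ?X (B - A) ** ?X) - (?X ** ?D + ?D ** ?X)"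
        by (simp add: matrix_simps)
      also have "\<dots> = ?D ** ?D" unfolding sylvester_eq[OF Xpd] by (simp add: matrix_simps Y(2) XX)
      finally show "?X ** (sylvester ?X (B - A) - ?D) + (sylvester ?X (B - A) - ?D) ** ?X = ?D ** ?D" .
    qed
    then have "norm (?D - sylvester ?X (B - A)) \<le> norm (?D ** ?D) / (2 * m)"
      using norm_sylvester_le[OF m(2,1), of "?D ** ?D"] by (simp add: norm_minus_commute)
    also have "\<dots> \<le> (norm ?D * norm ?D * K) / (2 * m)"
      using m(1) by (intro divide_right_mono K(2)) auto
    also have "\<dots> \<le> (norm (B - A) / m * (norm (B - A) / m) * K) / (2 * m)"
      using D m(1) K(1) by (intro divide_right_mono mult_right_mono mult_mono) auto
    also have "\<dots> = K / (2 * m ^ 3) * (norm (B - A))\<^sup>2"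
      by (simp add: power2_eq_square power3_eq_cube mult_ac)
    finally show ?thesis .
  qed
  then show ?thesis
    using linear_sylvester[OF Xpd]
    by (intro has_derivative_quadratic_remainder[where C = "K / (2 * m ^ 3)"])
       (auto simp: linear_conv_bounded_linear eventually_at_filter)
qed

lemma norm_matrix_inv_le:
  fixes X :: "complex^'d^'d"
  assumes "X - m *\<^sub>R mat 1 \<in> psd" "m > 0"
  shows "norm (matrix_inv X) \<le> norm (mat 1 :: complex^'d^'d) / m"
proof -
  note i = pd_inverse[OF pd_of_lower_bound[OF assms]]
  let ?Z = "matrix_inv X"
  have "m * (norm ?Z)\<^sup>2 \<le> (X ** ?Z) \<bullet> ?Z" using assms(1) by (rule mult_inner_lower_bound)
  also have "\<dots> \<le> norm (mat 1 :: complex^'d^'d) * norm ?Z" unfolding i(1) by (rule norm_cauchy_schwarz)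
  finally show ?thesis
    using assms(2) by (cases "norm ?Z = 0") (auto simp: power2_eq_square field_simps)
qed

text \<open>The remainder is \<open>Y\<^bsup>-1\<^esup> (Y - X) X\<^bsup>-1\<^esup> (Y - X) X\<^bsup>-1\<^esup>\<close>.\<close>

lemma matrix_inv_has_derivative:
  fixes X :: "complex^'d^'d"
  assumes X: "X \<in> pd"
  shows "(matrix_inv has_derivative (\<lambda>D. - (matrix_inv X ** D ** matrix_inv X))) (at X within pd)"
proof -
  have bl: "bounded_linear (\<lambda>D. - (matrix_inv X ** D ** matrix_inv X))"
    by (simp add: linear_conv_bounded_linear[symmetric] linear_iff matrix_simps)
  obtain m where m: "m > 0" "\<forall>\<^sub>F Y in at X within pd. Y - m *\<^sub>R mat 1 \<in> psd"
  proof -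
    have "\<forall>\<^sub>F Y in at X within pd. Y \<in> hermitian"
      by (simp add: eventually_at_filter pd_hermitian)
    from eventually_lower_bound[OF tendsto_ident_at X this] show ?thesis using that by blast
  qed
  obtain K where K: "K > 0" "\<And>(A::complex^'d^'d) (B::complex^'d^'d). norm (A ** B) \<le> norm A * norm B * K"
    using matrix_mult_norm_bound by blast
  let ?I = "matrix_inv X" and ?c = "norm (mat 1 :: complex^'d^'d) / m"
  have "\<forall>\<^sub>F Y in at X within pd. norm (matrix_inv Y - ?I - - (?I ** (Y - X) ** ?I))
      \<le> (?c * (norm ?I)\<^sup>2 * K ^ 4) * (norm (Y - X))\<^sup>2"
    using m(2)
  proof eventually_elim
    case (elim Y)
    let ?J = "matrix_inv Y" and ?D = "Y - X"
    note iX = pd_inverse[OF X] and iY = pd_inverse[OF pd_of_lower_bound[OF elim m(1)]]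
    have "?J ** ?D ** ?I ** ?D ** ?I = ?J - ?I - - (?I ** ?D ** ?I)"
    proof -
      have 1: "?J ** ?D ** ?I = ?I - ?J"
      proof -
        have "?J ** (Y - X) ** ?I = (?J ** Y) ** ?I - ?J ** (X ** ?I)" by (simp add: matrix_simps)
        then show ?thesis by (simp add: iX iY)
      qed
      have 2: "?I ** ?D ** ?I = ?I ** Y ** ?I - ?I" by (simp add: matrix_simps iX)
      have "?J ** ?D ** ?I ** ?D ** ?I = (?I - ?J) ** ?D ** ?I" by (simp add: 1)
      also have "\<dots> = ?I ** ?D ** ?I - ?J ** ?D ** ?I" by (simp add: matrix_mult_diff_left)
      finally show ?thesis by (simp add: 1)
    qed
    then have "norm (?J - ?I - - (?I ** ?D ** ?I)) = norm (?J ** ?D ** ?I ** ?D ** ?I)" by simp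
    also have "\<dots> \<le> ((((norm ?J * norm ?D * K) * norm ?I * K) * norm ?D * K) * norm ?I * K)"
      using K(1) by (intro order_trans[OF K(2)] mult_right_mono order_refl K(2)) auto
    also have "\<dots> = norm ?J * ((norm ?I)\<^sup>2 * K ^ 4 * (norm ?D)\<^sup>2)"
      by (simp add: power2_eq_square power4_eq_xxxx)
    also have "\<dots> \<le> ?c * ((norm ?I)\<^sup>2 * K ^ 4 * (norm ?D)\<^sup>2)"
      by (intro mult_right_mono norm_matrix_inv_le[OF elim m(1)]) simp
    finally show ?case by (simp add: mult_ac)
  qed
  from has_derivative_quadratic_remainder[OF bl this] show ?thesis .
qed

lemma tendsto_within_pd:
  assumes "(g has_derivative g') (at X within pd)" "(f \<longlongrightarrow> X) F" "X \<in> pd"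
    "\<forall>\<^sub>F x in F. f x \<in> hermitian"
  shows "((\<lambda>x. g (f x)) \<longlongrightarrow> g X) F"
proof -
  obtain m where m: "m > 0" "\<forall>\<^sub>F x in F. f x - m *\<^sub>R mat 1 \<in> psd"
    using eventually_lower_bound[OF assms(2-4)] by blast
  have "continuous (at X within pd) g" by (rule has_derivative_continuous[OF assms(1)])
  moreover have "\<forall>\<^sub>F x in F. f x \<in> pd"
    using m(2) by eventually_elim (rule pd_of_lower_bound[OF _ m(1)])
  ultimately show ?thesis using assms(2,3) by (metis continuous_within_tendsto_compose)
qed

lemmas tendsto_psd_sqrt = tendsto_within_pd[OF psd_sqrt_has_derivative]
lemmas tendsto_matrix_inv = tendsto_within_pd[OF matrix_inv_has_derivative]

section \<open>The optimal transport map and its differential\<close>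

lemma psd_kernel: "A \<in> psd \<Longrightarrow> v \<bullet> (A *v v) = 0 \<Longrightarrow> A *v v = 0"
proof -
  assume A: "A \<in> psd" and 0: "v \<bullet> (A *v v) = 0"
  let ?N = "psd_sqrt A"
  have N: "?N \<in> hermitian" "?N ** ?N = A" using psd_sqrt[OF A] psd_hermitian by auto
  have "v \<bullet> (A *v v) = (?N *v v) \<bullet> (?N *v v)"
    using N by (metis hermitian_iff_selfadjoint matrix_vector_mul_assoc)
  then have "?N *v v = 0" using 0 by simp
  then show ?thesis by (metis N(2) matrix_vector_mul_assoc matrix_vector_mult_0_right)
qed

lemma psd_injective_pd:
  assumes "A \<in> psd" "\<And>x. A *v x = 0 \<Longrightarrow> x = 0"
  shows "A \<in> pd"
proof -
  have "0 < v \<bullet> (A *v v)" if "v \<noteq> 0" for v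
    using assms(2)[OF psd_kernel[OF assms(1)], of v] psd_form[OF assms(1), of v] that by fastforce
  then show ?thesis using psd_hermitian[OF assms(1)] by (simp add: pd_def)
qed

lemma sandwich_cancel:
  fixes X :: "complex^'d^'d"
  assumes "X \<in> pd"
  shows "X ** (matrix_inv X ** B) = B" "matrix_inv X ** (X ** B) = B"
    "(B ** X) ** matrix_inv X = B" "(B ** matrix_inv X) ** X = B"
  by (simp_all only: matrix_mul_assoc[of X] matrix_mul_assoc[of "matrix_inv X"]
      matrix_mul_assoc[of B, symmetric] pd_inverse[OF assms] matrix_mul_lid matrix_mul_rid)

lemma transport_psd:
  assumes Q: "Q \<in> pd" and S: "S \<in> psd"
  shows "transport Q S \<in> psd" "transport Q S ** Q ** transport Q S = S"
    "psd_sqrt Q ** transport Q S ** psd_sqrt Q = psd_sqrt (psd_sqrt Q ** S ** psd_sqrt Q)"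
proof -
  let ?R = "psd_sqrt Q" let ?I = "matrix_inv ?R" let ?U = "psd_sqrt (?R ** S ** ?R)"
  have R: "?R \<in> pd" "?R ** ?R = Q"
    using psd_sqrt_pd[OF Q] psd_sqrt[OF pd_imp_psd[OF Q]] by auto
  note i = pd_inverse[OF R(1)]
  have "?R ** S ** ?R \<in> psd" using S pd_hermitian[OF R(1)] by (rule psd_conj)
  note U = psd_sqrt[OF this]
  show "transport Q S \<in> psd"
    unfolding transport_def using U(1) pd_hermitian[OF i(3)] by (rule psd_conj)
  show *: "?R ** transport Q S ** ?R = ?U"
    unfolding transport_def matrix_mul_assoc[symmetric]
    by (simp add: sandwich_cancel[OF R(1)] i)
  have "?R ** (transport Q S ** (?R ** ?R) ** transport Q S) ** ?R =
      (?R ** transport Q S ** ?R) ** (?R ** transport Q S ** ?R)"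
    by (simp only: matrix_mul_assoc)
  then have "?R ** (transport Q S ** Q ** transport Q S) ** ?R =
      (?R ** transport Q S ** ?R) ** (?R ** transport Q S ** ?R)"
    by (simp only: R(2))
  also have "\<dots> = ?R ** S ** ?R" unfolding * by (rule U(2))
  finally have "?I ** (?R ** (transport Q S ** Q ** transport Q S) ** ?R) ** ?I = ?I ** (?R ** S ** ?R) ** ?I"
    by simp
  then show "transport Q S ** Q ** transport Q S = S"
    by (simp only: matrix_mul_assoc[symmetric] sandwich_cancel[OF R(1)] i(1) matrix_mul_rid)
qed

text \<open>Conjugation of \<open>T Q T = S\<close> by \<open>Q\<^bsup>1/2\<^esup>\<close> exhibits \<open>Q\<^bsup>1/2\<^esup> T Q\<^bsup>1/2\<^esup>\<close> as the square root of
  \<open>Q\<^bsup>1/2\<^esup> S Q\<^bsup>1/2\<^esup>\<close>.  All further formulas for the transport map are verified through this equation.\<close>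

lemma transport_unique:
  assumes Q: "Q \<in> pd" and T: "T \<in> psd" "T ** Q ** T = S"
  shows "transport Q S = T"
proof -
  let ?R = "psd_sqrt Q"
  have R: "?R \<in> pd" "?R ** ?R = Q"
    using psd_sqrt_pd[OF Q] psd_sqrt[OF pd_imp_psd[OF Q]] by auto
  have "psd_sqrt (?R ** S ** ?R) = ?R ** T ** ?R"
  proof (rule psd_sqrt_unique)
    show "?R ** T ** ?R \<in> psd" using T(1) pd_hermitian[OF R(1)] by (rule psd_conj)
    have "?R ** T ** ?R ** (?R ** T ** ?R) = ?R ** (T ** (?R ** ?R) ** T) ** ?R"
      by (simp only: matrix_mul_assoc)
    then show "?R ** T ** ?R ** (?R ** T ** ?R) = ?R ** S ** ?R" by (simp only: R(2) T(2))
  qed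
  then show ?thesis
    unfolding transport_def
    by (simp only: matrix_mul_assoc[symmetric] sandwich_cancel[OF R(1)] pd_inverse[OF R(1)] matrix_mul_rid)
qed

text \<open>For singular \<open>S\<close> the matrix \<open>Q\<^bsup>1/2\<^esup> S Q\<^bsup>1/2\<^esup>\<close> is singular and the square root is not
  differentiable there.  With \<open>N = S\<^bsup>1/2\<^esup>\<close> and \<open>P\<close> the projector onto the kernel of \<open>S\<close>, however,
  \<open>N Q N + P\<close> is positive definite, \<open>P\<close> is an invisible block, and
  \<open>transport Q S = N (N Q N + P)\<^bsup>-1/2\<^esup> N\<close>, which is smooth in \<open>Q\<close>.\<close>

definition kernel_proj :: "complex^'d^'d \<Rightarrow> complex^'d^'d" where
  "kernel_proj S = (SOME P. P \<in> psd \<and>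
     (\<forall>x l. psd_sqrt S *v x = l *\<^sub>R x \<longrightarrow> P *v x = (if l = 0 then 1 else 0) *\<^sub>R x))"

definition root_form :: "complex^'d^'d \<Rightarrow> complex^'d^'d \<Rightarrow> complex^'d^'d" where
  "root_form S Q = psd_sqrt (psd_sqrt S ** Q ** psd_sqrt S + kernel_proj S)"

lemma kernel_proj:
  assumes S: "S \<in> psd"
  shows "kernel_proj S \<in> psd" "psd_sqrt S ** kernel_proj S = 0" "kernel_proj S ** psd_sqrt S = 0"
    "kernel_proj S ** kernel_proj S = kernel_proj S" "psd_sqrt S *v x = 0 \<Longrightarrow> kernel_proj S *v x = x"
proof -
  let ?N = "psd_sqrt S" and ?P = "kernel_proj S"
  have N: "?N \<in> hermitian" using psd_sqrt_hermitian[OF S] .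
  have "\<exists>P. P \<in> psd \<and> (\<forall>x l. ?N *v x = l *\<^sub>R x \<longrightarrow> P *v x = (if l = 0 then 1 else 0) *\<^sub>R x)"
  proof -
    have f: "0 \<le> (if l = 0 then 1 else (0::real))" for l :: real by simp
    from functional_calculus[OF N, of "\<lambda>l. if l = 0 then 1 else 0", OF f] show ?thesis by blast
  qed
  from someI_ex[OF this]
  have *: "?P \<in> psd \<and> (\<forall>x l. ?N *v x = l *\<^sub>R x \<longrightarrow> ?P *v x = (if l = 0 then 1 else 0) *\<^sub>R x)"
    unfolding kernel_proj_def .
  then show "?P \<in> psd" by blast
  have eig: "?P *v x = (if l = 0 then 1 else 0) *\<^sub>R x" if "?N *v x = l *\<^sub>R x" for x l
    using * that by blast
  show "?N ** ?P = 0"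
  proof (rule eq_on_eigenvectorsI[OF N])
    fix x l assume x: "?N *v x = l *\<^sub>R x"
    show "(?N ** ?P) *v x = 0 *v x"
      by (cases "l = 0") (simp_all add: matrix_vector_mul_assoc[symmetric] eig[OF x] x matrix_vector_scaleR)
  qed
  show "?P ** ?N = 0"
  proof (rule eq_on_eigenvectorsI[OF N])
    fix x l assume x: "?N *v x = l *\<^sub>R x"
    show "(?P ** ?N) *v x = 0 *v x"
      by (cases "l = 0") (simp_all add: matrix_vector_mul_assoc[symmetric] eig[OF x] x matrix_vector_scaleR)
  qed
  show "?P ** ?P = ?P"
  proof (rule eq_on_eigenvectorsI[OF N])
    fix x l assume x: "?N *v x = l *\<^sub>R x"
    show "(?P ** ?P) *v x = ?P *v x"
      by (cases "l = 0") (simp_all add: matrix_vector_mul_assoc[symmetric] eig[OF x] x matrix_vector_scaleR)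
  qed
  show "?N *v x = 0 \<Longrightarrow> ?P *v x = x" using eig[of x 0] by simp
qed

lemma root_form_pd:
  assumes S: "S \<in> psd" and Q: "Q \<in> pd"
  shows "psd_sqrt S ** Q ** psd_sqrt S + kernel_proj S \<in> pd" "root_form S Q \<in> pd"
    "root_form S Q ** root_form S Q = psd_sqrt S ** Q ** psd_sqrt S + kernel_proj S"
proof -
  let ?N = "psd_sqrt S" and ?P = "kernel_proj S"
  have N: "?N \<in> hermitian" using psd_sqrt_hermitian[OF S] .
  note P = kernel_proj[OF S]
  show 1: "?N ** Q ** ?N + ?P \<in> pd"
  proof (rule psd_injective_pd)
    show psd: "?N ** Q ** ?N + ?P \<in> psd"
      using psd_conj[OF pd_imp_psd[OF Q] N] P(1) by (rule psd_intros(1))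
    fix x assume "(?N ** Q ** ?N + ?P) *v x = 0"
    then have "0 = x \<bullet> ((?N ** Q ** ?N + ?P) *v x)" by simp
    also have "\<dots> = (?N *v x) \<bullet> (Q *v (?N *v x)) + x \<bullet> (?P *v x)"
      using N by (simp add: matvec_simps(3) inner_add_right matrix_vector_mul_assoc[symmetric]
          hermitian_iff_selfadjoint)
    finally have z: "(?N *v x) \<bullet> (Q *v (?N *v x)) = 0" "x \<bullet> (?P *v x) = 0"
      using psd_form[OF pd_imp_psd[OF Q], of "?N *v x"] psd_form[OF P(1), of x] by linarith+
    have "?N *v x = 0" using pd_form[OF Q, of "?N *v x"] z(1) by force
    then have "?P *v x = x" by (rule P(5))
    then show "x = 0" using z(2) by simp
  qed
  show "root_form S Q \<in> pd" unfolding root_form_def using 1 by (rule psd_sqrt_pd)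
  show "root_form S Q ** root_form S Q = ?N ** Q ** ?N + ?P"
    unfolding root_form_def using pd_imp_psd[OF 1] by (rule psd_sqrt)
qed

text \<open>Since \<open>X\<^sup>2 P = P\<close> for \<open>X = root_form S Q\<close>, the positive definite matrix \<open>X + 1\<close> annihilates \<open>X P - P\<close>.\<close>

lemma root_form_kernel:
  assumes S: "S \<in> psd" and Q: "Q \<in> pd"
  shows "root_form S Q ** kernel_proj S = kernel_proj S"
    "matrix_inv (root_form S Q) ** kernel_proj S = kernel_proj S"
proof -
  let ?N = "psd_sqrt S" and ?P = "kernel_proj S" let ?X = "root_form S Q"
  note P = kernel_proj[OF S] and X = root_form_pd[OF S Q]
  have "(?X ** ?X) ** ?P = ?P" unfolding X(3) by (simp add: matrix_simps) (simp add: P matrix_mul_assoc[symmetric])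
  then have "(?X + mat 1) ** (?X ** ?P - ?P) = 0" by (simp add: matrix_simps)
  moreover have "?X + mat 1 \<in> pd" using X(2) psd_intros(4) by (rule pd_add_psd)
  ultimately have "?X ** ?P - ?P = 0"
    by (metis sandwich_cancel(2) times0_right)
  then show "?X ** ?P = ?P" by simp
  then show "matrix_inv ?X ** ?P = ?P" by (metis X(2) sandwich_cancel(2))
qed

lemma transport_eq:
  assumes S: "S \<in> psd" and Q: "Q \<in> pd"
  shows "transport Q S = psd_sqrt S ** matrix_inv (root_form S Q) ** psd_sqrt S"
proof (rule transport_unique[OF Q])
  let ?N = "psd_sqrt S" and ?P = "kernel_proj S" let ?X = "root_form S Q" let ?I = "matrix_inv ?X"
  note P = kernel_proj[OF S] and X = root_form_pd[OF S Q]
  note i = pd_inverse[OF X(2)]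
  show "?N ** ?I ** ?N \<in> psd"
    using pd_imp_psd[OF i(3)] psd_sqrt_hermitian[OF S] by (rule psd_conj)
  have NQN: "?N ** Q ** ?N = ?X ** ?X - ?P" using X(3) by simp
  have "?N ** ?I ** ?N ** Q ** (?N ** ?I ** ?N) = ?N ** (?I ** (?N ** Q ** ?N) ** ?I) ** ?N"
    by (simp only: matrix_mul_assoc)
  also have "?I ** (?N ** Q ** ?N) ** ?I = mat 1 - ?P ** ?I"
    unfolding NQN matrix_mult_diff_right matrix_mult_diff_left
    by (simp add: matrix_mul_assoc root_form_kernel[OF S Q] i)
  also have "?N ** (mat 1 - ?P ** ?I) ** ?N = S"
    by (simp add: matrix_simps P psd_sqrt[OF S])
  finally show "?N ** ?I ** ?N ** Q ** (?N ** ?I ** ?N) = S" .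
qed

text \<open>The chain rule applied to \<open>N X\<^bsup>-1\<^esup> N\<close>, where \<open>X = root_form S Q\<close> and \<open>X\<^sup>2\<close> is affine in \<open>Q\<close>.\<close>

definition transport_deriv :: "complex^'d^'d \<Rightarrow> complex^'d^'d \<Rightarrow> complex^'d^'d \<Rightarrow> complex^'d^'d" where
  "transport_deriv Q S H =
     - (psd_sqrt S ** (matrix_inv (root_form S Q) **
          sylvester (root_form S Q) (psd_sqrt S ** H ** psd_sqrt S) ** matrix_inv (root_form S Q))
        ** psd_sqrt S)"

lemma transport_has_derivative:
  assumes S: "S \<in> psd" and Q: "Q \<in> pd"
  shows "((\<lambda>R. transport R S) has_derivative transport_deriv Q S) (at Q within hermitian)"
proof -
  let ?N = "psd_sqrt S" and ?P = "kernel_proj S" and ?X = "root_form S Q"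
  let ?A = "\<lambda>R. ?N ** R ** ?N + ?P"
  have lin: "bounded_linear (\<lambda>H. ?N ** H ** ?N)"
    by (simp add: linear_conv_bounded_linear[symmetric] linear_iff matrix_simps)
  have A: "(?A has_derivative (\<lambda>H. ?N ** H ** ?N)) (at Q within pd)"
    using has_derivative_add[OF bounded_linear_imp_has_derivative[OF lin] has_derivative_const] by simp
  have root: "(root_form S has_derivative (\<lambda>H. sylvester ?X (?N ** H ** ?N))) (at Q within pd)"
  proof -
    have "?A ` pd \<subseteq> pd" using root_form_pd(1)[OF S] by auto
    then have "(psd_sqrt has_derivative sylvester (psd_sqrt (?A Q))) (at (?A Q) within ?A ` pd)"
      using psd_sqrt_has_derivative[OF root_form_pd(1)[OF S Q]] by (rule has_derivative_subset[rotated])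
    from has_derivative_in_compose[OF A this] show ?thesis by (simp add: root_form_def[abs_def])
  qed
  have "((\<lambda>R. matrix_inv (root_form S R)) has_derivative
      (\<lambda>H. - (matrix_inv ?X ** sylvester ?X (?N ** H ** ?N) ** matrix_inv ?X))) (at Q within pd)"
  proof -
    have "root_form S ` pd \<subseteq> pd" using root_form_pd(2)[OF S] by auto
    then have "(matrix_inv has_derivative (\<lambda>D. - (matrix_inv ?X ** D ** matrix_inv ?X)))
        (at ?X within root_form S ` pd)"
      using matrix_inv_has_derivative[OF root_form_pd(2)[OF S Q]] by (rule has_derivative_subset[rotated])
    from has_derivative_in_compose[OF root this] show ?thesis .
  qed
  from bounded_linear.has_derivative[OF lin this]
  have "((\<lambda>R. ?N ** matrix_inv (root_form S R) ** ?N) has_derivative transport_deriv Q S) (at Q within pd)"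
    by (simp add: transport_deriv_def[abs_def] matrix_mult_minus_left matrix_mult_minus_right)
  then have "((\<lambda>R. transport R S) has_derivative transport_deriv Q S) (at Q within pd)"
    by (rule has_derivative_transform[OF Q transport_eq[OF S], rotated])
  then show ?thesis by (simp add: at_within_pd[OF Q])
qed

lemma has_derivative_line:
  fixes f :: "complex^'d^'d \<Rightarrow> 'b::real_normed_vector"
  assumes f: "(f has_derivative f') (at (Q + t *\<^sub>R H) within hermitian)"
    and Q: "Q \<in> hermitian" and H: "H \<in> hermitian"
  shows "((\<lambda>r. f (Q + r *\<^sub>R H)) has_derivative (\<lambda>r. f' (r *\<^sub>R H))) (at t within T)"
proof -
  have 1: "((\<lambda>r::real. Q + r *\<^sub>R H) has_derivative (\<lambda>r. r *\<^sub>R H)) (at t within T)"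
    by (auto intro!: derivative_eq_intros)
  have "(\<lambda>r::real. Q + r *\<^sub>R H) ` T \<subseteq> hermitian" using Q H by (auto intro!: hermitian_intros)
  then have "(f has_derivative f') (at (Q + t *\<^sub>R H) within (\<lambda>r::real. Q + r *\<^sub>R H) ` T)"
    by (rule has_derivative_subset[OF f])
  from has_derivative_in_compose[OF 1 this] show ?thesis .
qed

text \<open>The Hermitian matrices form a proper subspace, so a differential within it is determined only in
  Hermitian directions.  There it can be read off along a line.\<close>

lemma has_derivative_within_hermitian_unique:
  fixes f :: "complex^'d^'d \<Rightarrow> 'b::real_normed_vector"
  assumes f: "(f has_derivative f') (at Q within hermitian)" "(f has_derivative f'') (at Q within hermitian)"
    and Q: "Q \<in> hermitian" and H: "H \<in> hermitian"
  shows "f' H = f'' H"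
proof -
  have "(f has_derivative f') (at (Q + 0 *\<^sub>R H) within hermitian)"
    "(f has_derivative f'') (at (Q + 0 *\<^sub>R H) within hermitian)" using f by simp_all
  from this[THEN has_derivative_line[OF _ Q H, where T = UNIV]]
  have "(\<lambda>t::real. f' (t *\<^sub>R H)) = (\<lambda>t. f'' (t *\<^sub>R H))" by (rule has_derivative_unique)
  then show ?thesis by (metis scaleR_one)
qed

lemma difference_quotient_hermitian:
  fixes f :: "complex^'d^'d \<Rightarrow> 'b::real_normed_vector"
  assumes f: "(f has_derivative f') (at Q within hermitian)"
    and Q: "Q \<in> hermitian" and H: "H \<in> hermitian"
  shows "(\<lambda>n. real (Suc n) *\<^sub>R (f (Q + (1 / real (Suc n)) *\<^sub>R H) - f Q)) \<longlonglongrightarrow> f' H"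
proof -
  have "(f has_derivative f') (at (Q + 0 *\<^sub>R H) within hermitian)" using f by simp
  from has_derivative_line[OF this Q H, of UNIV]
  have "(\<lambda>h. norm (f (Q + h *\<^sub>R H) - f Q - f' (h *\<^sub>R H)) / norm h) \<midarrow>0\<rightarrow> 0"
    by (simp add: has_derivative_at)
  moreover have "filterlim (\<lambda>n. 1 / real (Suc n)) (at 0) sequentially"
    using LIMSEQ_Suc[OF lim_1_over_n] by (simp add: filterlim_at)
  ultimately have lim: "(\<lambda>n. norm (f (Q + (1 / real (Suc n)) *\<^sub>R H) - f Q - f' ((1 / real (Suc n)) *\<^sub>R H))
      / norm (1 / real (Suc n))) \<longlonglongrightarrow> 0" by (rule filterlim_compose)
  have "norm (f (Q + (1 / real (Suc n)) *\<^sub>R H) - f Q - f' ((1 / real (Suc n)) *\<^sub>R H)) / norm (1 / real (Suc n))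
      = norm (real (Suc n) *\<^sub>R (f (Q + (1 / real (Suc n)) *\<^sub>R H) - f Q) - f' H)" for n
  proof -
    define k where "k = real (Suc n)"
    have k: "k > 0" by (simp add: k_def)
    have "k *\<^sub>R (f (Q + (1 / k) *\<^sub>R H) - f Q) - f' H = k *\<^sub>R (f (Q + (1 / k) *\<^sub>R H) - f Q - f' ((1 / k) *\<^sub>R H))"
      using k by (simp add: linear_cmul[OF has_derivative_linear[OF f]] scaleR_diff_right)
    then have "norm (k *\<^sub>R (f (Q + (1 / k) *\<^sub>R H) - f Q) - f' H) = k * norm (f (Q + (1 / k) *\<^sub>R H) - f Q - f' ((1 / k) *\<^sub>R H))"
      using k by simp
    then show ?thesis using k unfolding k_def[symmetric] by simp
  qed
  with lim show ?thesis by (simp only: tendsto_norm_zero_iff LIM_zero_iff)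
qed

lemma dtransport_has_derivative:
  assumes S: "S \<in> psd" and Q: "Q \<in> pd"
  shows "((\<lambda>R. transport R S) has_derivative dtransport Q S) (at Q within hermitian)"
  unfolding dtransport_def
  using transport_has_derivative[OF assms] frechet_derivative_works differentiable_def by blast

lemma dtransport_eq:
  assumes "S \<in> psd" "Q \<in> pd" "H \<in> hermitian"
  shows "dtransport Q S H = transport_deriv Q S H"
  using dtransport_has_derivative[OF assms(1,2)] transport_has_derivative[OF assms(1,2)]
    pd_hermitian[OF assms(2)] assms(3) by (rule has_derivative_within_hermitian_unique)

lemma tendsto_root_form:
  assumes S: "S \<in> psd" and Q: "Q \<in> pd" and f: "(f \<longlongrightarrow> Q) F" "\<forall>\<^sub>F x in F. f x \<in> hermitian"
  shows "((\<lambda>x. root_form S (f x)) \<longlongrightarrow> root_form S Q) F"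
  unfolding root_form_def
proof (rule tendsto_psd_sqrt[OF root_form_pd(1)[OF S Q] _ root_form_pd(1)[OF S Q]])
  show "((\<lambda>x. psd_sqrt S ** f x ** psd_sqrt S + kernel_proj S) \<longlongrightarrow>
      psd_sqrt S ** Q ** psd_sqrt S + kernel_proj S) F"
    by (intro tendsto_intros f)
  show "\<forall>\<^sub>F x in F. psd_sqrt S ** f x ** psd_sqrt S + kernel_proj S \<in> hermitian"
    using f(2) by eventually_elim
      (intro hermitian_intros psd_sqrt_hermitian S psd_hermitian[OF kernel_proj(1)])
qed

lemma eventually_pd:
  assumes Q: "Q \<in> pd" and f: "(f \<longlongrightarrow> Q) F" "\<forall>\<^sub>F x in F. f x \<in> hermitian"
  shows "\<forall>\<^sub>F x in F. f x \<in> pd"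
proof -
  obtain m where m: "m > 0" "\<forall>\<^sub>F x in F. f x - m *\<^sub>R mat 1 \<in> psd"
    using eventually_lower_bound[OF f(1) Q f(2)] by blast
  show ?thesis using m(2) by eventually_elim (rule pd_of_lower_bound[OF _ m(1)])
qed

lemma tendsto_transport_deriv:
  assumes S: "S \<in> psd" and Q: "Q \<in> pd" and f: "(f \<longlongrightarrow> Q) F" "\<forall>\<^sub>F x in F. f x \<in> hermitian"
  shows "((\<lambda>x. transport_deriv (f x) S H) \<longlongrightarrow> transport_deriv Q S H) F"
proof -
  note r = tendsto_root_form[OF assms] root_form_pd(2)[OF S Q]
  have h: "\<forall>\<^sub>F x in F. root_form S (f x) \<in> hermitian"
    using eventually_pd[OF Q f] by eventually_elim (intro pd_hermitian root_form_pd S)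
  show ?thesis
    unfolding transport_deriv_def
    by (intro tendsto_intros tendsto_sylvester r h tendsto_matrix_inv[OF r(2)])
qed

lemma tendsto_transport:
  assumes S: "S \<in> psd" and Q: "Q \<in> pd" and f: "(f \<longlongrightarrow> Q) F" "\<forall>\<^sub>F x in F. f x \<in> hermitian"
  shows "((\<lambda>x. transport (f x) S) \<longlongrightarrow> transport Q S) F"
  using tendsto_within_pd[OF transport_has_derivative[OF S Q, folded at_within_pd[OF Q]] f(1) Q f(2)] .

lemma continuous_on_transport_right: "continuous_on psd (\<lambda>S. transport Q S)" if "Q \<in> pd"
proof -
  have R: "psd_sqrt Q \<in> hermitian" using psd_sqrt_hermitian[OF pd_imp_psd[OF that]] .
  have "continuous_on psd (\<lambda>S. psd_sqrt (psd_sqrt Q ** S ** psd_sqrt Q))"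
    using psd_conj[OF _ R]
    by (intro continuous_on_compose2[OF continuous_on_psd_sqrt] continuous_intros) auto
  then show ?thesis unfolding transport_def by (intro continuous_intros)
qed

text \<open>Everything below \<open>h A\<close> in the Loewner order is sent by \<open>sylvester (A\<^bsup>1/2\<^esup>)\<close> below
  \<open>(h/2) A\<^bsup>1/2\<^esup>\<close>.  Hence \<open>- h Q \<le> H \<le> h Q\<close> gives \<open>- (h/2) T \<le> dT(H) \<le> (h/2) T\<close>, uniformly in \<open>S\<close>, even
  though the inverse square root above blows up as \<open>S\<close> degenerates.\<close>

lemma transport_deriv_order_bound:
  assumes S: "S \<in> psd" and Q: "Q \<in> pd" and H: "h *\<^sub>R Q - H \<in> psd" and h: "0 \<le> h"
  shows "(h / 2) *\<^sub>R transport Q S + transport_deriv Q S H \<in> psd"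
proof -
  let ?N = "psd_sqrt S" and ?P = "kernel_proj S" let ?X = "root_form S Q" let ?I = "matrix_inv ?X"
  let ?Y = "sylvester ?X (?N ** H ** ?N)"
  note P = kernel_proj[OF S] and X = root_form_pd[OF S Q]
  note i = pd_inverse[OF X(2)]
  have N: "?N \<in> hermitian" by (rule psd_sqrt_hermitian[OF S])
  have "?N ** (h *\<^sub>R Q - H) ** ?N + h *\<^sub>R ?P \<in> psd"
    using psd_conj[OF H N] P(1) h by (intro psd_intros(1) psd_intros(2))
  also have "?N ** (h *\<^sub>R Q - H) ** ?N + h *\<^sub>R ?P = h *\<^sub>R (?X ** ?X) - ?N ** H ** ?N"
    unfolding X(3) by (simp add: matrix_simps scaleR_add_right)
  finally have "sylvester ?X (h *\<^sub>R (?X ** ?X) - ?N ** H ** ?N) \<in> psd" by (rule sylvester_psd[OF X(2)])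
  also have "sylvester ?X (h *\<^sub>R (?X ** ?X) - ?N ** H ** ?N) = (h / 2) *\<^sub>R ?X - ?Y"
    by (simp add: linear_diff[OF linear_sylvester[OF X(2)]] sylvester_square[OF X(2)])
  finally have "?N ** (?I ** ((h / 2) *\<^sub>R ?X - ?Y) ** ?I) ** ?N \<in> psd"
    using N pd_hermitian[OF i(3)] by (intro psd_conj)
  also have "?N ** (?I ** ((h / 2) *\<^sub>R ?X - ?Y) ** ?I) ** ?N = (h / 2) *\<^sub>R transport Q S + transport_deriv Q S H"
    unfolding transport_eq[OF S Q] transport_deriv_def by (simp add: matrix_simps i)
  finally show ?thesis .
qed

text \<open>The trace of \<open>S = T Q T\<close> is \<open>(Q T) \<bullet> T \<ge> q \<bar>T\<bar>\<^sup>2\<close>.\<close>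

lemma norm_transport_le:
  assumes S: "S \<in> psd" and Q: "Q - q *\<^sub>R mat 1 \<in> psd" and q: "q > 0"
  shows "(norm (transport Q S))\<^sup>2 \<le> rtrace S / q"
proof -
  let ?T = "transport Q S"
  have Qpd: "Q \<in> pd" using Q q by (rule pd_of_lower_bound)
  note T = transport_psd[OF Qpd S]
  have "rtrace S = (?T ** (Q ** ?T)) \<bullet> mat 1" by (simp add: rtrace_eq_inner T(2) matrix_mul_assoc)
  also have "\<dots> = (Q ** ?T) \<bullet> ?T"
    by (subst inner_matrix_mult_left) (simp add: hermitianD[OF psd_hermitian[OF T(1)]])
  finally show ?thesis using mult_inner_lower_bound(1)[OF Q, of ?T] q by (simp add: field_simps)
qed

lemma rtrace_le_norm: "rtrace A \<le> norm (mat 1 :: complex^'d^'d) * norm A" for A :: "complex^'d^'d"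
  using norm_cauchy_schwarz[of A "mat 1"] by (simp add: rtrace_eq_inner mult.commute)

lemma norm_transport_deriv_le:
  fixes S Q :: "complex^'d^'d"
  assumes S: "S \<in> psd" and Q: "Q - q *\<^sub>R mat 1 \<in> psd" and q: "q > 0" and H: "H \<in> hermitian"
  shows "norm (transport_deriv Q S H) \<le>
    (3 / 2 * norm (mat 1 :: complex^'d^'d) / q) * norm (transport Q S) * norm H"
proof -
  have Qpd: "Q \<in> pd" using Q q by (rule pd_of_lower_bound)
  define h where "h = norm H / q"
  have h: "0 \<le> h" "h * q = norm H" using q by (auto simp: h_def)
  have bound: "h *\<^sub>R Q - H' \<in> psd" if "H' \<in> hermitian" "norm H' = norm H" for H'
  proof -
    have "h *\<^sub>R (Q - q *\<^sub>R mat 1) + (norm H *\<^sub>R mat 1 - H') \<in> psd"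
      using Q h(1) hermitian_le_norm(1)[OF that(1)] that(2) by (intro psd_intros(1) psd_intros(2)) auto
    then show ?thesis by (simp add: scaleR_diff_right h(2))
  qed
  note D = transport_has_derivative[OF S Qpd, THEN has_derivative_linear]
  have 1: "(h / 2) *\<^sub>R transport Q S + transport_deriv Q S H \<in> psd"
    using bound[OF H] h by (intro transport_deriv_order_bound S Qpd) auto
  have 2: "(h / 2) *\<^sub>R transport Q S - transport_deriv Q S H \<in> psd"
    using transport_deriv_order_bound[OF S Qpd bound[of "- H"] h(1)] H
    by (simp add: hermitian_intros linear_neg[OF D])
  have "norm (transport_deriv Q S H) \<le> 3 * rtrace ((h / 2) *\<^sub>R transport Q S)"
    by (rule norm_le_of_order_bounds[OF 2 1])
  also have "\<dots> = (3 / 2 * h) * rtrace (transport Q S)" by (simp add: rtrace_eq_inner)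
  also have "\<dots> \<le> (3 / 2 * h) * (norm (mat 1 :: complex^'d^'d) * norm (transport Q S))"
    using h by (intro mult_left_mono rtrace_le_norm) auto
  finally show ?thesis by (simp add: h_def mult_ac)
qed

text \<open>With \<open>X Y\<^sub>i + Y\<^sub>i X = N H\<^sub>i N\<close> the bilinear form of the differential is
  \<open>- (Y\<^sub>1 \<bullet> Y\<^sub>2 X\<^bsup>-1\<^esup> + Y\<^sub>1 \<bullet> X\<^bsup>-1\<^esup> Y\<^sub>2)\<close>, visibly symmetric and negative.\<close>

lemma inner_transport_deriv:
  assumes S: "S \<in> psd" and Q: "Q \<in> pd"
  defines "Y \<equiv> \<lambda>H. sylvester (root_form S Q) (psd_sqrt S ** H ** psd_sqrt S)"
    and "I \<equiv> matrix_inv (root_form S Q)"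
  shows "G \<bullet> transport_deriv Q S H = - (Y G \<bullet> (Y H ** I) + Y G \<bullet> (I ** Y H))"
proof -
  let ?N = "psd_sqrt S" and ?X = "root_form S Q"
  have N: "ctranspose ?N = ?N" by (rule hermitianD[OF psd_sqrt_hermitian[OF S]])
  note X = root_form_pd[OF S Q] and i = pd_inverse[OF root_form_pd(2)[OF S Q], folded I_def]
  have hX: "ctranspose ?X = ?X" by (rule hermitianD[OF pd_hermitian[OF X(2)]])
  have "G \<bullet> transport_deriv Q S H = - (G \<bullet> (?N ** (I ** Y H ** I) ** ?N))"
    by (simp add: transport_deriv_def Y_def I_def)
  also have "G \<bullet> (?N ** W ** ?N) = (?N ** G ** ?N) \<bullet> W" for W
  proof -
    have "(?N ** W ** ?N) \<bullet> G = (?N ** W) \<bullet> (G ** ?N)" by (subst inner_matrix_mult_right) (simp only: N)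
    also have "\<dots> = W \<bullet> (?N ** G ** ?N)"
      by (subst inner_matrix_mult_left) (simp only: N matrix_mul_assoc)
    finally show ?thesis by (simp only: inner_commute)
  qed
  also have "?N ** G ** ?N = ?X ** Y G + Y G ** ?X"
    unfolding Y_def using sylvester_eq[OF X(2)] by metis
  also have "(?X ** Y G + Y G ** ?X) \<bullet> (I ** Y H ** I) =
      Y G \<bullet> (?X ** (I ** Y H ** I)) + Y G \<bullet> ((I ** Y H ** I) ** ?X)"
    unfolding inner_add_left
    by (simp only: inner_matrix_mult_left[of ?X "Y G"] inner_matrix_mult_right[of "Y G" ?X] hX)
  also have "?X ** (I ** Y H ** I) = Y H ** I"
    using i by (simp add: matrix_mul_assoc)
  also have "(I ** Y H ** I) ** ?X = I ** Y H"
    using i by (simp add: matrix_mul_assoc[symmetric])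
  finally show ?thesis by simp
qed

lemma transport_deriv_symmetric:
  assumes S: "S \<in> psd" and Q: "Q \<in> pd"
  shows "G \<bullet> transport_deriv Q S H = transport_deriv Q S G \<bullet> H"
proof -
  let ?I = "matrix_inv (root_form S Q)"
  have I: "ctranspose ?I = ?I"
    by (intro hermitianD pd_hermitian pd_inverse root_form_pd S Q)
  let ?Y = "\<lambda>H. sylvester (root_form S Q) (psd_sqrt S ** H ** psd_sqrt S)"
  have 1: "?Y G \<bullet> (?Y H ** ?I) = ?Y H \<bullet> (?Y G ** ?I)"
    using inner_matrix_mult_right[of "?Y G" ?I "?Y H", unfolded I] inner_commute by metis
  have 2: "?Y G \<bullet> (?I ** ?Y H) = ?Y H \<bullet> (?I ** ?Y G)"
    using inner_matrix_mult_left[of ?I "?Y G" "?Y H", unfolded I] inner_commute by metis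
  have "transport_deriv Q S G \<bullet> H = H \<bullet> transport_deriv Q S G" by (rule inner_commute)
  then show ?thesis unfolding inner_transport_deriv[OF S Q] by (simp only: 1 2)
qed

text \<open>For definite \<open>S\<close> the map \<open>H \<mapsto> N H N\<close> is injective, whence strictness.\<close>

lemma transport_deriv_negative:
  assumes S: "S \<in> psd" and Q: "Q \<in> pd"
  shows "H \<bullet> transport_deriv Q S H \<le> 0"
    "S \<in> pd \<Longrightarrow> H \<noteq> 0 \<Longrightarrow> H \<bullet> transport_deriv Q S H < 0"
proof -
  let ?N = "psd_sqrt S" and ?X = "root_form S Q" let ?I = "matrix_inv ?X"
  let ?Y = "sylvester ?X (?N ** H ** ?N)"
  note X = root_form_pd[OF S Q]
  obtain m where m: "m > 0" "?I - m *\<^sub>R mat 1 \<in> psd"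
    using pd_lower_bound[OF pd_inverse(3)[OF X(2)]] by blast
  have le: "H \<bullet> transport_deriv Q S H \<le> - (2 * m * (norm ?Y)\<^sup>2)"
    unfolding inner_transport_deriv[OF S Q]
    using mult_inner_lower_bound[OF m(2), of ?Y] by (simp add: inner_commute)
  also have "\<dots> \<le> 0" using m(1) by simp
  finally show "H \<bullet> transport_deriv Q S H \<le> 0" .
  show "H \<bullet> transport_deriv Q S H < 0" if "S \<in> pd" "H \<noteq> 0"
  proof -
    have N: "?N \<in> pd" by (rule psd_sqrt_pd[OF that(1)])
    have "?Y \<noteq> 0"
    proof
      assume "?Y = 0"
      then have "?N ** H ** ?N = 0" using sylvester_eq[OF X(2), of "?N ** H ** ?N"] by simp
      then have "matrix_inv ?N ** (?N ** H ** ?N) ** matrix_inv ?N = 0" by simp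
      then have "H = 0"
        by (simp only: matrix_mul_assoc[symmetric] sandwich_cancel[OF N] pd_inverse(1)[OF N] matrix_mul_rid)
      then show False using that(2) by simp
    qed
    then show ?thesis using le m(1) by (smt (verit) mult_pos_pos zero_less_norm_iff zero_less_power)
  qed
qed

lemma transport_self: "Q \<in> pd \<Longrightarrow> transport Q Q = mat 1"
  by (rule transport_unique) (auto simp: psd_intros)

text \<open>For \<open>S = Q\<close> the matrix \<open>root_form\<close> is \<open>Q\<close> itself and commutes with \<open>N = Q\<^bsup>1/2\<^esup>\<close>, so the outer factors
  \<open>N Q\<^bsup>-1\<^esup>\<close> pass through the Sylvester equation and cancel those of \<open>N H N\<close>.\<close>

lemma dtransport_self:
  assumes Q: "Q \<in> pd" and H: "H \<in> hermitian"
  shows "dtransport Q Q H = - sylvester Q H"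
proof -
  note Qp = pd_imp_psd[OF Q]
  let ?N = "psd_sqrt Q" and ?X = "root_form Q Q" let ?I = "matrix_inv ?X"
  let ?Y = "sylvester ?X (?N ** H ** ?N)"
  have N: "?N \<in> pd" "?N ** ?N = Q" using psd_sqrt_pd[OF Q] psd_sqrt[OF Qp] by auto
  have "kernel_proj Q = 0" by (metis N(1) Qp kernel_proj(2) times0_right sandwich_cancel(2))
  then have X: "?X = Q"
    unfolding root_form_def
    by (intro psd_sqrt_unique Qp) (metis N(2) add_0_right matrix_mul_assoc)
  note i = pd_inverse[OF Q] and i2 = sandwich_cancel[OF Q]
  have NIN: "?N ** (matrix_inv Q ** ?N) = mat 1" "?N ** matrix_inv Q ** ?N = mat 1"
    using transport_eq[OF Qp Q] transport_self[OF Q] by (simp_all add: X matrix_mul_assoc)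
  have comm: "Q ** ?N = ?N ** Q" using N(2) by (metis matrix_mul_assoc)
  have commI: "matrix_inv Q ** ?N = ?N ** matrix_inv Q"
    by (metis comm i2(2) i2(3) matrix_mul_assoc)
  have "sylvester Q H = ?N ** (matrix_inv Q ** ?Y ** matrix_inv Q) ** ?N"
  proof (rule sylvester_unique[OF Q])
    let ?Z = "?N ** (matrix_inv Q ** ?Y ** matrix_inv Q) ** ?N"
    have a: "Q ** ?N ** matrix_inv Q = ?N ** matrix_inv Q ** Q" 
      by (simp add: comm i matrix_mul_assoc[symmetric])
    have b: "matrix_inv Q ** ?N ** Q = Q ** matrix_inv Q ** ?N"
      by (metis comm i(1,2) i2(2) matrix_mul_assoc matrix_mul_lid)
    have "Q ** ?Z + ?Z ** Q = (Q ** ?N ** matrix_inv Q) ** ?Y ** (matrix_inv Q ** ?N)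
        + (?N ** matrix_inv Q) ** ?Y ** (matrix_inv Q ** ?N ** Q)"
      by (simp add: matrix_mul_assoc)
    also have "\<dots> = (?N ** matrix_inv Q) ** (Q ** ?Y + ?Y ** Q) ** (matrix_inv Q ** ?N)"
      unfolding a b by (simp add: matrix_mul_assoc matrix_mult_add_left matrix_add_ldistrib)
    also have "Q ** ?Y + ?Y ** Q = ?N ** H ** ?N"
      using sylvester_eq[OF Q] by (simp add: X)
    also have "(?N ** matrix_inv Q) ** (?N ** H ** ?N) ** (matrix_inv Q ** ?N) =
        (?N ** matrix_inv Q ** ?N) ** H ** (?N ** matrix_inv Q ** ?N)"
      by (simp only: matrix_mul_assoc)
    finally show "Q ** ?Z + ?Z ** Q = H" by (simp add: NIN)
  qed
  then show ?thesis
    by (simp add: dtransport_eq[OF Qp Q H] transport_deriv_def X)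
qed

section \<open>The Bures--Wasserstein distance\<close>

lemma rtrace_add: "rtrace (A + B) = rtrace A + rtrace B"
  and rtrace_scaleR: "rtrace (r *\<^sub>R A) = r * rtrace A"
  by (simp_all add: rtrace_eq_inner inner_add_left)

lemma fidelity_eq:
  assumes Q: "Q \<in> pd" and S: "S \<in> psd"
  shows "rtrace (psd_sqrt (psd_sqrt Q ** S ** psd_sqrt Q)) = transport Q S \<bullet> Q"
proof -
  let ?R = "psd_sqrt Q"
  have R: "ctranspose ?R = ?R" "?R ** ?R = Q"
    using psd_sqrt[OF pd_imp_psd[OF Q]] by (auto dest: psd_hermitian hermitianD)
  have "rtrace (?R ** transport Q S ** ?R) = transport Q S \<bullet> (?R ** ?R)"
    unfolding rtrace_eq_inner
    by (simp only: inner_matrix_mult_right[of _ ?R] inner_matrix_mult_left[of ?R] R(1) matrix_mul_lid)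
  then show ?thesis by (simp only: transport_psd(3)[OF Q S] R(2))
qed

lemma bw_dist_sq_eq:
  assumes Q: "Q \<in> pd" and S: "S \<in> psd"
  shows "bw_dist_sq Q S = rtrace Q + rtrace S - 2 * (transport Q S \<bullet> Q)"
  by (simp add: bw_dist_sq_def fidelity_eq[OF assms])

text \<open>Since \<open>S = T Q T\<close> for \<open>T = transport Q S\<close>, the distance is the Frobenius norm of
  \<open>Q\<^bsup>1/2\<^esup> (T - 1)\<close>.  Its behaviour near \<open>Q = S\<close>, where the square root in its definition is singular,
  is thus governed by the first differential of \<open>T\<close>.\<close>

lemma bw_dist_eq_norm:
  assumes Q: "Q \<in> pd" and S: "S \<in> psd"
  shows "bw_dist_sq Q S = (norm (psd_sqrt Q ** (transport Q S - mat 1)))\<^sup>2"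
proof -
  let ?R = "psd_sqrt Q" and ?T = "transport Q S"
  have R: "ctranspose ?R = ?R" "?R ** ?R = Q"
    using psd_sqrt[OF pd_imp_psd[OF Q]] by (auto dest: psd_hermitian hermitianD)
  note T = transport_psd[OF Q S]
  have hT: "ctranspose ?T = ?T" and hQ: "ctranspose Q = Q"
    using psd_hermitian[OF T(1)] pd_hermitian[OF Q] by (auto dest: hermitianD)
  have "(norm (?R ** (?T - mat 1)))\<^sup>2 = (?T - mat 1) \<bullet> (Q ** (?T - mat 1))"
    unfolding power2_norm_eq_inner
    by (subst inner_matrix_mult_left) (simp only: R(1) matrix_mul_assoc R(2))
  also have "\<dots> = ?T \<bullet> (Q ** ?T) - ?T \<bullet> Q - mat 1 \<bullet> (Q ** ?T) + mat 1 \<bullet> Q"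
    by (simp add: matrix_mult_diff_right inner_diff_left inner_diff_right)
  also have "?T \<bullet> (Q ** ?T) = rtrace S"
  proof -
    have "(?T ** (Q ** ?T)) \<bullet> mat 1 = (Q ** ?T) \<bullet> ?T"
      by (subst inner_matrix_mult_left) (simp add: hT)
    then show ?thesis by (simp add: rtrace_eq_inner inner_commute matrix_mul_assoc T(2))
  qed
  also have "mat 1 \<bullet> (Q ** ?T) = ?T \<bullet> Q"
    by (subst inner_commute, subst inner_matrix_mult_left) (simp add: hQ)
  also have "mat 1 \<bullet> Q = rtrace Q" by (simp add: rtrace_eq_inner inner_commute)
  finally show ?thesis by (simp add: bw_dist_sq_eq[OF assms])
qed

lemma tendsto_psd_sqrt_psd:
  assumes "(f \<longlongrightarrow> A) F" "A \<in> psd" "\<forall>\<^sub>F x in F. f x \<in> psd"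
  shows "((\<lambda>x. psd_sqrt (f x)) \<longlongrightarrow> psd_sqrt A) F"
  using continuous_on_tendsto_compose[OF continuous_on_psd_sqrt assms] .

lemma tendsto_bw_dist_sq:
  fixes Q S :: "complex^'d^'d"
  assumes Q: "(q \<longlongrightarrow> Q) F" "Q \<in> psd" "\<forall>\<^sub>F x in F. q x \<in> psd"
    and S: "(s \<longlongrightarrow> S) F" "S \<in> psd" "\<forall>\<^sub>F x in F. s x \<in> psd"
  shows "((\<lambda>x. bw_dist_sq (q x) (s x)) \<longlongrightarrow> bw_dist_sq Q S) F"
proof -
  have "((\<lambda>x. psd_sqrt (psd_sqrt (q x) ** s x ** psd_sqrt (q x))) \<longlongrightarrow> psd_sqrt (psd_sqrt Q ** S ** psd_sqrt Q)) F"
  proof (rule tendsto_psd_sqrt_psd)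
    show "((\<lambda>x. psd_sqrt (q x) ** s x ** psd_sqrt (q x)) \<longlongrightarrow> psd_sqrt Q ** S ** psd_sqrt Q) F"
      by (intro tendsto_intros tendsto_psd_sqrt_psd Q S)
    show "psd_sqrt Q ** S ** psd_sqrt Q \<in> psd" using Q S by (intro psd_conj psd_sqrt_hermitian)
    show "\<forall>\<^sub>F x in F. psd_sqrt (q x) ** s x ** psd_sqrt (q x) \<in> psd"
      using Q(3) S(3) by eventually_elim (intro psd_conj psd_sqrt_hermitian)
  qed
  then show ?thesis
    unfolding bw_dist_sq_def rtrace_eq_inner by (intro tendsto_intros Q S)
qed

lemma psd_regularize:
  fixes A :: "complex^'d^'d"
  assumes "A \<in> psd"
  shows "((\<lambda>e. A + e *\<^sub>R mat 1) \<longlongrightarrow> A) (at_right 0)" "\<forall>\<^sub>F e in at_right 0. A + e *\<^sub>R mat 1 \<in> pd"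
proof -
  have "((\<lambda>e. A + e *\<^sub>R mat 1) \<longlongrightarrow> A + 0 *\<^sub>R mat 1) (at_right 0)" by (intro tendsto_intros)
  then show "((\<lambda>e. A + e *\<^sub>R mat 1) \<longlongrightarrow> A) (at_right 0)" by simp
  show "\<forall>\<^sub>F e in at_right 0. A + e *\<^sub>R mat 1 \<in> pd"
    using eventually_at_right_less[of "0::real"]
    by eventually_elim (rule psd_add_pd[OF assms pd_scaleR[OF pd_mat1]])
qed

lemma transport_pd:
  assumes "Q \<in> pd" "S \<in> pd"
  shows "transport Q S \<in> pd"
proof (rule psd_injective_pd[OF transport_psd(1)[OF assms(1) pd_imp_psd[OF assms(2)]]])
  fix x assume "transport Q S *v x = 0"
  then have "S *v x = 0"
    using transport_psd(2)[OF assms(1) pd_imp_psd[OF assms(2)]]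
    by (metis matrix_vector_mul_assoc matrix_vector_mult_0_right)
  then show "x = 0" by (rule pd_kernel[OF assms(2)])
qed

text \<open>Convexity of the squared distance, in the form of the subgradient inequality at \<open>Q\<close>.  For
  \<open>T = transport Q S\<close> and \<open>U = transport R S\<close> it is the nonnegativity of the trace of
  \<open>R (U - T) T\<^bsup>-1\<^esup> (U - T)\<close>, expanded with \<open>U R U = S = T Q T\<close>.\<close>

lemma bw_dist_sq_subgradient_pd:
  assumes Q: "Q \<in> pd" and R: "R \<in> pd" and S: "S \<in> pd"
  shows "bw_dist_sq R S \<ge> bw_dist_sq Q S + (mat 1 - transport Q S) \<bullet> (R - Q)"
proof -
  let ?T = "transport Q S" and ?U = "transport R S" let ?I = "matrix_inv ?T"
  note Sp = pd_imp_psd[OF S]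
  note T = transport_psd[OF Q Sp] and U = transport_psd[OF R Sp]
  note i = pd_inverse[OF transport_pd[OF Q S]]
  have hT: "ctranspose ?T = ?T" and hU: "ctranspose ?U = ?U"
    using psd_hermitian[OF T(1)] psd_hermitian[OF U(1)] by (auto dest: hermitianD)
  have "(?U - ?T) ** ?I ** (?U - ?T) \<in> psd"
    using pd_imp_psd[OF i(3)] T(1) U(1) by (intro psd_conj hermitian_intros psd_hermitian)
  then have "0 \<le> ((?U - ?T) ** ?I ** (?U - ?T)) \<bullet> R" by (rule inner_psd_nonneg[OF _ pd_imp_psd[OF R]])
  also have "(?U - ?T) ** ?I ** (?U - ?T) = ?U ** ?I ** ?U - ?U - ?U + ?T"
    by (simp add: matrix_mult_diff_right matrix_mult_diff_left matrix_mul_assoc[symmetric] i)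
  also have "(?U ** ?I ** ?U - ?U - ?U + ?T) \<bullet> R = (?U ** ?I ** ?U) \<bullet> R - 2 * (?U \<bullet> R) + ?T \<bullet> R"
    unfolding inner_diff_left inner_add_left by simp
  also have "(?U ** ?I ** ?U) \<bullet> R = ?T \<bullet> Q"
  proof -
    have "(?U ** ?I ** ?U) \<bullet> R = ?I \<bullet> (?U ** R ** ?U)"
      by (simp only: inner_matrix_mult_right[of _ ?U] inner_matrix_mult_left[of ?U] hU matrix_mul_assoc)
    also have "\<dots> = ?I \<bullet> (?T ** Q ** ?T)" by (simp only: U(2) T(2))
    also have "\<dots> = (?T ** ?I ** ?T) \<bullet> Q"
      by (simp only: inner_matrix_mult_right[of _ ?T] inner_matrix_mult_left[of ?T] hT matrix_mul_assoc)
    finally show ?thesis by (simp add: i)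
  qed
  finally have "2 * (?U \<bullet> R) \<le> ?T \<bullet> Q + ?T \<bullet> R" by simp
  then show ?thesis
    unfolding bw_dist_sq_eq[OF Q Sp] bw_dist_sq_eq[OF R Sp]
    by (simp add: inner_diff_left inner_diff_right rtrace_eq_inner inner_commute)
qed

text \<open>By continuity from the definite case, with \<open>R + e\<close> and \<open>S + e\<close> in place of \<open>R\<close> and \<open>S\<close>.\<close>

lemma bw_dist_sq_subgradient:
  fixes Q R S :: "complex^'d^'d"
  assumes Q: "Q \<in> pd" and R: "R \<in> psd" and S: "S \<in> psd"
  shows "bw_dist_sq R S \<ge> bw_dist_sq Q S + (mat 1 - transport Q S) \<bullet> (R - Q)"
proof -
  note rR = psd_regularize[OF R] and rS = psd_regularize[OF S]
  let ?R = "\<lambda>e. R + e *\<^sub>R mat 1" and ?S = "\<lambda>e. S + e *\<^sub>R mat 1"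
  have e: "\<forall>\<^sub>F e in at_right 0. ?R e \<in> psd" "\<forall>\<^sub>F e in at_right 0. ?S e \<in> psd"
    using rR(2) rS(2) by (auto intro: eventually_mono pd_imp_psd)
  have T: "((\<lambda>e. transport Q (?S e)) \<longlongrightarrow> transport Q S) (at_right 0)"
    by (rule continuous_on_tendsto_compose[OF continuous_on_transport_right[OF Q] rS(1) S e(2)])
  show ?thesis
  proof (rule tendsto_le[OF trivial_limit_at_right_real])
    show "((\<lambda>e. bw_dist_sq (?R e) (?S e)) \<longlongrightarrow> bw_dist_sq R S) (at_right 0)"
      by (intro tendsto_bw_dist_sq rR rS R S e)
    show "((\<lambda>e. bw_dist_sq Q (?S e) + (mat 1 - transport Q (?S e)) \<bullet> (?R e - Q)) \<longlongrightarrow>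
        bw_dist_sq Q S + (mat 1 - transport Q S) \<bullet> (R - Q)) (at_right 0)"
      using pd_imp_psd[OF Q]
      by (intro tendsto_intros tendsto_bw_dist_sq rR rS S e T) auto
    show "\<forall>\<^sub>F e in at_right 0. bw_dist_sq Q (?S e) + (mat 1 - transport Q (?S e)) \<bullet> (?R e - Q) \<le> bw_dist_sq (?R e) (?S e)"
      using rR(2) rS(2) by eventually_elim (rule bw_dist_sq_subgradient_pd[OF Q])
  qed
qed

lemma bw_dist_sq_bounds:
  fixes Q S :: "complex^'d^'d"
  assumes Q: "Q \<in> psd" and S: "S \<in> psd"
  shows "0 \<le> bw_dist_sq Q S" "bw_dist_sq Q S \<le> rtrace Q + rtrace S"
proof -
  note rQ = psd_regularize[OF Q]
  show "0 \<le> bw_dist_sq Q S"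
  proof (rule tendsto_le[OF trivial_limit_at_right_real _ tendsto_const])
    show "((\<lambda>e. bw_dist_sq (Q + e *\<^sub>R mat 1) S) \<longlongrightarrow> bw_dist_sq Q S) (at_right 0)"
      using rQ(2) by (intro tendsto_bw_dist_sq rQ Q S tendsto_const)
        (auto elim!: eventually_mono intro: pd_imp_psd simp: S)
    show "\<forall>\<^sub>F e in at_right 0. 0 \<le> bw_dist_sq (Q + e *\<^sub>R mat 1) S"
      using rQ(2) by eventually_elim (simp add: bw_dist_eq_norm S)
  qed
  have "0 \<le> rtrace (psd_sqrt (psd_sqrt Q ** S ** psd_sqrt Q))"
    by (intro rtrace_psd_nonneg psd_sqrt psd_conj S psd_sqrt_hermitian Q)
  then show "bw_dist_sq Q S \<le> rtrace Q + rtrace S" by (simp add: bw_dist_sq_def)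
qed

text \<open>When \<open>Q\<close> is nearly degenerate in the direction \<open>v\<close>, transporting it to a matrix \<open>S \<ge> s\<close> takes
  a large map.  This is what keeps barycenters away from the boundary of the cone.\<close>

lemma transport_blowup:
  assumes Q: "Q \<in> pd" and S: "S - s *\<^sub>R mat 1 \<in> psd" and s: "s > 0"
  shows "s * (norm v)\<^sup>2 \<le> (v \<bullet> (Q *v v)) * (norm (transport Q S))\<^sup>2"
proof -
  let ?T = "transport Q S"
  have Spd: "S \<in> pd" using S s by (rule pd_of_lower_bound)
  note T = transport_psd[OF Q pd_imp_psd[OF Spd]] and i = pd_inverse[OF transport_pd[OF Q Spd]]
  define w where "w = matrix_inv ?T *v v"
  have v: "v = ?T *v w" by (simp add: w_def matrix_vector_mul_assoc i)
  have "v \<bullet> (Q *v v) = w \<bullet> (?T *v (Q *v (?T *v w)))"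
    unfolding v using psd_hermitian[OF T(1)] by (simp add: hermitian_iff_selfadjoint)
  also have "\<dots> = w \<bullet> (S *v w)" by (simp only: matrix_vector_mul_assoc matrix_mul_assoc T(2))
  also have "\<dots> \<ge> s * (norm w)\<^sup>2"
    using psd_form[OF S, of w] by (simp add: matvec_simps inner_diff_right dot_square_norm)
  finally have 1: "s * (norm w)\<^sup>2 \<le> v \<bullet> (Q *v v)" .
  have "s * (norm v)\<^sup>2 \<le> s * (norm ?T * norm w)\<^sup>2"
    unfolding v using s by (intro mult_left_mono power_mono norm_matrix_vector_le) auto
  also have "\<dots> = (s * (norm w)\<^sup>2) * (norm ?T)\<^sup>2" by (simp add: power_mult_distrib)
  also have "\<dots> \<le> (v \<bullet> (Q *v v)) * (norm ?T)\<^sup>2" using 1 by (rule mult_right_mono) simp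
  finally show ?thesis .
qed

section \<open>Laws of large numbers\<close>

text \<open>The largest of the partial sums of \<open>x\<close> of lengths \<open>0\<close> to \<open>n\<close>.  The recursion splits off the first
  term, since the argument below compares the sequence with its shift.\<close>

primrec max_sum :: "nat \<Rightarrow> (nat \<Rightarrow> real) \<Rightarrow> real" where
  "max_sum 0 x = 0"
| "max_sum (Suc n) x = max 0 (x 0 + max_sum n (\<lambda>i. x (Suc i)))"

lemma sum_le_max_sum: "k \<le> n \<Longrightarrow> (\<Sum>i<k. x i) \<le> max_sum n x"
proof (induction n arbitrary: k x)
  case (Suc n)
  show ?case
  proof (cases k)
    case (Suc j)
    then have "(\<Sum>i<k. x i) = x 0 + (\<Sum>i<j. x (Suc i))" by (simp add: sum.lessThan_Suc_shift del: sum.lessThan_Suc)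
    also have "\<dots> \<le> x 0 + max_sum n (\<lambda>i. x (Suc i))"
      using Suc.IH[of j "\<lambda>i. x (Suc i)"] Suc.prems Suc by simp
    finally show ?thesis by simp
  qed simp
qed simp

lemma max_sum_attained: "\<exists>k\<le>n. max_sum n x = (\<Sum>i<k. x i)"
proof (induction n arbitrary: x)
  case (Suc n)
  then obtain k where k: "k \<le> n" "max_sum n (\<lambda>i. x (Suc i)) = (\<Sum>i<k. x (Suc i))" by blast
  show ?case
  proof (cases "x 0 + max_sum n (\<lambda>i. x (Suc i)) \<le> 0")
    case True
    then show ?thesis by (intro exI[of _ 0]) simp
  next
    case False
    then show ?thesis using k by (intro exI[of _ "Suc k"]) (simp add: sum.lessThan_Suc_shift del: sum.lessThan_Suc)
  qed
qed simp

lemma max_sum_mono: "m \<le> n \<Longrightarrow> max_sum m x \<le> max_sum n x"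
  using max_sum_attained[of m x] sum_le_max_sum[of _ n x] by force

lemma max_sum_nonneg: "0 \<le> max_sum n x"
  using sum_le_max_sum[of 0 n x] by simp

lemma max_sum_le: "max_sum n x \<le> (\<Sum>i<n. \<bar>x i\<bar>)"
proof -
  obtain k where "k \<le> n" "max_sum n x = (\<Sum>i<k. x i)" using max_sum_attained by blast
  moreover have "(\<Sum>i<k. x i) \<le> (\<Sum>i<k. \<bar>x i\<bar>)" by (intro sum_mono) auto
  moreover have "(\<Sum>i<k. \<bar>x i\<bar>) \<le> (\<Sum>i<n. \<bar>x i\<bar>)" if "k \<le> n" using that by (intro sum_mono2) auto
  ultimately show ?thesis by simp
qed

lemma measurable_max_sum_compose:
  "(\<And>i. X i \<in> borel_measurable N) \<Longrightarrow> (\<lambda>\<omega>. max_sum n (\<lambda>i. X i \<omega>)) \<in> borel_measurable N"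
proof (induction n arbitrary: X)
  case (Suc n)
  from Suc.IH[of "\<lambda>i. X (Suc i)"] Suc.prems have "(\<lambda>\<omega>. max_sum n (\<lambda>i. X (Suc i) \<omega>)) \<in> borel_measurable N" by simp
  then show ?case using Suc.prems[of 0] by simp
qed simp

text \<open>The law of the maximum of the first \<open>n\<close> partial sums does not change when the sequence is
  shifted.  Were the partial sums unbounded almost surely, the identity
  \<open>max_sum (n + 1) X - max_sum n X' = max (- max_sum n X') (X 0)\<close> for the shifted sequence \<open>X'\<close>
  would have a nonnegative expectation on the left and one tending to that of \<open>X 0\<close> on the right.
  With a negative mean this is absurd, and the zero-one law does the rest.\<close>

lemma (in prob_space) partial_sums_bdd_above:
  fixes X :: "nat \<Rightarrow> 'a \<Rightarrow> real"
  assumes ind: "indep_vars (\<lambda>_. borel) X UNIV"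
    and law: "\<And>i. distr M borel (X i) = distr M borel (X 0)"
    and int: "integrable M (X 0)" and neg: "expectation (X 0) < 0"
  shows "AE \<omega> in M. bdd_above (range (\<lambda>n. \<Sum>i<n. X i \<omega>))"
proof -
  have meas [measurable]: "X i \<in> borel_measurable M" for i
    using ind by (auto simp: indep_vars_def2)
  have intX: "integrable M (X i)" for i
  proof -
    have "integrable (distr M borel (X i)) (\<lambda>x. x)"
      unfolding law[of i] using int by (subst integrable_distr_eq) auto
    then show ?thesis by (subst (asm) integrable_distr_eq) auto
  qed
  define m where "m n \<omega> = max_sum n (\<lambda>i. X i \<omega>)" for n \<omega>
  define m' where "m' n \<omega> = max_sum n (\<lambda>i. X (Suc i) \<omega>)" for n \<omega>
  have [measurable]: "m n \<in> borel_measurable M" "m' n \<in> borel_measurable M" for n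
    unfolding m_def[abs_def] m'_def[abs_def] by (intro measurable_max_sum_compose meas)+
  have int_m: "integrable M (m n)" for n
    by (rule Bochner_Integration.integrable_bound[where f = "\<lambda>\<omega>. \<Sum>i<n. \<bar>X i \<omega>\<bar>"])
       (use intX max_sum_le max_sum_nonneg in \<open>auto simp: m_def abs_of_nonneg sum_nonneg\<close>)
  have int_m': "integrable M (m' n)" for n
    by (rule Bochner_Integration.integrable_bound[where f = "\<lambda>\<omega>. \<Sum>i<n. \<bar>X (Suc i) \<omega>\<bar>"])
       (use intX max_sum_le max_sum_nonneg in \<open>auto simp: m'_def abs_of_nonneg sum_nonneg\<close>)
  have shift: "expectation (m' n) = expectation (m n)" for n
  proof -
    let ?\<mu> = "distr M borel (X 0)" and ?\<Pi> = "\<Pi>\<^sub>M i\<in>(UNIV::nat set). (borel :: real measure)"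
    have "(\<Pi>\<^sub>M i\<in>UNIV. distr M borel (X i)) = (\<Pi>\<^sub>M i\<in>UNIV. ?\<mu>)" by (intro PiM_cong refl law)
    then have joint: "distr M ?\<Pi> (\<lambda>\<omega>. \<lambda>i\<in>UNIV. X i \<omega>) = (\<Pi>\<^sub>M i\<in>UNIV. ?\<mu>)"
      using indep_vars_iff_distr_eq_PiM[of UNIV X "\<lambda>_. borel"] ind meas by simp
    have "distr M ?\<Pi> (\<lambda>\<omega>. \<lambda>i\<in>UNIV. X (Suc i) \<omega>) =
        distr (distr M ?\<Pi> (\<lambda>\<omega>. \<lambda>i\<in>UNIV. X i \<omega>)) ?\<Pi> (\<lambda>x. \<lambda>i\<in>UNIV. x (Suc i))"
      by (subst distr_distr) (auto simp: comp_def intro!: measurable_PiM_single')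
    also have "\<dots> = distr (\<Pi>\<^sub>M i\<in>UNIV. ?\<mu>) (\<Pi>\<^sub>M i\<in>UNIV. ?\<mu>) (\<lambda>x. \<lambda>i\<in>UNIV. x (Suc i))"
      unfolding joint by (rule distr_cong) (auto intro!: sets_PiM_cong)
    also have "\<dots> = (\<Pi>\<^sub>M i\<in>UNIV. ?\<mu>)"
      by (rule distr_PiM_reindex) (auto intro: prob_space_distr)
    finally have eq: "distr M ?\<Pi> (\<lambda>\<omega>. \<lambda>i\<in>UNIV. X (Suc i) \<omega>) = distr M ?\<Pi> (\<lambda>\<omega>. \<lambda>i\<in>UNIV. X i \<omega>)"
      by (simp only: joint)
    have [measurable]: "max_sum n \<in> borel_measurable (\<Pi>\<^sub>M i\<in>(UNIV::nat set). borel)"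
      using measurable_max_sum_compose[of "\<lambda>i x. x i" "\<Pi>\<^sub>M i\<in>(UNIV::nat set). borel" n] by simp
    have "expectation (m' n) = (\<integral>x. max_sum n x \<partial>distr M (\<Pi>\<^sub>M i\<in>UNIV. borel) (\<lambda>\<omega>. \<lambda>i\<in>UNIV. X (Suc i) \<omega>))"
      by (subst integral_distr) (auto simp: m'_def[abs_def] restrict_def intro!: measurable_PiM_single')
    also have "\<dots> = expectation (m n)"
      unfolding eq by (subst integral_distr) (auto simp: m_def[abs_def] restrict_def intro!: measurable_PiM_single')
    finally show ?thesis .
  qed
  \<comment> \<open>The right-hand side equals \<open>X 0\<close> as soon as \<open>m' n\<close> has reached \<open>- X 0\<close>.\<close>
  have step: "m (Suc n) \<omega> - m' n \<omega> = max (- m' n \<omega>) (X 0 \<omega>)" for n \<omega>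
    by (simp add: m_def m'_def max_def)
  have nonneg: "0 \<le> expectation (\<lambda>\<omega>. max (- m' n \<omega>) (X 0 \<omega>))" for n
  proof -
    have "expectation (m n) \<le> expectation (m (Suc n))"
      using int_m by (intro integral_mono) (auto simp: m_def max_sum_mono simp del: max_sum.simps)
    then have "0 \<le> expectation (\<lambda>\<omega>. m (Suc n) \<omega> - m' n \<omega>)"
      using int_m int_m' by (simp add: shift)
    then show ?thesis by (simp only: step)
  qed
  let ?B = "{\<omega>\<in>space M. \<not> bdd_above (range (\<lambda>n. \<Sum>i<n. X i \<omega>))}"
  have not1: "\<not> (AE \<omega> in M. \<omega> \<in> ?B)"
  proof
    assume B: "AE \<omega> in M. \<omega> \<in> ?B"
    have "(\<lambda>n. expectation (\<lambda>\<omega>. max (- m' n \<omega>) (X 0 \<omega>))) \<longlonglongrightarrow> expectation (X 0)"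
    proof (rule integral_dominated_convergence[where w = "\<lambda>\<omega>. \<bar>X 0 \<omega>\<bar>"])
      show "AE \<omega> in M. (\<lambda>n. max (- m' n \<omega>) (X 0 \<omega>)) \<longlonglongrightarrow> X 0 \<omega>"
        using B
      proof eventually_elim
        case (elim \<omega>)
        have "\<exists>N. m' N \<omega> > - X 0 \<omega>"
        proof (rule ccontr)
          assume "\<not> ?thesis"
          then have le: "m' N \<omega> \<le> - X 0 \<omega>" for N by (simp add: not_less)
          have "(\<Sum>i<n. X i \<omega>) \<le> max 0 (X 0 \<omega> + - X 0 \<omega>)" for n
            using sum_le_max_sum[of n "Suc n" "\<lambda>i. X i \<omega>"] le[of n] by (auto simp: m'_def max_def split: if_splits)
          then show False using elim by (auto simp: bdd_above_def)
        qed
        then obtain N where N: "m' N \<omega> > - X 0 \<omega>" by blast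
        have "max (- m' n \<omega>) (X 0 \<omega>) = X 0 \<omega>" if "n \<ge> N" for n
        proof -
          have "m' N \<omega> \<le> m' n \<omega>" using that by (simp add: m'_def max_sum_mono)
          then show ?thesis using N by simp
        qed
        then have "\<forall>\<^sub>F n in sequentially. max (- m' n \<omega>) (X 0 \<omega>) = X 0 \<omega>"
          by (auto simp: eventually_sequentially)
        then show ?case by (rule tendsto_eventually)
      qed
      show "AE \<omega> in M. norm (max (- m' n \<omega>) (X 0 \<omega>)) \<le> \<bar>X 0 \<omega>\<bar>" for n
      proof (rule AE_I2)
        fix \<omega>
        show "norm (max (- m' n \<omega>) (X 0 \<omega>)) \<le> \<bar>X 0 \<omega>\<bar>"
          using max_sum_nonneg[of n "\<lambda>i. X (Suc i) \<omega>"] by (auto simp: m'_def)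
      qed
    qed (use int in auto)
    then have "0 \<le> expectation (X 0)" using nonneg by (intro LIMSEQ_le_const) auto
    then show False using neg by simp
  qed
  have tail: "?B \<in> tail_events (\<lambda>i. {X i -` A \<inter> space M |A. A \<in> sets borel})"
    unfolding tail_events_def
  proof (rule INT_I)
    fix k :: nat
    define G where "G = \<Union> ((\<lambda>i. {X i -` A \<inter> space M |A. A \<in> sets borel}) ` {k..})"
    have G: "G \<subseteq> Pow (space M)" by (auto simp: G_def)
    define N where "N = sigma (space M) G"
    have sN: "space N = space M" "sets N = sigma_sets (space M) G"
      using G by (auto simp: N_def)
    have [measurable]: "X i \<in> borel_measurable N" if "k \<le> i" for i
      using that by (intro measurableI) (auto simp: sN G_def intro!: sigma_sets.Basic)
    have bdd: "bdd_above (range (\<lambda>n. \<Sum>i<n. X i \<omega>)) \<longleftrightarrow> (\<exists>c::nat. \<forall>n. (\<Sum>i<n. X (k + i) \<omega>) \<le> real c)" for \<omega>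
    proof
      assume "bdd_above (range (\<lambda>n. \<Sum>i<n. X i \<omega>))"
      then obtain c where c: "\<And>n. (\<Sum>i<n. X i \<omega>) \<le> c" by (auto simp: bdd_above_def)
      obtain d :: nat where d: "c - (\<Sum>i<k. X i \<omega>) \<le> real d" using real_arch_simple by blast
      have "(\<Sum>i<n. X (k + i) \<omega>) \<le> real d" for n
      proof -
        have "(\<Sum>i<k + n. X i \<omega>) = (\<Sum>i<k. X i \<omega>) + (\<Sum>i<n. X (k + i) \<omega>)"
          by (induction n) simp_all
        then show ?thesis using c[of "k + n"] d by simp
      qed
      then show "\<exists>c::nat. \<forall>n. (\<Sum>i<n. X (k + i) \<omega>) \<le> real c" by blast
    next
      assume "\<exists>c::nat. \<forall>n. (\<Sum>i<n. X (k + i) \<omega>) \<le> real c"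
      then obtain c :: nat where c: "\<And>n. (\<Sum>i<n. X (k + i) \<omega>) \<le> real c" by blast
      have "(\<Sum>i<n. X i \<omega>) \<le> (\<Sum>i<k. \<bar>X i \<omega>\<bar>) + real c" for n
      proof (cases "n \<le> k")
        case True
        have "(\<Sum>i<n. X i \<omega>) \<le> (\<Sum>i<n. \<bar>X i \<omega>\<bar>)" by (intro sum_mono) auto
        also have "\<dots> \<le> (\<Sum>i<k. \<bar>X i \<omega>\<bar>)" using True by (intro sum_mono2) auto
        finally show ?thesis by simp
      next
        case False
        then obtain j where j: "n = k + j" by (metis le_add_diff_inverse nat_le_linear)
        have "(\<Sum>i<n. X i \<omega>) = (\<Sum>i<k. X i \<omega>) + (\<Sum>i<j. X (k + i) \<omega>)"
          unfolding j by (induction j) simp_all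
        moreover have "(\<Sum>i<k. X i \<omega>) \<le> (\<Sum>i<k. \<bar>X i \<omega>\<bar>)" by (intro sum_mono) auto
        ultimately show ?thesis using c[of j] by simp
      qed
      then show "bdd_above (range (\<lambda>n. \<Sum>i<n. X i \<omega>))" by (auto simp: bdd_above_def)
    qed
    have "{\<omega>\<in>space N. \<not> (\<exists>c::nat. \<forall>n. (\<Sum>i<n. X (k + i) \<omega>) \<le> real c)} \<in> sets N"
      by measurable
    then show "?B \<in> sigma_sets (space M) (\<Union> ((\<lambda>i. {X i -` A \<inter> space M |A. A \<in> sets borel}) ` {k..}))"
      unfolding sN bdd G_def .
  qed
  have "prob ?B = 0 \<or> prob ?B = 1"
  proof (rule kolmogorov_0_1_law[OF _ _ tail])
    show "sigma_algebra (space M) {X i -` A \<inter> space M |A. A \<in> sets borel}" for i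
      using sets.sigma_algebra_axioms[of "vimage_algebra (space M) (X i) borel"]
      by (simp add: sets_vimage_algebra2)
    show "indep_sets (\<lambda>i. {X i -` A \<inter> space M |A. A \<in> sets borel}) UNIV"
      using ind by (simp add: indep_vars_def2)
  qed
  moreover have Bm: "?B \<in> events"
  proof -
    have "{X i -` A \<inter> space M |A. A \<in> sets borel} \<subseteq> events" for i
      using measurable_sets[OF meas[of i]] by auto
    from tail_events_sets[of "\<lambda>i. {X i -` A \<inter> space M |A. A \<in> sets borel}", OF this] tail
    show ?thesis by blast
  qed
  ultimately have "prob ?B = 0" using not1 AE_prob_1[of ?B] by blast
  then have "AE \<omega> in M. \<omega> \<notin> ?B" using Bm by (simp add: prob_eq_0)
  then show ?thesis using AE_space by eventually_elim auto
qed

text \<open>Shift the variables down to a mean of \<open>- 1 / (k + 1)\<close>: their partial sums are bounded above, so the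
  averages are eventually below any positive number.\<close>

lemma (in prob_space) average_le_eventually:
  fixes X :: "nat \<Rightarrow> 'a \<Rightarrow> real"
  assumes ind: "indep_vars (\<lambda>_. borel) X UNIV"
    and law: "\<And>i. distr M borel (X i) = distr M borel (X 0)"
    and int: "integrable M (X 0)"
  shows "AE \<omega> in M. \<forall>e>0. \<forall>\<^sub>F n in sequentially. (\<Sum>i<n. X i \<omega>) / real n < expectation (X 0) + e"
proof -
  have meas [measurable]: "X i \<in> borel_measurable M" for i
    using ind by (auto simp: indep_vars_def2)
  have 1: "AE \<omega> in M. bdd_above (range (\<lambda>n. \<Sum>i<n. (X i \<omega> - (expectation (X 0) + 1 / real (Suc k)))))" for k
  proof (rule partial_sums_bdd_above)
    let ?c = "expectation (X 0) + 1 / real (Suc k)"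
    show "indep_vars (\<lambda>_. borel) (\<lambda>i \<omega>. X i \<omega> - ?c) UNIV"
      by (rule indep_vars_compose2[OF ind]) simp
    show "distr M borel (\<lambda>\<omega>. X i \<omega> - ?c) = distr M borel (\<lambda>\<omega>. X 0 \<omega> - ?c)" for i
    proof -
      have "distr (distr M borel (X j)) borel (\<lambda>x. x - ?c) = distr M borel (\<lambda>\<omega>. X j \<omega> - ?c)" for j
        by (subst distr_distr) (auto simp: comp_def)
      then show ?thesis using law[of i] by metis
    qed
    show "integrable M (\<lambda>\<omega>. X 0 \<omega> - ?c)" using int by auto
    show "expectation (\<lambda>\<omega>. X 0 \<omega> - ?c) < 0" using int by (simp add: prob_space)
  qed
  have "AE \<omega> in M. \<forall>k. bdd_above (range (\<lambda>n. \<Sum>i<n. (X i \<omega> - (expectation (X 0) + 1 / real (Suc k)))))"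
    using 1 by (simp add: AE_all_countable)
  then show ?thesis
  proof (eventually_elim, intro allI impI)
    fix \<omega> and e :: real
    assume b: "\<forall>k. bdd_above (range (\<lambda>n. \<Sum>i<n. (X i \<omega> - (expectation (X 0) + 1 / real (Suc k)))))" and e: "0 < e"
    obtain k where k: "1 / real (Suc k) < e / 2" using e nat_approx_posE[of "e / 2"] by (auto simp: field_simps)
    obtain c where c: "\<And>n. (\<Sum>i<n. (X i \<omega> - (expectation (X 0) + 1 / real (Suc k)))) \<le> c"
      using b[rule_format, of k] by (auto simp: bdd_above_def)
    have "(\<lambda>n. c / real n) \<longlonglongrightarrow> 0" by (rule tendsto_divide_0[OF tendsto_const]) (simp add: filterlim_real_sequentially filterlim_at_top_imp_at_infinity)
    then have "\<forall>\<^sub>F n in sequentially. c / real n < e / 2" using e by (intro order_tendstoD) auto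
    then show "\<forall>\<^sub>F n in sequentially. (\<Sum>i<n. X i \<omega>) / real n < expectation (X 0) + e"
      using eventually_gt_at_top[of 0]
    proof eventually_elim
      case (elim n)
      define q where "q = expectation (X 0) + 1 / real (Suc k)"
      have "(\<Sum>i<n. X i \<omega>) - real n * q \<le> c"
        using c[of n, folded q_def] by (simp only: sum_subtractf) simp
      then have "(\<Sum>i<n. X i \<omega>) / real n \<le> c / real n + q"
        using elim(2) by (simp add: field_simps)
      then have "(\<Sum>i<n. X i \<omega>) / real n \<le> c / real n + (expectation (X 0) + 1 / real (Suc k))"
        by (simp only: q_def)
      then show ?case using elim(1) k by linarith
    qed
  qed
qed

lemma (in prob_space) strong_law_real:
  fixes X :: "nat \<Rightarrow> 'a \<Rightarrow> real"
  assumes ind: "indep_vars (\<lambda>_. borel) X UNIV"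
    and law: "\<And>i. distr M borel (X i) = distr M borel (X 0)"
    and int: "integrable M (X 0)"
  shows "AE \<omega> in M. (\<lambda>n. (\<Sum>i<n. X i \<omega>) / real n) \<longlonglongrightarrow> expectation (X 0)"
proof -
  have meas [measurable]: "X i \<in> borel_measurable M" for i
    using ind by (auto simp: indep_vars_def2)
  have "AE \<omega> in M. \<forall>e>0. \<forall>\<^sub>F n in sequentially. (\<Sum>i<n. - X i \<omega>) / real n < expectation (\<lambda>\<omega>. - X 0 \<omega>) + e"
  proof (rule average_le_eventually)
    show "indep_vars (\<lambda>_. borel) (\<lambda>i \<omega>. - X i \<omega>) UNIV" by (rule indep_vars_compose2[OF ind]) simp
    show "distr M borel (\<lambda>\<omega>. - X i \<omega>) = distr M borel (\<lambda>\<omega>. - X 0 \<omega>)" for i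
    proof -
      have "distr (distr M borel (X j)) borel uminus = distr M borel (\<lambda>\<omega>. - X j \<omega>)" for j
        by (subst distr_distr) (auto simp: comp_def)
      then show ?thesis using law[of i] by metis
    qed
  qed (use int in auto)
  with average_le_eventually[OF assms] show ?thesis
  proof eventually_elim
    case (elim \<omega>)
    show ?case
    proof (rule tendstoI)
      fix e :: real assume "0 < e"
      then have "\<forall>\<^sub>F n in sequentially. (\<Sum>i<n. X i \<omega>) / real n < expectation (X 0) + e"
        "\<forall>\<^sub>F n in sequentially. (\<Sum>i<n. - X i \<omega>) / real n < expectation (\<lambda>\<omega>. - X 0 \<omega>) + e"
        using elim by auto
      then show "\<forall>\<^sub>F n in sequentially. dist ((\<Sum>i<n. X i \<omega>) / real n) (expectation (X 0)) < e"
        by eventually_elim (simp add: sum_negf dist_real_def abs_less_iff)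
    qed
  qed
qed

locale iid_sample = prob_space \<Omega> for \<Omega> :: "'w measure" +
  fixes P :: "'s measure" and S :: "nat \<Rightarrow> 'w \<Rightarrow> 's"
  assumes indep: "indep_vars (\<lambda>_. P) S UNIV" and law: "\<And>i. distr \<Omega> P (S i) = P"
begin

lemma measurable_sample [measurable]: "S i \<in> measurable \<Omega> P"
  using indep by (auto simp: indep_vars_def2)

lemma sample_in_space: "\<omega> \<in> space \<Omega> \<Longrightarrow> S i \<omega> \<in> space P"
  using measurable_sample by (rule measurable_space)

lemma strong_law:
  fixes g :: "'s \<Rightarrow> 'c::euclidean_space"
  assumes g: "integrable P g"
  shows "AE \<omega> in \<Omega>. (\<lambda>n. (1 / real n) *\<^sub>R (\<Sum>i<n. g (S i \<omega>))) \<longlonglongrightarrow> (\<integral>s. g s \<partial>P)"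
proof -
  have gm [measurable]: "g \<in> borel_measurable P" using g by auto
  have "AE \<omega> in \<Omega>. \<forall>b\<in>Basis. (\<lambda>n. (\<Sum>i<n. g (S i \<omega>) \<bullet> b) / real n) \<longlonglongrightarrow> (\<integral>s. g s \<partial>P) \<bullet> b"
  proof (subst AE_finite_all, simp, intro ballI)
    fix b :: 'c assume "b \<in> Basis"
    have gb: "integrable P (\<lambda>s. g s \<bullet> b)" using g by auto
    have "AE \<omega> in \<Omega>. (\<lambda>n. (\<Sum>i<n. g (S i \<omega>) \<bullet> b) / real n) \<longlonglongrightarrow> expectation (\<lambda>\<omega>. g (S 0 \<omega>) \<bullet> b)"
    proof (rule strong_law_real)
      show "indep_vars (\<lambda>_. borel) (\<lambda>i \<omega>. g (S i \<omega>) \<bullet> b) UNIV"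
        by (rule indep_vars_compose2[OF indep]) simp
      have "distr (distr \<Omega> P (S j)) borel (\<lambda>s. g s \<bullet> b) = distr \<Omega> borel (\<lambda>\<omega>. g (S j \<omega>) \<bullet> b)" for j
        by (subst distr_distr) (auto simp: comp_def)
      then show "distr \<Omega> borel (\<lambda>\<omega>. g (S i \<omega>) \<bullet> b) = distr \<Omega> borel (\<lambda>\<omega>. g (S 0 \<omega>) \<bullet> b)" for i
        unfolding law by metis
      have "integrable (distr \<Omega> P (S 0)) (\<lambda>s. g s \<bullet> b)" using gb law by simp
      then show "integrable \<Omega> (\<lambda>\<omega>. g (S 0 \<omega>) \<bullet> b)" by (subst (asm) integrable_distr_eq) auto
    qed
    moreover have "expectation (\<lambda>\<omega>. g (S 0 \<omega>) \<bullet> b) = (\<integral>s. g s \<partial>P) \<bullet> b"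
    proof -
      have "expectation (\<lambda>\<omega>. g (S 0 \<omega>) \<bullet> b) = (\<integral>s. g s \<bullet> b \<partial>distr \<Omega> P (S 0))"
        by (subst integral_distr) auto
      then show ?thesis using g by (simp add: law)
    qed
    ultimately show "AE \<omega> in \<Omega>. (\<lambda>n. (\<Sum>i<n. g (S i \<omega>) \<bullet> b) / real n) \<longlonglongrightarrow> (\<integral>s. g s \<partial>P) \<bullet> b" by simp
  qed
  then show ?thesis
  proof eventually_elim
    case (elim \<omega>)
    then show ?case
      by (subst tendsto_componentwise_iff) (simp add: inner_sum_left)
  qed
qed

text \<open>A dominated family that is continuous in its parameter obeys the law of large numbers
  uniformly near each parameter: its modulus of continuity, a supremum over countably many
  parameters and hence measurable, is itself averaged.\<close>

lemma uniform_strong_law: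
  fixes f :: "'t::{metric_space, second_countable_topology} \<Rightarrow> 's \<Rightarrow> 'c::euclidean_space"
  assumes \<theta>: "\<theta> \<in> U"
    and cont: "\<And>s. s \<in> space P \<Longrightarrow> continuous_on U (\<lambda>t. f t s)"
    and meas: "\<And>t. t \<in> U \<Longrightarrow> f t \<in> borel_measurable P"
    and g: "integrable P g" and bound: "\<And>t s. t \<in> U \<Longrightarrow> s \<in> space P \<Longrightarrow> norm (f t s) \<le> g s"
  shows "AE \<omega> in \<Omega>. \<forall>e>0. \<exists>d>0. \<forall>\<^sub>F n in sequentially. \<forall>t\<in>U. dist t \<theta> < d \<longrightarrow>
           norm ((1 / real n) *\<^sub>R (\<Sum>i<n. f t (S i \<omega>)) - (\<integral>s. f \<theta> s \<partial>P)) < e"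
proof -
  obtain C where C: "countable C" "C \<subseteq> U" "U \<subseteq> closure C" by (rule separable)
  define D where "D k = insert \<theta> (C \<inter> ball \<theta> (1 / real (Suc k)))" for k
  have D: "countable (D k)" "D k \<noteq> {}" "D k \<subseteq> U" "\<And>t. t \<in> D k \<Longrightarrow> dist t \<theta> < 1 / real (Suc k)" for k
    using C \<theta> by (auto simp: D_def dist_commute)
  define m where "m k s = (SUP t\<in>D k. norm (f t s - f \<theta> s))" for k s
  have le2g: "norm (f t s - f \<theta> s) \<le> 2 * g s" if "t \<in> U" "s \<in> space P" for t s
    using norm_triangle_ineq4[of "f t s" "f \<theta> s"] bound[OF that] bound[OF \<theta> that(2)] by simp
  have bdd: "bdd_above ((\<lambda>t. norm (f t s - f \<theta> s)) ` D k)" if "s \<in> space P" for s k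
    using le2g[OF _ that] D(3)[of k] by (intro bdd_aboveI2[of _ _ "2 * g s"]) auto
  have m_meas [measurable]: "m k \<in> borel_measurable P" for k
    unfolding m_def using D(3)[of k] meas \<theta>
    by (intro borel_measurable_cSUP D(1) bdd) auto
  have m_bound: "0 \<le> m k s" "m k s \<le> 2 * g s" if "s \<in> space P" for k s
  proof -
    have "norm (f \<theta> s - f \<theta> s) \<le> m k s"
      unfolding m_def by (intro cSUP_upper bdd that) (simp add: D_def)
    then show "0 \<le> m k s" by simp
    show "m k s \<le> 2 * g s"
      unfolding m_def using D(3)[of k] by (intro cSUP_least D(2) le2g that) auto
  qed
  have m_upper: "norm (f t s - f \<theta> s) \<le> m k s" if t: "t \<in> U" "dist t \<theta> < 1 / real (Suc k)" and s: "s \<in> space P" for t k s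
  proof -
    obtain c where c: "\<And>n. c n \<in> C" "c \<longlonglongrightarrow> t" using C(3) t(1) by (metis closure_sequential subsetD)
    have "\<forall>\<^sub>F n in sequentially. dist (c n) \<theta> < 1 / real (Suc k)"
      using t(2) by (intro order_tendstoD(2)[OF tendsto_dist[OF c(2) tendsto_const]])
    then have ev: "\<forall>\<^sub>F n in sequentially. norm (f (c n) s - f \<theta> s) \<le> m k s"
    proof eventually_elim
      case (elim n)
      then show ?case
        unfolding m_def using c(1) by (intro cSUP_upper bdd s) (simp add: D_def dist_commute)
    qed
    have "(\<lambda>n. f (c n) s) \<longlonglongrightarrow> f t s"
      using c C(2)
      by (intro continuous_on_tendsto_compose[OF cont[OF s] c(2) t(1)]) (auto intro!: always_eventually)
    then have "(\<lambda>n. norm (f (c n) s - f \<theta> s)) \<longlonglongrightarrow> norm (f t s - f \<theta> s)" by (intro tendsto_intros)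
    then show ?thesis using ev by (intro tendsto_upperbound) auto
  qed
  have m_lim: "(\<lambda>k. m k s) \<longlonglongrightarrow> 0" if s: "s \<in> space P" for s
  proof (rule tendstoI)
    fix e :: real assume e: "0 < e"
    obtain d where d: "d > 0" "\<And>t. t \<in> U \<Longrightarrow> dist t \<theta> < d \<Longrightarrow> dist (f t s) (f \<theta> s) < e / 2"
      using cont[OF s] \<theta> e unfolding continuous_on_iff by (meson half_gt_zero)
    obtain K where K: "1 / real (Suc K) < d" using nat_approx_posE[OF d(1)] .
    have "dist (m k s) 0 < e" if "k \<ge> K" for k
    proof -
      have "m k s \<le> e / 2"
        unfolding m_def
      proof (rule cSUP_least[OF D(2)])
        fix t assume t: "t \<in> D k"
        have "1 / real (Suc k) \<le> 1 / real (Suc K)" using that by (simp add: frac_le)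
        then have "dist t \<theta> < d" using D(4)[OF t] K by linarith
        then show "norm (f t s - f \<theta> s) \<le> e / 2"
          using d(2)[of t] t D(3)[of k] by (auto simp: dist_norm intro: less_imp_le)
      qed
      then show ?thesis using m_bound(1)[OF s, of k] e by (simp add: dist_real_def)
    qed
    then show "\<forall>\<^sub>F k in sequentially. dist (m k s) 0 < e" by (auto simp: eventually_sequentially)
  qed
  have m_int: "integrable P (m k)" for k
    by (rule Bochner_Integration.integrable_bound[where f = "\<lambda>s. 2 * g s"])
       (use g m_bound in \<open>auto intro!: AE_I2 order_trans[OF _ abs_ge_self]\<close>)
  have Em: "(\<lambda>k. \<integral>s. m k s \<partial>P) \<longlonglongrightarrow> (\<integral>s. 0 \<partial>P)"
    by (rule integral_dominated_convergence[where w = "\<lambda>s. 2 * g s"])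
       (use g m_bound m_lim in \<open>auto intro!: AE_I2\<close>)
  have f_int: "integrable P (f \<theta>)"
    by (rule Bochner_Integration.integrable_bound[OF g meas[OF \<theta>]])
       (use bound[OF \<theta>] in \<open>auto intro!: AE_I2 order_trans[OF _ abs_ge_self]\<close>)
  have "AE \<omega> in \<Omega>. \<forall>k. (\<lambda>n. (1 / real n) *\<^sub>R (\<Sum>i<n. m k (S i \<omega>))) \<longlonglongrightarrow> (\<integral>s. m k s \<partial>P)"
    using strong_law[OF m_int] by (simp add: AE_all_countable)
  with strong_law[OF f_int] AE_space show ?thesis
  proof (eventually_elim, intro allI impI)
    fix \<omega> and e :: real
    assume lf: "(\<lambda>n. (1 / real n) *\<^sub>R (\<Sum>i<n. f \<theta> (S i \<omega>))) \<longlonglongrightarrow> (\<integral>s. f \<theta> s \<partial>P)" and \<omega>: "\<omega> \<in> space \<Omega>"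
      and lm: "\<forall>k. (\<lambda>n. (1 / real n) *\<^sub>R (\<Sum>i<n. m k (S i \<omega>))) \<longlonglongrightarrow> (\<integral>s. m k s \<partial>P)" and e: "0 < e"
    have "\<forall>\<^sub>F k in sequentially. (\<integral>s. m k s \<partial>P) < e / 2"
      using Em e by (intro order_tendstoD) auto
    then obtain k where k: "(\<integral>s. m k s \<partial>P) < e / 2" by (auto simp: eventually_sequentially)
    have 1: "\<forall>\<^sub>F n in sequentially. (1 / real n) *\<^sub>R (\<Sum>i<n. m k (S i \<omega>)) < e / 2"
      using lm[rule_format, of k] k by (intro order_tendstoD)
    have 2: "\<forall>\<^sub>F n in sequentially. dist ((1 / real n) *\<^sub>R (\<Sum>i<n. f \<theta> (S i \<omega>))) (\<integral>s. f \<theta> s \<partial>P) < e / 2"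
      using lf e by (intro tendstoD) auto
    have "\<forall>\<^sub>F n in sequentially. \<forall>t\<in>U. dist t \<theta> < 1 / real (Suc k) \<longrightarrow>
        norm ((1 / real n) *\<^sub>R (\<Sum>i<n. f t (S i \<omega>)) - (\<integral>s. f \<theta> s \<partial>P)) < e"
      using 1 2
    proof (eventually_elim, intro ballI impI)
      fix n t assume *: "(1 / real n) *\<^sub>R (\<Sum>i<n. m k (S i \<omega>)) < e / 2"
        "dist ((1 / real n) *\<^sub>R (\<Sum>i<n. f \<theta> (S i \<omega>))) (\<integral>s. f \<theta> s \<partial>P) < e / 2"
        and t: "t \<in> U" "dist t \<theta> < 1 / real (Suc k)"
      have "norm ((1 / real n) *\<^sub>R (\<Sum>i<n. f t (S i \<omega>)) - (1 / real n) *\<^sub>R (\<Sum>i<n. f \<theta> (S i \<omega>)))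
          = (1 / real n) * norm (\<Sum>i<n. f t (S i \<omega>) - f \<theta> (S i \<omega>))"
        by (simp add: scaleR_diff_right[symmetric] sum_subtractf)
      also have "\<dots> \<le> (1 / real n) * (\<Sum>i<n. m k (S i \<omega>))"
        using m_upper[OF t sample_in_space[OF \<omega>]] by (intro mult_left_mono sum_norm_le) auto
      finally show "norm ((1 / real n) *\<^sub>R (\<Sum>i<n. f t (S i \<omega>)) - (\<integral>s. f \<theta> s \<partial>P)) < e"
        using *(1)[unfolded real_scaleR_def] *(2)
          dist_triangle[of "(1 / real n) *\<^sub>R (\<Sum>i<n. f t (S i \<omega>))" "\<integral>s. f \<theta> s \<partial>P"
            "(1 / real n) *\<^sub>R (\<Sum>i<n. f \<theta> (S i \<omega>))"]
        unfolding dist_norm by linarith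
    qed
    then show "\<exists>d>0. \<forall>\<^sub>F n in sequentially. \<forall>t\<in>U. dist t \<theta> < d \<longrightarrow>
        norm ((1 / real n) *\<^sub>R (\<Sum>i<n. f t (S i \<omega>)) - (\<integral>s. f \<theta> s \<partial>P)) < e"
      by (intro exI[of _ "1 / real (Suc k)"]) simp
  qed
qed

end

section \<open>Weak limits from characteristic functions\<close>

text \<open>Real trigonometric polynomials with arbitrary frequencies: their expectations can be read off
  the characteristic function.  They form an algebra by the addition theorems.\<close>

inductive trig_poly :: "('a::euclidean_space \<Rightarrow> real) \<Rightarrow> bool" where
  wave: "trig_poly (\<lambda>x. c * cos (u \<bullet> x + \<theta>))"
| add: "trig_poly f \<Longrightarrow> trig_poly g \<Longrightarrow> trig_poly (\<lambda>x. f x + g x)"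

lemma trig_poly_const: "trig_poly (\<lambda>x. c)"
  using trig_poly.wave[of c 0 0] by simp

lemma trig_poly_mult:
  assumes "trig_poly f" "trig_poly g"
  shows "trig_poly (\<lambda>x. f x * g x)"
  using assms
proof (induction f arbitrary: g rule: trig_poly.induct)
  case (wave c u \<theta>)
  from wave show ?case
  proof (induction g rule: trig_poly.induct)
    case (wave d v \<phi>)
    have "(\<lambda>x. c * cos (u \<bullet> x + \<theta>) * (d * cos (v \<bullet> x + \<phi>))) =
        (\<lambda>x. (c * d / 2) * cos ((u - v) \<bullet> x + (\<theta> - \<phi>)) + (c * d / 2) * cos ((u + v) \<bullet> x + (\<theta> + \<phi>)))"
    proof
      fix x
      have 1: "(u - v) \<bullet> x + (\<theta> - \<phi>) = (u \<bullet> x + \<theta>) - (v \<bullet> x + \<phi>)"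
        and 2: "(u + v) \<bullet> x + (\<theta> + \<phi>) = (u \<bullet> x + \<theta>) + (v \<bullet> x + \<phi>)"
        by (simp_all add: inner_diff_left inner_add_left)
      show "c * cos (u \<bullet> x + \<theta>) * (d * cos (v \<bullet> x + \<phi>)) =
        (c * d / 2) * cos ((u - v) \<bullet> x + (\<theta> - \<phi>)) + (c * d / 2) * cos ((u + v) \<bullet> x + (\<theta> + \<phi>))"
        unfolding 1 2 cos_diff cos_add by (simp add: field_simps)
    qed
    then show ?case by (simp only:) (intro trig_poly.intros)
  next
    case (add f g)
    then show ?case by (simp only: distrib_left) (intro trig_poly.add)
  qed
next
  case (add f h)
  then show ?case by (simp only: distrib_right) (intro trig_poly.add; blast)
qed

lemma trig_poly_sum: "finite A \<Longrightarrow> (\<And>a. a \<in> A \<Longrightarrow> trig_poly (f a)) \<Longrightarrow> trig_poly (\<lambda>x. \<Sum>a\<in>A. f a x)"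
  by (induction A rule: finite_induct) (auto simp: trig_poly_const intro: trig_poly.add)

text \<open>\<open>sine_box L\<close> is close to the identity on bounded sets when \<open>L\<close> is large, has bounded range, and
  turns polynomials into trigonometric polynomials.  So every bounded continuous function, composed
  with it, is globally a uniform limit of trigonometric polynomials.\<close>

definition sine_box :: "real \<Rightarrow> 'a::euclidean_space \<Rightarrow> 'a" where
  "sine_box L x = (\<Sum>b\<in>Basis. (L * sin ((x \<bullet> b) / L)) *\<^sub>R b)"

lemma continuous_on_sine_box: "L \<noteq> 0 \<Longrightarrow> continuous_on UNIV (sine_box L)"
  unfolding sine_box_def by (intro continuous_intros) auto

lemma norm_sine_box_le:
  assumes "L > 0"
  shows "norm (sine_box L x :: 'a::euclidean_space) \<le> real DIM('a) * L"
  unfolding sine_box_def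
proof (rule sum_norm_bound)
  fix b :: 'a assume "b \<in> Basis"
  then show "norm ((L * sin ((x \<bullet> b) / L)) *\<^sub>R b) \<le> L"
    using assms mult_left_mono[OF abs_sin_le_one, of L "(x \<bullet> b) / L"] by (simp add: abs_mult)
qed

lemma dist_sine_box_le:
  fixes x :: "'a::euclidean_space"
  assumes "L > 0"
  shows "norm (sine_box L x - x) \<le> real DIM('a) * ((norm x)\<^sup>2 / L)"
proof -
  have "norm (sine_box L x - x) = norm (\<Sum>b\<in>Basis. (L * sin ((x \<bullet> b) / L) - x \<bullet> b) *\<^sub>R b)"
    by (simp add: sine_box_def scaleR_diff_left sum_subtractf euclidean_representation)
  also have "\<dots> \<le> real DIM('a) * ((norm x)\<^sup>2 / L)"
  proof (rule sum_norm_bound)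
    fix b :: 'a assume b: "b \<in> Basis"
    let ?t = "(x \<bullet> b) / L"
    have "\<bar>sin ?t - ?t\<bar> \<le> ?t\<^sup>2"
      using Maclaurin_sin_bound[of ?t 2] by (simp add: numeral_2_eq_2 sin_coeff_def)
    then have "L * \<bar>sin ?t - ?t\<bar> \<le> L * ?t\<^sup>2" using assms by (intro mult_left_mono) auto
    also have "\<dots> = (x \<bullet> b)\<^sup>2 / L" using assms by (simp add: power2_eq_square)
    also have "\<dots> \<le> (norm x)\<^sup>2 / L"
      using assms Basis_le_norm[OF b, of x] by (intro divide_right_mono) (auto simp: abs_le_square_iff[symmetric])
    also have "L * \<bar>sin ?t - ?t\<bar> = \<bar>L * (sin ?t - ?t)\<bar>" using assms by (simp add: abs_mult)
    also have "L * (sin ?t - ?t) = L * sin ?t - x \<bullet> b" using assms by (simp add: right_diff_distrib)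
    finally show "norm ((L * sin ((x \<bullet> b) / L) - x \<bullet> b) *\<^sub>R b) \<le> (norm x)\<^sup>2 / L"
      using b by simp
  qed
  finally show ?thesis .
qed

lemma trig_poly_of_polynomial:
  fixes p :: "'a::euclidean_space \<Rightarrow> real"
  assumes "real_polynomial_function p"
  shows "trig_poly (\<lambda>x. p (sine_box L x))"
  using assms
proof (induction rule: real_polynomial_function.induct)
  case (linear f)
  then interpret bounded_linear f .
  have "(\<lambda>x. f (sine_box L x)) = (\<lambda>x. \<Sum>b\<in>Basis. (L * f b) * cos (((1 / L) *\<^sub>R b) \<bullet> x + (- pi / 2)))"
  proof
    fix x :: 'a
    have "cos (((1 / L) *\<^sub>R b) \<bullet> x + (- pi / 2)) = sin ((x \<bullet> b) / L)" for b
      by (simp add: inner_commute cos_diff[of _ "pi / 2", simplified])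
    then show "f (sine_box L x) = (\<Sum>b\<in>Basis. (L * f b) * cos (((1 / L) *\<^sub>R b) \<bullet> x + (- pi / 2)))"
      by (simp add: sine_box_def sum scaleR mult_ac)
  qed
  then show ?case by (simp only:) (intro trig_poly_sum trig_poly.wave finite_Basis)
qed (auto intro: trig_poly_const trig_poly.add trig_poly_mult)

lemma trig_poly_bounded_continuous:
  "trig_poly f \<Longrightarrow> continuous_on UNIV f \<and> (\<exists>B. \<forall>x. \<bar>f x\<bar> \<le> B)"
proof (induction rule: trig_poly.induct)
  case (wave c u \<theta>)
  have "\<bar>c * cos (u \<bullet> x + \<theta>)\<bar> \<le> \<bar>c\<bar>" for x
    by (simp add: abs_mult mult_left_le)
  then show ?case by (intro conjI continuous_intros) blast
next
  case (add f g)
  then obtain B C where "\<And>x. \<bar>f x\<bar> \<le> B" "\<And>x. \<bar>g x\<bar> \<le> C" by blast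
  then have "\<bar>f x + g x\<bar> \<le> B + C" for x by (meson abs_triangle_ineq add_mono order_trans)
  with add show ?case by (intro conjI continuous_intros) blast+
qed

lemma integrable_bounded_continuous:
  fixes f :: "'a::euclidean_space \<Rightarrow> real"
  assumes "prob_space M" "X \<in> borel_measurable M" "continuous_on UNIV f" "\<And>x. \<bar>f x\<bar> \<le> B"
  shows "integrable M (\<lambda>\<omega>. f (X \<omega>))"
proof -
  interpret prob_space M by fact
  have "f \<in> borel_measurable borel" using assms(3) by (rule borel_measurable_continuous_onI)
  then show ?thesis
    using assms(2,4) by (intro integrable_const_bound[of _ B] measurable_compose[OF assms(2)]) auto
qed

lemma abs_integral_diff_le:
  fixes f g h :: "'v \<Rightarrow> real"
  assumes "integrable N f" "integrable N g" "integrable N h"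
    "\<And>\<omega>. \<omega> \<in> space N \<Longrightarrow> \<bar>f \<omega> - g \<omega>\<bar> \<le> h \<omega>"
  shows "\<bar>(LINT \<omega>|N. f \<omega>) - (LINT \<omega>|N. g \<omega>)\<bar> \<le> (LINT \<omega>|N. h \<omega>)"
proof -
  have "(LINT \<omega>|N. f \<omega>) - (LINT \<omega>|N. g \<omega>) = (LINT \<omega>|N. f \<omega> - g \<omega>)" using assms by simp
  moreover have "\<bar>LINT \<omega>|N. f \<omega> - g \<omega>\<bar> \<le> (LINT \<omega>|N. \<bar>f \<omega> - g \<omega>\<bar>)" by (rule integral_abs_bound)
  moreover have "(LINT \<omega>|N. \<bar>f \<omega> - g \<omega>\<bar>) \<le> (LINT \<omega>|N. h \<omega>)"
    using assms by (intro integral_mono) auto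
  ultimately show ?thesis by linarith
qed

text \<open>The bounded second moments play the part of tightness: they limit the mass where \<open>sine_box L\<close> is
  far from the identity.\<close>

locale char_convergence =
  fixes M :: "nat \<Rightarrow> 'w measure" and X :: "nat \<Rightarrow> 'w \<Rightarrow> 'a::euclidean_space" and \<mu> :: "'a measure" and K :: real
  assumes prob: "\<And>n. prob_space (M n)" and meas [measurable]: "\<And>n. X n \<in> borel_measurable (M n)"
    and lim_prob: "prob_space \<mu>" and lim_sets [measurable_cong]: "sets \<mu> = sets borel"
    and char_conv: "\<And>u. (\<lambda>n. CLINT \<omega>|M n. iexp (u \<bullet> X n \<omega>)) \<longlonglongrightarrow> (CLINT z|\<mu>. iexp (u \<bullet> z))"
    and moment: "\<And>n. integrable (M n) (\<lambda>\<omega>. (norm (X n \<omega>))\<^sup>2)" "\<And>n. (LINT \<omega>|M n. (norm (X n \<omega>))\<^sup>2) \<le> K"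
    and lim_moment: "integrable \<mu> (\<lambda>z. (norm z)\<^sup>2)" "(LINT z|\<mu>. (norm z)\<^sup>2) \<le> K"
begin

lemma measurable_id_lim: "(\<lambda>z. z) \<in> borel_measurable \<mu>"
  by (simp add: measurable_ident_sets lim_sets)

lemma trig_poly_conv:
  assumes "trig_poly f"
  shows "(\<lambda>n. LINT \<omega>|M n. f (X n \<omega>)) \<longlonglongrightarrow> (LINT z|\<mu>. f z)"
  using assms
proof (induction rule: trig_poly.induct)
  case (wave c u \<theta>)
  have int: "(LINT \<omega>|N. c * cos (u \<bullet> Y \<omega> + \<theta>)) = Re ((of_real c * iexp \<theta>) * (CLINT \<omega>|N. iexp (u \<bullet> Y \<omega>)))"
    if N: "prob_space N" "Y \<in> borel_measurable N" for N :: "'v measure" and Y :: "'v \<Rightarrow> 'a"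
  proof -
    interpret N: prob_space N by fact
    have i: "integrable N (\<lambda>\<omega>. iexp (u \<bullet> Y \<omega>))"
      using N(2) by (intro N.integrable_iexp) auto
    have "(of_real c * iexp \<theta>) * (CLINT \<omega>|N. iexp (u \<bullet> Y \<omega>)) = (CLINT \<omega>|N. (of_real c * iexp \<theta>) * iexp (u \<bullet> Y \<omega>))"
      using i by simp
    also have "Re \<dots> = (LINT \<omega>|N. Re ((of_real c * iexp \<theta>) * iexp (u \<bullet> Y \<omega>)))"
      using i by (subst integral_Re) auto
    also have "\<dots> = (LINT \<omega>|N. c * cos (u \<bullet> Y \<omega> + \<theta>))"
    proof (rule Bochner_Integration.integral_cong[OF refl])
      fix \<omega>
      have "(of_real c * iexp \<theta>) * iexp (u \<bullet> Y \<omega>) = of_real c * iexp (u \<bullet> Y \<omega> + \<theta>)"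
        by (simp add: exp_add distrib_left)
      then show "Re ((of_real c * iexp \<theta>) * iexp (u \<bullet> Y \<omega>)) = c * cos (u \<bullet> Y \<omega> + \<theta>)"
        by (simp only:) (simp add: Re_exp)
    qed
    finally show ?thesis by simp
  qed
  show ?case
    unfolding int[OF prob meas] int[OF lim_prob measurable_id_lim]
    by (intro tendsto_intros char_conv)
next
  case (add f g)
  obtain B where B: "\<And>x. \<bar>f x\<bar> \<le> B" "continuous_on UNIV f" using trig_poly_bounded_continuous[OF add.hyps(1)] by blast
  obtain C where C: "\<And>x. \<bar>g x\<bar> \<le> C" "continuous_on UNIV g" using trig_poly_bounded_continuous[OF add.hyps(2)] by blast
  note i = integrable_bounded_continuous[OF prob meas B(2,1)] integrable_bounded_continuous[OF prob meas C(2,1)]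
    integrable_bounded_continuous[OF lim_prob measurable_id_lim B(2,1)] integrable_bounded_continuous[OF lim_prob measurable_id_lim C(2,1)]
  show ?case
    using tendsto_add[OF add.IH] i by simp
qed

lemma sine_box_conv:
  fixes f :: "'a \<Rightarrow> real"
  assumes f: "continuous_on UNIV f" "\<And>x. \<bar>f x\<bar> \<le> B" and L: "L > 0"
  shows "(\<lambda>n. LINT \<omega>|M n. f (sine_box L (X n \<omega>))) \<longlonglongrightarrow> (LINT z|\<mu>. f (sine_box L z))"
proof (rule tendstoI)
  fix e :: real assume e: "0 < e"
  let ?K = "cball (0::'a) (real DIM('a) * L)"
  obtain p where p: "real_polynomial_function p" "\<And>x. x \<in> ?K \<Longrightarrow> \<bar>f x - p x\<bar> < e / 3"
    using Stone_Weierstrass_real_polynomial_function[of ?K f "e / 3"] f(1) e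
    by (auto intro: continuous_on_subset)
  define g where "g x = p (sine_box L x)" for x
  define h where "h x = f (sine_box L x)" for x
  have g: "trig_poly g" unfolding g_def by (rule trig_poly_of_polynomial[OF p(1)])
  obtain C where C: "\<And>x. \<bar>g x\<bar> \<le> C" "continuous_on UNIV g" using trig_poly_bounded_continuous[OF g] by blast
  have h: "\<And>x. \<bar>h x\<bar> \<le> B" "continuous_on UNIV h"
    using f L unfolding h_def by (auto intro!: continuous_on_compose2[OF f(1)] continuous_on_sine_box)
  have close: "\<bar>h x - g x\<bar> \<le> e / 3" for x
    using p(2)[of "sine_box L x"] norm_sine_box_le[OF L, of x] by (simp add: g_def h_def less_imp_le)
  have bound: "\<bar>(LINT \<omega>|N. h (Y \<omega>)) - (LINT \<omega>|N. g (Y \<omega>))\<bar> \<le> e / 3"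
    if N: "prob_space N" "Y \<in> borel_measurable N" for N :: "'v measure" and Y :: "'v \<Rightarrow> 'a"
  proof -
    interpret N: prob_space N by fact
    have "\<bar>(LINT \<omega>|N. h (Y \<omega>)) - (LINT \<omega>|N. g (Y \<omega>))\<bar> \<le> (LINT \<omega>|N. e / 3)"
      using integrable_bounded_continuous[OF N h(2,1)] integrable_bounded_continuous[OF N C(2,1)] close
      by (intro abs_integral_diff_le) auto
    then show ?thesis by (simp add: N.prob_space)
  qed
  have "\<forall>\<^sub>F n in sequentially. dist (LINT \<omega>|M n. g (X n \<omega>)) (LINT z|\<mu>. g z) < e / 3"
    using trig_poly_conv[OF g] e by (intro tendstoD) auto
  then show "\<forall>\<^sub>F n in sequentially. dist (LINT \<omega>|M n. f (sine_box L (X n \<omega>))) (LINT z|\<mu>. f (sine_box L z)) < e"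
  proof eventually_elim
    case (elim n)
    then show ?case
      using bound[OF prob[of n] meas[of n]] bound[OF lim_prob measurable_id_lim]
      unfolding h_def[symmetric] dist_real_def by linarith
  qed
qed

text \<open>Replacing \<open>f\<close> by \<open>f \<circ> sine_box L\<close> costs little where the norm is moderate, by uniform continuity, and
  elsewhere at most \<open>2 B\<close>, which is weighed against the second moment.\<close>

theorem uniformly_continuous_conv:
  fixes f :: "'a \<Rightarrow> real"
  assumes f: "uniformly_continuous_on UNIV f" "\<And>x. \<bar>f x\<bar> \<le> B"
  shows "(\<lambda>n. LINT \<omega>|M n. f (X n \<omega>)) \<longlonglongrightarrow> (LINT z|\<mu>. f z)"
proof (rule tendstoI)
  fix e :: real assume e: "0 < e"
  have fc: "continuous_on UNIV f" using f(1) by (rule uniformly_continuous_imp_continuous)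
  have B: "B \<ge> 0" using f(2)[of 0] by linarith
  have K: "K \<ge> 0" using lim_moment(2) by (rule order_trans[rotated]) simp
  obtain d where d: "d > 0" "\<And>x y. norm (x - y) < d \<Longrightarrow> \<bar>f x - f y\<bar> < e / 6"
    using f(1) e unfolding uniformly_continuous_on_def dist_norm real_norm_def
    by (metis UNIV_I zero_less_divide_iff zero_less_numeral)
  \<comment> \<open>The threshold \<open>r\<^bsup>-1/2\<^esup>\<close> separates moderate from large norms; \<open>L\<close> is such that \<open>sine_box L\<close> moves
    points of moderate norm by less than \<open>d\<close>.\<close>
  define r where "r = e / (12 * ((B + 1) * (K + 1)))"
  have r: "r > 0" "2 * B * r * K \<le> e / 6"
  proof -
    show "r > 0" using e B K by (simp add: r_def)
    define D where "D = (B + 1) * (K + 1)"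
    have D: "D > 0" "B * K \<le> D" using B K unfolding D_def by (auto intro: mult_mono)
    have "2 * B * r * K = (e / 6) * (B * K / D)" using D(1) by (simp add: r_def D_def[symmetric] mult.assoc)
    also have "\<dots> \<le> (e / 6) * 1" using D e by (intro mult_left_mono) auto
    finally show "2 * B * r * K \<le> e / 6" by simp
  qed
  define L where "L = 2 * real DIM('a) / (r * d)"
  have L: "L > 0" using r d by (simp add: L_def)
  define h where "h x = f (sine_box L x)" for x
  have h: "\<And>x. \<bar>h x\<bar> \<le> B" "continuous_on UNIV h"
    using f fc L unfolding h_def by (auto intro!: continuous_on_compose2[OF fc] continuous_on_sine_box)
  have close: "\<bar>f x - h x\<bar> \<le> e / 6 + 2 * B * r * (norm x)\<^sup>2" for x
  proof (cases "r * (norm x)\<^sup>2 \<le> 1")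
    case True
    have "norm (x - sine_box L x) \<le> real DIM('a) * ((norm x)\<^sup>2 / L)"
      using dist_sine_box_le[OF L, of x] by (simp add: norm_minus_commute)
    also have "\<dots> = (r * (norm x)\<^sup>2) * d / 2" using r d by (simp add: L_def field_simps)
    also have "\<dots> \<le> 1 * d / 2" using True d(1) by (intro divide_right_mono mult_right_mono) auto
    also have "\<dots> < d" using d(1) by simp
    finally have "\<bar>f x - h x\<bar> < e / 6" unfolding h_def by (rule d(2))
    moreover have "0 \<le> 2 * B * r * (norm x)\<^sup>2" using B r(1) by simp
    ultimately show ?thesis by linarith
  next
    case False
    have "\<bar>f x - h x\<bar> \<le> 2 * B * 1" using f(2)[of x] h(1)[of x] by linarith
    also have "\<dots> \<le> 2 * B * (r * (norm x)\<^sup>2)" using False B by (intro mult_left_mono) auto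
    finally show ?thesis using e by (simp add: mult.assoc)
  qed
  have bound: "\<bar>(LINT \<omega>|N. f (Y \<omega>)) - (LINT \<omega>|N. h (Y \<omega>))\<bar> \<le> e / 3"
    if N: "prob_space N" "Y \<in> borel_measurable N" and m: "integrable N (\<lambda>\<omega>. (norm (Y \<omega>))\<^sup>2)"
      "(LINT \<omega>|N. (norm (Y \<omega>))\<^sup>2) \<le> K" for N :: "'v measure" and Y :: "'v \<Rightarrow> 'a"
  proof -
    interpret N: prob_space N by fact
    have "\<bar>(LINT \<omega>|N. f (Y \<omega>)) - (LINT \<omega>|N. h (Y \<omega>))\<bar> \<le> (LINT \<omega>|N. e / 6 + 2 * B * r * (norm (Y \<omega>))\<^sup>2)"
      using integrable_bounded_continuous[OF N fc f(2)] integrable_bounded_continuous[OF N h(2,1)] close m(1)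
      by (intro abs_integral_diff_le) auto
    also have "\<dots> = e / 6 + 2 * B * r * (LINT \<omega>|N. (norm (Y \<omega>))\<^sup>2)" using m(1) by (simp add: N.prob_space)
    also have "\<dots> \<le> e / 6 + 2 * B * r * K" using m(2) B r(1) by (intro add_left_mono mult_left_mono) auto
    finally show ?thesis using r(2) by simp
  qed
  have "\<forall>\<^sub>F n in sequentially. dist (LINT \<omega>|M n. h (X n \<omega>)) (LINT z|\<mu>. h z) < e / 3"
    unfolding h_def using sine_box_conv[OF fc f(2) L] e by (intro tendstoD) auto
  then show "\<forall>\<^sub>F n in sequentially. dist (LINT \<omega>|M n. f (X n \<omega>)) (LINT z|\<mu>. f z) < e"
  proof eventually_elim
    case (elim n)
    then show ?case
      using bound[OF prob[of n] meas[of n] moment] bound[OF lim_prob measurable_id_lim lim_moment]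
      unfolding dist_real_def by linarith
  qed
qed

text \<open>Continuous mapping and Slutsky in one: the remainder need only be small relative to \<open>X n\<close>,
  because the second moments keep \<open>X n\<close> bounded in probability.\<close>

theorem weak_conv_compose:
  fixes \<phi> :: "'a \<Rightarrow> real"
  assumes \<phi>: "\<And>x y. \<bar>\<phi> x - \<phi> y\<bar> \<le> C * norm (x - y)"
    and Y [measurable]: "\<And>n. Y n \<in> borel_measurable (M n)"
    and small: "\<And>e. e > 0 \<Longrightarrow>
      (\<lambda>n. measure (M n) {\<omega>\<in>space (M n). \<bar>Y n \<omega> - \<phi> (X n \<omega>)\<bar> > e * norm (X n \<omega>)}) \<longlonglongrightarrow> 0"
  shows "weak_conv_m (\<lambda>n. distr (M n) borel (Y n)) (distr \<mu> borel \<phi>)"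
proof -
  have uc: "uniformly_continuous_on UNIV \<phi>"
    unfolding uniformly_continuous_on_def
  proof (intro allI impI)
    fix e :: real assume "0 < e"
    then show "\<exists>d>0. \<forall>x\<in>UNIV. \<forall>x'\<in>UNIV. dist x' x < d \<longrightarrow> dist (\<phi> x') (\<phi> x) < e"
    proof (intro exI[of _ "e / (\<bar>C\<bar> + 1)"] conjI ballI impI)
      fix x x' :: 'a assume "dist x' x < e / (\<bar>C\<bar> + 1)"
      then have "(\<bar>C\<bar> + 1) * norm (x' - x) < e" by (simp add: dist_norm field_simps)
      moreover have "C * norm (x' - x) \<le> (\<bar>C\<bar> + 1) * norm (x' - x)" by (intro mult_right_mono) auto
      ultimately show "dist (\<phi> x') (\<phi> x) < e" using \<phi>[of x' x] by (simp add: dist_real_def)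
    qed auto
  qed
  have \<phi>m [measurable]: "\<phi> \<in> borel_measurable borel"
    using uniformly_continuous_imp_continuous[OF uc] by (rule borel_measurable_continuous_onI)
  have \<phi>\<mu> [measurable]: "\<phi> \<in> borel_measurable \<mu>"
    using \<phi>m measurable_cong_sets[OF lim_sets refl] by blast
  have K: "K \<ge> 0" using lim_moment(2) by (rule order_trans[rotated]) simp
  show ?thesis
  proof (rule integral_cts_step_conv_imp_weak_conv)
    show "real_distribution (distr (M n) borel (Y n))" for n
      using prob_space.real_distribution_distr[OF prob Y] .
    show "real_distribution (distr \<mu> borel \<phi>)"
      using prob_space.real_distribution_distr[OF lim_prob \<phi>\<mu>] .
    fix a b :: real assume ab: "a < b"
    let ?s = "cts_step a b"
    have suc: "uniformly_continuous_on UNIV ?s" using ab by (rule cts_step_uniformly_continuous)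
    have s01: "0 \<le> ?s x" "?s x \<le> 1" for x using ab by (auto simp: cts_step_def)
    have [measurable]: "?s \<in> borel_measurable borel"
      using uniformly_continuous_imp_continuous[OF suc] by (rule borel_measurable_continuous_onI)
    have A: "(\<lambda>n. LINT \<omega>|M n. ?s (\<phi> (X n \<omega>))) \<longlonglongrightarrow> (LINT z|\<mu>. ?s (\<phi> z))"
    proof (rule uniformly_continuous_conv)
      show "uniformly_continuous_on UNIV (\<lambda>x. ?s (\<phi> x))"
      proof -
        have "uniformly_continuous_on (range \<phi>) ?s"
          using suc unfolding uniformly_continuous_on_def by blast
        from uniformly_continuous_on_compose[OF uc this] show ?thesis by (simp add: comp_def)
      qed
      show "\<bar>?s (\<phi> x)\<bar> \<le> 1" for x using s01[of "\<phi> x"] by simp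
    qed
    have B: "(\<lambda>n. (LINT \<omega>|M n. ?s (Y n \<omega>)) - (LINT \<omega>|M n. ?s (\<phi> (X n \<omega>)))) \<longlonglongrightarrow> 0"
    proof (rule tendstoI)
      fix e :: real assume e: "0 < e"
      obtain d where d: "d > 0" "\<And>x y. \<bar>x - y\<bar> < d \<Longrightarrow> \<bar>?s x - ?s y\<bar> < e / 3"
        using suc e unfolding uniformly_continuous_on_def dist_real_def
        by (metis UNIV_I zero_less_divide_iff zero_less_numeral)
      \<comment> \<open>By Chebyshev, \<open>q \<bar>X n\<bar> \<ge> d\<close> has probability at most \<open>q\<^sup>2 K / d\<^sup>2 \<le> e / 3\<close>.\<close>
      define q where "q = sqrt (e / (3 * (K + 1))) * d"
      have q: "q > 0" using e d K by (simp add: q_def)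
      have qK: "q\<^sup>2 * K / d\<^sup>2 \<le> e / 3"
      proof -
        have "q\<^sup>2 = e / (3 * (K + 1)) * d\<^sup>2" using e K by (simp add: q_def power_mult_distrib)
        then have "q\<^sup>2 * K / d\<^sup>2 = e * K / (3 * (K + 1))" using d(1) by simp
        also have "\<dots> \<le> e / 3" using e K by (simp add: field_simps)
        finally show ?thesis .
      qed
      let ?A = "\<lambda>n. {\<omega>\<in>space (M n). \<bar>Y n \<omega> - \<phi> (X n \<omega>)\<bar> > q * norm (X n \<omega>)}"
      have "\<forall>\<^sub>F n in sequentially. measure (M n) (?A n) < e / 3"
        using small[OF q] e by (intro order_tendstoD) auto
      then show "\<forall>\<^sub>F n in sequentially. dist ((LINT \<omega>|M n. ?s (Y n \<omega>)) - (LINT \<omega>|M n. ?s (\<phi> (X n \<omega>)))) 0 < e"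
      proof eventually_elim
        case (elim n)
        interpret N: prob_space "M n" by (rule prob)
        have int: "integrable (M n) (\<lambda>\<omega>. ?s (Z \<omega>))" if [measurable]: "Z \<in> borel_measurable (M n)" for Z
          using s01 by (intro N.integrable_const_bound[of _ 1]) auto
        have "\<bar>(LINT \<omega>|M n. ?s (Y n \<omega>)) - (LINT \<omega>|M n. ?s (\<phi> (X n \<omega>)))\<bar> \<le>
          (LINT \<omega>|M n. (e / 3 + (q\<^sup>2 / d\<^sup>2) * (norm (X n \<omega>))\<^sup>2) + indicator (?A n) \<omega>)"
        proof -
          have I: "integrable (M n) (indicator (?A n) :: _ \<Rightarrow> real)" by (intro N.integrable_const_bound[of _ 1]) auto
          have "\<bar>?s (Y n \<omega>) - ?s (\<phi> (X n \<omega>))\<bar> \<le> (e / 3 + (q\<^sup>2 / d\<^sup>2) * (norm (X n \<omega>))\<^sup>2) + indicator (?A n) \<omega>"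
            if \<omega>: "\<omega> \<in> space (M n)" for \<omega>
          proof -
            have le1: "\<bar>?s (Y n \<omega>) - ?s (\<phi> (X n \<omega>))\<bar> \<le> 1" using s01[of "Y n \<omega>"] s01[of "\<phi> (X n \<omega>)"] by linarith
            have nn: "0 \<le> (q\<^sup>2 / d\<^sup>2) * (norm (X n \<omega>))\<^sup>2" by simp
            consider "\<omega> \<in> ?A n" | "\<omega> \<notin> ?A n" "q * norm (X n \<omega>) < d" | "q * norm (X n \<omega>) \<ge> d" by linarith
            then show ?thesis
            proof cases
              case 1
              then have "indicator (?A n) \<omega> = (1::real)" by simp
              then show ?thesis using le1 nn e by linarith
            next
              case 2
              then have "\<bar>Y n \<omega> - \<phi> (X n \<omega>)\<bar> < d" using \<omega> by auto
              then have "\<bar>?s (Y n \<omega>) - ?s (\<phi> (X n \<omega>))\<bar> < e / 3" by (rule d(2))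
              moreover have "indicator (?A n) \<omega> = (0::real)" using 2 by simp
              ultimately show ?thesis using nn by linarith
            next
              case 3
              then have "d\<^sup>2 \<le> (q * norm (X n \<omega>))\<^sup>2" using d(1) by (intro power_mono) auto
              then have "1 \<le> (q\<^sup>2 / d\<^sup>2) * (norm (X n \<omega>))\<^sup>2" using d(1) by (simp add: field_simps)
              then show ?thesis using le1 e by (simp split: split_indicator)
            qed
          qed
          then show ?thesis
            using int[OF Y] int[of "\<lambda>\<omega>. \<phi> (X n \<omega>)"] moment(1)[of n] I
            by (intro abs_integral_diff_le Bochner_Integration.integrable_add) auto
        qed
        also have "\<dots> = e / 3 + (q\<^sup>2 / d\<^sup>2) * (LINT \<omega>|M n. (norm (X n \<omega>))\<^sup>2) + measure (M n) (?A n)"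
        proof -
          have I: "integrable (M n) (indicator (?A n) :: _ \<Rightarrow> real)" by (intro N.integrable_const_bound[of _ 1]) auto
          then show ?thesis using moment(1)[of n] by (simp add: N.prob_space Int_absorb2)
        qed
        also have "\<dots> \<le> e / 3 + (q\<^sup>2 / d\<^sup>2) * K + measure (M n) (?A n)"
          using moment(2)[of n] by (intro add_mono mult_left_mono) auto
        also have "(q\<^sup>2 / d\<^sup>2) * K = q\<^sup>2 * K / d\<^sup>2" by simp
        also have "e / 3 + q\<^sup>2 * K / d\<^sup>2 + measure (M n) (?A n) < e" using qK elim by linarith
        finally show ?case by simp
      qed
    qed
    have "(\<lambda>n. LINT \<omega>|M n. ?s (Y n \<omega>)) \<longlonglongrightarrow> (LINT z|\<mu>. ?s (\<phi> z))"
      using tendsto_add[OF A B] by simp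
    then show "(\<lambda>n. integral\<^sup>L (distr (M n) borel (Y n)) ?s) \<longlonglongrightarrow> integral\<^sup>L (distr \<mu> borel \<phi>) ?s"
      by (simp add: integral_distr)
  qed
qed

end

section \<open>Gaussian laws\<close>

subsection \<open>Orthogonal projection\<close>

lemma orth_proj:
  fixes M :: "'a::euclidean_space set"
  assumes M: "subspace M"
  shows "orth_proj M x \<in> M" "z \<in> M \<Longrightarrow> (x - orth_proj M x) \<bullet> z = 0"
proof -
  obtain y w where y: "y \<in> span M" "\<And>z. z \<in> span M \<Longrightarrow> orthogonal w z" "x = y + w"
    using orthogonal_subspace_decomp_exists[of M x] by blast
  have sM: "span M = M" using M by (simp add: span_eq_iff)
  have "\<exists>!y. y \<in> M \<and> (\<forall>z\<in>M. orthogonal (x - y) z)"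
  proof (rule ex1I[of _ y])
    show "y \<in> M \<and> (\<forall>z\<in>M. orthogonal (x - y) z)" using y sM by simp
    fix y' assume y': "y' \<in> M \<and> (\<forall>z\<in>M. orthogonal (x - y') z)"
    have "y - y' \<in> M" using y(1) y' M sM by (simp add: subspace_diff)
    then have "(x - y') \<bullet> (y - y') = 0" "(x - y) \<bullet> (y - y') = 0"
      using y' y sM by (auto simp: orthogonal_def)
    then have "(y - y') \<bullet> (y - y') = 0" by (simp add: inner_diff_left)
    then show "y' = y" by simp
  qed
  from theI'[OF this] show "orth_proj M x \<in> M" "z \<in> M \<Longrightarrow> (x - orth_proj M x) \<bullet> z = 0"
    by (auto simp: orth_proj_def orthogonal_def)
qed

lemma orth_proj_unique:
  assumes M: "subspace M" and y: "y \<in> M" "\<And>z. z \<in> M \<Longrightarrow> (x - y) \<bullet> z = 0"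
  shows "orth_proj M x = y"
proof -
  let ?p = "orth_proj M x"
  have "?p - y \<in> M" using orth_proj(1)[OF M] y(1) M by (simp add: subspace_diff)
  then have "(x - ?p) \<bullet> (?p - y) = 0" "(x - y) \<bullet> (?p - y) = 0"
    using orth_proj(2)[OF M] y(2) by auto
  then have "(?p - y) \<bullet> (?p - y) = 0" by (simp add: inner_diff_left)
  then show ?thesis by simp
qed

lemma inner_orth_proj: "subspace M \<Longrightarrow> z \<in> M \<Longrightarrow> orth_proj M x \<bullet> z = x \<bullet> z"
  using orth_proj(2)[of M z x] by (simp add: inner_diff_left)

lemma orth_proj_self: "subspace M \<Longrightarrow> x \<in> M \<Longrightarrow> orth_proj M x = x"
  by (rule orth_proj_unique) auto

lemma linear_orth_proj: "subspace M \<Longrightarrow> linear (orth_proj M)"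
  by (intro linearI orth_proj_unique subspace_add subspace_scale orth_proj)
     (auto simp: inner_add_left inner_diff_left inner_orth_proj algebra_simps)

lemma norm_orth_proj_le: "subspace M \<Longrightarrow> norm (orth_proj M x) \<le> norm x"
proof -
  assume M: "subspace M"
  have "(norm (orth_proj M x))\<^sup>2 = x \<bullet> orth_proj M x"
    using inner_orth_proj[OF M orth_proj(1)[OF M], of x x] by (simp add: power2_norm_eq_inner)
  also have "\<dots> \<le> norm x * norm (orth_proj M x)" by (rule norm_cauchy_schwarz)
  finally show ?thesis by (cases "norm (orth_proj M x) = 0") (auto simp: power2_eq_square)
qed

subsection \<open>One-dimensional normal laws\<close>

lemma centred_normal_eq_distr:
  assumes "0 \<le> \<sigma>"
  shows "centred_normal \<sigma> = distr std_normal_distribution borel (\<lambda>x. \<sigma> * x)"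
proof (cases "\<sigma> = 0")
  case True
  interpret real_distribution std_normal_distribution by (rule real_dist_normal_dist)
  show ?thesis using True by (simp add: centred_normal_def)
next
  case False
  interpret real_distribution std_normal_distribution by (rule real_dist_normal_dist)
  have "distr std_normal_distribution lborel (\<lambda>x. x) = std_normal_distribution"
    by (rule distr_id2) simp
  then have "distributed std_normal_distribution lborel (\<lambda>x. x) (normal_density 0 1)"
    by (simp add: distributed_def)
  from normal_density_affine[OF this, of \<sigma> 0] False assms
  have "distr std_normal_distribution lborel (\<lambda>x. \<sigma> * x) = density lborel (normal_density 0 \<sigma>)"
    by (simp add: distributed_def)
  moreover have "distr std_normal_distribution lborel (\<lambda>x. \<sigma> * x) = distr std_normal_distribution borel (\<lambda>x. \<sigma> * x)"
    by (rule distr_cong) simp_all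
  ultimately show ?thesis using False by (simp add: centred_normal_def)
qed

lemma char_centred_normal:
  assumes "0 \<le> \<sigma>"
  shows "char (centred_normal \<sigma>) t = exp (- (\<sigma>\<^sup>2 * t\<^sup>2) / 2)"
proof -
  have "char (centred_normal \<sigma>) t = char std_normal_distribution (t * \<sigma>)"
    unfolding centred_normal_eq_distr[OF assms] char_def
    by (subst integral_distr) (auto simp: mult_ac)
  also have "\<dots> = exp (- (\<sigma>\<^sup>2 * t\<^sup>2) / 2)"
    by (simp add: char_std_normal_distribution power_mult_distrib mult.commute)
  finally show ?thesis .
qed

lemma real_distribution_centred_normal: "0 \<le> \<sigma> \<Longrightarrow> real_distribution (centred_normal \<sigma>)"
  unfolding centred_normal_eq_distr
  by (intro prob_space.real_distribution_distr real_distribution.axioms(1)[OF real_dist_normal_dist]) simp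

lemma second_moment_centred_normal:
  assumes "0 \<le> \<sigma>"
  shows "integrable (centred_normal \<sigma>) (\<lambda>x. x\<^sup>2)" "(LINT x|centred_normal \<sigma>. x\<^sup>2) = \<sigma>\<^sup>2"
proof -
  have 1: "integrable std_normal_distribution (\<lambda>x. x\<^sup>2)" by (rule integrable_std_normal_distribution_moment)
  have 2: "(LINT x|std_normal_distribution. x\<^sup>2) = 1"
    using std_normal_distribution_even_moments[of 1] by simp
  show "integrable (centred_normal \<sigma>) (\<lambda>x. x\<^sup>2)"
    unfolding centred_normal_eq_distr[OF assms]
    by (subst integrable_distr_eq) (use 1 in \<open>auto simp: power_mult_distrib\<close>)
  show "(LINT x|centred_normal \<sigma>. x\<^sup>2) = \<sigma>\<^sup>2"
    unfolding centred_normal_eq_distr[OF assms]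
    by (subst integral_distr) (use 1 2 in \<open>auto simp: power_mult_distrib\<close>)
qed

subsection \<open>Gaussian laws on a subspace\<close>

context
  fixes M :: "'a::euclidean_space set" and C :: "'a \<Rightarrow> 'a" and \<mu> :: "'a measure"
  assumes M: "subspace M" and gauss: "centred_gaussian M C \<mu>"
begin

lemma gaussian_prob: "prob_space \<mu>" and gaussian_sets: "sets \<mu> = sets borel"
  and gaussian_AE: "AE z in \<mu>. z \<in> M"
  using gauss by (auto simp: centred_gaussian_def)

lemma gaussian_measurable: "f \<in> borel_measurable borel \<Longrightarrow> f \<in> borel_measurable \<mu>"
  using gaussian_sets measurable_cong_sets by blast

lemma gaussian_inner_moment:
  assumes u: "u \<in> M"
  shows "integrable \<mu> (\<lambda>z. (z \<bullet> u)\<^sup>2)" "(LINT z|\<mu>. (z \<bullet> u)\<^sup>2) = u \<bullet> C u"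
    "(CLINT z|\<mu>. iexp (t * (z \<bullet> u))) = exp (- (t\<^sup>2 * (u \<bullet> C u)) / 2)"
proof -
  have m [measurable]: "(\<lambda>z. z \<bullet> u) \<in> borel_measurable \<mu>" by (intro gaussian_measurable) simp
  obtain \<sigma> where s: "\<sigma> \<ge> 0" "distr \<mu> borel (\<lambda>z. z \<bullet> u) = centred_normal \<sigma>"
    using gauss u by (auto simp: centred_gaussian_def)
  show "integrable \<mu> (\<lambda>z. (z \<bullet> u)\<^sup>2)"
    using second_moment_centred_normal(1)[OF s(1)] unfolding s(2)[symmetric]
    by (subst (asm) integrable_distr_eq) auto
  show *: "(LINT z|\<mu>. (z \<bullet> u)\<^sup>2) = u \<bullet> C u"
    using gauss u by (simp add: centred_gaussian_def power2_eq_square)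
  have "\<sigma>\<^sup>2 = u \<bullet> C u"
    using second_moment_centred_normal(2)[OF s(1)] unfolding s(2)[symmetric]
    by (subst (asm) integral_distr) (auto simp: *)
  moreover have "(CLINT z|\<mu>. iexp (t * (z \<bullet> u))) = char (centred_normal \<sigma>) t"
    unfolding s(2)[symmetric] char_def by (subst integral_distr) auto
  ultimately show "(CLINT z|\<mu>. iexp (t * (z \<bullet> u))) = exp (- (t\<^sup>2 * (u \<bullet> C u)) / 2)"
    by (simp add: char_centred_normal[OF s(1)] mult.commute)
qed

lemma gaussian_char:
  "(CLINT z|\<mu>. iexp (u \<bullet> z)) = exp (- (orth_proj M u \<bullet> C (orth_proj M u)) / 2)"
proof -
  let ?u = "orth_proj M u"
  have "(CLINT z|\<mu>. iexp (u \<bullet> z)) = (CLINT z|\<mu>. iexp (1 * (z \<bullet> ?u)))"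
  proof (rule integral_cong_AE)
    show "AE z in \<mu>. iexp (u \<bullet> z) = iexp (1 * (z \<bullet> ?u))"
      using gaussian_AE
    proof eventually_elim
      case (elim z)
      have "u \<bullet> z = z \<bullet> ?u" using inner_orth_proj[OF M elim, of u] by (simp add: inner_commute)
      then show ?case by simp
    qed
  qed (intro gaussian_measurable; simp)+
  then show ?thesis using gaussian_inner_moment(3)[OF orth_proj(1)[OF M], of 1] by simp
qed

lemma gaussian_norm_moment:
  "integrable \<mu> (\<lambda>z. (norm z)\<^sup>2)"
  "(LINT z|\<mu>. (norm z)\<^sup>2) = (\<Sum>b\<in>Basis. orth_proj M b \<bullet> C (orth_proj M b))"
proof -
  note p = orth_proj(1)[OF M]
  have eq: "AE z in \<mu>. (norm z)\<^sup>2 = (\<Sum>b\<in>Basis. (z \<bullet> orth_proj M b)\<^sup>2)"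
    using gaussian_AE
  proof eventually_elim
    case (elim z)
    have "z \<bullet> b = z \<bullet> orth_proj M b" for b
      using inner_orth_proj[OF M elim, of b] by (simp add: inner_commute)
    then show ?case
      unfolding power2_norm_eq_inner by (subst euclidean_inner) (simp add: power2_eq_square)
  qed
  have i: "integrable \<mu> (\<lambda>z. \<Sum>b\<in>Basis. (z \<bullet> orth_proj M b)\<^sup>2)"
    using gaussian_inner_moment(1)[OF p] by auto
  have m: "(\<lambda>z. (norm z)\<^sup>2) \<in> borel_measurable \<mu>"
    "(\<lambda>z. \<Sum>b\<in>Basis. (z \<bullet> orth_proj M b)\<^sup>2) \<in> borel_measurable \<mu>"
    by (intro gaussian_measurable; simp)+
  show "integrable \<mu> (\<lambda>z. (norm z)\<^sup>2)" using i integrable_cong_AE[OF m eq] by blast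
  show "(LINT z|\<mu>. (norm z)\<^sup>2) = (\<Sum>b\<in>Basis. orth_proj M b \<bullet> C (orth_proj M b))"
    unfolding integral_cong_AE[OF m eq]
    using gaussian_inner_moment[OF p] by (simp add: Bochner_Integration.integral_sum)
qed

end

text \<open>The indicator of an open set is the limit of the Lipschitz functions \<open>min 1 (k d)\<close>, where \<open>d\<close> is the
  distance to the complement.\<close>

lemma measure_eqI_uniformly_continuous:
  fixes \<mu> \<nu> :: "'a::euclidean_space measure"
  assumes "prob_space \<mu>" "prob_space \<nu>" and sets: "sets \<mu> = sets borel" "sets \<nu> = sets borel"
    and eq: "\<And>f B. uniformly_continuous_on UNIV f \<Longrightarrow> (\<And>x. \<bar>f x\<bar> \<le> B) \<Longrightarrow>
      (LINT z|\<mu>. f z) = (LINT z|\<nu>. (f z :: real))"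
  shows "\<mu> = \<nu>"
proof -
  interpret \<mu>: prob_space \<mu> by fact
  interpret \<nu>: prob_space \<nu> by fact
  have conv: "(\<lambda>k. LINT z|N. min 1 (real k * infdist z (- U))) \<longlonglongrightarrow> measure N U"
    if N: "prob_space N" "sets N = sets borel" and U: "open U" "U \<noteq> UNIV" for N :: "'a measure" and U
  proof -
    interpret prob_space N by fact
    have [measurable_cong]: "sets N = sets borel" by fact
    have "(\<lambda>k. LINT z|N. min 1 (real k * infdist z (- U))) \<longlonglongrightarrow> (LINT z|N. indicator U z)"
    proof (rule integral_dominated_convergence[where w = "\<lambda>_. 1"])
      show "AE z in N. (\<lambda>k. min 1 (real k * infdist z (- U))) \<longlonglongrightarrow> indicator U z"
      proof (rule AE_I2)
        fix z
        show "(\<lambda>k. min 1 (real k * infdist z (- U))) \<longlonglongrightarrow> indicator U z"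
        proof (cases "z \<in> U")
          case True
          then have pos: "infdist z (- U) > 0"
            using U by (intro infdist_pos_not_in_closed) auto
          obtain k0 :: nat where "1 / infdist z (- U) \<le> real k0" using real_arch_simple by blast
          then have "1 \<le> real k * infdist z (- U)" if "k \<ge> k0" for k
            using that pos by (simp add: divide_le_eq) (meson mult_right_mono of_nat_le_iff order_trans less_imp_le)
          then have "\<forall>\<^sub>F k in sequentially. min 1 (real k * infdist z (- U)) = 1"
            by (auto simp: eventually_sequentially min_def)
          then show ?thesis using True by (simp add: tendsto_eventually)
        qed (simp)
      qed
      show "indicator U \<in> borel_measurable N"
        using U N(2) by (intro borel_measurable_indicator) simp
      have "(\<lambda>z. min 1 (real k * infdist z (- U))) \<in> borel_measurable borel" for k
        by (intro borel_measurable_continuous_onI continuous_intros)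
      then show "(\<lambda>z. min 1 (real k * infdist z (- U))) \<in> borel_measurable N" for k
        using measurable_cong_sets[OF N(2) refl] by blast
    qed (auto simp: infdist_nonneg)
    then show ?thesis using U N by simp
  qed
  have open_eq: "emeasure \<mu> U = emeasure \<nu> U" if U: "open U" for U
  proof (cases "U = UNIV")
    case True
    then show ?thesis
      using \<mu>.emeasure_space_1 \<nu>.emeasure_space_1 sets by (metis sets_eq_imp_space_eq space_borel)
  next
    case False
    have "(LINT z|\<mu>. min 1 (real k * infdist z (- U))) = (LINT z|\<nu>. min 1 (real k * infdist z (- U)))" for k
    proof (rule eq)
      show "uniformly_continuous_on UNIV (\<lambda>z. min 1 (real k * infdist z (- U)))"
        unfolding uniformly_continuous_on_def
      proof (intro allI impI)
        fix e :: real assume e: "0 < e"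
        show "\<exists>d>0. \<forall>x\<in>UNIV. \<forall>x'\<in>UNIV. dist x' x < d \<longrightarrow>
            dist (min 1 (real k * infdist x' (- U))) (min 1 (real k * infdist x (- U))) < e"
        proof (intro exI[of _ "e / (real k + 1)"] conjI ballI impI)
          fix x x' :: 'a assume d: "dist x' x < e / (real k + 1)"
          have "\<bar>infdist x' (- U) - infdist x (- U)\<bar> \<le> dist x' x"
            using infdist_triangle[of x' "- U" x] infdist_triangle[of x "- U" x'] by (simp add: dist_commute abs_le_iff)
          then have "real k * \<bar>infdist x' (- U) - infdist x (- U)\<bar> \<le> real k * dist x' x" by (rule mult_left_mono) simp
          also have "\<dots> \<le> (real k + 1) * dist x' x" by (intro mult_right_mono) auto
          also have "\<dots> < e" using d by (simp add: field_simps)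
          finally have "\<bar>real k * infdist x' (- U) - real k * infdist x (- U)\<bar> < e"
            by (simp add: abs_mult flip: right_diff_distrib)
          then show "dist (min 1 (real k * infdist x' (- U))) (min 1 (real k * infdist x (- U))) < e"
            unfolding dist_real_def by linarith
        qed (use e in auto)
      qed
      show "\<bar>min 1 (real k * infdist x (- U))\<bar> \<le> 1" for x by (simp add: infdist_nonneg)
    qed
    with conv[OF \<open>prob_space \<mu>\<close> sets(1) U False] conv[OF \<open>prob_space \<nu>\<close> sets(2) U False]
    have "measure \<mu> U = measure \<nu> U" by (simp add: LIMSEQ_unique)
    then show ?thesis by (simp add: \<mu>.emeasure_eq_measure \<nu>.emeasure_eq_measure)
  qed
  show ?thesis
  proof (rule measure_eqI_generator_eq[where A = "\<lambda>_. UNIV" and \<Omega> = UNIV and E = "{S. open S}"])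
    show "Int_stable {S :: 'a set. open S}" by (auto simp: Int_stable_def)
    show "sets \<mu> = sigma_sets UNIV {S. open S}" "sets \<nu> = sigma_sets UNIV {S. open S}"
      using sets by (simp_all add: borel_def)
  qed (use open_eq in auto)
qed

text \<open>A constant sequence of laws converges to every law with the same characteristic function.\<close>

lemma centred_gaussian_unique:
  fixes \<mu> \<nu> :: "'a::euclidean_space measure"
  assumes M: "subspace M" and \<mu>: "centred_gaussian M C \<mu>" and \<nu>: "centred_gaussian M C \<nu>"
  shows "\<mu> = \<nu>"
proof (rule measure_eqI_uniformly_continuous)
  fix f :: "'a \<Rightarrow> real" and B assume f: "uniformly_continuous_on UNIV f" "\<And>x. \<bar>f x\<bar> \<le> B"
  interpret char_convergence "\<lambda>_. \<mu>" "\<lambda>_ z. z" \<nu> "\<Sum>b\<in>Basis. orth_proj M b \<bullet> C (orth_proj M b)"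
    by (rule char_convergence.intro)
       (simp_all add: gaussian_prob[OF M \<mu>] gaussian_prob[OF M \<nu>] gaussian_sets[OF M \<nu>]
          gaussian_char[OF M \<mu>] gaussian_char[OF M \<nu>] gaussian_measurable[OF M \<mu>]
          gaussian_norm_moment[OF M \<mu>] gaussian_norm_moment[OF M \<nu>])
  have "(\<lambda>n::nat. LINT z|\<mu>. f z) \<longlonglongrightarrow> (LINT z|\<nu>. f z)" by (rule uniformly_continuous_conv[OF f])
  then show "(LINT z|\<mu>. f z) = (LINT z|\<nu>. f z)" by (simp add: LIMSEQ_const_iff)
qed (use gaussian_prob[OF M] gaussian_sets[OF M] \<mu> \<nu> in auto)

text \<open>A law with a given covariance is a linear image of independent standard normals, one for each
  eigenvector of the covariance.\<close>

lemma centred_gaussian_exists: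
  fixes R :: "'a::euclidean_space \<Rightarrow> 'a"
  assumes M: "subspace M" and R: "linear R" "\<And>x. x \<in> M \<Longrightarrow> R x \<in> M"
    and sa: "\<And>x y. x \<in> M \<Longrightarrow> y \<in> M \<Longrightarrow> R x \<bullet> y = x \<bullet> R y" and nonneg: "\<And>x. x \<in> M \<Longrightarrow> 0 \<le> x \<bullet> R x"
    and C: "\<And>x. x \<in> M \<Longrightarrow> C x = R x"
  shows "\<exists>\<mu>. centred_gaussian M C \<mu>"
proof -
  obtain B l where B: "B \<subseteq> M" "finite B" "pairwise orthogonal B" "\<And>b. b \<in> B \<Longrightarrow> norm b = 1" "span B = M"
    "\<And>b. b \<in> B \<Longrightarrow> R b = l b *\<^sub>R b"
    using selfadjoint_spectral[OF M R(1,2) sa] by blast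
  have l: "0 \<le> l b" if "b \<in> B" for b
    using nonneg[of b] B(1,4,6) that by (auto simp: norm_eq_1)
  have expand: "(\<Sum>b\<in>B. (u \<bullet> b) *\<^sub>R b) = u" if "u \<in> M" for u
    using orthonormal_basis_expand[OF B(3,4) _ B(2), of u] that B(5) by simp
  have form: "u \<bullet> R u = (\<Sum>b\<in>B. l b * (b \<bullet> u)\<^sup>2)" if "u \<in> M" for u
  proof -
    have "R u = R (\<Sum>b\<in>B. (u \<bullet> b) *\<^sub>R b)" by (simp add: expand[OF that])
    also have "\<dots> = (\<Sum>b\<in>B. (u \<bullet> b) *\<^sub>R l b *\<^sub>R b)"
      unfolding linear_sum[OF R(1)] by (intro sum.cong) (auto simp: linear_cmul[OF R(1)] B(6))
    finally show ?thesis
      by (simp add: inner_sum_right power2_eq_square inner_commute mult_ac)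
  qed
  let ?G = "\<Pi>\<^sub>M b\<in>B. std_normal_distribution"
  interpret N: real_distribution std_normal_distribution by (rule real_dist_normal_dist)
  interpret product_sigma_finite "\<lambda>_::'a. std_normal_distribution" by unfold_locales
  interpret G: prob_space ?G by (intro prob_space_PiM) (simp add: N.prob_space_axioms)
  define Z where "Z g = (\<Sum>b\<in>B. (sqrt (l b) * g b) *\<^sub>R b)" for g
  have Zm [measurable]: "Z \<in> borel_measurable ?G" unfolding Z_def[abs_def] by measurable
  define \<mu> where "\<mu> = distr ?G borel Z"
  interpret \<mu>: prob_space \<mu> unfolding \<mu>_def by (rule G.prob_space_distr) simp
  have sets_\<mu> [measurable_cong]: "sets \<mu> = sets borel" by (simp add: \<mu>_def)
  have normal: "distr \<mu> borel (\<lambda>z. z \<bullet> u) = centred_normal (sqrt (u \<bullet> R u))" if u: "u \<in> M" for u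
  proof (rule Levy_uniqueness)
    show "real_distribution (distr \<mu> borel (\<lambda>z. z \<bullet> u))" by simp
    have nn: "0 \<le> u \<bullet> R u" by (rule nonneg[OF u])
    then show "real_distribution (centred_normal (sqrt (u \<bullet> R u)))" by (intro real_distribution_centred_normal) simp
    show "char (distr \<mu> borel (\<lambda>z. z \<bullet> u)) = char (centred_normal (sqrt (u \<bullet> R u)))"
    proof
      fix t
      have "char (distr \<mu> borel (\<lambda>z. z \<bullet> u)) t = (CLINT g|?G. iexp (t * (Z g \<bullet> u)))"
        unfolding char_def \<mu>_def by (subst integral_distr, simp, simp, subst integral_distr) auto
      also have "\<dots> = (CLINT g|?G. (\<Prod>b\<in>B. iexp ((t * sqrt (l b) * (b \<bullet> u)) * g b)))"
      proof (rule Bochner_Integration.integral_cong[OF refl])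
        fix g
        have "complex_of_real (t * (Z g \<bullet> u)) = (\<Sum>b\<in>B. complex_of_real ((t * sqrt (l b) * (b \<bullet> u)) * g b))"
          by (simp add: Z_def inner_sum_left sum_distrib_left mult_ac)
        then show "iexp (t * (Z g \<bullet> u)) = (\<Prod>b\<in>B. iexp ((t * sqrt (l b) * (b \<bullet> u)) * g b))"
          by (simp only: sum_distrib_left exp_sum[OF B(2)])
      qed
      also have "\<dots> = (\<Prod>b\<in>B. CLINT x|std_normal_distribution. iexp ((t * sqrt (l b) * (b \<bullet> u)) * x))"
        by (rule product_integral_prod[OF B(2)])
           (intro N.integrable_iexp, simp, simp del: of_real_mult)
      also have "\<dots> = (\<Prod>b\<in>B. char std_normal_distribution (t * sqrt (l b) * (b \<bullet> u)))"
        by (simp add: char_def)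
      also have "\<dots> = (\<Prod>b\<in>B. complex_of_real (exp (- (t\<^sup>2 * (l b * (b \<bullet> u)\<^sup>2)) / 2)))"
        using l by (intro prod.cong refl) (simp add: char_std_normal_distribution power_mult_distrib)
      also have "\<dots> = complex_of_real (exp (\<Sum>b\<in>B. - (t\<^sup>2 * (l b * (b \<bullet> u)\<^sup>2)) / 2))"
        by (simp add: exp_sum[OF B(2)])
      also have "(\<Sum>b\<in>B. - (t\<^sup>2 * (l b * (b \<bullet> u)\<^sup>2)) / 2) = - ((u \<bullet> R u) * t\<^sup>2) / 2"
        by (simp add: form[OF u] sum_divide_distrib[symmetric] sum_negf sum_distrib_left mult_ac)
      finally show "char (distr \<mu> borel (\<lambda>z. z \<bullet> u)) t = char (centred_normal (sqrt (u \<bullet> R u))) t"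
        using nn by (simp add: char_centred_normal)
    qed
  qed
  have sq: "integrable \<mu> (\<lambda>z. (z \<bullet> u)\<^sup>2)" "(LINT z|\<mu>. (z \<bullet> u)\<^sup>2) = u \<bullet> R u" if u: "u \<in> M" for u
  proof -
    have nn: "0 \<le> sqrt (u \<bullet> R u)" using nonneg[OF u] by simp
    show "integrable \<mu> (\<lambda>z. (z \<bullet> u)\<^sup>2)"
      using second_moment_centred_normal(1)[OF nn] unfolding normal[OF u, symmetric]
      by (subst (asm) integrable_distr_eq) auto
    show "(LINT z|\<mu>. (z \<bullet> u)\<^sup>2) = u \<bullet> R u"
      using second_moment_centred_normal(2)[OF nn] nonneg[OF u] unfolding normal[OF u, symmetric]
      by (subst (asm) integral_distr) auto
  qed
  have "centred_gaussian M C \<mu>"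
    unfolding centred_gaussian_def
  proof (intro conjI ballI)
    show "prob_space \<mu>" by (rule \<mu>.prob_space_axioms)
    show "sets \<mu> = sets borel" by (rule sets_\<mu>)
    have "Z g \<in> M" for g
      unfolding Z_def using B(1) M by (intro subspace_sum subspace_scale) auto
    then show "AE z in \<mu>. z \<in> M"
      unfolding \<mu>_def using closed_subspace[OF M] by (subst AE_distr_iff) auto
    fix u assume u: "u \<in> M"
    show "\<exists>\<sigma>\<ge>0. distr \<mu> borel (\<lambda>z. z \<bullet> u) = centred_normal \<sigma>"
      using normal[OF u] nonneg[OF u] by (intro exI[of _ "sqrt (u \<bullet> R u)"]) simp
    fix v assume v: "v \<in> M"
    have uv: "u + v \<in> M" "u - v \<in> M" using u v M by (auto intro: subspace_add subspace_diff)
    have "(LINT z|\<mu>. (z \<bullet> u) * (z \<bullet> v)) = (LINT z|\<mu>. (1/4) * ((z \<bullet> (u + v))\<^sup>2 - (z \<bullet> (u - v))\<^sup>2))"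
      by (intro Bochner_Integration.integral_cong refl)
         (simp add: inner_add_right inner_diff_right power2_eq_square algebra_simps)
    also have "\<dots> = (1/4) * ((u + v) \<bullet> R (u + v) - (u - v) \<bullet> R (u - v))"
      using sq[OF uv(1)] sq[OF uv(2)] by simp
    also have "\<dots> = u \<bullet> R v"
      using sa[OF u v]
      by (simp add: linear_add[OF R(1)] linear_diff[OF R(1)] inner_add_left inner_add_right
          inner_diff_left inner_diff_right inner_commute[of v])
    finally show "(LINT z|\<mu>. (z \<bullet> u) * (z \<bullet> v)) = u \<bullet> C v" by (simp add: C[OF v])
  qed
  then show ?thesis by blast
qed

lemma centred_gaussian_gaussian_law:
  assumes "subspace M" "\<exists>\<mu>. centred_gaussian M C \<mu>"
  shows "centred_gaussian M C (gaussian_law M C)"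
  unfolding gaussian_law_def using assms centred_gaussian_unique by (metis the_equality)

section \<open>The population barycenter\<close>

lemma inner_eqI_on:
  fixes x y :: "'a::euclidean_space"
  assumes "subspace M" "x \<in> M" "y \<in> M" "\<And>z. z \<in> M \<Longrightarrow> z \<bullet> x = z \<bullet> y"
  shows "x = y"
proof -
  have "(x - y) \<bullet> x = (x - y) \<bullet> y" using assms by (intro assms(4) subspace_diff)
  then have "(x - y) \<bullet> (x - y) = 0" by (simp add: inner_diff_right)
  then show ?thesis by simp
qed

text \<open>The operators on \<open>M\<close> are functions with prescribed values on \<open>M\<close> alone, and symmetry already makes
  them linear there.  Composition with the projector extends them linearly.\<close>

lemma linear_of_symmetric:
  fixes G :: "'a::euclidean_space \<Rightarrow> 'a"
  assumes M: "subspace M" and G: "\<And>x. x \<in> M \<Longrightarrow> G x \<in> M"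
    and sym: "\<And>x y. x \<in> M \<Longrightarrow> y \<in> M \<Longrightarrow> x \<bullet> G y = G x \<bullet> y"
  shows "linear (\<lambda>x. G (orth_proj M x))"
  using M orth_proj(1)[OF M]
  by (intro linearI inner_eqI_on[OF M] subspace_add subspace_scale G)
     (auto simp: sym G subspace_add subspace_scale linear_add[OF linear_orth_proj[OF M]]
        linear_cmul[OF linear_orth_proj[OF M]] inner_add_right)

text \<open>By compactness of the unit sphere of \<open>M\<close>.\<close>

lemma coercive_of_positive:
  fixes G :: "'a::euclidean_space \<Rightarrow> 'a"
  assumes M: "subspace M" and G: "\<And>x. x \<in> M \<Longrightarrow> G x \<in> M"
    and sym: "\<And>x y. x \<in> M \<Longrightarrow> y \<in> M \<Longrightarrow> x \<bullet> G y = G x \<bullet> y"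
    and pos: "\<And>x. x \<in> M \<Longrightarrow> x \<noteq> 0 \<Longrightarrow> 0 < x \<bullet> G x"
  shows "\<exists>c>0. \<forall>x\<in>M. c * (norm x)\<^sup>2 \<le> x \<bullet> G x"
proof (cases "sphere 0 1 \<inter> M = {}")
  case True
  have "x = 0" if "x \<in> M" for x
  proof (rule ccontr)
    assume "x \<noteq> 0"
    then have "(1 / norm x) *\<^sub>R x \<in> sphere 0 1 \<inter> M" using that subspace_scale[OF M] by simp
    then show False using True by blast
  qed
  then have "1 * (norm x)\<^sup>2 \<le> x \<bullet> G x" if "x \<in> M" for x using that by force
  then show ?thesis by (intro exI[of _ 1]) simp
next
  case False
  define H where "H x = G (orth_proj M x)" for x
  have H: "linear H" unfolding H_def[abs_def] by (rule linear_of_symmetric[OF M G sym])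
  have HG: "H x = G x" if "x \<in> M" for x by (simp add: H_def orth_proj_self[OF M that])
  have "continuous_on (sphere 0 1 \<inter> M) (\<lambda>x. x \<bullet> H x)"
    by (intro continuous_intros linear_continuous_on linear_conv_bounded_linear[THEN iffD1] H)
  moreover have "compact (sphere 0 1 \<inter> M)" by (simp add: compact_Int_closed closed_subspace[OF M])
  ultimately obtain v where v: "v \<in> sphere 0 1 \<inter> M" "\<And>x. x \<in> sphere 0 1 \<inter> M \<Longrightarrow> v \<bullet> H v \<le> x \<bullet> H x"
    using continuous_attains_inf[OF _ False] by meson
  have "(v \<bullet> H v) * (norm x)\<^sup>2 \<le> x \<bullet> G x" if x: "x \<in> M" for x
  proof (cases "x = 0")
    case False
    have "(1 / norm x) *\<^sub>R x \<in> sphere 0 1 \<inter> M" using x False subspace_scale[OF M] by simp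
    from v(2)[OF this] have "v \<bullet> H v \<le> x \<bullet> H x / (norm x)\<^sup>2"
      by (simp add: linear_cmul[OF H] power2_eq_square)
    then show ?thesis using False by (simp add: pos_le_divide_eq HG[OF x])
  qed simp
  moreover have "0 < v \<bullet> H v"
  proof -
    have "v \<in> M" "v \<noteq> 0" using v(1) by force+
    then show ?thesis using pos HG by simp
  qed
  ultimately show ?thesis by blast
qed

text \<open>A coercive \<open>G\<close> is injective on \<open>M\<close>.  Extended by the identity on the orthogonal complement it is an
  injective linear endomorphism of the whole space, hence onto.\<close>

lemma coercive_inverse:
  fixes G :: "'a::euclidean_space \<Rightarrow> 'a"
  assumes M: "subspace M" and G: "\<And>x. x \<in> M \<Longrightarrow> G x \<in> M"
    and sym: "\<And>x y. x \<in> M \<Longrightarrow> y \<in> M \<Longrightarrow> x \<bullet> G y = G x \<bullet> y"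
    and coercive: "\<And>x. x \<in> M \<Longrightarrow> c * (norm x)\<^sup>2 \<le> x \<bullet> G x" and c: "c > 0"
  shows "y \<in> M \<Longrightarrow> inv_into M G y \<in> M" "y \<in> M \<Longrightarrow> G (inv_into M G y) = y"
    "x \<in> M \<Longrightarrow> y \<in> M \<Longrightarrow> c * norm (x - y) \<le> norm (G x - G y)"
    "x \<in> M \<Longrightarrow> y \<in> M \<Longrightarrow> x \<bullet> inv_into M G y = inv_into M G x \<bullet> y"
    "linear (\<lambda>x. inv_into M G (orth_proj M x))"
proof -
  note p = orth_proj(1)[OF M]
  define L where "L x = G (orth_proj M x)" for x
  have L: "linear L" unfolding L_def[abs_def] by (rule linear_of_symmetric[OF M G sym])
  have LG: "L x = G x" if "x \<in> M" for x by (simp add: L_def orth_proj_self[OF M that])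
  show lower: "c * norm (x - y) \<le> norm (G x - G y)" if "x \<in> M" "y \<in> M" for x y
  proof -
    have xy: "x - y \<in> M" using that M by (intro subspace_diff)
    have "G (x - y) = G x - G y" using LG[OF xy] LG[OF that(1)] LG[OF that(2)] linear_diff[OF L] by metis
    then have "c * (norm (x - y))\<^sup>2 \<le> norm (x - y) * norm (G x - G y)"
      using coercive[OF xy] norm_cauchy_schwarz[of "x - y" "G (x - y)"] by simp
    then show ?thesis by (cases "x = y") (simp_all add: power2_eq_square)
  qed
  define H where "H x = L x + (x - orth_proj M x)" for x
  have H: "linear H"
    by (rule linearI)
       (simp_all add: H_def linear_add[OF linear_orth_proj[OF M]] linear_cmul[OF linear_orth_proj[OF M]]
          linear_add[OF L] linear_cmul[OF L] algebra_simps)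
  have "x = 0" if "H x = 0" for x
  proof -
    have "orth_proj M x \<bullet> G (orth_proj M x) = orth_proj M x \<bullet> H x"
      using orth_proj(2)[OF M p, of x x] by (simp add: H_def L_def inner_add_right inner_commute)
    then have "c * (norm (orth_proj M x))\<^sup>2 \<le> 0" using coercive[OF p, of x] that by simp
    then have *: "orth_proj M x = 0" using c by (simp add: mult_le_0_iff)
    then have "L x = 0" using linear_0[OF L] LG[OF subspace_0[OF M]] by (simp add: L_def)
    then show "x = 0" using that * by (simp add: H_def)
  qed
  then have "inj H" using linear_injective_0[OF H] by blast
  then have surj: "surj H" using linear_injective_imp_surjective[OF H] by blast
  have onto: "G ` M = M"
  proof
    show "M \<subseteq> G ` M"
    proof
      fix y assume y: "y \<in> M"
      obtain x where x: "y = H x" using surj by blast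
      have "orth_proj M y = G (orth_proj M x)"
      proof (rule orth_proj_unique[OF M G[OF p]])
        fix z assume "z \<in> M"
        then show "(y - G (orth_proj M x)) \<bullet> z = 0"
          using orth_proj(2)[OF M, of z x] by (simp add: x H_def L_def)
      qed
      then show "y \<in> G ` M" using orth_proj_self[OF M y] p by auto
    qed
  qed (use G in auto)
  show im: "inv_into M G y \<in> M" if "y \<in> M" for y using inv_into_into[of y G M] onto that by simp
  show inv: "G (inv_into M G y) = y" if "y \<in> M" for y using f_inv_into_f[of y G M] onto that by simp
  show ksym: "x \<bullet> inv_into M G y = inv_into M G x \<bullet> y" if "x \<in> M" "y \<in> M" for x y
    using sym[OF im[OF that(1)] im[OF that(2)]] by (simp add: inv that)
  show "linear (\<lambda>x. inv_into M G (orth_proj M x))"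
    by (rule linear_of_symmetric[OF M im ksym])
qed

text \<open>First-order optimality without differentiating the objective: a subgradient that is
  continuous at a minimiser vanishes along the constraint.\<close>

lemma subgradient_stationary:
  fixes Q :: "complex^'d^'d" and V :: "complex^'d^'d \<Rightarrow> real"
  assumes Q: "Q \<in> pd" and H: "\<And>r. Q + r *\<^sub>R H \<in> A" "H \<in> hermitian"
    and min: "\<And>R. R \<in> psd \<inter> A \<Longrightarrow> V Q \<le> V R"
    and sub: "\<And>R. R \<in> pd \<Longrightarrow> V Q \<ge> V R + G R \<bullet> (Q - R)"
    and cont: "\<And>q. (\<And>n. q n \<in> hermitian) \<Longrightarrow> q \<longlonglongrightarrow> Q \<Longrightarrow> (\<lambda>n::nat. G (q n)) \<longlonglongrightarrow> G Q"
  shows "G Q \<bullet> H = 0"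
proof -
  have *: "G Q \<bullet> (c *\<^sub>R H) \<ge> 0" for c
  proof -
    define q where "q n = Q + (c / real (Suc n)) *\<^sub>R H" for n
    have "(\<lambda>n. c / real (Suc n)) \<longlonglongrightarrow> 0"
      using LIMSEQ_Suc[OF lim_const_over_n[of c]] by simp
    then have "q \<longlonglongrightarrow> Q + 0 *\<^sub>R H" unfolding q_def by (intro tendsto_intros)
    then have lim: "q \<longlonglongrightarrow> Q" by simp
    have herm: "q n \<in> hermitian" for n unfolding q_def using pd_hermitian[OF Q] H by (intro hermitian_intros)
    have pdq: "\<forall>\<^sub>F n in sequentially. q n \<in> pd" by (rule eventually_pd[OF Q lim]) (simp add: herm)
    have ev: "\<forall>\<^sub>F n in sequentially. 0 \<le> G (q n) \<bullet> (c *\<^sub>R H)"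
      using pdq
    proof eventually_elim
      case (elim n)
      have "V Q \<le> V (q n)" using min[of "q n"] H(1) pd_imp_psd[OF elim] by (simp add: q_def)
      then have "G (q n) \<bullet> (Q - q n) \<le> 0" using sub[OF elim] by linarith
      also have "Q - q n = - (1 / real (Suc n)) *\<^sub>R (c *\<^sub>R H)" by (simp add: q_def)
      finally show ?case by (simp add: zero_le_divide_iff)
    qed
    have "(\<lambda>n. G (q n) \<bullet> (c *\<^sub>R H)) \<longlonglongrightarrow> G Q \<bullet> (c *\<^sub>R H)"
      by (intro tendsto_intros cont[OF herm lim])
    then show ?thesis using ev by (intro tendsto_lowerbound) auto
  qed
  show ?thesis using *[of 1] *[of "-1"] by simp
qed

locale bw_model = P: prob_space P
  for P :: "(complex^'d^'d) measure" +
  fixes M :: "(complex^'d^'d) set" and Q0 Qstar :: "complex^'d^'d" and A :: "(complex^'d^'d) set"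
  assumes sets_P: "sets P = sets (restrict_space borel psd)"
    and P_pd: "measure P pd > 0"
    and P_trace: "integrable P rtrace"
    and M: "subspace M" and M_hermitian: "M \<subseteq> hermitian"
    and Q0: "Q0 \<in> hermitian"
    and A: "A = (\<lambda>X. Q0 + X) ` M"
    and A_pd: "pd \<inter> A \<noteq> {}"
    and barycenter: "is_barycenter P A Qstar"
begin

lemma space_P: "space P = psd"
  using sets_eq_imp_space_eq[OF sets_P] by (simp add: space_restrict_space)

lemma measurable_P: "continuous_on psd f \<Longrightarrow> f \<in> borel_measurable P"
  using borel_measurable_continuous_on_restrict[of psd f] measurable_cong_sets[OF sets_P refl] by blast

lemma measurable_transport: "Q \<in> pd \<Longrightarrow> transport Q \<in> borel_measurable P"
  by (intro measurable_P continuous_on_transport_right)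

lemma A_diff: "R \<in> A \<Longrightarrow> R' \<in> A \<Longrightarrow> R - R' \<in> M"
  unfolding A using subspace_diff[OF M] by auto

lemma A_add: "R \<in> A \<Longrightarrow> X \<in> M \<Longrightarrow> R + X \<in> A"
  unfolding A using subspace_add[OF M] by (auto simp: add.assoc)

lemma transport_norm_bound:
  assumes "Q - q *\<^sub>R mat 1 \<in> psd" "q > 0" "S \<in> psd"
  shows "norm (transport Q S) \<le> 1 + rtrace S / q"
proof -
  have "norm (transport Q S) \<le> 1 + (norm (transport Q S))\<^sup>2"
    using sum_squares_bound[of "norm (transport Q S)" 1] by (simp add: power2_eq_square) (smt (verit) norm_ge_zero)
  then show ?thesis using norm_transport_le[OF assms(3,1,2)] by simp
qed

lemma integrable_dominated:
  fixes f :: "complex^'d^'d \<Rightarrow> 'c::euclidean_space"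
  assumes "f \<in> borel_measurable P" "\<And>S. S \<in> psd \<Longrightarrow> norm (f S) \<le> c + k * rtrace S"
  shows "integrable P f"
proof (rule Bochner_Integration.integrable_bound[OF _ assms(1)])
  show "integrable P (\<lambda>S. c + k * rtrace S)" using P_trace by auto
  show "AE S in P. norm (f S) \<le> norm (c + k * rtrace S)"
    using assms(2) by (intro AE_I2) (simp add: space_P order_trans[OF _ abs_ge_self])
qed

lemma integrable_transport: "Q \<in> pd \<Longrightarrow> integrable P (transport Q)"
proof -
  assume Q: "Q \<in> pd"
  obtain q where q: "q > 0" "Q - q *\<^sub>R mat 1 \<in> psd" using pd_lower_bound[OF Q] by blast
  show ?thesis
    using transport_norm_bound[OF q(2,1)]
    by (intro integrable_dominated[where c = 1 and k = "1 / q"] measurable_transport Q) simp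
qed

lemma integrable_bw_dist_sq: "R \<in> psd \<Longrightarrow> integrable P (bw_dist_sq R)"
proof -
  assume R: "R \<in> psd"
  have "continuous_on psd (bw_dist_sq R)"
    unfolding continuous_on_def
    using R by (auto intro!: tendsto_bw_dist_sq tendsto_ident_at simp: eventually_at_filter)
  then show ?thesis
    using bw_dist_sq_bounds[OF R]
    by (intro integrable_dominated[where c = "rtrace R" and k = 1] measurable_P) auto
qed

definition mean_sq :: "complex^'d^'d \<Rightarrow> real" where
  "mean_sq R = (LINT S|P. bw_dist_sq R S)"

definition mean_transport :: "complex^'d^'d \<Rightarrow> complex^'d^'d" where
  "mean_transport Q = (LINT S|P. transport Q S)"

lemma barycenter_psd: "Qstar \<in> psd" and barycenter_A: "Qstar \<in> A"
  and barycenter_min: "R \<in> psd \<Longrightarrow> R \<in> A \<Longrightarrow> mean_sq Qstar \<le> mean_sq R"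
  using barycenter by (auto simp: is_barycenter_def is_arg_min_def mean_sq_def not_less)

lemma mean_subgradient:
  assumes Q: "Q \<in> pd" and R: "R \<in> psd"
  shows "mean_sq R \<ge> mean_sq Q + (mat 1 - mean_transport Q) \<bullet> (R - Q)"
proof -
  have "mean_sq Q + (mat 1 - mean_transport Q) \<bullet> (R - Q) =
      (LINT S|P. bw_dist_sq Q S + (mat 1 - transport Q S) \<bullet> (R - Q))"
    using integrable_bw_dist_sq[OF pd_imp_psd[OF Q]] integrable_transport[OF Q]
    by (simp add: mean_sq_def mean_transport_def P.prob_space inner_diff_left)
  also have "\<dots> \<le> mean_sq R"
    unfolding mean_sq_def
    using integrable_bw_dist_sq[OF pd_imp_psd[OF Q]] integrable_bw_dist_sq[OF R] integrable_transport[OF Q]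
      bw_dist_sq_subgradient[OF Q R]
    by (intro integral_mono) (auto simp: space_P)
  finally show ?thesis .
qed

text \<open>The positive definite matrices are the union of the sets \<open>S \<ge> 1 / (k + 1)\<close>.\<close>

lemma uniformly_pd_mass: "\<exists>s>0. measure P {S\<in>psd. S - s *\<^sub>R mat 1 \<in> psd} > 0"
proof (rule ccontr)
  assume n: "\<not> ?thesis"
  let ?E = "\<lambda>k. {S\<in>psd. S - (1 / real (Suc k)) *\<^sub>R mat 1 \<in> psd}"
  have m: "?E k \<in> sets P" for k
  proof -
    have "closed ((\<lambda>S. S - (1 / real (Suc k)) *\<^sub>R mat 1) -` psd :: (complex^'d^'d) set)"
      by (intro continuous_closed_vimage closed_psd) (auto intro!: continuous_intros)
    then have "closed (psd \<inter> (\<lambda>S. S - (1 / real (Suc k)) *\<^sub>R mat 1) -` psd :: (complex^'d^'d) set)"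
      using closed_psd by blast
    then have "psd \<inter> (\<lambda>S. S - (1 / real (Suc k)) *\<^sub>R mat 1) -` psd \<in> sets (borel :: (complex^'d^'d) measure)"
      by (rule borel_closed)
    then show ?thesis
      unfolding sets_P sets_restrict_space by (rule image_eqI[rotated]) blast
  qed
  have "measure P (?E k) = 0" for k
  proof -
    have "\<forall>s>0. \<not> measure P {S\<in>psd. S - s *\<^sub>R mat 1 \<in> psd} > 0" using n by blast
    from this[rule_format, of "1 / real (Suc k)"] have "\<not> measure P (?E k) > 0" by (simp del: of_nat_Suc)
    then show ?thesis using measure_nonneg[of P "?E k"] by linarith
  qed
  then have "emeasure P (?E k) = 0" for k by (simp add: P.emeasure_eq_measure)
  then have "emeasure P (\<Union>k. ?E k) = 0" using m by (intro emeasure_UN_eq_0) auto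
  moreover have "(\<Union>k. ?E k) = (pd :: (complex^'d^'d) set)"
  proof (intro subset_antisym subsetI)
    fix S :: "complex^'d^'d" assume "S \<in> (\<Union>k. ?E k)"
    then obtain k where "S - (1 / real (Suc k)) *\<^sub>R mat 1 \<in> psd" by blast
    then show "S \<in> pd" by (rule pd_of_lower_bound) simp
  next
    fix S :: "complex^'d^'d" assume S: "S \<in> pd"
    obtain s where s: "s > 0" "S - s *\<^sub>R mat 1 \<in> psd" using pd_lower_bound[OF S] by blast
    obtain k where k: "1 / real (Suc k) < s" using nat_approx_posE[OF s(1)] .
    have "S - s *\<^sub>R mat 1 + (s - 1 / real (Suc k)) *\<^sub>R mat 1 \<in> psd"
      using k by (intro psd_intros(1) s(2) psd_intros(2) psd_intros(4)) simp
    then have "S - (1 / real (Suc k)) *\<^sub>R mat 1 \<in> psd" by (simp add: scaleR_left_diff_distrib)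
    then show "S \<in> (\<Union>k. ?E k)" using pd_imp_psd[OF S] by blast
  qed
  ultimately show False using P_pd by (simp add: measure_def)
qed

text \<open>If \<open>Qstar\<close> had a null vector, moving towards a positive definite \<open>R\<close> would gain at an infinite
  rate: optimality bounds the mean of \<open>transport (Qstar + t (R - Qstar))\<close> uniformly in \<open>t\<close>, whereas that
  map has norm of order \<open>t\<^bsup>-1/2\<^esup>\<close> on an event of positive probability.\<close>

lemma barycenter_pd: "Qstar \<in> pd"
proof (rule ccontr)
  assume "Qstar \<notin> pd"
  then obtain v where v: "v \<noteq> 0" "Qstar *v v = 0"
    using psd_injective_pd[OF barycenter_psd] by blast
  obtain R where R: "R \<in> pd" "R \<in> A" using A_pd by blast
  obtain r where r: "r > 0" "R - r *\<^sub>R mat 1 \<in> psd" using pd_lower_bound[OF R(1)] by blast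
  obtain s where s: "s > 0" "measure P {S\<in>psd. S - s *\<^sub>R mat 1 \<in> psd} > 0" using uniformly_pd_mass by blast
  let ?E = "{S\<in>psd. S - s *\<^sub>R mat 1 \<in> psd}"
  have E: "?E \<in> sets P" using s(2) measure_notin_sets[of ?E P] by force
  \<comment> \<open>By \<open>transport_blowup\<close>, maps to matrices \<open>S \<ge> s\<close> have norm at least \<open>c t\<^bsup>-1/2\<^esup>\<close>.\<close>
  define c where "c = sqrt (s * (norm v)\<^sup>2 / (v \<bullet> (R *v v)))"
  have vR: "v \<bullet> (R *v v) > 0" by (rule pd_form[OF R(1) v(1)])
  have c: "c > 0" using s(1) v(1) vR by (simp add: c_def)
  define K where "K = rtrace R + (rtrace Qstar + rtrace R + (LINT S|P. rtrace S))"
  have bound: "r * (c / sqrt t * measure P ?E) \<le> K" if t: "0 < t" "t \<le> 1/2" for t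
  proof -
    define Q where "Q = (1 - t) *\<^sub>R Qstar + t *\<^sub>R R"
    have Q: "Q \<in> pd"
      unfolding Q_def using t by (intro psd_add_pd psd_intros(2) barycenter_psd pd_scaleR R) auto
    have QA: "Q \<in> A"
    proof -
      have "Q = Qstar + t *\<^sub>R (R - Qstar)" by (simp add: Q_def algebra_simps)
      then show ?thesis using A_add[OF barycenter_A subspace_scale[OF M A_diff[OF R(2) barycenter_A]]] by simp
    qed
    let ?T = "mean_transport Q"
    have tr: "mean_transport Q \<bullet> X = (LINT S|P. transport Q S \<bullet> X)" for X
      unfolding mean_transport_def using integrable_transport[OF Q] by simp
    have "mean_sq Qstar \<ge> mean_sq Q + (mat 1 - ?T) \<bullet> (Qstar - Q)"
      by (rule mean_subgradient[OF Q barycenter_psd])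
    then have "(mat 1 - ?T) \<bullet> (Qstar - Q) \<le> 0" using barycenter_min[OF pd_imp_psd[OF Q] QA] by linarith
    also have "Qstar - Q = (- t) *\<^sub>R (R - Qstar)" by (simp add: Q_def algebra_simps)
    finally have "0 \<le> t * ((mat 1 - ?T) \<bullet> (R - Qstar))" by simp
    then have "0 \<le> (mat 1 - ?T) \<bullet> (R - Qstar)" using t(1) by (simp add: zero_le_mult_iff)
    then have le: "?T \<bullet> R \<le> rtrace R - rtrace Qstar + ?T \<bullet> Qstar"
      by (simp add: inner_diff_left inner_diff_right rtrace_eq_inner inner_commute)
    have "?T \<bullet> Qstar \<le> rtrace Qstar + rtrace R + (LINT S|P. rtrace S)"
    proof -
      have "transport Q S \<bullet> Qstar \<le> rtrace Qstar + rtrace R + rtrace S" if S: "S \<in> psd" for S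
      proof -
        have "0 \<le> transport Q S \<bullet> R" "0 \<le> transport Q S \<bullet> Qstar"
          using transport_psd(1)[OF Q S] barycenter_psd pd_imp_psd[OF R(1)] by (auto intro: inner_psd_nonneg)
        then have "(1 / 2) * (transport Q S \<bullet> Qstar) \<le> (1 - t) * (transport Q S \<bullet> Qstar) + t * (transport Q S \<bullet> R)"
          using t by (intro add_increasing2 mult_right_mono) auto
        also have "\<dots> = transport Q S \<bullet> Q" by (simp add: Q_def inner_add_right)
        also have "2 * (transport Q S \<bullet> Q) \<le> rtrace Q + rtrace S"
          using bw_dist_sq_bounds(1)[OF pd_imp_psd[OF Q] S] unfolding bw_dist_sq_eq[OF Q S] by simp
        finally have "transport Q S \<bullet> Qstar \<le> rtrace Q + rtrace S" by linarith
        moreover have "rtrace Q \<le> rtrace Qstar + rtrace R"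
          unfolding Q_def rtrace_add rtrace_scaleR
          using t rtrace_psd_nonneg[OF barycenter_psd] rtrace_psd_nonneg[OF pd_imp_psd[OF R(1)]]
          by (intro add_mono mult_left_le_one_le) auto
        ultimately show ?thesis by linarith
      qed
      then have "(LINT S|P. transport Q S \<bullet> Qstar) \<le> (LINT S|P. rtrace Qstar + rtrace R + rtrace S)"
        using integrable_transport[OF Q] P_trace by (intro integral_mono) (auto simp: space_P)
      then show ?thesis using P_trace by (simp add: tr P.prob_space)
    qed
    then have "?T \<bullet> R \<le> K" using le rtrace_psd_nonneg[OF barycenter_psd] by (simp add: K_def)
    moreover have "r * (c / sqrt t * measure P ?E) \<le> ?T \<bullet> R"
    proof -
      have "r * (c / sqrt t) * indicator ?E S \<le> transport Q S \<bullet> R" if S: "S \<in> psd" for S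
      proof -
        note T = transport_psd(1)[OF Q S]
        have "0 \<le> transport Q S \<bullet> (R - r *\<^sub>R mat 1)" by (rule inner_psd_nonneg[OF T r(2)])
        then have ge: "r * rtrace (transport Q S) \<le> transport Q S \<bullet> R"
          by (simp add: inner_diff_right rtrace_eq_inner)
        have "c / sqrt t \<le> rtrace (transport Q S)" if "S \<in> ?E"
        proof -
          have "Q *v v = t *\<^sub>R (R *v v)" by (simp add: Q_def matvec_simps v(2))
          then have "s * (norm v)\<^sup>2 \<le> (t * (v \<bullet> (R *v v))) * (norm (transport Q S))\<^sup>2"
            using transport_blowup[OF Q _ s(1), of S v] that by simp
          then have "s * (norm v)\<^sup>2 / (v \<bullet> (R *v v)) / t \<le> (norm (transport Q S))\<^sup>2"
            using vR t(1) by (simp add: field_simps)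
          then have "sqrt (s * (norm v)\<^sup>2 / (v \<bullet> (R *v v)) / t) \<le> norm (transport Q S)"
            by (intro real_le_lsqrt) auto
          also have "\<dots> \<le> rtrace (transport Q S)" by (rule norm_psd_le_rtrace[OF T])
          finally show ?thesis by (simp only: c_def real_sqrt_divide)
        qed
        then have "r * (c / sqrt t) \<le> transport Q S \<bullet> R" if "S \<in> ?E"
          using order_trans[OF mult_left_mono ge, of "c / sqrt t"] r(1) that by simp
        then show ?thesis
          using inner_psd_nonneg[OF T pd_imp_psd[OF R(1)]] by (cases "S \<in> ?E") simp_all
      qed
      moreover have iE: "integrable P (indicator ?E :: _ \<Rightarrow> real)"
        using E by (simp add: P.emeasure_eq_measure)
      ultimately have "(LINT S|P. r * (c / sqrt t) * indicator ?E S) \<le> (LINT S|P. transport Q S \<bullet> R)"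
        using integrable_transport[OF Q] by (intro integral_mono) (auto simp: space_P)
      then show ?thesis
        using E sets.sets_into_space[OF E] by (simp add: tr Int_absorb2 mult.assoc)
    qed
    ultimately show ?thesis by linarith
  qed
  define k where "k = r * c * measure P ?E"
  have k: "k > 0" using r c s by (simp add: k_def)
  define t where "t = min (1/2) ((k / (\<bar>K\<bar> + 1))\<^sup>2)"
  have t: "0 < t" "t \<le> 1/2" using k by (auto simp: t_def)
  have "sqrt t \<le> sqrt ((k / (\<bar>K\<bar> + 1))\<^sup>2)" by (intro real_sqrt_le_mono) (simp add: t_def)
  also have "\<dots> = k / (\<bar>K\<bar> + 1)" using k by simp
  finally have "(\<bar>K\<bar> + 1) * sqrt t \<le> k" by (simp add: pos_le_divide_eq mult.commute)
  moreover have "k \<le> K * sqrt t"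
    using bound[OF t] t(1) by (simp add: k_def field_simps)
  ultimately have "(\<bar>K\<bar> + 1) * sqrt t \<le> K * sqrt t" by linarith
  then have "\<bar>K\<bar> + 1 \<le> K" using t(1) by simp
  then show False by linarith
qed

end

lemma finite_orthonormal_basis:
  fixes M :: "'a::euclidean_space set"
  assumes "subspace M"
  obtains B where "B \<subseteq> M" "finite B" "\<And>b. b \<in> B \<Longrightarrow> norm b = 1" "\<And>x. x \<in> M \<Longrightarrow> (\<Sum>b\<in>B. (x \<bullet> b) *\<^sub>R b) = x"
proof -
  obtain B where B: "B \<subseteq> M" "pairwise orthogonal B" "\<And>b. b \<in> B \<Longrightarrow> norm b = 1" "independent B" "span B = M"
    using orthonormal_basis_subspace[OF assms] by blast
  have f: "finite B" using B(4) by (rule independent_imp_finite)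
  show thesis
  proof (rule that[OF B(1) f B(3)])
    fix x assume "x \<in> M"
    then show "(\<Sum>b\<in>B. (x \<bullet> b) *\<^sub>R b) = x" using orthonormal_basis_expand[OF B(2,3) _ f, of x] B(5) by simp
  qed
qed

context bw_model
begin

text \<open>The parameters are kept in a ball around the barycenter on which all matrices exceed a fixed
  multiple of the identity, so that every bound below is uniform.\<close>

definition rad :: real where
  "rad = (SOME m. 0 < m \<and> Qstar - (2 * m) *\<^sub>R mat 1 \<in> psd)"

definition U :: "(complex^'d^'d) set" where "U = hermitian \<inter> ball Qstar rad"

lemma rad: "0 < rad" "Qstar - (2 * rad) *\<^sub>R mat 1 \<in> psd"
proof -
  obtain m where "m > 0" "Qstar - m *\<^sub>R mat 1 \<in> psd" using pd_lower_bound[OF barycenter_pd] by blast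
  then have "\<exists>m. 0 < m \<and> Qstar - (2 * m) *\<^sub>R mat 1 \<in> psd" by (intro exI[of _ "m / 2"]) simp
  from someI_ex[OF this] show "0 < rad" "Qstar - (2 * rad) *\<^sub>R mat 1 \<in> psd" by (auto simp: rad_def)
qed

lemma U_hermitian: "Q \<in> U \<Longrightarrow> Q \<in> hermitian" by (simp add: U_def)

lemma U_lower: "Q \<in> U \<Longrightarrow> Q - rad *\<^sub>R mat 1 \<in> psd"
  using pd_neighbourhood[OF rad(2), of Q rad] by (simp add: U_def dist_norm norm_minus_commute)

lemma U_pd: "Q \<in> U \<Longrightarrow> Q \<in> pd" using U_lower rad(1) by (rule pd_of_lower_bound)

lemma Qstar_hermitian: "Qstar \<in> hermitian" by (rule pd_hermitian[OF barycenter_pd])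

lemma Qstar_U: "Qstar \<in> U" using rad(1) Qstar_hermitian by (simp add: U_def)

lemma U_convex: "convex U"
  unfolding U_def by (intro convex_Int convex_ball subspace_imp_convex subspace_hermitian)

lemma eventually_U:
  assumes "(f \<longlongrightarrow> Qstar) F" "\<forall>\<^sub>F x in F. f x \<in> hermitian"
  shows "\<forall>\<^sub>F x in F. f x \<in> U"
  using tendstoD[OF assms(1) rad(1)] assms(2) by eventually_elim (simp add: U_def dist_commute)

lemma transport_bound: "Q \<in> U \<Longrightarrow> S \<in> psd \<Longrightarrow> norm (transport Q S) \<le> 1 + rtrace S / rad"
  by (rule transport_norm_bound[OF U_lower rad(1)])

definition dconst :: real where "dconst = 3 / 2 * norm (mat 1 :: complex^'d^'d) / rad"

lemma dconst_nonneg: "0 \<le> dconst" using rad(1) by (simp add: dconst_def)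

lemma deriv_bound:
  assumes "Q \<in> U" "S \<in> psd" "H \<in> hermitian"
  shows "norm (transport_deriv Q S H) \<le> dconst * (1 + rtrace S / rad) * norm H"
proof -
  have "norm (transport_deriv Q S H) \<le> dconst * norm (transport Q S) * norm H"
    unfolding dconst_def by (rule norm_transport_deriv_le[OF assms(2) U_lower[OF assms(1)] rad(1) assms(3)])
  also have "\<dots> \<le> dconst * (1 + rtrace S / rad) * norm H"
    using transport_bound[OF assms(1,2)] dconst_nonneg by (intro mult_right_mono mult_left_mono) auto
  finally show ?thesis .
qed

text \<open>A differential is a pointwise limit of difference quotients.\<close>

lemma measurable_deriv:
  assumes Q: "Q \<in> pd" and H: "H \<in> hermitian"
  shows "(\<lambda>S. transport_deriv Q S H) \<in> borel_measurable P"
proof -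
  have "(\<lambda>n. 1 / real (Suc n)) \<longlonglongrightarrow> 0" using LIMSEQ_Suc[OF lim_1_over_n] .
  then have "(\<lambda>n. Q + (1 / real (Suc n)) *\<^sub>R H) \<longlonglongrightarrow> Q + 0 *\<^sub>R H" by (intro tendsto_intros)
  then have lim: "(\<lambda>n. Q + (1 / real (Suc n)) *\<^sub>R H) \<longlonglongrightarrow> Q" by simp
  have "\<forall>\<^sub>F n in sequentially. Q + (1 / real (Suc n)) *\<^sub>R H \<in> pd"
    using pd_hermitian[OF Q] H by (intro eventually_pd[OF Q lim] always_eventually allI hermitian_intros)
  then obtain N where N: "\<And>n. n \<ge> N \<Longrightarrow> Q + (1 / real (Suc n)) *\<^sub>R H \<in> pd"
    by (auto simp: eventually_sequentially)
  show ?thesis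
  proof (rule borel_measurable_LIMSEQ_metric)
    fix n
    show "(\<lambda>S. real (Suc (n + N)) *\<^sub>R (transport (Q + (1 / real (Suc (n + N))) *\<^sub>R H) S - transport Q S)) \<in> borel_measurable P"
      using measurable_transport[OF N[of "n + N"]] measurable_transport[OF Q] by measurable
  next
    fix S assume "S \<in> space P"
    then have S: "S \<in> psd" by (simp add: space_P)
    show "(\<lambda>n. real (Suc (n + N)) *\<^sub>R (transport (Q + (1 / real (Suc (n + N))) *\<^sub>R H) S - transport Q S))
        \<longlonglongrightarrow> transport_deriv Q S H"
      using LIMSEQ_ignore_initial_segment[OF difference_quotient_hermitian[OF transport_has_derivative[OF S Q] pd_hermitian[OF Q] H], of N] .
  qed
qed

lemma integrable_deriv:
  assumes Q: "Q \<in> U" and H: "H \<in> hermitian"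
  shows "integrable P (\<lambda>S. transport_deriv Q S H)"
  using deriv_bound[OF Q _ H]
  by (intro integrable_dominated[where c = "dconst * norm H" and k = "dconst * norm H / rad"]
        measurable_deriv U_pd Q H) (auto simp: algebra_simps)

lemma barycenter_stationary:
  assumes X: "X \<in> M"
  shows "(mat 1 - mean_transport Qstar) \<bullet> X = 0"
proof (rule subgradient_stationary[where V = mean_sq and A = A and G = "\<lambda>Q. mat 1 - mean_transport Q", OF barycenter_pd])
  show "Qstar + r *\<^sub>R X \<in> A" for r by (rule A_add[OF barycenter_A subspace_scale[OF M X]])
  show "X \<in> hermitian" using X M_hermitian by blast
  show "mean_sq Qstar \<le> mean_sq R" if "R \<in> psd \<inter> A" for R using that barycenter_min by blast
  show "mean_sq R + (mat 1 - mean_transport R) \<bullet> (Qstar - R) \<le> mean_sq Qstar" if "R \<in> pd" for R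
    by (rule mean_subgradient[OF that barycenter_psd])
  fix q :: "nat \<Rightarrow> complex^'d^'d" assume q: "\<And>n. q n \<in> hermitian" "q \<longlonglongrightarrow> Qstar"
  have "\<forall>\<^sub>F n in sequentially. q n \<in> U" using q by (intro eventually_U always_eventually) auto
  then obtain N where N: "\<And>n. n \<ge> N \<Longrightarrow> q n \<in> U" by (auto simp: eventually_sequentially)
  have "(\<lambda>n. mean_transport (q (n + N))) \<longlonglongrightarrow> mean_transport Qstar"
    unfolding mean_transport_def
  proof (rule integral_dominated_convergence[where w = "\<lambda>S. 1 + rtrace S / rad"])
    show "transport Qstar \<in> borel_measurable P" by (rule measurable_transport[OF barycenter_pd])
    show "transport (q (n + N)) \<in> borel_measurable P" for n using N by (intro measurable_transport U_pd) simp
    show "integrable P (\<lambda>S. 1 + rtrace S / rad)" using P_trace by auto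
    show "AE S in P. (\<lambda>n. transport (q (n + N)) S) \<longlonglongrightarrow> transport Qstar S"
      using q by (intro AE_I2 tendsto_transport barycenter_pd LIMSEQ_ignore_initial_segment[OF q(2)])
        (auto simp: space_P intro!: always_eventually)
    show "AE S in P. norm (transport (q (n + N)) S) \<le> 1 + rtrace S / rad" for n
      using N by (intro AE_I2 transport_bound) (auto simp: space_P)
  qed
  then show "(\<lambda>n. mat 1 - mean_transport (q n)) \<longlonglongrightarrow> mat 1 - mean_transport Qstar"
    by (intro tendsto_intros) (rule LIMSEQ_offset)
qed

subsection \<open>The Hessian of the objective and the limiting covariance\<close>

definition mean_deriv :: "complex^'d^'d \<Rightarrow> complex^'d^'d" where
  "mean_deriv X = (LINT S|P. transport_deriv Qstar S X)"

abbreviation F :: "complex^'d^'d \<Rightarrow> complex^'d^'d" where "F \<equiv> F_op P M Qstar"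

lemma M_herm: "X \<in> M \<Longrightarrow> X \<in> hermitian" using M_hermitian by blast

lemma F_eq: "X \<in> M \<Longrightarrow> F X = - orth_proj M (mean_deriv X)"
proof -
  assume X: "X \<in> M"
  have "(LINT S|P. compress M (dtransport Qstar S) X) = (LINT S|P. orth_proj M (transport_deriv Qstar S X))"
    by (intro Bochner_Integration.integral_cong refl)
       (simp add: compress_def space_P dtransport_eq barycenter_pd M_herm[OF X])
  also have "\<dots> = orth_proj M (mean_deriv X)"
    unfolding mean_deriv_def
    by (rule integral_bounded_linear[OF linear_conv_bounded_linear[THEN iffD1, OF linear_orth_proj[OF M]]
          integrable_deriv[OF Qstar_U M_herm[OF X]]])
  finally show ?thesis by (simp add: F_op_def)
qed

lemma F_M: "X \<in> M \<Longrightarrow> F X \<in> M"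
  by (simp add: F_eq orth_proj(1)[OF M] subspace_neg[OF M])

lemma inner_F: "X \<in> M \<Longrightarrow> Y \<in> M \<Longrightarrow> Y \<bullet> F X = - (LINT S|P. Y \<bullet> transport_deriv Qstar S X)"
proof -
  assume X: "X \<in> M" and Y: "Y \<in> M"
  have "Y \<bullet> F X = - (Y \<bullet> mean_deriv X)"
    using inner_orth_proj[OF M Y, of "mean_deriv X"] by (simp add: F_eq[OF X] inner_commute)
  also have "Y \<bullet> mean_deriv X = (LINT S|P. Y \<bullet> transport_deriv Qstar S X)"
    unfolding mean_deriv_def using integrable_deriv[OF Qstar_U M_herm[OF X]] by simp
  finally show ?thesis .
qed

lemma F_symmetric: "X \<in> M \<Longrightarrow> Y \<in> M \<Longrightarrow> Y \<bullet> F X = F Y \<bullet> X"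
proof -
  assume X: "X \<in> M" and Y: "Y \<in> M"
  have "(LINT S|P. Y \<bullet> transport_deriv Qstar S X) = (LINT S|P. X \<bullet> transport_deriv Qstar S Y)"
    using transport_deriv_symmetric[OF _ barycenter_pd, of _ Y X]
    by (intro Bochner_Integration.integral_cong refl) (simp add: space_P inner_commute[of X])
  then have "Y \<bullet> F X = X \<bullet> F Y" by (simp add: inner_F X Y)
  then show ?thesis by (simp add: inner_commute)
qed

text \<open>Each differential is negative, and strictly so for the definite \<open>S\<close>, which have positive
  probability.\<close>

lemma F_positive:
  assumes X: "X \<in> M" "X \<noteq> 0"
  shows "0 < X \<bullet> F X"
proof -
  let ?f = "\<lambda>S. - (X \<bullet> transport_deriv Qstar S X)"
  have i: "integrable P ?f" using integrable_deriv[OF Qstar_U M_herm[OF X(1)]] by auto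
  have nn: "AE S in P. 0 \<le> ?f S"
    using transport_deriv_negative(1)[OF _ barycenter_pd] by (intro AE_I2) (simp add: space_P)
  have eq: "X \<bullet> F X = (LINT S|P. ?f S)" by (simp add: inner_F X)
  moreover have "0 \<le> (LINT S|P. ?f S)" using nn by (rule integral_nonneg_AE)
  moreover have "(LINT S|P. ?f S) \<noteq> 0"
  proof
    assume "(LINT S|P. ?f S) = 0"
    then have "AE S in P. ?f S = 0" using integral_nonneg_eq_0_iff_AE[OF i nn] by simp
    then have "AE S in P. S \<notin> pd"
    proof eventually_elim
      case (elim S)
      then show ?case
        using transport_deriv_negative(2)[OF pd_imp_psd barycenter_pd, of S X] X(2) by force
    qed
    then have "measure P pd = 0"
      using P_pd measure_notin_sets[of pd P] P.prob_eq_0[of pd] by fastforce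
    then show False using P_pd by simp
  qed
  ultimately show ?thesis by simp
qed

text \<open>A lower bound for the spectrum of the symmetric operator \<open>F\<close> on \<open>M\<close>.\<close>

definition lam :: real where "lam = (SOME c. 0 < c \<and> (\<forall>x\<in>M. c * (norm x)\<^sup>2 \<le> x \<bullet> F x))"

lemma lam: "0 < lam" "X \<in> M \<Longrightarrow> lam * (norm X)\<^sup>2 \<le> X \<bullet> F X"
proof -
  have "\<exists>c. 0 < c \<and> (\<forall>x\<in>M. c * (norm x)\<^sup>2 \<le> x \<bullet> F x)"
    using coercive_of_positive[OF M F_M F_symmetric[rotated] F_positive] by blast
  from someI_ex[OF this] show "0 < lam" "X \<in> M \<Longrightarrow> lam * (norm X)\<^sup>2 \<le> X \<bullet> F X" by (auto simp: lam_def)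
qed

abbreviation K :: "complex^'d^'d \<Rightarrow> complex^'d^'d" where "K \<equiv> inv_into M F"

lemma K: "Y \<in> M \<Longrightarrow> K Y \<in> M" "Y \<in> M \<Longrightarrow> F (K Y) = Y"
    "X \<in> M \<Longrightarrow> Y \<in> M \<Longrightarrow> lam * norm (X - Y) \<le> norm (F X - F Y)"
    "X \<in> M \<Longrightarrow> Y \<in> M \<Longrightarrow> X \<bullet> K Y = K X \<bullet> Y"
    "linear (\<lambda>x. K (orth_proj M x))"
  by (rule coercive_inverse[OF M F_M F_symmetric[rotated] lam(2) lam(1)]; assumption)+

end

text \<open>With \<open>K\<close> the inverse of \<open>F\<close> or of its estimate, the sandwich is the limiting covariance or its
  plug-in version.  Its form is that of \<open>\<Sigma>\<close>, pulled back along \<open>K\<close>; it is therefore a covariance.\<close>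

lemma sandwich_operator:
  fixes K \<Sigma> :: "'a::euclidean_space \<Rightarrow> 'a"
  assumes M: "subspace M" and K: "\<And>x. x \<in> M \<Longrightarrow> K x \<in> M" "\<And>x y. x \<in> M \<Longrightarrow> y \<in> M \<Longrightarrow> x \<bullet> K y = K x \<bullet> y"
    and S: "\<And>x y. x \<in> M \<Longrightarrow> y \<in> M \<Longrightarrow> x \<bullet> \<Sigma> y = b x y" and b: "\<And>x y. b x y = b y x" "\<And>x. 0 \<le> b x x"
  defines "C \<equiv> K \<circ> compress M \<Sigma> \<circ> K"
  shows "x \<in> M \<Longrightarrow> C x \<in> M" "x \<in> M \<Longrightarrow> y \<in> M \<Longrightarrow> x \<bullet> C y = b (K x) (K y)"
    "\<exists>\<mu>. centred_gaussian M C \<mu>"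
proof -
  show CM: "C x \<in> M" if "x \<in> M" for x
    using that by (simp add: C_def compress_def K orth_proj(1)[OF M])
  show form: "x \<bullet> C y = b (K x) (K y)" if "x \<in> M" "y \<in> M" for x y
  proof -
    have "x \<bullet> C y = K x \<bullet> orth_proj M (\<Sigma> (K y))"
      using that by (simp add: C_def compress_def K orth_proj(1)[OF M])
    also have "\<dots> = K x \<bullet> \<Sigma> (K y)"
      using inner_orth_proj[OF M K(1)[OF that(1)], of "\<Sigma> (K y)"] by (simp add: inner_commute)
    finally show ?thesis using that by (simp add: S K)
  qed
  have sym: "x \<bullet> C y = C x \<bullet> y" if "x \<in> M" "y \<in> M" for x y
    using form[OF that] form[OF that(2,1)] b(1) by (metis inner_commute)
  show "\<exists>\<mu>. centred_gaussian M C \<mu>"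
  proof (rule centred_gaussian_exists[OF M linear_of_symmetric[OF M CM sym]])
    fix x y assume x: "x \<in> M" and y: "y \<in> M"
    show "C (orth_proj M x) \<in> M" using x by (simp add: CM orth_proj(1)[OF M])
    show "C (orth_proj M x) \<bullet> y = x \<bullet> C (orth_proj M y)"
      using sym[OF x y] by (simp add: orth_proj_self[OF M] x y)
    show "0 \<le> x \<bullet> C (orth_proj M x)" by (simp add: orth_proj_self[OF M x] form[OF x x] b)
    show "C x = C (orth_proj M x)" by (simp add: orth_proj_self[OF M x])
  qed
qed

context bw_model
begin

text \<open>The influence function: \<open>Q n - Qstar\<close> is to first order the average of the scores of the sample.\<close>

definition score :: "complex^'d^'d \<Rightarrow> complex^'d^'d" where
  "score S = K (orth_proj M (transport Qstar S - mat 1))"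

lemma score_M: "score S \<in> M" by (simp add: score_def K(1) orth_proj(1)[OF M])

lemma inner_score: "X \<in> M \<Longrightarrow> score S \<bullet> X = (transport Qstar S - mat 1) \<bullet> K X"
  using K(4)[OF orth_proj(1)[OF M], of X "transport Qstar S - mat 1"]
  by (simp add: score_def inner_orth_proj[OF M K(1)])

lemma bounded_linear_K: "bounded_linear (\<lambda>x. K (orth_proj M x))"
  using K(5) by (simp add: linear_conv_bounded_linear)

lemma transport_sq_bound:
  assumes "Q \<in> U" "S \<in> psd"
  shows "(norm (transport Q S - mat 1))\<^sup>2 \<le> 2 * (norm (mat 1 :: complex^'d^'d))\<^sup>2 + (2 / rad) * rtrace S"
proof -
  let ?a = "norm (transport Q S)" and ?b = "norm (mat 1 :: complex^'d^'d)"
  have "(norm (transport Q S - mat 1))\<^sup>2 \<le> (?a + ?b)\<^sup>2"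
    by (intro power_mono norm_triangle_ineq4) simp
  also have "\<dots> \<le> 2 * ?a\<^sup>2 + 2 * ?b\<^sup>2"
    using sum_squares_bound[of ?a ?b] by (simp add: power2_sum)
  also have "?a\<^sup>2 \<le> rtrace S / rad" by (rule norm_transport_le[OF assms(2) U_lower[OF assms(1)] rad(1)])
  finally show ?thesis by (simp add: mult.commute)
qed

lemma integrable_inner_transport:
  "integrable P (\<lambda>S. ((transport Qstar S - mat 1) \<bullet> X) * ((transport Qstar S - mat 1) \<bullet> Y))"
proof (rule integrable_dominated)
  show "(\<lambda>S. ((transport Qstar S - mat 1) \<bullet> X) * ((transport Qstar S - mat 1) \<bullet> Y)) \<in> borel_measurable P"
    using measurable_transport[OF barycenter_pd] by simp
  fix S :: "complex^'d^'d" assume S: "S \<in> psd"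
  let ?t = "transport Qstar S - mat 1"
  have "\<bar>(?t \<bullet> X) * (?t \<bullet> Y)\<bar> \<le> (norm ?t * norm X) * (norm ?t * norm Y)"
    unfolding abs_mult by (intro mult_mono Cauchy_Schwarz_ineq2) auto
  also have "\<dots> = (norm X * norm Y) * (norm ?t)\<^sup>2" by (simp add: power2_eq_square)
  also have "\<dots> \<le> (norm X * norm Y) * (2 * (norm (mat 1 :: complex^'d^'d))\<^sup>2 + (2 / rad) * rtrace S)"
    by (intro mult_left_mono transport_sq_bound Qstar_U S) simp
  finally show "norm ((?t \<bullet> X) * (?t \<bullet> Y)) \<le>
      (norm X * norm Y) * (2 * (norm (mat 1 :: complex^'d^'d))\<^sup>2) + ((norm X * norm Y) * (2 / rad)) * rtrace S"
    by (simp add: algebra_simps)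
qed

definition cov :: "complex^'d^'d \<Rightarrow> complex^'d^'d \<Rightarrow> real" where
  "cov X Y = (LINT S|P. ((transport Qstar S - mat 1) \<bullet> X) * ((transport Qstar S - mat 1) \<bullet> Y))"

lemma cov: "cov X Y = cov Y X" "0 \<le> cov X X"
  by (auto simp: cov_def mult.commute)

text \<open>By stationarity the mean of the transport map and the identity agree as functionals on \<open>M\<close>, so
  centring at either gives the same form.\<close>

lemma inner_Sigma: "X \<in> M \<Longrightarrow> Y \<in> M \<Longrightarrow> X \<bullet> Sigma_op P Qstar Y = cov X Y"
proof -
  assume X: "X \<in> M" and Y: "Y \<in> M"
  let ?m = "mean_transport Qstar"
  have c: "(transport Qstar S - ?m) \<bullet> Z = (transport Qstar S - mat 1) \<bullet> Z" if "Z \<in> M" for S Z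
    using barycenter_stationary[OF that] by (simp add: inner_diff_left)
  let ?f = "\<lambda>S. tensor_op (transport Qstar S - ?m) (transport Qstar S - ?m) Y"
  have f: "?f S = ((transport Qstar S - mat 1) \<bullet> Y) *\<^sub>R (transport Qstar S - mat 1) +
      ((transport Qstar S - mat 1) \<bullet> Y) *\<^sub>R (mat 1 - ?m)" for S
    by (simp add: tensor_op_def c[OF Y] scaleR_add_right[symmetric])
  have i1: "integrable P (\<lambda>S. ((transport Qstar S - mat 1) \<bullet> Y) *\<^sub>R (transport Qstar S - mat 1))"
  proof -
    have "integrable P (\<lambda>S. \<Sum>b\<in>Basis. (((transport Qstar S - mat 1) \<bullet> Y) * ((transport Qstar S - mat 1) \<bullet> b)) *\<^sub>R b)"
      using integrable_inner_transport by (intro Bochner_Integration.integrable_sum integrable_scaleR_left) blast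
    moreover have "(\<Sum>b\<in>Basis. (((transport Qstar S - mat 1) \<bullet> Y) * ((transport Qstar S - mat 1) \<bullet> b)) *\<^sub>R b)
        = ((transport Qstar S - mat 1) \<bullet> Y) *\<^sub>R (transport Qstar S - mat 1)" for S
      by (subst (3) euclidean_representation[symmetric]) (simp add: scaleR_sum_right)
    ultimately show ?thesis by simp
  qed
  have i2: "integrable P (\<lambda>S. ((transport Qstar S - mat 1) \<bullet> Y) *\<^sub>R (mat 1 - ?m))"
    using integrable_transport[OF barycenter_pd] by auto
  have i: "integrable P ?f" unfolding f using i1 i2 by auto
  have "X \<bullet> Sigma_op P Qstar Y = X \<bullet> (LINT S|P. ?f S)"
    by (simp add: Sigma_op_def mean_transport_def Let_def)
  also have "\<dots> = (LINT S|P. X \<bullet> ?f S)" using i by simp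
  also have "\<dots> = cov X Y"
    unfolding cov_def
  proof (rule Bochner_Integration.integral_cong[OF refl])
    fix S
    have "X \<bullet> ?f S = ((transport Qstar S - mat 1) \<bullet> Y) * ((transport Qstar S - ?m) \<bullet> X)"
      by (simp only: tensor_op_def c[OF Y] inner_scaleR_right inner_commute[of X])
    then show "X \<bullet> ?f S = ((transport Qstar S - mat 1) \<bullet> X) * ((transport Qstar S - mat 1) \<bullet> Y)"
      by (simp only: c[OF X] mult.commute)
  qed
  finally show ?thesis .
qed

lemma Xi: "X \<in> M \<Longrightarrow> Xi_op P M Qstar X \<in> M"
    "X \<in> M \<Longrightarrow> Y \<in> M \<Longrightarrow> X \<bullet> Xi_op P M Qstar Y = cov (K X) (K Y)"
    "\<exists>\<mu>. centred_gaussian M (Xi_op P M Qstar) \<mu>"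
  unfolding Xi_op_def by (rule sandwich_operator[OF M K(1) K(4) inner_Sigma cov]; assumption)+

lemma cov_score: "X \<in> M \<Longrightarrow> Y \<in> M \<Longrightarrow> cov (K X) (K Y) = (LINT S|P. (score S \<bullet> X) * (score S \<bullet> Y))"
  by (simp add: cov_def inner_score)

lemma integrable_score_sq: "integrable P (\<lambda>S. (score S \<bullet> X)\<^sup>2)"
proof -
  have "score S \<bullet> X = (transport Qstar S - mat 1) \<bullet> K (orth_proj M X)" for S
    using inner_score[OF orth_proj(1)[OF M], of S X] inner_orth_proj[OF M score_M, of X S]
    by (simp add: inner_commute)
  then show ?thesis using integrable_inner_transport by (simp add: power2_eq_square)
qed

lemma mean_score: "integrable P score" "(LINT S|P. score S) = 0"
proof -
  have i: "integrable P (\<lambda>S. transport Qstar S - mat 1)" using integrable_transport[OF barycenter_pd] by auto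
  show "integrable P score"
    unfolding score_def[abs_def] by (rule integrable_bounded_linear[OF bounded_linear_K i])
  have "(LINT S|P. score S) = K (orth_proj M (LINT S|P. transport Qstar S - mat 1))"
    unfolding score_def by (rule integral_bounded_linear[OF bounded_linear_K i])
  also have "(LINT S|P. transport Qstar S - mat 1) = mean_transport Qstar - mat 1"
    using integrable_transport[OF barycenter_pd] by (simp add: mean_transport_def P.prob_space)
  also have "orth_proj M (mean_transport Qstar - mat 1) = 0"
    using barycenter_stationary by (intro orth_proj_unique[OF M subspace_0[OF M]]) (simp add: inner_diff_left)
  also have "K 0 = 0" using linear_0[OF K(5)] orth_proj_self[OF M subspace_0[OF M]] by simp
  finally show "(LINT S|P. score S) = 0" .
qed

end

section \<open>The multivariate central limit theorem\<close>

lemma (in prob_space) second_moment_sum: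
  fixes X :: "nat \<Rightarrow> 'a \<Rightarrow> real"
  assumes ind: "indep_vars (\<lambda>_. borel) X UNIV"
    and sq: "\<And>i. integrable M (\<lambda>\<omega>. (X i \<omega>)\<^sup>2)" "\<And>i. expectation (\<lambda>\<omega>. (X i \<omega>)\<^sup>2) = v"
    and mean: "\<And>i. expectation (X i) = 0"
  shows "integrable M (\<lambda>\<omega>. (\<Sum>i<n. X i \<omega>)\<^sup>2) \<and> expectation (\<lambda>\<omega>. (\<Sum>i<n. X i \<omega>)\<^sup>2) = real n * v"
proof (induction n)
  case (Suc n)
  have meas [measurable]: "X i \<in> borel_measurable M" for i using ind by (auto simp: indep_vars_def2)
  have int: "integrable M (X i)" for i
    by (rule square_integrable_imp_integrable[OF _ sq(1)]) simp
  have iv: "indep_var borel (X n) borel (\<lambda>\<omega>. \<Sum>i\<in>{..<n}. X i \<omega>)"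
    by (rule indep_vars_sum) (auto intro: indep_vars_subset[OF ind])
  have iS: "integrable M (\<lambda>\<omega>. \<Sum>i<n. X i \<omega>)" using int by auto
  have cross: "integrable M (\<lambda>\<omega>. X n \<omega> * (\<Sum>i<n. X i \<omega>))" "expectation (\<lambda>\<omega>. X n \<omega> * (\<Sum>i<n. X i \<omega>)) = 0"
    using indep_var_integrable[OF iv int iS] indep_var_lebesgue_integral[OF iv int iS] by (simp_all add: mean)
  have eq: "(\<Sum>i<Suc n. X i \<omega>)\<^sup>2 = (\<Sum>i<n. X i \<omega>)\<^sup>2 + 2 * (X n \<omega> * (\<Sum>i<n. X i \<omega>)) + (X n \<omega>)\<^sup>2" for \<omega>
    by (simp add: power2_sum)
  show ?case unfolding eq using Suc cross sq by (simp add: algebra_simps)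
qed simp

context iid_sample
begin

lemma integral_sample:
  fixes g :: "'s \<Rightarrow> 'c::{banach, second_countable_topology}"
  assumes [measurable]: "g \<in> borel_measurable P"
  shows "integrable \<Omega> (\<lambda>\<omega>. g (S i \<omega>)) \<longleftrightarrow> integrable P g" "(\<integral>\<omega>. g (S i \<omega>) \<partial>\<Omega>) = (\<integral>s. g s \<partial>P)"
proof -
  have "integrable (distr \<Omega> P (S i)) g \<longleftrightarrow> integrable \<Omega> (\<lambda>\<omega>. g (S i \<omega>))" by (rule integrable_distr_eq) auto
  then show "integrable \<Omega> (\<lambda>\<omega>. g (S i \<omega>)) \<longleftrightarrow> integrable P g" by (simp add: law)
  have "(\<integral>s. g s \<partial>distr \<Omega> P (S i)) = (\<integral>\<omega>. g (S i \<omega>) \<partial>\<Omega>)" by (rule integral_distr) auto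
  then show "(\<integral>\<omega>. g (S i \<omega>) \<partial>\<Omega>) = (\<integral>s. g s \<partial>P)" by (simp add: law)
qed

definition normalized_sum :: "('s \<Rightarrow> 'c::euclidean_space) \<Rightarrow> nat \<Rightarrow> 'w \<Rightarrow> 'c" where
  "normalized_sum a n \<omega> = (1 / sqrt (real n)) *\<^sub>R (\<Sum>i<n. a (S i \<omega>))"

context
  fixes a :: "'s \<Rightarrow> 'c::euclidean_space"
  assumes a: "integrable P a" and mean: "(\<integral>s. a s \<partial>P) = 0" and sq: "\<And>u. integrable P (\<lambda>s. (a s \<bullet> u)\<^sup>2)"
begin

lemma a_measurable [measurable]: "a \<in> borel_measurable P" using a by simp

lemma component_indep: "indep_vars (\<lambda>_. borel) (\<lambda>i \<omega>. a (S i \<omega>) \<bullet> u) UNIV"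
  by (rule indep_vars_compose2[OF indep]) simp

lemma component_moments:
  "expectation (\<lambda>\<omega>. a (S i \<omega>) \<bullet> u) = 0" "integrable \<Omega> (\<lambda>\<omega>. (a (S i \<omega>) \<bullet> u)\<^sup>2)"
  "expectation (\<lambda>\<omega>. (a (S i \<omega>) \<bullet> u)\<^sup>2) = (\<integral>s. (a s \<bullet> u)\<^sup>2 \<partial>P)"
  using integral_sample[of "\<lambda>s. a s \<bullet> u" i] integral_sample[of "\<lambda>s. (a s \<bullet> u)\<^sup>2" i] a mean sq by simp_all

lemma measurable_normalized_sum: "normalized_sum a n \<in> borel_measurable \<Omega>"
  unfolding normalized_sum_def[abs_def] by measurable

lemma normalized_sum_moment:
  "integrable \<Omega> (\<lambda>\<omega>. (norm (normalized_sum a n \<omega>))\<^sup>2)"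
  "expectation (\<lambda>\<omega>. (norm (normalized_sum a n \<omega>))\<^sup>2) \<le> (\<Sum>b\<in>Basis. \<integral>s. (a s \<bullet> b)\<^sup>2 \<partial>P)"
proof -
  have eq: "(norm (normalized_sum a n \<omega>))\<^sup>2 = (1 / real n) * (\<Sum>b\<in>Basis. (\<Sum>i<n. a (S i \<omega>) \<bullet> b)\<^sup>2)" for \<omega>
  proof -
    have "(norm (normalized_sum a n \<omega>))\<^sup>2 = (\<Sum>b\<in>Basis. (normalized_sum a n \<omega> \<bullet> b)\<^sup>2)"
      unfolding power2_norm_eq_inner by (subst euclidean_inner) (simp add: power2_eq_square)
    also have "\<dots> = (\<Sum>b\<in>Basis. (1 / real n) * (\<Sum>i<n. a (S i \<omega>) \<bullet> b)\<^sup>2)"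
    proof (rule sum.cong[OF refl])
      fix b
      have "normalized_sum a n \<omega> \<bullet> b = (1 / sqrt (real n)) * (\<Sum>i<n. a (S i \<omega>) \<bullet> b)"
        unfolding normalized_sum_def inner_scaleR_left inner_sum_left ..
      then show "(normalized_sum a n \<omega> \<bullet> b)\<^sup>2 = (1 / real n) * (\<Sum>i<n. a (S i \<omega>) \<bullet> b)\<^sup>2"
        by (simp only: power_mult_distrib) (simp add: power_divide)
    qed
    finally show ?thesis by (simp only: sum_distrib_left)
  qed
  note m = second_moment_sum[OF component_indep component_moments(2,3,1), where n = n]
  show "integrable \<Omega> (\<lambda>\<omega>. (norm (normalized_sum a n \<omega>))\<^sup>2)" unfolding eq using m by auto
  have "expectation (\<lambda>\<omega>. (norm (normalized_sum a n \<omega>))\<^sup>2) =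
      (1 / real n) * (\<Sum>b\<in>Basis. real n * (\<integral>s. (a s \<bullet> b)\<^sup>2 \<partial>P))"
    unfolding eq using m by (simp add: Bochner_Integration.integral_sum)
  also have "\<dots> \<le> (\<Sum>b\<in>Basis. \<integral>s. (a s \<bullet> b)\<^sup>2 \<partial>P)"
    by (cases "n = 0") (simp_all add: sum_distrib_left[symmetric] sum_nonneg)
  finally show "expectation (\<lambda>\<omega>. (norm (normalized_sum a n \<omega>))\<^sup>2) \<le> (\<Sum>b\<in>Basis. \<integral>s. (a s \<bullet> b)\<^sup>2 \<partial>P)" .
qed

text \<open>The one-dimensional theorem applies to each component of positive variance; a component of variance
  zero vanishes almost surely.\<close>

lemma normalized_sum_char:
  "(\<lambda>n. CLINT \<omega>|\<Omega>. iexp (u \<bullet> normalized_sum a n \<omega>)) \<longlonglongrightarrow> exp (- (\<integral>s. (a s \<bullet> u)\<^sup>2 \<partial>P) / 2)"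
proof -
  let ?v = "\<integral>s. (a s \<bullet> u)\<^sup>2 \<partial>P" and ?X = "\<lambda>i \<omega>. a (S i \<omega>) \<bullet> u"
  have v: "0 \<le> ?v" by simp
  have sum: "u \<bullet> normalized_sum a n \<omega> = (\<Sum>i<n. ?X i \<omega>) / sqrt (real n)" for n \<omega>
    by (simp add: normalized_sum_def inner_sum_left inner_commute[of u])
  show ?thesis
  proof (cases "?v = 0")
    case True
    have 0: "AE \<omega> in \<Omega>. \<forall>i. ?X i \<omega> = 0"
    proof (subst AE_all_countable, rule allI)
      fix i
      have "AE \<omega> in \<Omega>. (?X i \<omega>)\<^sup>2 = 0"
        using component_moments(2,3)[of i u] True
        by (subst integral_nonneg_eq_0_iff_AE[symmetric]) auto
      then show "AE \<omega> in \<Omega>. ?X i \<omega> = 0" by simp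
    qed
    have "(CLINT \<omega>|\<Omega>. iexp (u \<bullet> normalized_sum a n \<omega>)) = 1" for n
    proof -
      have "(CLINT \<omega>|\<Omega>. iexp (u \<bullet> normalized_sum a n \<omega>)) = (CLINT \<omega>|\<Omega>. 1)"
      proof (rule integral_cong_AE)
        show "AE \<omega> in \<Omega>. iexp (u \<bullet> normalized_sum a n \<omega>) = 1"
          using 0 by eventually_elim (simp add: sum)
        show "(\<lambda>\<omega>. iexp (u \<bullet> normalized_sum a n \<omega>)) \<in> borel_measurable \<Omega>"
          using measurable_normalized_sum[of n] by measurable
      qed simp
      then show ?thesis by (simp add: prob_space)
    qed
    then show ?thesis by (simp add: True)
  next
    case False
    define \<sigma> where "\<sigma> = sqrt ?v"
    have vp: "0 < ?v" using False v by linarith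
    then have \<sigma>: "\<sigma> > 0" "\<sigma>\<^sup>2 = ?v" using v by (simp_all only: \<sigma>_def real_sqrt_gt_zero real_sqrt_pow2)
    have D: "distr \<Omega> borel (?X i) = distr P borel (\<lambda>s. a s \<bullet> u)" for i
    proof -
      have "distr (distr \<Omega> P (S i)) borel (\<lambda>s. a s \<bullet> u) = distr \<Omega> borel (?X i)"
        by (subst distr_distr) (auto simp: comp_def)
      then show ?thesis by (simp add: law)
    qed
    have W: "weak_conv_m (\<lambda>n. distr \<Omega> borel (\<lambda>\<omega>. (\<Sum>i<n. ?X i \<omega>) / sqrt (real n * \<sigma>\<^sup>2))) std_normal_distribution"
      using component_moments \<sigma>
      by (intro central_limit_theorem_zero_mean[OF component_indep _ _ _ _ D]) (simp_all)
    have m [measurable]: "(\<lambda>\<omega>. (\<Sum>i<n. ?X i \<omega>) / sqrt (real n * \<sigma>\<^sup>2)) \<in> borel_measurable \<Omega>" for n by measurable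
    have "(\<lambda>n. char (distr \<Omega> borel (\<lambda>\<omega>. (\<Sum>i<n. ?X i \<omega>) / sqrt (real n * \<sigma>\<^sup>2))) \<sigma>) \<longlonglongrightarrow> char std_normal_distribution \<sigma>"
      by (rule levy_continuity1[OF _ real_dist_normal_dist W]) simp
    moreover have "char (distr \<Omega> borel (\<lambda>\<omega>. (\<Sum>i<n. ?X i \<omega>) / sqrt (real n * \<sigma>\<^sup>2))) \<sigma> =
        (CLINT \<omega>|\<Omega>. iexp (u \<bullet> normalized_sum a n \<omega>))" for n
    proof -
      have e: "\<sigma> * (x / sqrt (real n * \<sigma>\<^sup>2)) = x / sqrt (real n)" for x
        using \<sigma>(1) by (simp add: real_sqrt_mult)
      have "char (distr \<Omega> borel (\<lambda>\<omega>. (\<Sum>i<n. ?X i \<omega>) / sqrt (real n * \<sigma>\<^sup>2))) \<sigma> =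
          (CLINT \<omega>|\<Omega>. iexp (\<sigma> * ((\<Sum>i<n. ?X i \<omega>) / sqrt (real n * \<sigma>\<^sup>2))))"
        unfolding char_def by (subst integral_distr) auto
      then show ?thesis by (simp only: e sum)
    qed
    ultimately show ?thesis by (simp add: char_std_normal_distribution \<sigma>(2))
  qed
qed

end

end

section \<open>The empirical barycenter\<close>

context bw_model
begin

text \<open>The first-order term of the distance to \<open>Qstar\<close>.\<close>

definition phi :: "complex^'d^'d \<Rightarrow> real" where
  "phi z = norm (psd_sqrt Qstar ** dtransport Qstar Qstar z)"

lemma bounded_linear_dtransport: "Q \<in> pd \<Longrightarrow> bounded_linear (dtransport Q Q)"
  by (rule has_derivative_bounded_linear[OF dtransport_has_derivative[OF pd_imp_psd]])

lemma phi_inner: "bounded_linear (\<lambda>z. psd_sqrt Qstar ** dtransport Qstar Qstar z)"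
  by (rule bounded_linear_compose[OF bounded_bilinear.bounded_linear_right[OF bounded_bilinear_matrix_mult]
        bounded_linear_dtransport[OF barycenter_pd]])

lemma phi_scale: "0 \<le> r \<Longrightarrow> phi (r *\<^sub>R z) = r * phi z"
  unfolding phi_def by (simp add: linear_cmul[OF bounded_linear.linear[OF phi_inner]])

lemma phi_lipschitz: "\<exists>C\<ge>0. \<forall>x y. \<bar>phi x - phi y\<bar> \<le> C * norm (x - y)"
proof -
  obtain C where C: "0 \<le> C" "\<And>x. norm (psd_sqrt Qstar ** dtransport Qstar Qstar x) \<le> norm x * C"
    using bounded_linear.nonneg_bounded[OF phi_inner] by blast
  have "\<bar>phi x - phi y\<bar> \<le> C * norm (x - y)" for x y
    using norm_triangle_ineq3[of "psd_sqrt Qstar ** dtransport Qstar Qstar x" "psd_sqrt Qstar ** dtransport Qstar Qstar y"]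
      C(2)[of "x - y"] by (simp add: phi_def linear_diff[OF bounded_linear.linear[OF phi_inner]] mult.commute)
  then show ?thesis using C(1) by blast
qed

text \<open>In \<open>\<bar>R\<^bsup>1/2\<^esup> (transport R Qstar - 1)\<bar>\<close> the second factor vanishes at \<open>R = Qstar\<close>, so differentiability of
  the second factor and mere continuity of the first suffice.\<close>

lemma distance_expansion:
  assumes e: "0 < e"
  shows "\<exists>d>0. \<forall>R\<in>U. dist R Qstar < d \<longrightarrow> \<bar>bw_dist R Qstar - phi (R - Qstar)\<bar> \<le> e * norm (R - Qstar)"
proof -
  let ?L = "dtransport Qstar Qstar" and ?N = "psd_sqrt Qstar"
  note Qp = pd_imp_psd[OF barycenter_pd]
  obtain k where k: "k > 0" "\<And>(A::complex^'d^'d) (B::complex^'d^'d). norm (A ** B) \<le> norm A * norm B * k"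
    using matrix_mult_norm_bound by blast
  obtain B where B: "B > 0" "\<And>x. norm (?L x) \<le> norm x * B"
    using bounded_linear.pos_bounded[OF bounded_linear_dtransport[OF barycenter_pd]] by blast
  define c where "c = (norm ?N + 1 + B) * k"
  have "norm ?N + 1 + B > 0" using B(1) norm_ge_zero[of ?N] by linarith
  then have c: "c > 0" unfolding c_def using k(1) by (rule mult_pos_pos)
  define \<eta> where "\<eta> = min 1 (e / c)"
  have \<eta>: "\<eta> > 0" "\<eta> \<le> 1" "\<eta> * c \<le> e" using e c by (auto simp: \<eta>_def min_def field_simps)
  obtain d1 where d1: "d1 > 0" "\<And>R. R \<in> hermitian \<Longrightarrow> norm (R - Qstar) < d1 \<Longrightarrow>
      norm (transport R Qstar - transport Qstar Qstar - ?L (R - Qstar)) \<le> \<eta> * norm (R - Qstar)"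
    using dtransport_has_derivative[OF Qp barycenter_pd] \<eta>(1) unfolding has_derivative_within_alt by blast
  obtain d2 where d2: "d2 > 0" "\<And>R. R \<in> psd \<Longrightarrow> dist R Qstar < d2 \<Longrightarrow> dist (psd_sqrt R) ?N < \<eta>"
    using continuous_on_psd_sqrt Qp \<eta>(1) unfolding continuous_on_iff by meson
  have "\<bar>bw_dist R Qstar - phi (R - Qstar)\<bar> \<le> e * norm (R - Qstar)" if R: "R \<in> U" "dist R Qstar < min d1 d2" for R
  proof -
    let ?h = "R - Qstar" let ?r = "transport R Qstar - mat 1 - ?L ?h" and ?D = "psd_sqrt R - ?N"
    have r: "norm ?r \<le> \<eta> * norm ?h"
      using d1(2)[OF U_hermitian[OF R(1)]] R(2) by (simp add: transport_self[OF barycenter_pd] dist_norm)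
    have D: "norm ?D \<le> \<eta>" using d2(2)[OF pd_imp_psd[OF U_pd[OF R(1)]]] R(2) by (simp add: dist_norm)
    have "bw_dist R Qstar = norm (psd_sqrt R ** (transport R Qstar - mat 1))"
      by (simp add: bw_dist_def bw_dist_eq_norm[OF U_pd[OF R(1)] Qp])
    also have "psd_sqrt R ** (transport R Qstar - mat 1) = ?N ** ?L ?h + (psd_sqrt R ** ?r + ?D ** ?L ?h)"
      by (simp add: matrix_mult_diff_right matrix_mult_diff_left)
    finally have "\<bar>bw_dist R Qstar - phi ?h\<bar> \<le> norm (psd_sqrt R ** ?r + ?D ** ?L ?h)"
      unfolding phi_def using norm_triangle_ineq3[of "?N ** ?L ?h + (psd_sqrt R ** ?r + ?D ** ?L ?h)" "?N ** ?L ?h"] by simp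
    also have "\<dots> \<le> norm (psd_sqrt R) * norm ?r * k + norm ?D * norm (?L ?h) * k"
      by (intro order_trans[OF norm_triangle_ineq] add_mono k)
    also have "\<dots> \<le> (norm ?N + 1) * (\<eta> * norm ?h) * k + \<eta> * (norm ?h * B) * k"
    proof (intro add_mono mult_right_mono mult_mono r D B(2))
      have "norm (psd_sqrt R) \<le> norm ?N + norm ?D" using norm_triangle_ineq[of ?N ?D] by simp
      then show "norm (psd_sqrt R) \<le> norm ?N + 1" using D \<eta>(2) by linarith
    qed (use k \<eta> in auto)
    also have "\<dots> = (\<eta> * c) * norm ?h" by (simp add: c_def algebra_simps)
    also have "\<dots> \<le> e * norm ?h" using \<eta>(3) by (intro mult_right_mono) auto
    finally show ?thesis .
  qed
  then show ?thesis using d1(1) d2(1) by (intro exI[of _ "min d1 d2"]) auto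
qed

end

locale bw_sample = bw_model P M Q0 Qstar A + iid_sample \<Omega> P S
  for P :: "(complex^'d^'d) measure" and M Q0 Qstar A and \<Omega> :: "'w measure" and S +
  fixes Q :: "nat \<Rightarrow> 'w \<Rightarrow> complex^'d^'d"
  assumes Q_meas: "\<And>n. n \<ge> 1 \<Longrightarrow> Q n \<in> borel_measurable \<Omega>"
    and Q_emp: "\<And>n \<omega>. n \<ge> 1 \<Longrightarrow> \<omega> \<in> space \<Omega> \<Longrightarrow> is_empirical_barycenter n (\<lambda>i. S i \<omega>) A (Q n \<omega>)"
begin

definition avg_sq :: "nat \<Rightarrow> 'w \<Rightarrow> complex^'d^'d \<Rightarrow> real" where
  "avg_sq n \<omega> R = (1 / real n) * (\<Sum>i<n. bw_dist_sq R (S i \<omega>))"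

definition avg_transport :: "nat \<Rightarrow> 'w \<Rightarrow> complex^'d^'d \<Rightarrow> complex^'d^'d" where
  "avg_transport n \<omega> R = (1 / real n) *\<^sub>R (\<Sum>i<n. transport R (S i \<omega>))"

definition avg_deriv :: "nat \<Rightarrow> 'w \<Rightarrow> complex^'d^'d \<Rightarrow> complex^'d^'d \<Rightarrow> complex^'d^'d" where
  "avg_deriv n \<omega> R X = (1 / real n) *\<^sub>R (\<Sum>i<n. transport_deriv R (S i \<omega>) X)"

definition avg_cov :: "nat \<Rightarrow> 'w \<Rightarrow> complex^'d^'d \<Rightarrow> complex^'d^'d \<Rightarrow> complex^'d^'d \<Rightarrow> real" where
  "avg_cov n \<omega> R X Y =
     (1 / real n) * (\<Sum>i<n. ((transport R (S i \<omega>) - mat 1) \<bullet> X) * ((transport R (S i \<omega>) - mat 1) \<bullet> Y))"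

text \<open>Consistency, the linearisation and the plug-in limit are deterministic statements on this event:
  the uniformity in \<open>R\<close> permits evaluation at the random point \<open>Q n \<omega>\<close>.\<close>

definition good :: "'w \<Rightarrow> bool" where
  "good \<omega> \<longleftrightarrow> \<omega> \<in> space \<Omega> \<and>
     (\<lambda>n. avg_transport n \<omega> Qstar) \<longlonglongrightarrow> mean_transport Qstar \<and>
     (\<forall>e>0. \<exists>d>0. \<forall>\<^sub>F n in sequentially. \<forall>R\<in>U. dist R Qstar < d \<longrightarrow>
        (\<forall>X\<in>M. norm (avg_deriv n \<omega> R X - mean_deriv X) \<le> e * norm X)) \<and>
     (\<forall>b\<in>Basis. \<forall>b'\<in>Basis. \<forall>e>0. \<exists>d>0. \<forall>\<^sub>F n in sequentially. \<forall>R\<in>U. dist R Qstar < d \<longrightarrow>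
        norm (avg_cov n \<omega> R b b' - cov b b') < e)"

lemma sample_psd: "\<omega> \<in> space \<Omega> \<Longrightarrow> S i \<omega> \<in> psd"
  using sample_in_space space_P by blast

text \<open>The uniform law holds for each vector of a finite orthonormal basis of \<open>M\<close>, and a linear map is
  controlled by its values there.\<close>

lemma uniform_law_deriv:
  "AE \<omega> in \<Omega>. \<forall>e>0. \<exists>d>0. \<forall>\<^sub>F n in sequentially. \<forall>R\<in>U. dist R Qstar < d \<longrightarrow>
     (\<forall>X\<in>M. norm (avg_deriv n \<omega> R X - mean_deriv X) \<le> e * norm X)"
proof -
  obtain B where B: "B \<subseteq> M" "finite B" "\<And>b. b \<in> B \<Longrightarrow> norm b = 1" "\<And>x. x \<in> M \<Longrightarrow> (\<Sum>b\<in>B. (x \<bullet> b) *\<^sub>R b) = x"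
    using finite_orthonormal_basis[OF M] by blast
  have one: "AE \<omega> in \<Omega>. \<forall>e>0. \<exists>d>0. \<forall>\<^sub>F n in sequentially. \<forall>R\<in>U. dist R Qstar < d \<longrightarrow>
     norm (avg_deriv n \<omega> R b - mean_deriv b) < e" if b: "b \<in> B" for b
    unfolding avg_deriv_def mean_deriv_def
  proof (rule uniform_strong_law[OF Qstar_U, where g = "\<lambda>S. dconst * (1 + rtrace S / rad)"])
    have bh: "b \<in> hermitian" using b B(1) M_herm by blast
    show "continuous_on U (\<lambda>R. transport_deriv R S b)" if "S \<in> space P" for S
      unfolding continuous_on_def using that U_pd U_hermitian
      by (auto intro!: tendsto_transport_deriv tendsto_ident_at simp: space_P eventually_at_filter)
    show "(\<lambda>S. transport_deriv R S b) \<in> borel_measurable P" if "R \<in> U" for R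
      using that bh by (intro measurable_deriv U_pd)
    show "integrable P (\<lambda>S. dconst * (1 + rtrace S / rad))" using P_trace by auto
    show "norm (transport_deriv R S b) \<le> dconst * (1 + rtrace S / rad)" if "R \<in> U" "S \<in> space P" for R S
      using deriv_bound[OF that(1) _ bh, of S] that(2) B(3)[OF b] by (simp add: space_P)
  qed
  have "AE \<omega> in \<Omega>. \<forall>b\<in>B. \<forall>e>0. \<exists>d>0. \<forall>\<^sub>F n in sequentially. \<forall>R\<in>U. dist R Qstar < d \<longrightarrow>
     norm (avg_deriv n \<omega> R b - mean_deriv b) < e"
    using one by (subst AE_finite_all[OF B(2)]) blast
  with AE_space show ?thesis
  proof (eventually_elim, intro allI impI)
    fix \<omega> and e :: real
    assume \<omega>: "\<omega> \<in> space \<Omega>" and *: "\<forall>b\<in>B. \<forall>e>0. \<exists>d>0. \<forall>\<^sub>F n in sequentially. \<forall>R\<in>U. dist R Qstar < d \<longrightarrow>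
      norm (avg_deriv n \<omega> R b - mean_deriv b) < e" and e: "0 < e"
    define e' where "e' = e / (real (card B) + 1)"
    have e': "e' > 0" using e by (simp add: e'_def)
    have "\<forall>b\<in>B. \<exists>d>0. \<forall>\<^sub>F n in sequentially. \<forall>R\<in>U. dist R Qstar < d \<longrightarrow>
      norm (avg_deriv n \<omega> R b - mean_deriv b) < e'" using * e' by blast
    from bchoice[OF this] obtain d where dd: "\<forall>b\<in>B. 0 < d b \<and> (\<forall>\<^sub>F n in sequentially. \<forall>R\<in>U. dist R Qstar < d b \<longrightarrow>
      norm (avg_deriv n \<omega> R b - mean_deriv b) < e')" ..
    then have d: "\<And>b. b \<in> B \<Longrightarrow> d b > 0" "\<forall>b\<in>B. \<forall>\<^sub>F n in sequentially. \<forall>R\<in>U. dist R Qstar < d b \<longrightarrow>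
      norm (avg_deriv n \<omega> R b - mean_deriv b) < e'" by blast+
    define D where "D = Min (insert 1 (d ` B))"
    have D: "D > 0" "\<And>b. b \<in> B \<Longrightarrow> D \<le> d b" using B(2) d(1) by (auto simp: D_def)
    have "\<forall>\<^sub>F n in sequentially. \<forall>b\<in>B. \<forall>R\<in>U. dist R Qstar < d b \<longrightarrow>
      norm (avg_deriv n \<omega> R b - mean_deriv b) < e'" by (rule eventually_ball_finite[OF B(2) d(2)])
    then have "\<forall>\<^sub>F n in sequentially. \<forall>R\<in>U. dist R Qstar < D \<longrightarrow>
        (\<forall>X\<in>M. norm (avg_deriv n \<omega> R X - mean_deriv X) \<le> e * norm X)"
    proof (eventually_elim, intro ballI impI)
      fix n R X
      assume n: "\<forall>b\<in>B. \<forall>R\<in>U. dist R Qstar < d b \<longrightarrow> norm (avg_deriv n \<omega> R b - mean_deriv b) < e'"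
        and R: "R \<in> U" "dist R Qstar < D" and X: "X \<in> M"
      have lin: "linear (transport_deriv R' S')" if "S' \<in> psd" "R' \<in> U" for R' S'
        by (rule has_derivative_linear[OF transport_has_derivative[OF that(1) U_pd[OF that(2)]]])
      have 1: "avg_deriv n \<omega> R X = (\<Sum>b\<in>B. (X \<bullet> b) *\<^sub>R avg_deriv n \<omega> R b)"
      proof -
        have "transport_deriv R (S i \<omega>) X = (\<Sum>b\<in>B. (X \<bullet> b) *\<^sub>R transport_deriv R (S i \<omega>) b)" for i
        proof -
          note l = lin[OF sample_psd[OF \<omega>] R(1), of i]
          have "transport_deriv R (S i \<omega>) (\<Sum>b\<in>B. (X \<bullet> b) *\<^sub>R b) = (\<Sum>b\<in>B. (X \<bullet> b) *\<^sub>R transport_deriv R (S i \<omega>) b)"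
            by (simp add: linear_sum[OF l] linear_cmul[OF l])
          then show ?thesis by (simp add: B(4)[OF X])
        qed
        then have "(\<Sum>i<n. transport_deriv R (S i \<omega>) X) = (\<Sum>i<n. \<Sum>b\<in>B. (X \<bullet> b) *\<^sub>R transport_deriv R (S i \<omega>) b)"
          by simp
        also have "\<dots> = (\<Sum>b\<in>B. (X \<bullet> b) *\<^sub>R (\<Sum>i<n. transport_deriv R (S i \<omega>) b))"
          unfolding scaleR_sum_right by (rule sum.swap)
        finally show ?thesis
          unfolding avg_deriv_def by (simp only: scaleR_sum_right scaleR_left_commute)
      qed
      have 2: "mean_deriv X = (\<Sum>b\<in>B. (X \<bullet> b) *\<^sub>R mean_deriv b)"
      proof -
        have "mean_deriv X = (LINT S|P. (\<Sum>b\<in>B. (X \<bullet> b) *\<^sub>R transport_deriv Qstar S b))"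
          unfolding mean_deriv_def
        proof (rule Bochner_Integration.integral_cong[OF refl])
          fix S assume "S \<in> space P"
          then have l: "linear (transport_deriv Qstar S)" using lin Qstar_U by (simp add: space_P)
          have "transport_deriv Qstar S (\<Sum>b\<in>B. (X \<bullet> b) *\<^sub>R b) = (\<Sum>b\<in>B. (X \<bullet> b) *\<^sub>R transport_deriv Qstar S b)"
            by (simp add: linear_sum[OF l] linear_cmul[OF l])
          then show "transport_deriv Qstar S X = (\<Sum>b\<in>B. (X \<bullet> b) *\<^sub>R transport_deriv Qstar S b)" by (simp add: B(4)[OF X])
        qed
        also have "\<dots> = (\<Sum>b\<in>B. (X \<bullet> b) *\<^sub>R mean_deriv b)"
          unfolding mean_deriv_def
          using integrable_deriv[OF Qstar_U] B(1) M_herm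
          by (subst Bochner_Integration.integral_sum) auto
        finally show ?thesis .
      qed
      have "avg_deriv n \<omega> R X - mean_deriv X = (\<Sum>b\<in>B. (X \<bullet> b) *\<^sub>R (avg_deriv n \<omega> R b - mean_deriv b))"
        by (simp add: 1 2 sum_subtractf scaleR_diff_right)
      also have "norm \<dots> \<le> real (card B) * (norm X * e')"
      proof (rule sum_norm_bound)
        fix b assume b: "b \<in> B"
        have "\<bar>X \<bullet> b\<bar> \<le> norm X" using Cauchy_Schwarz_ineq2[of X b] B(3)[OF b] by simp
        moreover have "norm (avg_deriv n \<omega> R b - mean_deriv b) \<le> e'"
          using n b R D(2)[OF b] by (intro less_imp_le) auto
        ultimately show "norm ((X \<bullet> b) *\<^sub>R (avg_deriv n \<omega> R b - mean_deriv b)) \<le> norm X * e'"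
          by (simp add: mult_mono)
      qed
      also have "\<dots> = (real (card B) * e') * norm X" by simp
      also have "\<dots> \<le> e * norm X"
        using e by (intro mult_right_mono) (auto simp: e'_def field_simps)
      finally show "norm (avg_deriv n \<omega> R X - mean_deriv X) \<le> e * norm X" .
    qed
    then show "\<exists>d>0. \<forall>\<^sub>F n in sequentially. \<forall>R\<in>U. dist R Qstar < d \<longrightarrow>
        (\<forall>X\<in>M. norm (avg_deriv n \<omega> R X - mean_deriv X) \<le> e * norm X)" using D(1) by blast
  qed
qed

lemma AE_good: "AE \<omega> in \<Omega>. good \<omega>"
proof -
  have 1: "AE \<omega> in \<Omega>. (\<lambda>n. avg_transport n \<omega> Qstar) \<longlonglongrightarrow> mean_transport Qstar"
    unfolding avg_transport_def mean_transport_def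
    by (rule strong_law[OF integrable_transport[OF barycenter_pd]])
  have 3: "AE \<omega> in \<Omega>. \<forall>e>0. \<exists>d>0. \<forall>\<^sub>F n in sequentially. \<forall>R\<in>U. dist R Qstar < d \<longrightarrow>
        norm (avg_cov n \<omega> R b b' - cov b b') < e" if b: "b \<in> Basis" "b' \<in> Basis" for b b'
  proof -
    let ?f = "\<lambda>R S. ((transport R S - mat 1) \<bullet> b) * ((transport R S - mat 1) \<bullet> b')"
    have "AE \<omega> in \<Omega>. \<forall>e>0. \<exists>d>0. \<forall>\<^sub>F n in sequentially. \<forall>R\<in>U. dist R Qstar < d \<longrightarrow>
      norm ((1 / real n) *\<^sub>R (\<Sum>i<n. ?f R (S i \<omega>)) - (LINT s|P. ?f Qstar s)) < e"
    proof (rule uniform_strong_law[OF Qstar_U])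
      show "continuous_on U (\<lambda>R. ?f R S)" if "S \<in> space P" for S
        unfolding continuous_on_def using that U_pd U_hermitian
        by (auto intro!: tendsto_intros tendsto_transport tendsto_ident_at simp: space_P eventually_at_filter)
      show "?f R \<in> borel_measurable P" if "R \<in> U" for R
        using measurable_transport[OF U_pd[OF that]] by simp
      show "integrable P (\<lambda>S. 2 * (norm (mat 1 :: complex^'d^'d))\<^sup>2 + (2 / rad) * rtrace S)" using P_trace by auto
      fix R S assume R: "R \<in> U" and "S \<in> space P"
      then have S: "S \<in> psd" by (simp add: space_P)
      let ?t = "transport R S - mat 1"
      have "\<bar>(?t \<bullet> b) * (?t \<bullet> b')\<bar> \<le> norm ?t * norm ?t"
        unfolding abs_mult by (intro mult_mono Basis_le_norm b) auto
      also have "\<dots> \<le> 2 * (norm (mat 1 :: complex^'d^'d))\<^sup>2 + (2 / rad) * rtrace S"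
        using transport_sq_bound[OF R S] by (simp only: power2_eq_square)
      finally show "norm (?f R S) \<le> 2 * (norm (mat 1 :: complex^'d^'d))\<^sup>2 + (2 / rad) * rtrace S"
        by (simp only: real_norm_def)
    qed
    then show ?thesis by (simp only: avg_cov_def cov_def real_scaleR_def)
  qed
  have 4: "AE \<omega> in \<Omega>. \<forall>b\<in>Basis. \<forall>b'\<in>Basis. \<forall>e>0. \<exists>d>0. \<forall>\<^sub>F n in sequentially. \<forall>R\<in>U. dist R Qstar < d \<longrightarrow>
        norm (avg_cov n \<omega> R b b' - cov b b') < e"
    using 3 by (simp add: AE_finite_all)
  show ?thesis
    using AE_space 1 uniform_law_deriv 4 unfolding good_def by eventually_elim blast
qed

end

context bw_sample
begin

lemma emp:
  assumes "n \<ge> 1" "\<omega> \<in> space \<Omega>"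
  shows "Q n \<omega> \<in> psd" "Q n \<omega> \<in> A" "R \<in> psd \<Longrightarrow> R \<in> A \<Longrightarrow> avg_sq n \<omega> (Q n \<omega>) \<le> avg_sq n \<omega> R"
  using Q_emp[OF assms] by (auto simp: is_empirical_barycenter_def is_arg_min_def avg_sq_def not_less)

lemma emp_diff: "n \<ge> 1 \<Longrightarrow> \<omega> \<in> space \<Omega> \<Longrightarrow> Q n \<omega> - Qstar \<in> M"
  by (rule A_diff[OF emp(2) barycenter_A])

lemma avg_subgradient:
  assumes n: "n \<ge> 1" and \<omega>: "\<omega> \<in> space \<Omega>" and R: "R \<in> pd" and R': "R' \<in> psd"
  shows "avg_sq n \<omega> R' \<ge> avg_sq n \<omega> R + (mat 1 - avg_transport n \<omega> R) \<bullet> (R' - R)"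
proof -
  have n0: "real n > 0" using n by simp
  have "(mat 1 - avg_transport n \<omega> R) \<bullet> (R' - R) =
      (1 / real n) * (\<Sum>i<n. (mat 1 - transport R (S i \<omega>)) \<bullet> (R' - R))"
    using n0 by (simp add: avg_transport_def inner_diff_left inner_sum_left sum_subtractf right_diff_distrib)
  then have "avg_sq n \<omega> R + (mat 1 - avg_transport n \<omega> R) \<bullet> (R' - R) =
      (1 / real n) * (\<Sum>i<n. bw_dist_sq R (S i \<omega>) + (mat 1 - transport R (S i \<omega>)) \<bullet> (R' - R))"
    by (simp add: avg_sq_def sum.distrib distrib_left)
  also have "\<dots> \<le> avg_sq n \<omega> R'"
    unfolding avg_sq_def using bw_dist_sq_subgradient[OF R R' sample_psd[OF \<omega>]]
    by (intro mult_left_mono sum_mono) auto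
  finally show ?thesis .
qed

lemma empirical_stationary:
  assumes n: "n \<ge> 1" and \<omega>: "\<omega> \<in> space \<Omega>" and pd: "Q n \<omega> \<in> pd" and X: "X \<in> M"
  shows "(mat 1 - avg_transport n \<omega> (Q n \<omega>)) \<bullet> X = 0"
proof (rule subgradient_stationary[where V = "avg_sq n \<omega>" and A = A and G = "\<lambda>R. mat 1 - avg_transport n \<omega> R", OF pd])
  show "Q n \<omega> + r *\<^sub>R X \<in> A" for r by (rule A_add[OF emp(2)[OF n \<omega>] subspace_scale[OF M X]])
  show "X \<in> hermitian" by (rule M_herm[OF X])
  show "avg_sq n \<omega> (Q n \<omega>) \<le> avg_sq n \<omega> R" if "R \<in> psd \<inter> A" for R using that emp(3)[OF n \<omega>] by blast
  show "avg_sq n \<omega> R + (mat 1 - avg_transport n \<omega> R) \<bullet> (Q n \<omega> - R) \<le> avg_sq n \<omega> (Q n \<omega>)" if "R \<in> pd" for R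
    by (rule avg_subgradient[OF n \<omega> that emp(1)[OF n \<omega>]])
  fix q :: "nat \<Rightarrow> complex^'d^'d" assume q: "\<And>n. q n \<in> hermitian" "q \<longlonglongrightarrow> Q n \<omega>"
  show "(\<lambda>k. mat 1 - avg_transport n \<omega> (q k)) \<longlonglongrightarrow> mat 1 - avg_transport n \<omega> (Q n \<omega>)"
    unfolding avg_transport_def using q
    by (intro tendsto_intros tendsto_transport sample_psd \<omega> pd always_eventually) auto
qed

text \<open>The scalar mean value theorem on the segment from \<open>R\<close> to \<open>R'\<close>; the intermediate point depends on \<open>Y\<close>.\<close>

lemma mean_value:
  assumes \<omega>: "\<omega> \<in> space \<Omega>" and R: "R \<in> U" "R' \<in> U" and d: "dist R Qstar < d" "dist R' Qstar < d"
  shows "\<exists>\<xi>\<in>U. dist \<xi> Qstar < d \<and> (avg_transport n \<omega> R' - avg_transport n \<omega> R) \<bullet> Y = avg_deriv n \<omega> \<xi> (R' - R) \<bullet> Y"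
proof -
  let ?H = "R' - R"
  have H: "?H \<in> hermitian" using R by (intro hermitian_intros U_hermitian)
  have seg: "R + t *\<^sub>R ?H \<in> U \<and> dist (R + t *\<^sub>R ?H) Qstar < d" if "0 \<le> t" "t \<le> 1" for t
  proof -
    have eq: "R + t *\<^sub>R ?H = (1 - t) *\<^sub>R R + t *\<^sub>R R'" by (simp add: algebra_simps)
    have "R + t *\<^sub>R ?H \<in> U" unfolding eq using that by (intro convexD[OF U_convex] R) auto
    moreover have "R + t *\<^sub>R ?H \<in> ball Qstar d"
      unfolding eq using that d by (intro convexD[OF convex_ball]) (auto simp: dist_commute)
    ultimately show ?thesis by (simp add: dist_commute)
  qed
  let ?f = "\<lambda>t. avg_transport n \<omega> (R + t *\<^sub>R ?H) \<bullet> Y"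
  have "((\<lambda>t. avg_transport n \<omega> (R + t *\<^sub>R ?H) \<bullet> Y) has_derivative
      (\<lambda>r. avg_deriv n \<omega> (R + t *\<^sub>R ?H) (r *\<^sub>R ?H) \<bullet> Y)) (at t within {0..1})" if "0 \<le> t" "t \<le> 1" for t
  proof -
    have "((\<lambda>t. transport (R + t *\<^sub>R ?H) (S i \<omega>)) has_derivative
      (\<lambda>r. transport_deriv (R + t *\<^sub>R ?H) (S i \<omega>) (r *\<^sub>R ?H))) (at t within {0..1})" for i
      using transport_has_derivative[OF sample_psd[OF \<omega>] U_pd] seg[OF that] U_hermitian[OF R(1)] H
      by (intro has_derivative_line) auto
    then show ?thesis
      unfolding avg_transport_def avg_deriv_def
      by (intro has_derivative_inner_left has_derivative_scaleR_right has_derivative_sum)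
  qed
  then obtain t where t: "t \<in> {0<..<1}" "?f 1 - ?f 0 = avg_deriv n \<omega> (R + t *\<^sub>R ?H) ((1 - 0) *\<^sub>R ?H) \<bullet> Y"
    using mvt_simple[of 0 1 ?f "\<lambda>t r. avg_deriv n \<omega> (R + t *\<^sub>R ?H) (r *\<^sub>R ?H) \<bullet> Y"] by auto
  then show ?thesis
    using seg[of t] by (intro bexI[of _ "R + t *\<^sub>R ?H"]) (auto simp: inner_diff_left)
qed

lemma inner_mean_deriv: "X \<in> M \<Longrightarrow> Y \<in> M \<Longrightarrow> mean_deriv X \<bullet> Y = - (Y \<bullet> F X)"
  using inner_orth_proj[OF M, of Y "mean_deriv X"] by (simp add: F_eq inner_commute)

text \<open>On a small sphere around \<open>Qstar\<close> the empirical gradient points outwards, since the empirical Hessian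
  is close to the coercive population one.  By convexity the empirical minimiser then lies inside.\<close>

lemma consistency:
  assumes g: "good \<omega>"
  shows "(\<lambda>n. Q n \<omega>) \<longlonglongrightarrow> Qstar"
proof (rule tendstoI)
  fix e :: real assume e: "0 < e"
  have \<omega>: "\<omega> \<in> space \<Omega>" using g by (simp add: good_def)
  obtain d where d: "d > 0" and E2: "\<forall>\<^sub>F n in sequentially. \<forall>R\<in>U. dist R Qstar < d \<longrightarrow>
      (\<forall>X\<in>M. norm (avg_deriv n \<omega> R X - mean_deriv X) \<le> (lam / 2) * norm X)"
    using g lam(1) unfolding good_def by (meson half_gt_zero)
  define \<delta> where "\<delta> = min (min d rad) e / 2"
  have \<delta>: "0 < \<delta>" "\<delta> < d" "\<delta> < rad" "\<delta> < e" using d e rad(1) by (auto simp: \<delta>_def)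
  have "\<forall>\<^sub>F n in sequentially. dist (avg_transport n \<omega> Qstar) (mean_transport Qstar) < lam * \<delta> / 4"
    using g lam(1) \<delta>(1) unfolding good_def by (intro tendstoD) auto
  with E2 eventually_ge_at_top[of 1]
  show "\<forall>\<^sub>F n in sequentially. dist (Q n \<omega>) Qstar < e"
  proof eventually_elim
    case (elim n)
    note n = elim(2)
    show ?case
    proof (rule ccontr)
      assume far: "\<not> dist (Q n \<omega>) Qstar < e"
      define h where "h = Q n \<omega> - Qstar"
      have \<rho>: "norm h > \<delta>" using far \<delta>(4) by (simp add: h_def dist_norm)
      have hM: "h \<in> M" unfolding h_def by (rule emp_diff[OF n \<omega>])
      define u where "u = (1 / norm h) *\<^sub>R h"
      have u: "u \<in> M" "norm u = 1" "h = norm h *\<^sub>R u"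
        using \<rho> \<delta>(1) subspace_scale[OF M hM] by (auto simp: u_def)
      let ?x = "\<delta> *\<^sub>R u"
      have xM: "?x \<in> M" by (rule subspace_scale[OF M u(1)])
      \<comment> \<open>The point of the sphere of radius \<open>\<delta>\<close> on the segment from \<open>Qstar\<close> to \<open>Q n \<omega>\<close>.\<close>
      define R where "R = Qstar + ?x"
      have dR: "dist R Qstar = \<delta>" using u(2) \<delta>(1) by (simp add: R_def dist_norm)
      have RU: "R \<in> U"
        using dR \<delta>(3) hermitian_intros(1)[OF Qstar_hermitian M_herm[OF xM]] by (simp add: U_def R_def dist_commute)
      have RA: "R \<in> A" unfolding R_def by (rule A_add[OF barycenter_A xM])
      obtain \<xi> where \<xi>: "\<xi> \<in> U" "dist \<xi> Qstar < d"
        "(avg_transport n \<omega> R - avg_transport n \<omega> Qstar) \<bullet> u = avg_deriv n \<omega> \<xi> (R - Qstar) \<bullet> u"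
        using mean_value[OF \<omega> Qstar_U RU, of d n u] dR \<delta> d by auto
      have "(avg_deriv n \<omega> \<xi> ?x - mean_deriv ?x) \<bullet> u \<le> (lam / 2) * \<delta>"
      proof -
        have "norm (avg_deriv n \<omega> \<xi> ?x - mean_deriv ?x) \<le> (lam / 2) * norm ?x" using elim(1) \<xi> xM by blast
        then show ?thesis
          using norm_cauchy_schwarz[of "avg_deriv n \<omega> \<xi> ?x - mean_deriv ?x" u] u(2) \<delta>(1) by simp
      qed
      moreover have "mean_deriv ?x \<bullet> u \<le> - (lam * \<delta>)"
      proof -
        have "lam * (norm ?x)\<^sup>2 \<le> ?x \<bullet> F ?x" by (rule lam(2)[OF xM])
        then have "\<delta> * (lam * \<delta>) \<le> \<delta> * (u \<bullet> F ?x)" using u(2) \<delta>(1) by (simp add: power2_eq_square mult_ac)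
        then have "lam * \<delta> \<le> u \<bullet> F ?x" using \<delta>(1) by simp
        then show ?thesis by (simp add: inner_mean_deriv[OF xM u(1)])
      qed
      ultimately have 1: "(avg_transport n \<omega> R - avg_transport n \<omega> Qstar) \<bullet> u \<le> - (lam * \<delta>) / 2"
        unfolding \<xi>(3) by (simp add: R_def inner_diff_left)
      have 2: "(mean_transport Qstar - avg_transport n \<omega> Qstar) \<bullet> u \<ge> - (lam * \<delta> / 4)"
      proof -
        have "\<bar>(mean_transport Qstar - avg_transport n \<omega> Qstar) \<bullet> u\<bar> \<le> norm (mean_transport Qstar - avg_transport n \<omega> Qstar) * norm u"
          by (rule Cauchy_Schwarz_ineq2)
        then show ?thesis using elim(3) u(2) by (simp add: dist_norm norm_minus_commute)
      qed
      have "(mat 1 - avg_transport n \<omega> R) \<bullet> u = (mat 1 - mean_transport Qstar) \<bullet> u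
          + (mean_transport Qstar - avg_transport n \<omega> Qstar) \<bullet> u - (avg_transport n \<omega> R - avg_transport n \<omega> Qstar) \<bullet> u"
        by (simp add: inner_diff_left)
      also have "\<dots> \<ge> lam * \<delta> / 4" using 1 2 barycenter_stationary[OF u(1)] by simp
      finally have "0 < (mat 1 - avg_transport n \<omega> R) \<bullet> u" using lam(1) \<delta>(1) by (smt (verit) divide_pos_pos mult_pos_pos)
      then have "0 < (norm h - \<delta>) * ((mat 1 - avg_transport n \<omega> R) \<bullet> u)" using \<rho> by simp
      also have "\<dots> = (mat 1 - avg_transport n \<omega> R) \<bullet> (Q n \<omega> - R)"
      proof -
        have "Q n \<omega> - R = h - ?x" by (simp add: R_def h_def)
        also have "\<dots> = (norm h - \<delta>) *\<^sub>R u" by (subst u(3)) (simp only: scaleR_left_diff_distrib)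
        finally show ?thesis by simp
      qed
      finally have "avg_sq n \<omega> R < avg_sq n \<omega> (Q n \<omega>)"
        using avg_subgradient[OF n \<omega> U_pd[OF RU] emp(1)[OF n \<omega>]] by linarith
      then show False using emp(3)[OF n \<omega> pd_imp_psd[OF U_pd[OF RU]] RA] by simp
    qed
  qed
qed

lemma eventually_emp_U:
  assumes g: "good \<omega>"
  shows "\<forall>\<^sub>F n in sequentially. n \<ge> 1 \<and> Q n \<omega> \<in> U"
proof -
  have \<omega>: "\<omega> \<in> space \<Omega>" using g by (simp add: good_def)
  have "\<forall>\<^sub>F n in sequentially. Q n \<omega> \<in> hermitian"
    using eventually_ge_at_top[of 1] by eventually_elim (intro psd_hermitian emp(1) \<omega>)
  from eventually_conj[OF eventually_ge_at_top eventually_U[OF consistency[OF g] this]] show ?thesis .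
qed

lemma mean_score_eq:
  assumes "n \<ge> 1"
  shows "K (orth_proj M (avg_transport n \<omega> Qstar - mat 1)) = (1 / real n) *\<^sub>R (\<Sum>i<n. score (S i \<omega>))"
proof -
  have n0: "real n > 0" using assms by simp
  have "avg_transport n \<omega> Qstar - mat 1 = (1 / real n) *\<^sub>R (\<Sum>i<n. transport Qstar (S i \<omega>) - mat 1)"
    using n0 by (simp add: avg_transport_def sum_subtractf scaleR_diff_right sum_constant_scaleR del: sum_constant)
  then show ?thesis
    unfolding score_def
    by (simp only: linear_cmul[OF K(5)] linear_sum[OF K(5)])
qed

text \<open>The projected empirical score vanishes at \<open>Q n\<close>, so its increment from \<open>Qstar\<close> is minus its value
  at \<open>Qstar\<close>.  That increment is also \<open>- F (Q n - Qstar)\<close> up to a small relative error, and \<open>F\<close> has a bounded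
  inverse.\<close>

lemma linearization:
  assumes g: "good \<omega>" and e: "0 < e"
  shows "\<forall>\<^sub>F n in sequentially. norm ((Q n \<omega> - Qstar) - (1 / real n) *\<^sub>R (\<Sum>i<n. score (S i \<omega>)))
    \<le> e * norm (Q n \<omega> - Qstar)"
proof -
  have \<omega>: "\<omega> \<in> space \<Omega>" using g by (simp add: good_def)
  have le: "e * lam > 0" using e lam(1) by simp
  obtain d where d: "d > 0" and E2: "\<forall>\<^sub>F n in sequentially. \<forall>R\<in>U. dist R Qstar < d \<longrightarrow>
      (\<forall>X\<in>M. norm (avg_deriv n \<omega> R X - mean_deriv X) \<le> (e * lam) * norm X)"
    using g le unfolding good_def by meson
  have "\<forall>\<^sub>F n in sequentially. dist (Q n \<omega>) Qstar < d" using consistency[OF g] d by (rule tendstoD)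
  with eventually_emp_U[OF g] E2 show ?thesis
  proof eventually_elim
    case (elim n)
    then have n: "n \<ge> 1" and QU: "Q n \<omega> \<in> U" by auto
    let ?\<Pi> = "orth_proj M"
    let ?h = "Q n \<omega> - Qstar" and ?G = "?\<Pi> (avg_transport n \<omega> Qstar - mat 1)"
    note p = orth_proj(1)[OF M] and lp = linear_orth_proj[OF M]
    have hM: "?h \<in> M" by (rule emp_diff[OF n \<omega>])
    \<comment> \<open>The Taylor remainder.  The mean value theorem is scalar, so it is applied to the component along
      the remainder itself.\<close>
    let ?y = "?\<Pi> (avg_transport n \<omega> (Q n \<omega>) - avg_transport n \<omega> Qstar) + F ?h"
    have yM: "?y \<in> M" by (rule subspace_add[OF M p F_M[OF hM]])
    have "norm ?y \<le> e * lam * norm ?h"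
    proof -
      obtain \<xi> where \<xi>: "\<xi> \<in> U" "dist \<xi> Qstar < d"
        "(avg_transport n \<omega> (Q n \<omega>) - avg_transport n \<omega> Qstar) \<bullet> ?y = avg_deriv n \<omega> \<xi> ?h \<bullet> ?y"
        using mean_value[OF \<omega> Qstar_U QU, of d n ?y] elim d by auto
      have "?y \<bullet> ?y = (avg_transport n \<omega> (Q n \<omega>) - avg_transport n \<omega> Qstar) \<bullet> ?y + F ?h \<bullet> ?y"
        using inner_orth_proj[OF M yM] by (simp only: inner_add_left)
      also have "F ?h \<bullet> ?y = - (mean_deriv ?h \<bullet> ?y)"
        using inner_mean_deriv[OF hM yM] by (simp add: inner_commute)
      also have "(avg_transport n \<omega> (Q n \<omega>) - avg_transport n \<omega> Qstar) \<bullet> ?y + - (mean_deriv ?h \<bullet> ?y)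
          = (avg_deriv n \<omega> \<xi> ?h - mean_deriv ?h) \<bullet> ?y"
        by (simp only: \<xi>(3)) (simp add: inner_diff_left)
      also have "\<dots> \<le> norm (avg_deriv n \<omega> \<xi> ?h - mean_deriv ?h) * norm ?y" by (rule norm_cauchy_schwarz)
      also have "\<dots> \<le> (e * lam * norm ?h) * norm ?y" using elim \<xi> hM by (intro mult_right_mono) auto
      finally show ?thesis
        using e lam(1) by (cases "?y = 0") (auto simp: dot_square_norm power2_eq_square)
    qed
    moreover have "?\<Pi> (avg_transport n \<omega> (Q n \<omega>) - mat 1) = 0"
      using empirical_stationary[OF n \<omega> U_pd[OF QU]]
      by (intro orth_proj_unique[OF M subspace_0[OF M]]) (simp add: inner_diff_left)
    then have "?\<Pi> (avg_transport n \<omega> (Q n \<omega>) - avg_transport n \<omega> Qstar) = - ?G"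
      using linear_diff[OF lp, of "avg_transport n \<omega> (Q n \<omega>) - mat 1" "avg_transport n \<omega> Qstar - mat 1"] by simp
    ultimately have "norm (F ?h - F (K ?G)) \<le> e * lam * norm ?h" by (simp add: K(2)[OF p])
    then have "lam * norm (?h - K ?G) \<le> e * lam * norm ?h" using K(3)[OF hM K(1)[OF p]] by (rule order_trans[rotated])
    then have "norm (?h - K ?G) \<le> e * norm ?h" using lam(1) by (simp add: mult.assoc mult.left_commute)
    then show ?case by (simp only: mean_score_eq[OF n])
  qed
qed

text \<open>Both errors are relative to \<open>Q n - Qstar\<close>, which by \<open>linearization\<close> is at most twice the mean score;
  so the total error is small relative to the normalised sum.\<close>

lemma distance_linearization:
  assumes g: "good \<omega>" and e: "0 < e"
  shows "\<forall>\<^sub>F n in sequentially. \<bar>sqrt (real n) * bw_dist (Q n \<omega>) Qstar - phi (normalized_sum score n \<omega>)\<bar>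
    \<le> e * norm (normalized_sum score n \<omega>)"
proof -
  obtain C where C: "C \<ge> 0" "\<And>x y. \<bar>phi x - phi y\<bar> \<le> C * norm (x - y)" using phi_lipschitz by blast
  define e' where "e' = min (1 / 2) (e / (2 * (C + 1)))"
  have e': "0 < e'" "e' \<le> 1 / 2"
    using e C(1) by (simp_all only: e'_def min.cobounded1) (simp add: add_nonneg_pos)
  have "2 * (C + 1) * e' \<le> 2 * (C + 1) * (e / (2 * (C + 1)))"
    using C(1) by (intro mult_left_mono) (auto simp: e'_def)
  also have "\<dots> = e" using C(1) by simp
  finally have e'': "2 * (C + 1) * e' \<le> e" .
  obtain d where d: "d > 0" "\<And>R. R \<in> U \<Longrightarrow> dist R Qstar < d \<Longrightarrow> \<bar>bw_dist R Qstar - phi (R - Qstar)\<bar> \<le> e' * norm (R - Qstar)"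
    using distance_expansion[OF e'(1)] by blast
  have "\<forall>\<^sub>F n in sequentially. dist (Q n \<omega>) Qstar < d" using consistency[OF g] d(1) by (rule tendstoD)
  with eventually_emp_U[OF g] linearization[OF g e'(1)] show ?thesis
  proof eventually_elim
    case (elim n)
    let ?h = "Q n \<omega> - Qstar" and ?k = "(1 / real n) *\<^sub>R (\<Sum>i<n. score (S i \<omega>))"
    have n: "n \<ge> 1" and QU: "Q n \<omega> \<in> U" using elim by auto
    have "norm ?h \<le> norm ?k + norm (?h - ?k)" using norm_triangle_ineq[of ?k "?h - ?k"] by simp
    also have "\<dots> \<le> norm ?k + (1/2) * norm ?h"
      using elim(2) mult_right_mono[OF e'(2) norm_ge_zero[of ?h]] by linarith
    finally have hk: "norm ?h \<le> 2 * norm ?k" by linarith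
    have "\<bar>bw_dist (Q n \<omega>) Qstar - phi ?k\<bar> \<le> \<bar>bw_dist (Q n \<omega>) Qstar - phi ?h\<bar> + \<bar>phi ?h - phi ?k\<bar>" by linarith
    also have "\<dots> \<le> e' * norm ?h + C * (e' * norm ?h)"
      using d(2)[OF QU] elim C(1) by (intro add_mono order_trans[OF C(2)] mult_left_mono) auto
    also have "\<dots> = ((C + 1) * e') * norm ?h" by (simp add: algebra_simps)
    also have "\<dots> \<le> ((C + 1) * e') * (2 * norm ?k)" using C(1) e'(1) hk by (intro mult_left_mono) auto
    also have "\<dots> = (2 * (C + 1) * e') * norm ?k" by simp
    also have "\<dots> \<le> e * norm ?k" using e'' by (intro mult_right_mono) auto
    finally have *: "\<bar>bw_dist (Q n \<omega>) Qstar - phi ?k\<bar> \<le> e * norm ?k" .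
    have W: "normalized_sum score n \<omega> = sqrt (real n) *\<^sub>R ?k"
    proof -
      have "sqrt (real n) * (1 / real n) = 1 / sqrt (real n)" using n by (simp add: field_simps)
      then show ?thesis by (simp add: normalized_sum_def)
    qed
    have "\<bar>sqrt (real n) * bw_dist (Q n \<omega>) Qstar - phi (normalized_sum score n \<omega>)\<bar> =
        sqrt (real n) * \<bar>bw_dist (Q n \<omega>) Qstar - phi ?k\<bar>"
      unfolding W by (simp only: phi_scale[OF real_sqrt_ge_zero[OF of_nat_0_le_iff]] right_diff_distrib[symmetric] abs_mult) simp
    also have "\<dots> \<le> sqrt (real n) * (e * norm ?k)" by (intro mult_left_mono *) simp
    also have "\<dots> = e * norm (normalized_sum score n \<omega>)" unfolding W by simp
    finally show ?case .
  qed
qed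

section \<open>The limit law of the distance\<close>

lemma distance_measurable: "(\<lambda>\<omega>. sqrt (real n) * bw_dist (Q n \<omega>) Qstar) \<in> borel_measurable \<Omega>"
proof (cases "n = 0")
  case False
  then have n: "n \<ge> 1" by simp
  have "Q n \<in> measurable \<Omega> (restrict_space borel psd)"
    using Q_meas[OF n] emp(1)[OF n] by (intro measurable_restrict_space2) auto
  moreover have "continuous_on psd (\<lambda>R. bw_dist R Qstar)"
    unfolding bw_dist_def continuous_on_def using barycenter_psd
    by (auto intro!: tendsto_real_sqrt tendsto_bw_dist_sq tendsto_ident_at simp: eventually_at_filter)
  then have "(\<lambda>R. bw_dist R Qstar) \<in> borel_measurable (restrict_space borel psd)"
    by (rule borel_measurable_continuous_on_restrict)
  ultimately have "(\<lambda>\<omega>. bw_dist (Q n \<omega>) Qstar) \<in> borel_measurable \<Omega>" by (rule measurable_compose)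
  then show ?thesis by simp
qed simp

abbreviation limit_law :: "(complex^'d^'d) measure" where
  "limit_law \<equiv> gaussian_law M (Xi_op P M Qstar)"

lemma limit_gaussian: "centred_gaussian M (Xi_op P M Qstar) limit_law"
  by (rule centred_gaussian_gaussian_law[OF M Xi(3)])

lemma Xi_form: "orth_proj M u \<bullet> Xi_op P M Qstar (orth_proj M u) = (LINT S|P. (score S \<bullet> u)\<^sup>2)"
proof -
  note p = orth_proj(1)[OF M]
  have "score S \<bullet> orth_proj M u = score S \<bullet> u" for S
    using inner_orth_proj[OF M score_M, of u S] by (simp add: inner_commute)
  then show ?thesis by (simp add: Xi(2)[OF p p] cov_score[OF p p] power2_eq_square)
qed

lemma measure_tendsto_0:
  assumes N: "\<And>n. A' n \<in> sets \<Omega>" and ev: "AE \<omega> in \<Omega>. \<forall>\<^sub>F n in sequentially. \<omega> \<notin> A' n"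
  shows "(\<lambda>n. prob (A' n)) \<longlonglongrightarrow> 0"
proof -
  have "(\<lambda>n. \<integral>\<omega>. indicator (A' n) \<omega> \<partial>\<Omega>) \<longlonglongrightarrow> (\<integral>\<omega>. (0::real) \<partial>\<Omega>)"
  proof (rule integral_dominated_convergence[where w = "\<lambda>_. 1"])
    show "AE \<omega> in \<Omega>. (\<lambda>n. indicator (A' n) \<omega> :: real) \<longlonglongrightarrow> 0"
      using ev
    proof eventually_elim
      case (elim \<omega>)
      then have "\<forall>\<^sub>F n in sequentially. indicator (A' n) \<omega> = (0::real)" by eventually_elim simp
      then show ?case by (rule tendsto_eventually)
    qed
  qed (use N in \<open>auto split: split_indicator\<close>)
  then show ?thesis using N sets.sets_into_space by (simp add: Int_absorb2)
qed

lemma phi_measurable [measurable]: "phi \<in> borel_measurable borel"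
proof -
  have "(\<lambda>z. psd_sqrt Qstar ** dtransport Qstar Qstar z) \<in> borel_measurable borel"
    by (intro borel_measurable_continuous_onI linear_continuous_on phi_inner)
  then show ?thesis unfolding phi_def[abs_def] by measurable
qed

theorem distance_weak_limit:
  "weak_conv_m (\<lambda>n. distr \<Omega> borel (\<lambda>\<omega>. sqrt (real n) * bw_dist (Q n \<omega>) Qstar)) (distr limit_law borel phi)"
proof -
  let ?W = "normalized_sum score"
  note ms = mean_score integrable_score_sq
  note G = limit_gaussian
  have Wm [measurable]: "?W n \<in> borel_measurable \<Omega>" for n by (rule measurable_normalized_sum[OF ms])
  define k where "k = (\<Sum>b\<in>Basis. LINT S|P. (score S \<bullet> b)\<^sup>2)"
  interpret char_convergence "\<lambda>_. \<Omega>" ?W limit_law k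
  proof (rule char_convergence.intro)
    show "prob_space \<Omega>" by (rule prob_space_axioms)
    show "prob_space limit_law" "sets limit_law = sets borel"
      using gaussian_prob[OF M G] gaussian_sets[OF M G] .
    show "integrable \<Omega> (\<lambda>\<omega>. (norm (?W n \<omega>))\<^sup>2)" "expectation (\<lambda>\<omega>. (norm (?W n \<omega>))\<^sup>2) \<le> k" for n
      unfolding k_def by (rule normalized_sum_moment[OF ms])+
    show "integrable limit_law (\<lambda>z. (norm z)\<^sup>2)" by (rule gaussian_norm_moment[OF M G])
    show "(LINT z|limit_law. (norm z)\<^sup>2) \<le> k"
      unfolding gaussian_norm_moment(2)[OF M G] Xi_form k_def by simp
    show "(\<lambda>n. CLINT \<omega>|\<Omega>. iexp (u \<bullet> ?W n \<omega>)) \<longlonglongrightarrow> (CLINT z|limit_law. iexp (u \<bullet> z))" for u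
      using normalized_sum_char[OF ms, of u] unfolding gaussian_char[OF M G] Xi_form by simp
  qed (rule Wm)
  obtain C where C: "\<And>x y. \<bar>phi x - phi y\<bar> \<le> C * norm (x - y)" using phi_lipschitz by blast
  show ?thesis
  proof (rule weak_conv_compose[OF C distance_measurable])
    fix e :: real assume e: "0 < e"
    show "(\<lambda>n. prob {\<omega>\<in>space \<Omega>. e * norm (?W n \<omega>) < \<bar>sqrt (real n) * bw_dist (Q n \<omega>) Qstar - phi (?W n \<omega>)\<bar>}) \<longlonglongrightarrow> 0"
    proof (rule measure_tendsto_0)
      show "{\<omega>\<in>space \<Omega>. e * norm (?W n \<omega>) < \<bar>sqrt (real n) * bw_dist (Q n \<omega>) Qstar - phi (?W n \<omega>)\<bar>} \<in> sets \<Omega>" for n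
        using distance_measurable[of n] by measurable
      show "AE \<omega> in \<Omega>. \<forall>\<^sub>F n in sequentially.
          \<omega> \<notin> {\<omega>\<in>space \<Omega>. e * norm (?W n \<omega>) < \<bar>sqrt (real n) * bw_dist (Q n \<omega>) Qstar - phi (?W n \<omega>)\<bar>}"
        using AE_good
      proof eventually_elim
        case (elim \<omega>)
        show ?case using distance_linearization[OF elim e] by eventually_elim auto
      qed
    qed
  qed
qed

end

section \<open>The plug-in limit law\<close>

context bw_sample
begin

context
  fixes \<omega> :: 'w
  assumes g: "good \<omega>"
begin

abbreviation "Fh n \<equiv> F_hat n (\<lambda>i. S i \<omega>) M (Q n \<omega>)"
abbreviation "Kh n \<equiv> inv_into M (Fh n)"
abbreviation "Sh n \<equiv> Sigma_hat n (\<lambda>i. S i \<omega>) (Q n \<omega>)"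
abbreviation "Xh n \<equiv> Xi_hat n (\<lambda>i. S i \<omega>) M (Q n \<omega>)"

lemma good_space: "\<omega> \<in> space \<Omega>" using g by (simp add: good_def)

lemma Fh_eq:
  assumes n: "n \<ge> 1" and QU: "Q n \<omega> \<in> U" and X: "X \<in> M"
  shows "Fh n X = - orth_proj M (avg_deriv n \<omega> (Q n \<omega>) X)"
proof -
  note l = linear_orth_proj[OF M]
  have "dtransport (Q n \<omega>) (S i \<omega>) X = transport_deriv (Q n \<omega>) (S i \<omega>) X" for i
    by (rule dtransport_eq[OF sample_psd[OF good_space] U_pd[OF QU] M_herm[OF X]])
  then show ?thesis
    by (simp add: F_hat_def compress_def avg_deriv_def linear_cmul[OF l] linear_sum[OF l])
qed

lemma Fh_M: "n \<ge> 1 \<Longrightarrow> Q n \<omega> \<in> U \<Longrightarrow> X \<in> M \<Longrightarrow> Fh n X \<in> M"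
  by (simp add: Fh_eq orth_proj(1)[OF M] subspace_neg[OF M])

lemma inner_Fh:
  assumes n: "n \<ge> 1" and QU: "Q n \<omega> \<in> U" and X: "X \<in> M" and Y: "Y \<in> M"
  shows "X \<bullet> Fh n Y = - (X \<bullet> avg_deriv n \<omega> (Q n \<omega>) Y)"
  using inner_orth_proj[OF M X, of "avg_deriv n \<omega> (Q n \<omega>) Y"] by (simp add: Fh_eq[OF n QU Y] inner_commute)

lemma Fh_symmetric:
  assumes n: "n \<ge> 1" and QU: "Q n \<omega> \<in> U" and X: "X \<in> M" and Y: "Y \<in> M"
  shows "X \<bullet> Fh n Y = Fh n X \<bullet> Y"
proof -
  have s: "X \<bullet> transport_deriv (Q n \<omega>) (S i \<omega>) Y = Y \<bullet> transport_deriv (Q n \<omega>) (S i \<omega>) X" for i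
    using transport_deriv_symmetric[OF sample_psd[OF good_space] U_pd[OF QU], of X i Y] by (simp only: inner_commute)
  have "X \<bullet> avg_deriv n \<omega> (Q n \<omega>) Y = Y \<bullet> avg_deriv n \<omega> (Q n \<omega>) X"
    unfolding avg_deriv_def inner_scaleR_right inner_sum_right by (simp only: s)
  then have "X \<bullet> Fh n Y = Y \<bullet> Fh n X" by (simp only: inner_Fh[OF n QU X Y] inner_Fh[OF n QU Y X])
  then show ?thesis by (simp only: inner_commute)
qed

lemma Fh_close:
  assumes e: "0 < e"
  shows "\<forall>\<^sub>F n in sequentially. \<forall>X\<in>M. norm (Fh n X - F X) \<le> e * norm X"
proof -
  obtain d where d: "d > 0" and E: "\<forall>\<^sub>F n in sequentially. \<forall>R\<in>U. dist R Qstar < d \<longrightarrow>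
      (\<forall>X\<in>M. norm (avg_deriv n \<omega> R X - mean_deriv X) \<le> e * norm X)"
    using g e unfolding good_def by meson
  have "\<forall>\<^sub>F n in sequentially. dist (Q n \<omega>) Qstar < d" using consistency[OF g] d by (rule tendstoD)
  with eventually_emp_U[OF g] E show ?thesis
  proof (eventually_elim, intro ballI)
    fix n X
    assume 1: "1 \<le> n \<and> Q n \<omega> \<in> U" "dist (Q n \<omega>) Qstar < d" and X: "X \<in> M"
      and E: "\<forall>R\<in>U. dist R Qstar < d \<longrightarrow> (\<forall>X\<in>M. norm (avg_deriv n \<omega> R X - mean_deriv X) \<le> e * norm X)"
    have "Fh n X - F X = - orth_proj M (avg_deriv n \<omega> (Q n \<omega>) X - mean_deriv X)"
      using 1 by (simp add: Fh_eq X F_eq linear_diff[OF linear_orth_proj[OF M]])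
    then have "norm (Fh n X - F X) \<le> norm (avg_deriv n \<omega> (Q n \<omega>) X - mean_deriv X)"
      using norm_orth_proj_le[OF M] by simp
    also have "\<dots> \<le> e * norm X" using E 1 X by blast
    finally show "norm (Fh n X - F X) \<le> e * norm X" .
  qed
qed

text \<open>Coercivity of the estimated Hessian with half the constant of \<open>F\<close> makes its inverse, and with it the
  plug-in covariance, well defined.\<close>

definition regular :: "nat \<Rightarrow> bool" where
  "regular n \<longleftrightarrow> n \<ge> 1 \<and> Q n \<omega> \<in> U \<and> (\<forall>X\<in>M. (lam / 2) * (norm X)\<^sup>2 \<le> X \<bullet> Fh n X)"

lemma eventually_regular: "\<forall>\<^sub>F n in sequentially. regular n"
proof -
  have "\<forall>\<^sub>F n in sequentially. \<forall>X\<in>M. norm (Fh n X - F X) \<le> (lam / 2) * norm X"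
    using lam(1) by (intro Fh_close) simp
  with eventually_emp_U[OF g] show ?thesis
  proof eventually_elim
    case (elim n)
    have "(lam / 2) * (norm X)\<^sup>2 \<le> X \<bullet> Fh n X" if X: "X \<in> M" for X
    proof -
      have "\<bar>X \<bullet> (Fh n X - F X)\<bar> \<le> norm X * ((lam / 2) * norm X)"
        using elim(2) X by (intro order_trans[OF Cauchy_Schwarz_ineq2] mult_left_mono) auto
      also have "\<dots> = (lam / 2) * (norm X)\<^sup>2" by (simp add: power2_eq_square)
      finally have "\<bar>X \<bullet> Fh n X - X \<bullet> F X\<bar> \<le> (lam / 2) * (norm X)\<^sup>2" by (simp only: inner_diff_right)
      moreover have "lam * (norm X)\<^sup>2 \<le> X \<bullet> F X" by (rule lam(2)[OF X])
      ultimately show ?thesis by linarith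
    qed
    then show ?case using elim(1) by (simp add: regular_def)
  qed
qed

lemma Kh:
  assumes r: "regular n"
  shows "Y \<in> M \<Longrightarrow> Kh n Y \<in> M" "Y \<in> M \<Longrightarrow> Fh n (Kh n Y) = Y"
    "X \<in> M \<Longrightarrow> Y \<in> M \<Longrightarrow> (lam / 2) * norm (X - Y) \<le> norm (Fh n X - Fh n Y)"
    "X \<in> M \<Longrightarrow> Y \<in> M \<Longrightarrow> X \<bullet> Kh n Y = Kh n X \<bullet> Y"
proof -
  have n: "n \<ge> 1" and QU: "Q n \<omega> \<in> U" and c: "\<And>X. X \<in> M \<Longrightarrow> (lam / 2) * (norm X)\<^sup>2 \<le> X \<bullet> Fh n X"
    using r by (auto simp: regular_def)
  have l: "lam / 2 > 0" using lam(1) by simp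
  note * = coercive_inverse[OF M Fh_M[OF n QU] Fh_symmetric[OF n QU] c l]
  show "Y \<in> M \<Longrightarrow> Kh n Y \<in> M" by (rule *(1); assumption)
  show "Y \<in> M \<Longrightarrow> Fh n (Kh n Y) = Y" by (rule *(2); assumption)
  show "X \<in> M \<Longrightarrow> Y \<in> M \<Longrightarrow> (lam / 2) * norm (X - Y) \<le> norm (Fh n X - Fh n Y)" by (rule *(3); assumption)
  show "X \<in> M \<Longrightarrow> Y \<in> M \<Longrightarrow> X \<bullet> Kh n Y = Kh n X \<bullet> Y" by (rule *(4); assumption)
qed

text \<open>Apply the lower bound for \<open>Fh n\<close> to \<open>K X\<close> and \<open>Kh n X\<close>: both have nearly the same image.\<close>

lemma Kh_tendsto:
  assumes X: "X \<in> M"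
  shows "(\<lambda>n. Kh n X) \<longlonglongrightarrow> K X"
proof (rule tendstoI)
  fix e :: real assume e: "0 < e"
  define e' where "e' = e * lam / (4 * (norm (K X) + 1))"
  have e': "0 < e'" using e lam(1) by (simp add: e'_def add_nonneg_pos)
  show "\<forall>\<^sub>F n in sequentially. dist (Kh n X) (K X) < e"
    using Fh_close[OF e'] eventually_regular
  proof eventually_elim
    case (elim n)
    have KM: "K X \<in> M" by (rule K(1)[OF X])
    have "(lam / 2) * norm (K X - Kh n X) \<le> norm (Fh n (K X) - Fh n (Kh n X))"
      by (rule Kh(3)[OF elim(2) KM Kh(1)[OF elim(2) X]])
    also have "Fh n (K X) - Fh n (Kh n X) = Fh n (K X) - F (K X)" by (simp add: Kh(2)[OF elim(2) X] K(2)[OF X])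
    also have "norm \<dots> \<le> e' * norm (K X)" using elim(1) KM by blast
    also have "\<dots> \<le> e' * (norm (K X) + 1)" using e' by (intro mult_left_mono) auto
    also have "\<dots> = (lam / 2) * (e / 2)"
    proof -
      have "0 < norm (K X) + 1" by (simp add: add_nonneg_pos)
      then show ?thesis unfolding e'_def by (simp add: divide_simps del: distrib_left_numeral)
    qed
    finally have "norm (K X - Kh n X) \<le> e / 2" using lam(1) by simp
    then show ?case using e by (simp add: dist_norm norm_minus_commute)
  qed
qed

lemma inner_Sh: "X \<bullet> Sh n Y = avg_cov n \<omega> (Q n \<omega>) X Y"
  by (simp add: Sigma_hat_def tensor_op_def avg_cov_def inner_sum_right inner_commute[of X] mult.commute)

lemma avg_cov: "avg_cov n \<omega> R X Y = avg_cov n \<omega> R Y X" "0 \<le> avg_cov n \<omega> R X X"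
  by (auto simp: avg_cov_def mult.commute intro!: divide_nonneg_nonneg sum_nonneg)

lemma Xh:
  assumes r: "regular n"
  shows "X \<in> M \<Longrightarrow> Y \<in> M \<Longrightarrow> X \<bullet> Xh n Y = avg_cov n \<omega> (Q n \<omega>) (Kh n X) (Kh n Y)"
    "centred_gaussian M (Xh n) (gaussian_law M (Xh n))"
proof -
  note * = sandwich_operator[where K = "Kh n" and \<Sigma> = "Sh n" and b = "avg_cov n \<omega> (Q n \<omega>)",
      OF M Kh(1)[OF r] Kh(4)[OF r] inner_Sh avg_cov, folded Xi_hat_def]
  show "X \<in> M \<Longrightarrow> Y \<in> M \<Longrightarrow> X \<bullet> Xh n Y = avg_cov n \<omega> (Q n \<omega>) (Kh n X) (Kh n Y)" by (rule *(2); assumption)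
  have "\<exists>\<mu>. centred_gaussian M (Xh n) \<mu>" by (rule *(3); assumption)
  then show "centred_gaussian M (Xh n) (gaussian_law M (Xh n))" by (rule centred_gaussian_gaussian_law[OF M])
qed

text \<open>In coordinates the estimated form is separated from its moving arguments \<open>Kh n X\<close>.\<close>

lemma cov_expand:
  shows "cov X X = (\<Sum>b\<in>Basis. \<Sum>b'\<in>Basis. (X \<bullet> b) * (X \<bullet> b') * cov b b')"
  and avg_cov_expand: "avg_cov n \<omega> R X X = (\<Sum>b\<in>Basis. \<Sum>b'\<in>Basis. (X \<bullet> b) * (X \<bullet> b') * avg_cov n \<omega> R b b')"
proof -
  have e: "(t \<bullet> X) * (t \<bullet> X) = (\<Sum>b\<in>Basis. \<Sum>b'\<in>Basis. (X \<bullet> b) * (X \<bullet> b') * ((t \<bullet> b) * (t \<bullet> b')))" for t :: "complex^'d^'d"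
    by (subst (1 2) euclidean_inner) (simp add: sum_product mult_ac)
  show "cov X X = (\<Sum>b\<in>Basis. \<Sum>b'\<in>Basis. (X \<bullet> b) * (X \<bullet> b') * cov b b')"
    unfolding cov_def e using integrable_inner_transport
    by (simp add: Bochner_Integration.integral_sum Bochner_Integration.integrable_sum)
  have "(\<Sum>i<n. \<Sum>b\<in>Basis. \<Sum>b'\<in>Basis. (X \<bullet> b) * (X \<bullet> b') * h i b b') =
      (\<Sum>b\<in>Basis. \<Sum>b'\<in>Basis. (X \<bullet> b) * (X \<bullet> b') * (\<Sum>i<n. h i b b'))" for h :: "nat \<Rightarrow> complex^'d^'d \<Rightarrow> complex^'d^'d \<Rightarrow> real"
    unfolding sum_distrib_left by (subst sum.swap, rule sum.cong[OF refl], rule sum.swap)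
  then show "avg_cov n \<omega> R X X = (\<Sum>b\<in>Basis. \<Sum>b'\<in>Basis. (X \<bullet> b) * (X \<bullet> b') * avg_cov n \<omega> R b b')"
    unfolding avg_cov_def e by (simp add: sum_distrib_left mult_ac)
qed

lemma avg_cov_tendsto:
  assumes b: "b \<in> Basis" "b' \<in> Basis"
  shows "(\<lambda>n. avg_cov n \<omega> (Q n \<omega>) b b') \<longlonglongrightarrow> cov b b'"
proof (rule tendstoI)
  fix e :: real assume "0 < e"
  then obtain d where d: "d > 0" and E: "\<forall>\<^sub>F n in sequentially. \<forall>R\<in>U. dist R Qstar < d \<longrightarrow> norm (avg_cov n \<omega> R b b' - cov b b') < e"
    using g b unfolding good_def by blast
  have "\<forall>\<^sub>F n in sequentially. dist (Q n \<omega>) Qstar < d" using consistency[OF g] d by (rule tendstoD)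
  with eventually_emp_U[OF g] E show "\<forall>\<^sub>F n in sequentially. dist (avg_cov n \<omega> (Q n \<omega>) b b') (cov b b') < e"
    by eventually_elim (simp add: dist_norm)
qed

lemma Xh_tendsto:
  assumes X: "X \<in> M"
  shows "(\<lambda>n. X \<bullet> Xh n X) \<longlonglongrightarrow> X \<bullet> Xi_op P M Qstar X"
proof -
  have "(\<lambda>n. avg_cov n \<omega> (Q n \<omega>) (Kh n X) (Kh n X)) \<longlonglongrightarrow> cov (K X) (K X)"
    unfolding cov_expand avg_cov_expand by (intro tendsto_intros avg_cov_tendsto Kh_tendsto X)
  moreover have "\<forall>\<^sub>F n in sequentially. X \<bullet> Xh n X = avg_cov n \<omega> (Q n \<omega>) (Kh n X) (Kh n X)"
    using eventually_regular by eventually_elim (rule Xh(1)[OF _ X X])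
  ultimately show ?thesis unfolding Xi(2)[OF X X] by (rule Lim_transform_eventually[OF _ eventually_mono]) simp
qed

definition phih :: "nat \<Rightarrow> complex^'d^'d \<Rightarrow> real" where
  "phih n z = norm (psd_sqrt (Q n \<omega>) ** dtransport (Q n \<omega>) (Q n \<omega>) z)"

lemma phih_measurable:
  assumes "Q n \<omega> \<in> U"
  shows "phih n \<in> borel_measurable borel"
proof -
  have "bounded_linear (\<lambda>z. psd_sqrt (Q n \<omega>) ** dtransport (Q n \<omega>) (Q n \<omega>) z)"
    by (rule bounded_linear_compose[OF bounded_bilinear.bounded_linear_right[OF bounded_bilinear_matrix_mult]
          bounded_linear_dtransport[OF U_pd[OF assms]]])
  then have "(\<lambda>z. psd_sqrt (Q n \<omega>) ** dtransport (Q n \<omega>) (Q n \<omega>) z) \<in> borel_measurable borel"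
    by (intro borel_measurable_continuous_onI linear_continuous_on)
  then show ?thesis unfolding phih_def[abs_def] by measurable
qed

text \<open>The differential of \<open>transport R R\<close> is minus the solution operator of the Sylvester equation, which is
  continuous in \<open>R\<close>; closeness on a finite basis of \<open>M\<close> gives closeness relative to the norm.\<close>

lemma phih_close:
  assumes e: "0 < e"
  shows "\<forall>\<^sub>F n in sequentially. \<forall>z\<in>M. \<bar>phih n z - phi z\<bar> \<le> e * norm z"
proof -
  obtain B where B: "B \<subseteq> M" "finite B" "\<And>b. b \<in> B \<Longrightarrow> norm b = 1" "\<And>x. x \<in> M \<Longrightarrow> (\<Sum>b\<in>B. (x \<bullet> b) *\<^sub>R b) = x"
    using finite_orthonormal_basis[OF M] by blast
  define L where "L R z = psd_sqrt R ** sylvester R z" for R z :: "complex^'d^'d"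
  define e' where "e' = e / (real (card B) + 1)"
  have e': "0 < e'" using e by (simp add: e'_def)
  have herm: "\<forall>\<^sub>F n in sequentially. Q n \<omega> \<in> hermitian"
    using eventually_emp_U[OF g] by eventually_elim (simp add: U_hermitian)
  have "\<forall>b\<in>B. \<forall>\<^sub>F n in sequentially. dist (L (Q n \<omega>) b) (L Qstar b) < e'"
  proof
    fix b assume "b \<in> B"
    have "(\<lambda>n. L (Q n \<omega>) b) \<longlonglongrightarrow> L Qstar b"
      unfolding L_def using consistency[OF g] herm barycenter_pd
      by (intro tendsto_intros tendsto_psd_sqrt tendsto_sylvester)
    then show "\<forall>\<^sub>F n in sequentially. dist (L (Q n \<omega>) b) (L Qstar b) < e'" using e' by (rule tendstoD)
  qed
  then have "\<forall>\<^sub>F n in sequentially. \<forall>b\<in>B. dist (L (Q n \<omega>) b) (L Qstar b) < e'"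
    by (rule eventually_ball_finite[OF B(2)])
  with eventually_emp_U[OF g] show ?thesis
  proof (eventually_elim, intro ballI)
    fix n z
    assume n: "1 \<le> n \<and> Q n \<omega> \<in> U" and E: "\<forall>b\<in>B. dist (L (Q n \<omega>) b) (L Qstar b) < e'" and z: "z \<in> M"
    have eq: "norm (psd_sqrt R ** dtransport R R z) = norm (L R z)" if "R \<in> pd" for R
      by (simp add: dtransport_self[OF that M_herm[OF z]] L_def matrix_mult_minus_right)
    have lin: "linear (L R)" if "R \<in> pd" for R
    proof -
      have "linear ((**) (psd_sqrt R) \<circ> sylvester R)"
        by (rule linear_compose[OF linear_sylvester[OF that]
              bounded_linear.linear[OF bounded_bilinear.bounded_linear_right[OF bounded_bilinear_matrix_mult]]])
      then show ?thesis by (simp add: L_def[abs_def] comp_def)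
    qed
    have expand: "L R z = (\<Sum>b\<in>B. (z \<bullet> b) *\<^sub>R L R b)" if "R \<in> pd" for R
    proof -
      have "L R (\<Sum>b\<in>B. (z \<bullet> b) *\<^sub>R b) = (\<Sum>b\<in>B. (z \<bullet> b) *\<^sub>R L R b)"
        by (simp add: linear_sum[OF lin[OF that]] linear_cmul[OF lin[OF that]])
      then show ?thesis by (simp add: B(4)[OF z])
    qed
    have Qpd: "Q n \<omega> \<in> pd" using n U_pd by blast
    have "\<bar>phih n z - phi z\<bar> \<le> norm (L (Q n \<omega>) z - L Qstar z)"
      unfolding phih_def phi_def eq[OF Qpd] eq[OF barycenter_pd] by (rule norm_triangle_ineq3)
    also have "L (Q n \<omega>) z - L Qstar z = (\<Sum>b\<in>B. (z \<bullet> b) *\<^sub>R (L (Q n \<omega>) b - L Qstar b))"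
      by (simp add: expand[OF Qpd] expand[OF barycenter_pd] sum_subtractf scaleR_diff_right)
    also have "norm \<dots> \<le> real (card B) * (norm z * e')"
    proof (rule sum_norm_bound)
      fix b assume b: "b \<in> B"
      have "\<bar>z \<bullet> b\<bar> \<le> norm z" using Cauchy_Schwarz_ineq2[of z b] B(3)[OF b] by simp
      moreover have "norm (L (Q n \<omega>) b - L Qstar b) \<le> e'" using E b by (simp add: dist_norm less_imp_le)
      ultimately show "norm ((z \<bullet> b) *\<^sub>R (L (Q n \<omega>) b - L Qstar b)) \<le> norm z * e'"
        by (simp add: mult_mono)
    qed
    also have "\<dots> = (real (card B) * e') * norm z" by simp
    also have "\<dots> \<le> e * norm z"
      using e by (intro mult_right_mono) (auto simp: e'_def field_simps)
    finally show "\<bar>phih n z - phi z\<bar> \<le> e * norm z" .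
  qed
qed

text \<open>The plug-in laws are indexed from the first sample size after which every estimate is well
  defined.\<close>

theorem plugin_weak_limit:
  "\<exists>N. (\<forall>n\<ge>N. real_distribution (distr (gaussian_law M (Xh n)) borel (phih n))) \<and>
     weak_conv_m (\<lambda>n. distr (gaussian_law M (Xh (n + N))) borel (phih (n + N))) (distr limit_law borel phi)"
proof -
  obtain N where N: "\<And>n. n \<ge> N \<Longrightarrow> regular n" using eventually_regular by (auto simp: eventually_sequentially)
  have r: "regular (n + N)" for n by (rule N) simp
  let ?\<nu> = "\<lambda>n. gaussian_law M (Xh n)"
  note G = limit_gaussian and p = orth_proj(1)[OF M]
  note Gn = Xh(2)[OF r]
  have phih_meas: "phih n \<in> borel_measurable (?\<nu> n)" if "regular n" for n
    using phih_measurable[of n] that gaussian_measurable[OF M Xh(2)[OF that]] by (auto simp: regular_def)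
  have dist: "real_distribution (distr (?\<nu> n) borel (phih n))" if "n \<ge> N" for n
    by (rule prob_space.real_distribution_distr[OF gaussian_prob[OF M Xh(2)[OF N[OF that]]] phih_meas[OF N[OF that]]])
  have conv: "(\<lambda>n. orth_proj M u \<bullet> Xh (n + N) (orth_proj M u)) \<longlonglongrightarrow> orth_proj M u \<bullet> Xi_op P M Qstar (orth_proj M u)" for u
    by (rule LIMSEQ_ignore_initial_segment[OF Xh_tendsto[OF p]])
  have mconv: "(\<lambda>n. \<Sum>b\<in>Basis. orth_proj M b \<bullet> Xh (n + N) (orth_proj M b)) \<longlonglongrightarrow>
      (\<Sum>b\<in>Basis. orth_proj M b \<bullet> Xi_op P M Qstar (orth_proj M b))"
    by (intro tendsto_sum conv)
  obtain k1 where k1: "\<And>n. norm (\<Sum>b\<in>Basis. orth_proj M b \<bullet> Xh (n + N) (orth_proj M b)) \<le> k1"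
    using convergent_imp_Bseq[OF convergentI[OF mconv]] by (auto simp: Bseq_def)
  define k where "k = max k1 (\<Sum>b\<in>Basis. orth_proj M b \<bullet> Xi_op P M Qstar (orth_proj M b))"
  interpret char_convergence "\<lambda>n. ?\<nu> (n + N)" "\<lambda>_ z. z" limit_law k
  proof (rule char_convergence.intro)
    show "prob_space (?\<nu> (n + N))" for n by (rule gaussian_prob[OF M Gn])
    show "(\<lambda>z. z) \<in> borel_measurable (?\<nu> (n + N))" for n by (rule gaussian_measurable[OF M Gn]) simp
    show "prob_space limit_law" "sets limit_law = sets borel"
      using gaussian_prob[OF M G] gaussian_sets[OF M G] .
    show "integrable (?\<nu> (n + N)) (\<lambda>z. (norm z)\<^sup>2)" for n by (rule gaussian_norm_moment[OF M Gn])
    show "(LINT z|?\<nu> (n + N). (norm z)\<^sup>2) \<le> k" for n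
      unfolding gaussian_norm_moment(2)[OF M Gn] k_def using k1[of n] by simp
    show "integrable limit_law (\<lambda>z. (norm z)\<^sup>2)" by (rule gaussian_norm_moment[OF M G])
    show "(LINT z|limit_law. (norm z)\<^sup>2) \<le> k"
      unfolding gaussian_norm_moment(2)[OF M G] k_def by simp
    show "(\<lambda>n. CLINT z|?\<nu> (n + N). iexp (u \<bullet> z)) \<longlonglongrightarrow> (CLINT z|limit_law. iexp (u \<bullet> z))" for u
      unfolding gaussian_char[OF M Gn] gaussian_char[OF M G]
      by (intro tendsto_of_real tendsto_exp tendsto_divide tendsto_minus conv tendsto_const) simp
  qed
  obtain C where C: "\<And>x y. \<bar>phi x - phi y\<bar> \<le> C * norm (x - y)" using phi_lipschitz by blast
  have "weak_conv_m (\<lambda>n. distr (?\<nu> (n + N)) borel (phih (n + N))) (distr limit_law borel phi)"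
  proof (rule weak_conv_compose[OF C])
    show "phih (n + N) \<in> borel_measurable (?\<nu> (n + N))" for n by (rule phih_meas[OF r])
  next
    fix e :: real assume e: "0 < e"
    have "\<forall>\<^sub>F n in sequentially. \<forall>z\<in>M. \<bar>phih (n + N) z - phi z\<bar> \<le> e * norm z"
      using phih_close[OF e] by (rule eventually_sequentially_seg[THEN iffD2])
    then have "\<forall>\<^sub>F n in sequentially. measure (?\<nu> (n + N))
        {z\<in>space (?\<nu> (n + N)). e * norm z < \<bar>phih (n + N) z - phi z\<bar>} = 0"
    proof eventually_elim
      case (elim n)
      interpret N': prob_space "?\<nu> (n + N)" by (rule gaussian_prob[OF M Gn])
      have "AE z in ?\<nu> (n + N). \<not> (e * norm z < \<bar>phih (n + N) z - phi z\<bar>)"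
        using gaussian_AE[OF M Gn] by eventually_elim (use elim in \<open>force simp: not_less\<close>)
      then show ?case by (simp add: N'.prob_eq_0_AE)
    qed
    then show "(\<lambda>n. measure (?\<nu> (n + N)) {z\<in>space (?\<nu> (n + N)). e * norm z < \<bar>phih (n + N) z - phi z\<bar>}) \<longlonglongrightarrow> 0"
      by (rule tendsto_eventually)
  qed
  then show ?thesis using dist by blast
qed

end

end

text \<open>Both sequences approach \<open>\<rho>\<close>.  Only probability laws on the line are points of the metric space, so the
  triangle inequality is used from index \<open>N\<close> on.\<close>

lemma metrized_merge:
  assumes dw: "metrizes_weak_convergence dw"
    and \<mu>: "\<And>n. real_distribution (\<mu> n)" "real_distribution \<rho>" "weak_conv_m \<mu> \<rho>"
    and \<nu>: "\<And>n. n \<ge> N \<Longrightarrow> real_distribution (\<nu> n)" "weak_conv_m (\<lambda>n. \<nu> (n + N)) \<rho>"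
  shows "(\<lambda>n. dw (\<mu> n) (\<nu> n)) \<longlonglongrightarrow> 0"
proof -
  interpret Metric_space "{\<mu>. real_distribution \<mu>}" dw using dw by (simp add: metrizes_weak_convergence_def)
  have conv: "(\<lambda>n. dw (\<mu>s n) \<rho>) \<longlonglongrightarrow> 0" if "\<And>n. real_distribution (\<mu>s n)" "weak_conv_m \<mu>s \<rho>" for \<mu>s
    using dw that \<mu>(2) by (simp add: metrizes_weak_convergence_def)
  have 1: "(\<lambda>n. dw (\<mu> (n + N)) \<rho>) \<longlonglongrightarrow> 0" by (rule LIMSEQ_ignore_initial_segment[OF conv[OF \<mu>(1,3)]])
  have 2: "(\<lambda>n. dw (\<nu> (n + N)) \<rho>) \<longlonglongrightarrow> 0" by (rule conv[OF _ \<nu>(2)]) (simp add: \<nu>(1))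
  have "(\<lambda>n. dw (\<mu> (n + N)) (\<nu> (n + N))) \<longlonglongrightarrow> 0"
  proof (rule tendsto_sandwich[OF _ _ tendsto_const])
    show "(\<lambda>n. dw (\<mu> (n + N)) \<rho> + dw (\<nu> (n + N)) \<rho>) \<longlonglongrightarrow> 0" using tendsto_add[OF 1 2] by simp
    have "dw (\<mu> (n + N)) (\<nu> (n + N)) \<le> dw (\<mu> (n + N)) \<rho> + dw (\<nu> (n + N)) \<rho>" for n
      using triangle[of "\<mu> (n + N)" \<rho> "\<nu> (n + N)"] \<mu>(1)[of "n + N"] \<mu>(2) \<nu>(1)[of "n + N"]
      by (simp add: commute[of \<rho>])
    then show "\<forall>\<^sub>F n in sequentially. dw (\<mu> (n + N)) (\<nu> (n + N)) \<le> dw (\<mu> (n + N)) \<rho> + dw (\<nu> (n + N)) \<rho>" by simp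
  qed simp
  then show ?thesis by (rule LIMSEQ_offset)
qed

theorem corollary2p1:
  fixes P :: "(complex^'d^'d) measure"
    and M :: "(complex^'d^'d) set"
    and Q0 Qstar :: "complex^'d^'d"
    and \<Omega> :: "'w measure"
    and S Q :: "nat \<Rightarrow> 'w \<Rightarrow> complex^'d^'d"
    and dw :: "real measure \<Rightarrow> real measure \<Rightarrow> real"
  defines "A \<equiv> (\<lambda>X. Q0 + X) ` M"
  assumes P: "prob_space P" "sets P = sets (restrict_space borel psd)"
    and P_pd: "measure P pd > 0"
    and P_trace: "integrable P rtrace"
    and M: "subspace M" "M \<subseteq> hermitian"
    and Q0: "Q0 \<in> hermitian"
    and A_pd: "pd \<inter> A \<noteq> {}"
    and \<Omega>: "prob_space \<Omega>"
    and S_indep: "prob_space.indep_vars \<Omega> (\<lambda>_. P) S UNIV"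
    and S_law: "\<And>i. distr \<Omega> P (S i) = P"
    and Qstar: "is_barycenter P A Qstar"
    and Q_meas: "\<And>n. n \<ge> 1 \<Longrightarrow> Q n \<in> borel_measurable \<Omega>"
    and Q_emp: "\<And>n \<omega>. n \<ge> 1 \<Longrightarrow> \<omega> \<in> space \<Omega> \<Longrightarrow>
                  is_empirical_barycenter n (\<lambda>i. S i \<omega>) A (Q n \<omega>)"
    and dw: "metrizes_weak_convergence dw"
  shows "weak_conv_m
           (\<lambda>n. distr \<Omega> borel (\<lambda>\<omega>. sqrt (real n) * bw_dist (Q n \<omega>) Qstar))
           (distr (gaussian_law M (Xi_op P M Qstar)) borel
             (\<lambda>z. norm (psd_sqrt Qstar ** dtransport Qstar Qstar z)))
         \<and>
         (AE \<omega> in \<Omega>.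
           (\<lambda>n. dw (distr \<Omega> borel (\<lambda>\<omega>'. sqrt (real n) * bw_dist (Q n \<omega>') Qstar))
                   (distr (gaussian_law M (Xi_hat n (\<lambda>i. S i \<omega>) M (Q n \<omega>))) borel
                     (\<lambda>z. norm (psd_sqrt (Q n \<omega>) ** dtransport (Q n \<omega>) (Q n \<omega>) z))))
           \<longlonglongrightarrow> 0)"
proof -
  interpret prob_space \<Omega> by fact
  interpret bw_sample P M Q0 Qstar A \<Omega> S Q
    using assms
    by (intro bw_sample.intro bw_model.intro bw_model_axioms.intro iid_sample.intro
          iid_sample_axioms.intro bw_sample_axioms.intro) auto
  have phi: "(\<lambda>z. norm (psd_sqrt Qstar ** dtransport Qstar Qstar z)) = phi"
    by (simp add: phi_def[abs_def])
  have phi_meas: "phi \<in> borel_measurable limit_law"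
    by (rule gaussian_measurable[OF M(1) limit_gaussian phi_measurable])
  have lim: "real_distribution (distr limit_law borel phi)"
    by (rule prob_space.real_distribution_distr[OF gaussian_prob[OF M(1) limit_gaussian] phi_meas])
  have "AE \<omega> in \<Omega>. (\<lambda>n. dw (distr \<Omega> borel (\<lambda>\<omega>'. sqrt (real n) * bw_dist (Q n \<omega>') Qstar))
      (distr (gaussian_law M (Xi_hat n (\<lambda>i. S i \<omega>) M (Q n \<omega>))) borel
        (\<lambda>z. norm (psd_sqrt (Q n \<omega>) ** dtransport (Q n \<omega>) (Q n \<omega>) z)))) \<longlonglongrightarrow> 0"
    using AE_good
  proof eventually_elim
    case (elim \<omega>)
    obtain N where N: "\<forall>n\<ge>N. real_distribution (distr (gaussian_law M (Xi_hat n (\<lambda>i. S i \<omega>) M (Q n \<omega>))) borel (phih \<omega> n))"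
      "weak_conv_m (\<lambda>n. distr (gaussian_law M (Xi_hat (n + N) (\<lambda>i. S i \<omega>) M (Q (n + N) \<omega>))) borel (phih \<omega> (n + N)))
        (distr limit_law borel phi)"
      using plugin_weak_limit[OF elim] by blast
    show ?case
      by (rule metrized_merge[OF dw _ lim distance_weak_limit, where N = N and
            \<nu> = "\<lambda>n. distr (gaussian_law M (Xi_hat n (\<lambda>i. S i \<omega>) M (Q n \<omega>))) borel (phih \<omega> n)",
            unfolded phih_def[OF elim, abs_def]])
         (use N in \<open>auto simp: phih_def[OF elim, abs_def] intro!: real_distribution_distr distance_measurable\<close>)
  qed
  then show ?thesis using distance_weak_limit unfolding phi by blast
qed

end
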